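(* Let $k\ge1$ be an integer. The finite element $(\Omega,\mathcal U^{(2),k}(\Omega),\Sigma^{(2),k})$ is divergence-conforming and unisolvent. That is: (i) (conforming) $\mathcal U^{(2),k}(\Omega)\subset H(\mathrm{div},\Omega)$ and, for every face $F$ of $\Omega$ and every $u\in\mathcal U^{(2),k}(\Omega)$, all face degrees of freedom in $\Sigma^{(2),k}$ associated with $F$ vanish on $u$ if and only if the normal component of $u$ vanishes on $F$; (ii) (unisolvent) for every family of real numbers $(u_m)_{m\in\Sigma^{(2),k}}$ there is exactly one $u\in\mathcal U^{(2),k}(\Omega)$ with $m(u)=u_m$ for all $m\in\Sigma^{(2),k}$.
   Context: Finite pyramid: $\Omega=\{(\xi,\eta,\zeta)\in\mathbb R^3:\xi,\eta,\zeta\ge0,\ \xi\le1-\zeta,\ \eta\le1-\zeta\}$, with four triangular faces $S_{i,\Omega}$ ($i=1,\dots,4$) and square base $B$. Infinite pyramid: $\Omega_\infty=\{(x,y,z): 0\le x,y\le1,\ z\ge0\}$ (together with a point $\infty$). Map: $\phi:\Omega_\infty\to\Omega$, $\phi(x,y,z)=\left(\frac{x}{1+z},\frac{y}{1+z},\frac{z}{1+z}\right)$, a diffeomorphism onto $\Omega$ minus its apex $(0,0,1)$. Pullbacks: for 1-forms (vector fields $E$) $\phi^*E=D\phi^T(E\circ\phi)$; for 2-forms (vector fields $v$) $\phi^*v=|D\phi|\,D\phi^{-1}(v\circ\phi)$, $|D\phi|$ being the Jacobian determinant; $(\phi^{-1})^*=(\phi^* )^{-1}$. $Q^{l,m,n}$: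 polynomials of degree at most $l,m,n$ in $x,y,z$; $Q^{l,m,n}_k=\{u/(1+z)^k:u\in Q^{l,m,n}\}$; $P^n_k[w,z]=\{u(w,z)/(1+z)^k:u$ polynomial of total degree $\le n\}$. Polynomial spaces with a negative degree are $\{0\}$. 2-forms: $$\overline{\mathcal U^{(2),k}}(\Omega_\infty)=Q_{k+2}^{k,k-1,k-2}\times Q_{k+2}^{k-1,k,k-2}\times Q_{k+2}^{k-1,k-1,k-1}\oplus\Big\{\tfrac{z^{k-1}}{(1+z)^{k+2}}(0,2s,s_y(1+z))^T\Big\}\oplus\Big\{\tfrac{z^{k-1}}{(1+z)^{k+2}}(2t,0,t_x(1+z))^T\Big\},$$ where $s$ ranges over $Q^{k-1,k}[x,y]$ and $t$ over $Q^{k,k-1}[x,y]$. $\mathcal U^{(2),k}(\Omega_\infty)$ is the set of $u\in\overline{\mathcal U^{(2),k}}(\Omega_\infty)$ whose normal components lie in $P^{k-1}_{k+2}[x,z]$ on the faces $y=0$, $y=1$ and in $P^{k-1}_{k+2}[y,z]$ on the faces $x=0$, $x=1$. $\mathcal U^{(2),k}(\Omega)=(\phi^{-1})^*\mathcal U^{(2),k}(\Omega_\infty)$. $\mathcal U^{(1),k}_{0,\mathrm{curl}}(\Omega)=(\phi^{-1})^*\mathcal U^{(1),k}_{0,\mathrm{curl}}(\Omega_\infty)$ (1-form pullback), where $\mathcal U^{(1),k}_{0,\mathrm{curl}}(\Omega_\infty)$ consists of the fields $\big(y(1-y)zq_1,\ x(1-x)zq_2,\ x(1-x)y(1-y)\rho\big)^T$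 with $q_1\in Q_{k+1}^{k-1,k-2,k-2}$, $q_2\in Q_{k+1}^{k-2,k-1,k-2}$, $\rho\in Q_{k+1}^{k-2,k-2,0}$. $\mathcal U^{(2),k}_{0,\mathrm{div}}(\Omega)=(\phi^{-1})^*\mathcal U^{(2),k}_{0,\mathrm{div}}(\Omega_\infty)$ (2-form pullback), where $\mathcal U^{(2),k}_{0,\mathrm{div}}(\Omega_\infty)$ consists of the fields $$\tfrac{z^{k-1}}{(1+z)^{k+2}}\big(r_y+2t,\ r_x+2s,\ (1+z)(r_{xy}+s_y+t_x)\big)^T+(0,0,z\chi_3)^T$$ with $r=x(1-x)y(1-y)p$, $p\in Q^{k-2,k-2}[x,y]$; $t=x(1-x)\tilde t$, $\tilde t\in P^{k-2}(x)$; $s=y(1-y)\tilde s$, $\tilde s\in P^{k-2}(y)$; $\chi_3\in Q_{k+2}^{k-1,k-1,k-2}$. Subscripts $x,y$ on $r,s,t$ denote partial derivatives. $\mathcal B[P]$ denotes an arbitrary (fixed) basis of a finite-dimensional space $P$; $\nu$ is a unit normal to a face. $P^n(S_{i,\Omega})$: polynomials of total degree $\le n$ on the face; $Q^{m,n}(B)$: polynomials on $B$ of degree $\le m$ in $\xi$, $\le n$ in $\eta$. Degrees of freedom $\Sigma^{(2),k}$ (linear functionals of $u$): triangular faces: $u\mapsto\int_{S_{i,\Omega}}(u\cdot\nu)\,q\,dA$, $q\in\mathcal B[P^{k-1}(S_{i,\Omega})]$, $i=1,\dots,4$; base: $u\mapsto\int_B(u\cdot\nu)\,q\,dA$, $q\in\mathcal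 B[Q^{k-1,k-1}(B)]$; volume: $u\mapsto\int_\Omega u\cdot(\nabla\times v)\,dV$, $v\in\mathcal B[\mathcal U^{(1),k}_{0,\mathrm{curl}}(\Omega)]$, and $u\mapsto\int_\Omega(\nabla\cdot u)(\nabla\cdot v)\,dV$, $v\in\mathcal B[\mathcal U^{(2),k}_{0,\mathrm{div}}(\Omega)]$. *)

theory Defs
  imports "HOL-Analysis.Analysis" "HOL-Library.Function_Algebras"
begin

section \<open>Polynomial spaces\<close>

text \<open>
  Degrees are integers: a negative degree bound makes the index set empty, so that the space
  is \<open>{0}\<close>.
\<close>

definition poly1 :: "int \<Rightarrow> (real \<Rightarrow> real) set" where
  "poly1 n = {f. \<exists>c. f = (\<lambda>x. \<Sum>i\<in>{i. int i \<le> n}. c i * x ^ i)}"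

definition polyQ2 :: "int \<Rightarrow> int \<Rightarrow> (real \<Rightarrow> real \<Rightarrow> real) set" where
  "polyQ2 l m = {f. \<exists>c. f = (\<lambda>x y. \<Sum>(i, j)\<in>{(i, j). int i \<le> l \<and> int j \<le> m}. c i j * x ^ i * y ^ j)}"

definition polyQ3 :: "int \<Rightarrow> int \<Rightarrow> int \<Rightarrow> (real \<Rightarrow> real \<Rightarrow> real \<Rightarrow> real) set" where
  "polyQ3 l m n = {f. \<exists>c. f = (\<lambda>x y z.
     \<Sum>(i, j, h)\<in>{(i, j, h). int i \<le> l \<and> int j \<le> m \<and> int h \<le> n}. c i j h * x ^ i * y ^ j * z ^ h)}"

definition polyP2 :: "int \<Rightarrow> (real \<Rightarrow> real \<Rightarrow> real) set" where
  "polyP2 n = {f. \<exists>c. f = (\<lambda>x y. \<Sum>(i, j)\<in>{(i, j). int (i + j) \<le> n}. c i j * x ^ i * y ^ j)}"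

definition polyP3 :: "int \<Rightarrow> (real \<Rightarrow> real \<Rightarrow> real \<Rightarrow> real) set" where
  "polyP3 n = {f. \<exists>c. f = (\<lambda>x y z.
     \<Sum>(i, j, h)\<in>{(i, j, h). int (i + j + h) \<le> n}. c i j h * x ^ i * y ^ j * z ^ h)}"

text \<open>The weighted spaces \<open>Q\<^bsub>w\<^esub>\<^bsup>l,m,n\<^esup>\<close> and \<open>P\<^bsub>w\<^esub>\<^bsup>n\<^esup>\<close>.\<close>

definition ratQ :: "nat \<Rightarrow> int \<Rightarrow> int \<Rightarrow> int \<Rightarrow> (real^3 \<Rightarrow> real) set" where
  "ratQ w l m n = {f. \<exists>g\<in>polyQ3 l m n. f = (\<lambda>p. g (p$1) (p$2) (p$3) / (1 + p$3) ^ w)}"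

definition ratP :: "nat \<Rightarrow> int \<Rightarrow> (real \<Rightarrow> real \<Rightarrow> real) set" where
  "ratP w n = {f. \<exists>g\<in>polyP2 n. f = (\<lambda>v z. g v z / (1 + z) ^ w)}"

section \<open>The pyramids and the pullbacks\<close>

definition Omega :: "(real^3) set" where
  "Omega = {p. 0 \<le> p$1 \<and> 0 \<le> p$2 \<and> 0 \<le> p$3 \<and> p$1 \<le> 1 - p$3 \<and> p$2 \<le> 1 - p$3}"

definition apex :: "real^3" where
  "apex = vector [0, 0, 1]"

text \<open>The point at infinity, which corresponds to the apex, is left out: no field has a value there.\<close>

definition Omega_inf :: "(real^3) set" where
  "Omega_inf = {p. 0 \<le> p$1 \<and> p$1 \<le> 1 \<and> 0 \<le> p$2 \<and> p$2 \<le> 1 \<and> 0 \<le> p$3}"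

definition phi :: "real^3 \<Rightarrow> real^3" where
  "phi p = vector [p$1 / (1 + p$3), p$2 / (1 + p$3), p$3 / (1 + p$3)]"

lemma phi_bij_betw: "bij_betw phi Omega_inf (Omega - {apex})"
proof (rule bij_betw_byWitness[where f' = "\<lambda>q. vector [q$1 / (1 - q$3), q$2 / (1 - q$3), q$3 / (1 - q$3)]"])
  have *: "q$3 < 1" if "q \<in> Omega - {apex}" for q
  proof (rule ccontr)
    assume "\<not> q$3 < 1"
    with that have "q$3 = 1" "q$1 = 0" "q$2 = 0"
      by (auto simp: Omega_def)
    with that show False
      by (auto simp: apex_def vec_eq_iff forall_3)
  qed
  show "\<forall>p\<in>Omega_inf. vector [phi p$1 / (1 - phi p$3), phi p$2 / (1 - phi p$3), phi p$3 / (1 - phi p$3)] = p"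
  proof
    fix p assume "p \<in> Omega_inf"
    then have "1 + p$3 \<noteq> 0" by (auto simp: Omega_inf_def)
    then show "vector [phi p$1 / (1 - phi p$3), phi p$2 / (1 - phi p$3), phi p$3 / (1 - phi p$3)] = p"
      by (simp add: vec_eq_iff forall_3 phi_def divide_simps)
  qed
  show "\<forall>q\<in>Omega - {apex}. phi (vector [q$1 / (1 - q$3), q$2 / (1 - q$3), q$3 / (1 - q$3)]) = q"
  proof
    fix q assume "q \<in> Omega - {apex}"
    then have "1 - q$3 \<noteq> 0" using * by force
    then show "phi (vector [q$1 / (1 - q$3), q$2 / (1 - q$3), q$3 / (1 - q$3)]) = q"
      by (simp add: vec_eq_iff forall_3 phi_def divide_simps)
  qed
  show "phi ` Omega_inf \<subseteq> Omega - {apex}"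
  proof
    fix q assume "q \<in> phi ` Omega_inf"
    then obtain p where p: "p \<in> Omega_inf" "q = phi p" by blast
    then have z: "1 + p$3 > 0" by (auto simp: Omega_inf_def)
    then have "1 - p$3 / (1 + p$3) = 1 / (1 + p$3)" by (simp add: field_simps)
    with p z show "q \<in> Omega - {apex}"
      by (auto simp: Omega_inf_def Omega_def phi_def apex_def vec_eq_iff forall_3
          intro: divide_right_mono)
  qed
  show "(\<lambda>q. vector [q$1 / (1 - q$3), q$2 / (1 - q$3), q$3 / (1 - q$3)]) ` (Omega - {apex}) \<subseteq> Omega_inf"
    using * by (fastforce simp: Omega_inf_def Omega_def divide_simps)
qed

definition pullback1 :: "(real^3 \<Rightarrow> real^3) \<Rightarrow> real^3 \<Rightarrow> real^3" where
  "pullback1 E p = transpose (jacobian phi (at p)) *v E (phi p)"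

definition pullback2 :: "(real^3 \<Rightarrow> real^3) \<Rightarrow> real^3 \<Rightarrow> real^3" where
  "pullback2 v p = det (jacobian phi (at p)) *\<^sub>R (matrix_inv (jacobian phi (at p)) *v v (phi p))"

text \<open>
  The image of a space \<open>W\<close> of fields on the infinite pyramid under the inverse of a pullback \<open>pb\<close>.
  Only the values on \<^const>\<open>Omega_inf\<close> of the members of \<open>W\<close> matter. The resulting fields live
  on \<open>Omega - {apex}\<close>; as functions on the whole of space they are normalised to be zero elsewhere,
  so that equality of functions is equality of fields on \<open>Omega - {apex}\<close>.
\<close>

definition push_space ::
  "((real^3 \<Rightarrow> real^3) \<Rightarrow> real^3 \<Rightarrow> real^3) \<Rightarrow> (real^3 \<Rightarrow> real^3) set \<Rightarrow> (real^3 \<Rightarrow> real^3) set" where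
  "push_space pb W =
     {v. (\<forall>q. q \<notin> Omega - {apex} \<longrightarrow> v q = 0) \<and> (\<exists>w\<in>W. \<forall>p\<in>Omega_inf. pb v p = w p)}"

section \<open>The approximation space and the spaces of volume test fields\<close>

definition U2bar_inf :: "nat \<Rightarrow> (real^3 \<Rightarrow> real^3) set" where
  "U2bar_inf k = {u.
     \<exists>a\<in>ratQ (k+2) (int k) (int k - 1) (int k - 2).
     \<exists>b\<in>ratQ (k+2) (int k - 1) (int k) (int k - 2).
     \<exists>c\<in>ratQ (k+2) (int k - 1) (int k - 1) (int k - 1).
     \<exists>s\<in>polyQ2 (int k - 1) (int k).
     \<exists>t\<in>polyQ2 (int k) (int k - 1).
       u = (\<lambda>p. let x = p$1; y = p$2; z = p$3 in
              vector [a p, b p, c p]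
              + (z ^ (k - 1) / (1 + z) ^ (k + 2)) *\<^sub>R
                  vector [0, 2 * s x y, deriv (\<lambda>y. s x y) y * (1 + z)]
              + (z ^ (k - 1) / (1 + z) ^ (k + 2)) *\<^sub>R
                  vector [2 * t x y, 0, deriv (\<lambda>x. t x y) x * (1 + z)])}"

definition U2_inf :: "nat \<Rightarrow> (real^3 \<Rightarrow> real^3) set" where
  "U2_inf k = {u \<in> U2bar_inf k.
     (\<forall>y\<in>{0, 1}. \<exists>f\<in>ratP (k+2) (int k - 1). \<forall>x\<in>{0..1}. \<forall>z\<ge>0. u (vector [x, y, z]) $ 2 = f x z) \<and>
     (\<forall>x\<in>{0, 1}. \<exists>f\<in>ratP (k+2) (int k - 1). \<forall>y\<in>{0..1}. \<forall>z\<ge>0. u (vector [x, y, z]) $ 1 = f y z)}"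

definition U2 :: "nat \<Rightarrow> (real^3 \<Rightarrow> real^3) set" where
  "U2 k = push_space pullback2 (U2_inf k)"

definition U1_0curl_inf :: "nat \<Rightarrow> (real^3 \<Rightarrow> real^3) set" where
  "U1_0curl_inf k = {u.
     \<exists>q1\<in>ratQ (k+1) (int k - 1) (int k - 2) (int k - 2).
     \<exists>q2\<in>ratQ (k+1) (int k - 2) (int k - 1) (int k - 2).
     \<exists>\<rho>\<in>ratQ (k+1) (int k - 2) (int k - 2) 0.
       u = (\<lambda>p. let x = p$1; y = p$2; z = p$3 in
              vector [y * (1 - y) * z * q1 p, x * (1 - x) * z * q2 p, x * (1 - x) * y * (1 - y) * \<rho> p])}"

definition U1_0curl :: "nat \<Rightarrow> (real^3 \<Rightarrow> real^3) set" where
  "U1_0curl k = push_space pullback1 (U1_0curl_inf k)"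

definition U2_0div_inf :: "nat \<Rightarrow> (real^3 \<Rightarrow> real^3) set" where
  "U2_0div_inf k = {u.
     \<exists>pp\<in>polyQ2 (int k - 2) (int k - 2).
     \<exists>tt\<in>poly1 (int k - 2).
     \<exists>ss\<in>poly1 (int k - 2).
     \<exists>chi3\<in>ratQ (k+2) (int k - 1) (int k - 1) (int k - 2).
       u = (\<lambda>p. let x = p$1; y = p$2; z = p$3;
                    r = (\<lambda>x y. x * (1 - x) * y * (1 - y) * pp x y);
                    t = (\<lambda>x. x * (1 - x) * tt x);
                    s = (\<lambda>y. y * (1 - y) * ss y);
                    r_x = (\<lambda>x y. deriv (\<lambda>x. r x y) x);
                    r_y = (\<lambda>x y. deriv (\<lambda>y. r x y) y);
                    r_xy = (\<lambda>x y. deriv (\<lambda>y. r_x x y) y)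
                in
              (z ^ (k - 1) / (1 + z) ^ (k + 2)) *\<^sub>R
                vector [r_y x y + 2 * t x, r_x x y + 2 * s y,
                        (1 + z) * (r_xy x y + deriv s y + deriv t x)]
              + vector [0, 0, z * chi3 p])}"

definition U2_0div :: "nat \<Rightarrow> (real^3 \<Rightarrow> real^3) set" where
  "U2_0div k = push_space pullback2 (U2_0div_inf k)"

section \<open>Vector calculus and H(div)\<close>

text \<open>
  Derivatives are taken within \<^const>\<open>Omega\<close>. In the interior they are the ordinary ones, and
  they are not affected by the zero extension at the other boundary points. At the apex they may
  be meaningless, which no integral sees.
\<close>

definition divergence :: "(real^3 \<Rightarrow> real^3) \<Rightarrow> real^3 \<Rightarrow> real" where
  "divergence v p = trace (jacobian v (at p within Omega))"

definition curl :: "(real^3 \<Rightarrow> real^3) \<Rightarrow> real^3 \<Rightarrow> real^3" where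
  "curl v p = (let J = jacobian v (at p within Omega) in
     vector [J$3$2 - J$2$3, J$1$3 - J$3$1, J$2$1 - J$1$2])"

definition gradient :: "(real^3 \<Rightarrow> real) \<Rightarrow> real^3 \<Rightarrow> real^3" where
  "gradient f p = (\<chi> i. frechet_derivative f (at p) (axis i 1))"

primrec C_diff :: "nat \<Rightarrow> (real^3 \<Rightarrow> real) \<Rightarrow> bool" where
  "C_diff 0 f \<longleftrightarrow> continuous_on UNIV f"
| "C_diff (Suc n) f \<longleftrightarrow> (\<forall>p. f differentiable (at p)) \<and> (\<forall>i. C_diff n (\<lambda>p. gradient f p $ i))"

definition test_functions :: "(real^3) set \<Rightarrow> (real^3 \<Rightarrow> real) set" where
  "test_functions S = {\<psi>. (\<forall>n. C_diff n \<psi>) \<and>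
     compact (closure {p. \<psi> p \<noteq> 0}) \<and> closure {p. \<psi> p \<noteq> 0} \<subseteq> S}"

definition L2_on :: "(real^3) set \<Rightarrow> (real^3 \<Rightarrow> 'b::euclidean_space) \<Rightarrow> bool" where
  "L2_on S f \<longleftrightarrow> f \<in> borel_measurable (lebesgue_on S) \<and> integrable (lebesgue_on S) (\<lambda>p. (norm (f p))\<^sup>2)"

text \<open>Square integrable fields on the open set \<open>S\<close> with a square integrable weak divergence.\<close>

definition Hdiv :: "(real^3) set \<Rightarrow> (real^3 \<Rightarrow> real^3) set" where
  "Hdiv S = {u. L2_on S u \<and> (\<exists>d. L2_on S d \<and>
     (\<forall>\<psi>\<in>test_functions S.
        (LINT p|lebesgue_on S. u p \<bullet> gradient \<psi> p) = - (LINT p|lebesgue_on S. d p * \<psi> p)))}"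

section \<open>Faces\<close>

text \<open>
  The triangular faces lie in the planes \<open>\<xi> = 0\<close>, \<open>\<eta> = 0\<close>, \<open>\<xi> = 1 - \<zeta>\<close> and \<open>\<eta> = 1 - \<zeta>\<close>. Each face
  is the image of a plane domain under \<open>(s, t) \<mapsto> origin + s *\<^sub>R edge1 + t *\<^sub>R edge2\<close>,
  through which surface integrals are computed.
\<close>

datatype pyramid_face = Xi0 | Eta0 | Xi1 | Eta1 | Base

fun face :: "pyramid_face \<Rightarrow> (real^3) set" where
  "face Xi0 = {p \<in> Omega. p$1 = 0}"
| "face Eta0 = {p \<in> Omega. p$2 = 0}"
| "face Xi1 = {p \<in> Omega. p$1 = 1 - p$3}"
| "face Eta1 = {p \<in> Omega. p$2 = 1 - p$3}"
| "face Base = {p \<in> Omega. p$3 = 0}"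

fun face_origin :: "pyramid_face \<Rightarrow> real^3" where
  "face_origin Xi1 = vector [1, 0, 0]"
| "face_origin Eta1 = vector [0, 1, 0]"
| "face_origin _ = 0"

fun face_edge1 :: "pyramid_face \<Rightarrow> real^3" where
  "face_edge1 Xi0 = vector [0, 1, 0]"
| "face_edge1 Xi1 = vector [0, 1, 0]"
| "face_edge1 _ = vector [1, 0, 0]"

fun face_edge2 :: "pyramid_face \<Rightarrow> real^3" where
  "face_edge2 Xi0 = vector [0, 0, 1]"
| "face_edge2 Eta0 = vector [0, 0, 1]"
| "face_edge2 Xi1 = vector [-1, 0, 1]"
| "face_edge2 Eta1 = vector [0, -1, 1]"
| "face_edge2 Base = vector [0, 1, 0]"

definition face_param :: "pyramid_face \<Rightarrow> real \<times> real \<Rightarrow> real^3" where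
  "face_param F = (\<lambda>(s, t). face_origin F + s *\<^sub>R face_edge1 F + t *\<^sub>R face_edge2 F)"

definition face_domain :: "pyramid_face \<Rightarrow> (real \<times> real) set" where
  "face_domain F = (if F = Base then {(s, t). 0 \<le> s \<and> s \<le> 1 \<and> 0 \<le> t \<and> t \<le> 1}
                    else {(s, t). 0 \<le> s \<and> 0 \<le> t \<and> s + t \<le> 1})"

lemma face_param_image: "face_param F ` face_domain F = face F"
proof -
  have "face_param F ` face_domain F \<subseteq> face F"
    by (cases F) (auto simp: face_param_def face_domain_def Omega_def)
  moreover have "p \<in> face_param F ` face_domain F" if "p \<in> face F" for p
  proof -
    define st where "st = (if F = Xi0 \<or> F = Xi1 then (p$2, p$3)
                          else if F = Base then (p$1, p$2) else (p$1, p$3))"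
    have "st \<in> face_domain F" "p = face_param F st"
      using that
      by (cases F; auto simp: st_def face_param_def face_domain_def Omega_def vec_eq_iff forall_3)+
    then show ?thesis by blast
  qed
  ultimately show ?thesis by blast
qed

definition face_integral :: "pyramid_face \<Rightarrow> (real^3 \<Rightarrow> real) \<Rightarrow> real" where
  "face_integral F f =
     norm (cross3 (face_edge1 F) (face_edge2 F)) *
     (LINT st|lebesgue_on (face_domain F). f (face_param F st))"

definition unit_normal :: "pyramid_face \<Rightarrow> real^3 \<Rightarrow> bool" where
  "unit_normal F n \<longleftrightarrow> norm n = 1 \<and> (\<forall>p\<in>face F. \<forall>q\<in>face F. (p - q) \<bullet> n = 0)"

text \<open>
  A polynomial on a face is the restriction of a polynomial in the ambient coordinates; as a
  function on the whole of space it is normalised to be zero off the face.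
\<close>

definition face_polys :: "nat \<Rightarrow> pyramid_face \<Rightarrow> (real^3 \<Rightarrow> real) set" where
  "face_polys k F =
     (if F = Base
      then {f. \<exists>g\<in>polyQ2 (int k - 1) (int k - 1). f = (\<lambda>p. if p \<in> face F then g (p$1) (p$2) else 0)}
      else {f. \<exists>g\<in>polyP3 (int k - 1). f = (\<lambda>p. if p \<in> face F then g (p$1) (p$2) (p$3) else 0)})"

section \<open>Bases of function spaces and the degrees of freedom\<close>

definition fscale :: "real \<Rightarrow> ('a \<Rightarrow> 'b::real_vector) \<Rightarrow> 'a \<Rightarrow> 'b" where
  "fscale c f = (\<lambda>x. c *\<^sub>R f x)"

interpretation fun_vs: vector_space "fscale :: real \<Rightarrow> ('a \<Rightarrow> 'b::real_vector) \<Rightarrow> 'a \<Rightarrow> 'b"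
  by unfold_locales (auto simp: fscale_def fun_eq_iff scaleR_add_right scaleR_add_left)

definition is_basis :: "('a \<Rightarrow> 'b::real_vector) set \<Rightarrow> ('a \<Rightarrow> 'b) set \<Rightarrow> bool" where
  "is_basis B V \<longleftrightarrow> fun_vs.independent B \<and> fun_vs.span B = V"

text \<open>
  The degrees of freedom are labelled by the test function that they use; the functional that
  belongs to a label is given by \<open>dof_value\<close>. Families indexed by degrees of freedom are indexed
  by labels, so nothing is identified if two labels should give the same functional.
\<close>

datatype dof = Face_dof pyramid_face "real^3 \<Rightarrow> real"
  | Curl_dof "real^3 \<Rightarrow> real^3"
  | Div_dof "real^3 \<Rightarrow> real^3"

fun dof_value :: "(pyramid_face \<Rightarrow> real^3) \<Rightarrow> dof \<Rightarrow> (real^3 \<Rightarrow> real^3) \<Rightarrow> real" where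
  "dof_value \<nu> (Face_dof F q) u = face_integral F (\<lambda>p. (u p \<bullet> \<nu> F) * q p)"
| "dof_value \<nu> (Curl_dof v) u = (LINT p|lebesgue_on Omega. u p \<bullet> curl v p)"
| "dof_value \<nu> (Div_dof v) u = (LINT p|lebesgue_on Omega. divergence u p * divergence v p)"

definition face_dofs :: "(pyramid_face \<Rightarrow> (real^3 \<Rightarrow> real) set) \<Rightarrow> pyramid_face \<Rightarrow> dof set" where
  "face_dofs BF F = Face_dof F ` BF F"

definition Sigma2 :: "(pyramid_face \<Rightarrow> (real^3 \<Rightarrow> real) set) \<Rightarrow> (real^3 \<Rightarrow> real^3) set \<Rightarrow>
    (real^3 \<Rightarrow> real^3) set \<Rightarrow> dof set" where
  "Sigma2 BF BC BD = (\<Union>F. face_dofs BF F) \<union> Curl_dof ` BC \<union> Div_dof ` BD"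

end

theory Submission
  imports Defs
begin

text \<open>
  On the infinite pyramid every field of the space is a triple of polynomial numerators over
  \<open>(1+z)^(k+2)\<close>, and the space is described by degree bounds on the three numerators and on the
  numerator of the divergence. Hence the curls of the fields in \<open>U1_0curl\<close>, whose divergence
  vanishes, belong to it for degree reasons alone.

  The heart of the matter is that a member with vanishing normal traces is the curl of a member of
  \<open>U1_0curl\<close> plus a member of \<open>U2_0div\<close>. Integrating the tangential components in \<open>z\<close> leaves a
  polynomial in \<open>x\<close> and \<open>y\<close> that has to be split into the mean and the derivative of a bubble,
  in \<open>y\<close> for the first and in \<open>x\<close> for the second component; this fixes all the free data.

  On \<open>U1_0curl\<close> the curl and on \<open>U2_0div\<close> the divergence is injective, so the volume degrees of
  freedom give positive definite Gram matrices, and so do the face degrees of freedom on the face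
  polynomials. Together with explicit liftings of the normal traces, one solves for the face data
  first, then for the divergence data, and finally for the curl data. No dimension is counted.
\<close>

section \<open>Polynomials\<close>

text \<open>Clearing the denominator \<open>(1+z)^w\<close> turns the derivative in \<open>z\<close>
  into the operator \<open>(1+z) F' - w F\<close>. As it is invertible in low degrees, a degree
  bound on its image is one on \<open>F\<close>; so the bound on the divergence numerator controls
  the third component, both when the space is described and when the remainder of the splitting is
  identified. The same bound has a geometric side: \<open>1 + z\<close> is
  \<open>1 / (1 - q$3)\<close>, and after the Piola transform the divergence carries the weight
  \<open>(1 - q$3) ^ (k - 1)\<close>, which balances degree \<open>k - 1\<close> exactly. Single
  partial derivatives may blow up at the apex; only their sum stays bounded. The obstacle in the
  splitting is that the primitives in \<open>z\<close> must vanish at \<open>z = 0\<close>. This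
  gives one equation on the unit square for each tangential component; the bubble \<open>p\<close>
  of the divergence part enters both with the same sign, the bubble \<open>\<rho>\<close> of the
  curl part with opposite signs, so sum and difference decouple them. All operators act in one
  variable; Lagrange interpolation carries them to three variables with uniform degrees.\<close>

lemma int_le_set: "{i. int i \<le> n} = (if n < 0 then {} else {..nat n})"
  by auto

lemma finite_int_le [simp]: "finite {i. int i \<le> n}"
  by (simp add: int_le_set)

text \<open>Degrees are bounded through vanishing coefficients and not through
  \<open>degree\<close>, because a negative \<open>n\<close> must leave only the zero polynomial
  while \<open>degree 0\<close> is \<open>0\<close>.\<close>

lemma poly1_iff: "f \<in> poly1 n \<longleftrightarrow> (\<exists>p. f = poly p \<and> (\<forall>i. n < int i \<longrightarrow> coeff p i = 0))"
proof
  assume "f \<in> poly1 n"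
  then obtain c where c: "f = (\<lambda>x. \<Sum>i\<in>{i. int i \<le> n}. c i * x ^ i)"
    by (auto simp: poly1_def)
  let ?p = "\<Sum>i\<in>{i. int i \<le> n}. monom (c i) i"
  have "f = poly ?p"
    by (simp add: c poly_sum poly_monom fun_eq_iff)
  moreover have "\<forall>i. n < int i \<longrightarrow> coeff ?p i = 0"
    by (auto simp: coeff_sum intro!: sum.neutral)
  ultimately show "\<exists>p. f = poly p \<and> (\<forall>i. n < int i \<longrightarrow> coeff p i = 0)" by blast
next
  assume "\<exists>p. f = poly p \<and> (\<forall>i. n < int i \<longrightarrow> coeff p i = 0)"
  then obtain p where p: "f = poly p" "\<forall>i. n < int i \<longrightarrow> coeff p i = 0" by blast
  have "poly p x = (\<Sum>i\<in>{i. int i \<le> n}. coeff p i * x ^ i)" for x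
    unfolding poly_altdef
  proof (rule sum.mono_neutral_cong)
    show "coeff p i * x ^ i = 0" if "i \<in> {..degree p} - {i. int i \<le> n}" for i
      using that p(2) by auto
    show "coeff p i * x ^ i = 0" if "i \<in> {i. int i \<le> n} - {..degree p}" for i
      using that by (auto simp: coeff_eq_0)
  qed auto
  with p(1) show "f \<in> poly1 n"
    unfolding poly1_def by blast
qed

lemma poly1I: "(\<And>i. n < int i \<Longrightarrow> coeff p i = 0) \<Longrightarrow> poly p \<in> poly1 n"
  by (auto simp: poly1_iff)

lemma poly1_zero [simp]: "(\<lambda>x. 0) \<in> poly1 n"
  using poly1I[of n 0] by (simp add: poly_0[abs_def])

lemma poly1_neg: "n < 0 \<Longrightarrow> f \<in> poly1 n \<longleftrightarrow> f = (\<lambda>x. 0)"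
  by (auto simp: poly1_def int_le_set)

lemma poly1_add: "f \<in> poly1 n \<Longrightarrow> g \<in> poly1 n \<Longrightarrow> (\<lambda>x. f x + g x) \<in> poly1 n"
  unfolding poly1_iff
proof (elim exE conjE)
  fix p q assume "f = poly p" "g = poly q" "\<forall>i. n < int i \<longrightarrow> coeff p i = 0" "\<forall>i. n < int i \<longrightarrow> coeff q i = 0"
  then show "\<exists>p. (\<lambda>x. f x + g x) = poly p \<and> (\<forall>i. n < int i \<longrightarrow> coeff p i = 0)"
    by (intro exI[of _ "p + q"]) auto
qed

lemma poly1_mult: "f \<in> poly1 m \<Longrightarrow> g \<in> poly1 n \<Longrightarrow> (\<lambda>x. f x * g x) \<in> poly1 (m + n)"
  unfolding poly1_iff
proof (elim exE conjE)
  fix p q assume *: "f = poly p" "g = poly q" "\<forall>i. m < int i \<longrightarrow> coeff p i = 0" "\<forall>i. n < int i \<longrightarrow> coeff q i = 0"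
  have "coeff (p * q) i = 0" if "m + n < int i" for i
    unfolding coeff_mult
  proof (rule sum.neutral, intro ballI)
    fix j assume "j \<in> {..i}"
    with that have "m < int j \<or> n < int (i - j)" by auto
    with * show "coeff p j * coeff q (i - j) = 0" by auto
  qed
  with * show "\<exists>p. (\<lambda>x. f x * g x) = poly p \<and> (\<forall>i. m + n < int i \<longrightarrow> coeff p i = 0)"
    by (intro exI[of _ "p * q"]) auto
qed

lemma poly1_mono: "f \<in> poly1 m \<Longrightarrow> m \<le> n \<Longrightarrow> f \<in> poly1 n"
  unfolding poly1_iff by (metis order.strict_trans1)

lemma poly1_const: "0 \<le> n \<Longrightarrow> (\<lambda>x. c) \<in> poly1 n"
  by (auto simp: poly1_iff fun_eq_iff coeff_pCons intro!: exI[of _ "[:c:]"] split: nat.splits)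

lemma poly1_ident: "1 \<le> n \<Longrightarrow> (\<lambda>x. x) \<in> poly1 n"
  by (auto simp: poly1_iff fun_eq_iff coeff_pCons intro!: exI[of _ "[:0, 1:]"] split: nat.splits)

lemma poly1_cmult: "f \<in> poly1 n \<Longrightarrow> (\<lambda>x. c * f x) \<in> poly1 n"
  using poly1_mult[OF poly1_const[of 0 c], of f n] by simp

lemma poly1_cmult_right: "f \<in> poly1 n \<Longrightarrow> (\<lambda>x. f x * c) \<in> poly1 n"
  using poly1_cmult[of f n c] by (simp add: mult.commute)

lemma poly1_diff: "f \<in> poly1 n \<Longrightarrow> g \<in> poly1 n \<Longrightarrow> (\<lambda>x. f x - g x) \<in> poly1 n"
  using poly1_add[OF _ poly1_cmult[of g n "-1"]] by simp

lemma poly1_minus: "f \<in> poly1 n \<Longrightarrow> (\<lambda>x. - f x) \<in> poly1 n"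
  using poly1_cmult[of f n "-1"] by simp

lemma poly1_divide: "f \<in> poly1 n \<Longrightarrow> (\<lambda>x. f x / c) \<in> poly1 n"
  using poly1_cmult[of f n "inverse c"] by (simp add: field_simps)

lemma poly1_sum: "(\<And>i. i \<in> I \<Longrightarrow> f i \<in> poly1 n) \<Longrightarrow> (\<lambda>x. \<Sum>i\<in>I. f i x) \<in> poly1 n"
  by (induction I rule: infinite_finite_induct) (auto intro: poly1_add)

lemma poly1_power: "(\<lambda>x. x ^ i) \<in> poly1 (int i)"
proof (induction i)
  case (Suc i)
  then show ?case using poly1_mult[OF poly1_ident[of 1] Suc] by simp
qed (simp add: poly1_const)

lemma poly1_top: 
  assumes "f \<in> poly1 (int n)"
  shows "\<exists>c. \<exists>g\<in>poly1 (int n - 1). f = (\<lambda>x. c * x ^ n + g x)"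
proof -
  obtain p where p: "f = poly p" "\<forall>i. int n < int i \<longrightarrow> coeff p i = 0"
    using assms by (auto simp: poly1_iff)
  have "poly (p - monom (coeff p n) n) \<in> poly1 (int n - 1)"
    using p(2) by (intro poly1I) (auto simp: not_less le_less)
  then show ?thesis using p(1)
    by (intro exI[of _ "coeff p n"] bexI[of _ "poly (p - monom (coeff p n) n)"])
       (auto simp: poly_monom)
qed

lemma poly1_DERIV:
  "f \<in> poly1 n \<Longrightarrow> (f has_real_derivative deriv f x) (at x)"
  unfolding poly1_iff DERIV_deriv_iff_real_differentiable using poly_DERIV real_differentiable_def by blast

lemma poly1_deriv:
  assumes "f \<in> poly1 n" shows "deriv f \<in> poly1 (n - 1)"
proof -
  obtain p where p: "f = poly p" "\<forall>i. n < int i \<longrightarrow> coeff p i = 0"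
    using assms by (auto simp: poly1_iff)
  have "deriv f = poly (pderiv p)"
    by (auto simp: p intro!: DERIV_imp_deriv poly_DERIV)
  then show ?thesis using p(2)
    by (auto intro!: poly1I simp: coeff_pderiv)
qed

lemma poly1_zero_infinite:
  assumes "f \<in> poly1 n" "infinite S" "\<And>x. x \<in> S \<Longrightarrow> f x = 0"
  shows "f x = 0"
proof -
  obtain p where p: "f = poly p" using assms by (auto simp: poly1_iff)
  have "p = 0"
  proof (rule ccontr)
    assume "p \<noteq> 0"
    then have "finite {x. poly p x = 0}" by (rule poly_roots_finite)
    then have "finite S" using assms(3) p by (elim finite_subset[rotated]) auto
    with assms(2) show False by simp
  qed
  then show ?thesis using p by simp
qed

lemma poly1_div_root:
  assumes "f \<in> poly1 n" "f a = 0"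
  shows "\<exists>g\<in>poly1 (n - 1). f = (\<lambda>x. (x - a) * g x)"
proof -
  obtain p where p: "f = poly p" "\<forall>i. n < int i \<longrightarrow> coeff p i = 0"
    using assms by (auto simp: poly1_iff)
  then have "[:-a, 1:] dvd p" using assms by (simp add: poly_eq_0_iff_dvd)
  then obtain q where q: "p = [:-a, 1:] * q" by (elim dvdE)
  have "coeff q i = 0" if "n - 1 < int i" for i
  proof (rule ccontr)
    assume "coeff q i \<noteq> 0"
    then have "q \<noteq> 0" "i \<le> degree q" by (auto intro: le_degree)
    then have "degree p = Suc (degree q)" "p \<noteq> 0" 
      unfolding q by (auto simp: degree_mult_eq simp del: mult_pCons_left)
    moreover have "n < int (Suc (degree q))" using that \<open>i \<le> degree q\<close> by linarith
    ultimately show False using p(2) by (metis leading_coeff_0_iff)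
  qed
  then show ?thesis
    by (intro bexI[of _ "poly q"] poly1I) (auto simp: p q algebra_simps)
qed

lemma poly1_antideriv:
  assumes "f \<in> poly1 n"
  shows "\<exists>g\<in>poly1 (n + 1). g 0 = 0 \<and> (\<forall>x. (g has_real_derivative f x) (at x))"
proof -
  obtain c where c: "f = (\<lambda>x. \<Sum>i\<in>{i. int i \<le> n}. c i * x ^ i)"
    using assms by (auto simp: poly1_def)
  let ?g = "\<lambda>x. \<Sum>i\<in>{i. int i \<le> n}. c i / (real i + 1) * x ^ Suc i"
  have "(?g has_real_derivative f x) (at x)" for x
    unfolding c by (rule derivative_eq_intros DERIV_sum refl | simp add: field_simps)+
  moreover have "?g \<in> poly1 (n + 1)"
    by (intro poly1_sum poly1_cmult poly1_mono[OF poly1_power]) auto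
  ultimately show ?thesis by (intro bexI[of _ ?g]) auto
qed

text \<open>The derivative of \<open>F / (1+z)^w\<close> is \<open>((1+z) F' - w F) / (1+z)^(w+1)\<close>. As an operator on numerators
  it is bijective on polynomials of degree below \<open>w\<close>.\<close>

lemma poly1_op_coeff:
  assumes "F = poly p"
  shows "(\<lambda>z. (1 + z) * deriv F z - w * F z) = poly ([:1, 1:] * pderiv p - smult w p)"
    and "coeff ([:1, 1:] * pderiv p - smult w p) j = real (Suc j) * coeff p (Suc j) + (real j - w) * coeff p j"
proof -
  have "deriv F = poly (pderiv p)"
    by (auto simp: assms intro!: DERIV_imp_deriv poly_DERIV)
  then show "(\<lambda>z. (1 + z) * deriv F z - w * F z) = poly ([:1, 1:] * pderiv p - smult w p)"
    by (auto simp: assms algebra_simps)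
  show "coeff ([:1, 1:] * pderiv p - smult w p) j = real (Suc j) * coeff p (Suc j) + (real j - w) * coeff p j"
    by (cases j) (auto simp: coeff_pderiv coeff_pCons algebra_simps)
qed

text \<open>The operator multiplies the leading coefficient by \<open>degree p - w\<close>, and this
  factor is nonzero because the degree stays below \<open>w\<close>.\<close>

lemma poly1_op_inj:
  assumes "F \<in> poly1 n" "real_of_int n < w" "\<And>z. (1 + z) * deriv F z - w * F z = 0"
  shows "F z = 0"
proof -
  obtain p where p: "F = poly p" "\<forall>i. n < int i \<longrightarrow> coeff p i = 0"
    using assms by (auto simp: poly1_iff)
  have "poly ([:1, 1:] * pderiv p - smult w p) = poly 0"
    using poly1_op_coeff(1)[OF p(1), of w] assms(3) by (simp add: fun_eq_iff del: mult_pCons_left)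
  then have "[:1, 1:] * pderiv p - smult w p = 0" by (simp only: poly_eq_poly_eq_iff)
  then have "real (Suc (degree p)) * coeff p (Suc (degree p)) + (real (degree p) - w) * lead_coeff p = 0"
    using poly1_op_coeff(2)[OF p(1), of w] by (metis coeff_0)
  then have "real (degree p) = w \<or> lead_coeff p = 0" by (simp add: coeff_eq_0)
  moreover have "real (degree p) \<noteq> w" if "lead_coeff p \<noteq> 0"
  proof -
    have "int (degree p) \<le> n" using that p(2) by (meson not_less)
    then have "real (degree p) \<le> real_of_int n" by linarith
    with assms(2) show ?thesis by linarith
  qed
  ultimately have "p = 0" by auto
  then show ?thesis by (simp add: p)
qed

text \<open>Elimination from the top: \<open>z ^ m\<close> is mapped to \<open>(m - w) z ^ m\<close>
  plus lower terms, so a multiple of \<open>z ^ m\<close> removes the top coefficient of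
  \<open>f\<close> without raising the degree.\<close>

lemma poly1_op_surj:
  assumes "f \<in> poly1 n" "real_of_int n < w"
  shows "\<exists>F\<in>poly1 n. \<forall>z. (1 + z) * deriv F z - w * F z = f z"
proof (cases "n < 0")
  case True
  then show ?thesis using assms by (intro bexI[of _ f]) (auto simp: poly1_neg)
next
  case False
  \<comment> \<open>Writing the degree as \<open>int m - 1\<close> lets the induction start from the
    zero space; the condition \<open>real m < w + 1\<close> keeps the divisor
    \<open>real m - w\<close> of each step nonzero.\<close>
  have "\<exists>F\<in>poly1 (int m - 1). \<forall>z. (1 + z) * deriv F z - w * F z = f z"
    if "f \<in> poly1 (int m - 1)" "real m < w + 1" for m f
    using that
  proof (induction m arbitrary: f)
    case 0
    then show ?case by (intro bexI[of _ f]) (auto simp: poly1_neg)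
  next
    case (Suc m)
    from Suc.prems poly1_top[of f m] obtain c g where g: "g \<in> poly1 (int m - 1)" "f = (\<lambda>x. c * x ^ m + g x)"
      by auto
    define b where "b = c / (real m - w)"
    let ?h = "\<lambda>z. g z - b * (real m * z ^ (m - 1))"
    have "?h \<in> poly1 (int m - 1)"
      using g by (cases m) (auto intro!: poly1_diff poly1_cmult poly1_mono[OF poly1_power])
    then obtain F where F: "F \<in> poly1 (int m - 1)" "\<And>z. (1 + z) * deriv F z - w * F z = ?h z"
      using Suc.IH[of ?h] Suc.prems by auto
    let ?F = "\<lambda>z. b * z ^ m + F z"
    have "?F \<in> poly1 (int (Suc m) - 1)"
      using F by (auto intro!: poly1_add poly1_cmult poly1_power intro: poly1_mono)
    moreover have "deriv ?F z = b * (real m * z ^ (m - 1)) + deriv F z" for z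
      by (rule DERIV_imp_deriv) (auto intro!: derivative_eq_intros poly1_DERIV[OF F(1)])
    moreover have "(1 + z) * (b * (real m * z ^ (m - 1)) + deriv F z) - w * (b * z ^ m + F z) = f z" for z
    proof -
      have bm: "b * (real m - w) = c" using Suc.prems by (simp add: b_def)
      \<comment> \<open>For \<open>m = 0\<close> the exponent \<open>m - 1\<close> truncates to
        \<open>0\<close>, and the factor \<open>real m\<close> makes both sides zero.\<close>
      have zz: "z * z ^ (m - 1) * real m = z ^ m * real m" by (cases m) auto
      have "(1 + z) * (b * (real m * z ^ (m - 1)) + deriv F z) - w * (b * z ^ m + F z)
        = b * (real m * z ^ (m - 1)) + b * (z * z ^ (m - 1) * real m) - w * b * z ^ m + ((1 + z) * deriv F z - w * F z)"
        by (simp add: algebra_simps)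
      also have "\<dots> = b * (real m - w) * z ^ m + g z"
        unfolding zz F(2) by (simp add: algebra_simps)
      finally show ?thesis by (simp add: bm g)
    qed
    ultimately show ?case by (intro bexI[of _ ?F]) auto
  qed
  from this[of f "Suc (nat n)"] False assms show ?thesis by auto
qed

text \<open>Here the coefficient recursion is run upwards from \<open>coeff p 0 = 0\<close>: all
  coefficients up to \<open>m\<close> vanish, and the line of the recursion for \<open>j = m\<close>
  then yields \<open>c = 0\<close>. It shows that the solution with right-hand side
  \<open>z ^ (k - 1)\<close> is nonzero at \<open>0\<close>, and it drives the injectivity of the
  divergence.\<close>

lemma poly1_op_power:
  assumes "F \<in> poly1 (int m)" "F 0 = 0" "\<And>z. (1 + z) * deriv F z - w * F z = c * z ^ m"
  shows "F z = 0" "c = 0"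
proof -
  obtain p where p: "F = poly p" "\<forall>i. int m < int i \<longrightarrow> coeff p i = 0"
    using assms by (auto simp: poly1_iff)
  have "poly ([:1, 1:] * pderiv p - smult w p) = poly (monom c m)"
    using poly1_op_coeff(1)[OF p(1), of w] assms(3) by (simp add: fun_eq_iff poly_monom del: mult_pCons_left)
  then have eq: "[:1, 1:] * pderiv p - smult w p = monom c m" by (simp only: poly_eq_poly_eq_iff)
  have rec: "real (Suc j) * coeff p (Suc j) + (real j - w) * coeff p j = (if j = m then c else 0)" for j
    using poly1_op_coeff(2)[OF p(1), of w j] unfolding eq by (cases "j = m") auto
  have "j \<le> m \<Longrightarrow> coeff p j = 0" for j
  proof (induction j)
    case 0
    then show ?case using assms(2) p(1) by (simp add: poly_0_coeff_0)
  next
    case (Suc j)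
    then show ?case using rec[of j] by (simp del: of_nat_Suc)
  qed
  then have "p = 0" using p(2) by (intro poly_eqI) (metis coeff_0 not_less of_nat_less_iff)
  then show "F z = 0" "c = 0" using p eq by auto
qed

text \<open>The Lagrange basis at the nodes \<open>0, ..., n\<close>. A polynomial becomes a
  combination of fixed polynomials with its own values as coefficients, so linear constructions in
  one variable extend to several, the other variables acting as parameters.\<close>

lemma poly1_interpolation:
  "\<exists>L. (\<forall>i. L i \<in> poly1 n) \<and> (\<forall>f\<in>poly1 n. \<forall>x. f x = (\<Sum>i\<in>{i. int i \<le> n}. f (real i) * L i x))"
proof (cases "n < 0")
  case True
  then show ?thesis by (intro exI[of _ "\<lambda>i x. 0"]) (auto simp: poly1_neg int_le_set)
next
  case False
  let ?I = "{i. int i \<le> n}"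
  define L where "L = (\<lambda>i x. if i \<in> ?I then \<Prod>j\<in>?I - {i}. (x - real j) / (real i - real j) else 0)"
  have prod: "finite J \<Longrightarrow> (\<lambda>x. \<Prod>j\<in>J. (x - real j) / (real i - real j)) \<in> poly1 (int (card J))" for i J
  proof (induction J rule: finite_induct)
    case (insert j J)
    have "(\<lambda>x. x - real j) \<in> poly1 1" by (auto intro!: poly1_diff poly1_ident poly1_const)
    from poly1_mult[OF poly1_divide[OF this] insert.IH] insert show ?case by simp
  qed (simp add: poly1_const)
  have "L i \<in> poly1 n" for i
  proof (cases "i \<in> ?I")
    case True
    then have "int (card (?I - {i})) = n" using False by (simp add: int_le_set)
    then show ?thesis using prod[of "?I - {i}" i] True by (simp add: L_def)
  qed (simp add: L_def)
  moreover have "f x = (\<Sum>i\<in>?I. f (real i) * L i x)" if f: "f \<in> poly1 n" for f x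
  proof -
    let ?g = "\<lambda>x. f x - (\<Sum>i\<in>?I. f (real i) * L i x)"
    have g: "?g \<in> poly1 n"
      using f \<open>\<And>i. L i \<in> poly1 n\<close> by (intro poly1_diff poly1_sum poly1_cmult) auto
    then obtain p where p: "?g = poly p" "\<forall>i. n < int i \<longrightarrow> coeff p i = 0"
      by (auto simp: poly1_iff)
    have 0: "?g (real m) = 0" if "m \<in> ?I" for m
    proof -
      have "(\<Sum>i\<in>?I. f (real i) * L i (real m)) = (\<Sum>i\<in>?I. if i = m then f (real i) else 0)"
      proof (rule sum.cong)
        fix i assume i: "i \<in> ?I"
        show "f (real i) * L i (real m) = (if i = m then f (real i) else 0)"
        proof (cases "i = m")
          case True
          have "(\<Prod>j\<in>?I - {m}. (real m - real j) / (real m - real j)) = 1"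
            by (intro prod.neutral) auto
          then have "L m (real m) = 1" using that unfolding L_def by (simp only: if_True)
          then show ?thesis using True by simp
        next
          case False
          then have "L i (real m) = 0"
            using i that finite_int_le by (auto simp: L_def intro!: prod_zero bexI[of _ m])
          then show ?thesis using False by simp
        qed
      qed simp
      also have "\<dots> = f (real m)" using that by (subst sum.delta) auto
      finally show ?thesis by simp
    qed
    have "p = 0"
    proof (rule ccontr)
      assume "p \<noteq> 0"
      have "card ?I = card (real ` ?I)" by (simp add: card_image)
      also have "\<dots> \<le> card {x. poly p x = 0}"
        using 0[unfolded p(1)[THEN fun_cong]] by (intro card_mono poly_roots_finite \<open>p \<noteq> 0\<close>) blast
      also have "\<dots> \<le> degree p" by (rule card_poly_roots_bound[OF \<open>p \<noteq> 0\<close>])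
      finally have "n < int (degree p)" using False by (simp add: int_le_set)
      then show False using p(2) \<open>p \<noteq> 0\<close> by (metis leading_coeff_0_iff)
    qed
    with fun_cong[OF p(1), of x] show ?thesis by simp
  qed
  ultimately show ?thesis by blast
qed

section \<open>Polynomials in three variables\<close>

lemma polyQ3_index: "{(i, j, h). int i \<le> l \<and> int j \<le> m \<and> int h \<le> n} = {i. int i \<le> l} \<times> {j. int j \<le> m} \<times> {h. int h \<le> n}"
  by auto

lemma polyQ3_add: 
  assumes "f \<in> polyQ3 l m n" "g \<in> polyQ3 l m n" 
  shows "(\<lambda>x y z. f x y z + g x y z) \<in> polyQ3 l m n"
proof -
  obtain c d where "f = (\<lambda>x y z. \<Sum>(i, j, h)\<in>{(i, j, h). int i \<le> l \<and> int j \<le> m \<and> int h \<le> n}. c i j h * x ^ i * y ^ j * z ^ h)"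
    "g = (\<lambda>x y z. \<Sum>(i, j, h)\<in>{(i, j, h). int i \<le> l \<and> int j \<le> m \<and> int h \<le> n}. d i j h * x ^ i * y ^ j * z ^ h)"
    using assms by (auto simp: polyQ3_def)
  then show ?thesis unfolding polyQ3_def
    by (intro CollectI exI[of _ "\<lambda>i j h. c i j h + d i j h"])
       (simp add: sum.distrib[symmetric] case_prod_unfold algebra_simps)
qed

lemma polyQ3_zero: "(\<lambda>x y z. 0) \<in> polyQ3 l m n"
  unfolding polyQ3_def by (intro CollectI exI[of _ "\<lambda>i j h. 0"]) simp

lemma polyQ3_sum: "(\<And>i. i \<in> I \<Longrightarrow> f i \<in> polyQ3 l m n) \<Longrightarrow> (\<lambda>x y z. \<Sum>i\<in>I. f i x y z) \<in> polyQ3 l m n"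
  by (induction I rule: infinite_finite_induct) (auto intro: polyQ3_add polyQ3_zero)

lemma polyQ3_prod:
  assumes "a \<in> poly1 l" "b \<in> poly1 m" "c \<in> poly1 n"
  shows "(\<lambda>x y z. a x * b y * c z) \<in> polyQ3 l m n"
proof -
  obtain ca cb cc where "a = (\<lambda>x. \<Sum>i\<in>{i. int i \<le> l}. ca i * x ^ i)" 
    "b = (\<lambda>x. \<Sum>i\<in>{i. int i \<le> m}. cb i * x ^ i)" "c = (\<lambda>x. \<Sum>i\<in>{i. int i \<le> n}. cc i * x ^ i)"
    using assms by (auto simp: poly1_def)
  then have "a x * b y * c z = (\<Sum>i\<in>{i. int i \<le> l}. \<Sum>j\<in>{j. int j \<le> m}. \<Sum>h\<in>{h. int h \<le> n}. 
      ca i * cb j * cc h * x ^ i * y ^ j * z ^ h)" for x y z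
  proof -
    assume *: "a = (\<lambda>x. \<Sum>i\<in>{i. int i \<le> l}. ca i * x ^ i)" 
      "b = (\<lambda>x. \<Sum>i\<in>{i. int i \<le> m}. cb i * x ^ i)" "c = (\<lambda>x. \<Sum>i\<in>{i. int i \<le> n}. cc i * x ^ i)"
    have "a x * (b y * c z) = (\<Sum>i\<in>{i. int i \<le> l}. \<Sum>j\<in>{j. int j \<le> m}. \<Sum>h\<in>{h. int h \<le> n}. 
      (ca i * x ^ i) * ((cb j * y ^ j) * (cc h * z ^ h)))"
    proof -
      have bc: "b y * c z = (\<Sum>j\<in>{j. int j \<le> m}. \<Sum>h\<in>{h. int h \<le> n}. (cb j * y ^ j) * (cc h * z ^ h))"
        by (simp only: * sum_product)
      show ?thesis unfolding bc by (simp only: *(1) sum_product) (simp only: sum_distrib_left)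
    qed
    then show ?thesis by (simp add: mult_ac)
  qed
  then show ?thesis unfolding polyQ3_def polyQ3_index
    by (intro CollectI exI[of _ "\<lambda>i j h. ca i * cb j * cc h"])
       (simp add: sum.cartesian_product[symmetric] fun_eq_iff)
qed

text \<open>By interpolation, a function that is polynomial in each variable separately, with uniform
  degree bounds, is a polynomial.\<close>

lemma polyQ3_iff:
  "f \<in> polyQ3 l m n \<longleftrightarrow> (\<forall>y z. (\<lambda>x. f x y z) \<in> poly1 l) \<and> (\<forall>x z. (\<lambda>y. f x y z) \<in> poly1 m)
     \<and> (\<forall>x y. (\<lambda>z. f x y z) \<in> poly1 n)" (is "?A \<longleftrightarrow> ?B")
proof
  assume ?A
  then obtain c where c: "f = (\<lambda>x y z. \<Sum>t\<in>{(i, j, h). int i \<le> l \<and> int j \<le> m \<and> int h \<le> n}. c (fst t) (fst (snd t)) (snd (snd t)) * x ^ fst t * y ^ fst (snd t) * z ^ snd (snd t))"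
    by (auto simp: polyQ3_def case_prod_unfold)
  show ?B unfolding c
    by (intro conjI allI poly1_sum poly1_cmult poly1_cmult_right poly1_mono[OF poly1_power]) auto
next
  assume B: ?B
  obtain L where L: "\<forall>i. L i \<in> poly1 l" "\<forall>f\<in>poly1 l. \<forall>x. f x = (\<Sum>i\<in>{i. int i \<le> l}. f (real i) * L i x)"
    using poly1_interpolation by metis
  obtain M where M: "\<forall>i. M i \<in> poly1 m" "\<forall>f\<in>poly1 m. \<forall>x. f x = (\<Sum>i\<in>{i. int i \<le> m}. f (real i) * M i x)"
    using poly1_interpolation by metis
  obtain N where N: "\<forall>i. N i \<in> poly1 n" "\<forall>f\<in>poly1 n. \<forall>x. f x = (\<Sum>i\<in>{i. int i \<le> n}. f (real i) * N i x)"
    using poly1_interpolation by metis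
  have "f x y z = (\<Sum>i\<in>{i. int i \<le> l}. \<Sum>j\<in>{i. int i \<le> m}. \<Sum>h\<in>{i. int i \<le> n}. f i j h * L i x * M j y * N h z)" for x y z
  proof -
    have "f x y z = (\<Sum>i\<in>{i. int i \<le> l}. f i y z * L i x)"
      using L(2)[rule_format, of "\<lambda>x. f x y z" x] B by blast
    also have "\<dots> = (\<Sum>i\<in>{i. int i \<le> l}. (\<Sum>j\<in>{i. int i \<le> m}. f i j z * M j y) * L i x)"
    proof -
      have "f i y z = (\<Sum>j\<in>{i. int i \<le> m}. f i j z * M j y)" for i :: real
        using M(2)[rule_format, of "\<lambda>y. f i y z" y] B by blast
      then show ?thesis by simp
    qed
    also have "\<dots> = (\<Sum>i\<in>{i. int i \<le> l}. (\<Sum>j\<in>{i. int i \<le> m}. (\<Sum>h\<in>{i. int i \<le> n}. f i j h * N h z) * M j y) * L i x)"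
    proof -
      have "f i j z = (\<Sum>h\<in>{i. int i \<le> n}. f i j h * N h z)" for i j :: real
        using N(2)[rule_format, of "\<lambda>z. f i j z" z] B by blast
      then show ?thesis by simp
    qed
    finally show ?thesis by (simp add: sum_distrib_left sum_distrib_right mult_ac)
  qed
  then have "f = (\<lambda>x y z. \<Sum>i\<in>{i. int i \<le> l}. \<Sum>j\<in>{i. int i \<le> m}. \<Sum>h\<in>{i. int i \<le> n}. f i j h * L i x * M j y * N h z)"
    unfolding fun_eq_iff by blast
  also have "\<dots> \<in> polyQ3 l m n"
  proof (intro polyQ3_sum)
    fix i j h :: nat
    have "(\<lambda>x. f i j h * L i x) \<in> poly1 l" using L by (auto intro: poly1_cmult)
    from polyQ3_prod[OF this, of "M j" m "N h" n] M N
    show "(\<lambda>x y z. f i j h * L i x * M j y * N h z) \<in> polyQ3 l m n" by simp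
  qed
  finally show ?A .
qed

lemma polyQ3_sec:
  assumes "f \<in> polyQ3 l m n"
  shows "(\<lambda>x. f x y z) \<in> poly1 l" "(\<lambda>y. f x y z) \<in> poly1 m" "(\<lambda>z. f x y z) \<in> poly1 n"
  using assms by (auto simp: polyQ3_iff)

lemma polyQ3_swap12: "(\<lambda>x y z. f y x z) \<in> polyQ3 l m n \<longleftrightarrow> f \<in> polyQ3 m l n"
  by (auto simp: polyQ3_iff)

lemma polyQ3_swap13: "(\<lambda>x y z. f z y x) \<in> polyQ3 l m n \<longleftrightarrow> f \<in> polyQ3 n m l"
  by (auto simp: polyQ3_iff)

lemma polyQ2_iff_Q3: "f \<in> polyQ2 l m \<longleftrightarrow> (\<lambda>x y z. f x y) \<in> polyQ3 l m 0"
proof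
  have *: "{(i, j, h). int i \<le> l \<and> int j \<le> m \<and> int h \<le> 0} = (\<lambda>(i, j). (i, j, 0)) ` {(i, j). int i \<le> l \<and> int j \<le> m}"
    by auto
  have inj: "inj_on (\<lambda>(i, j). (i, j, 0::nat)) A" for A :: "(nat \<times> nat) set"
    by (auto simp: inj_on_def)
  have reidx: "(\<Sum>(i, j, h)\<in>(\<lambda>(i, j). (i, j, 0)) ` A. g i j h) = (\<Sum>(i, j)\<in>A. g i j 0)"
    for A and g :: "nat \<Rightarrow> nat \<Rightarrow> nat \<Rightarrow> real"
    by (subst sum.reindex[OF inj]) (simp add: case_prod_unfold)
  { assume "f \<in> polyQ2 l m"
    then obtain c where "f = (\<lambda>x y. \<Sum>(i, j)\<in>{(i, j). int i \<le> l \<and> int j \<le> m}. c i j * x ^ i * y ^ j)"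
      by (auto simp: polyQ2_def)
    then show "(\<lambda>x y z. f x y) \<in> polyQ3 l m 0"
      unfolding polyQ3_def * by (intro CollectI exI[of _ "\<lambda>i j h. c i j"]) (simp add: reidx) }
  { assume "(\<lambda>x y z. f x y) \<in> polyQ3 l m 0"
    then obtain c where c: "(\<lambda>x y (z::real). f x y) = (\<lambda>x y z. \<Sum>(i, j)\<in>{(i, j). int i \<le> l \<and> int j \<le> m}. c i j 0 * x ^ i * y ^ j)"
      unfolding polyQ3_def * by (auto simp: reidx)
    have "f = (\<lambda>x y. \<Sum>(i, j)\<in>{(i, j). int i \<le> l \<and> int j \<le> m}. c i j 0 * x ^ i * y ^ j)"
    proof (intro ext)
      fix x y
      show "f x y = (\<Sum>(i, j)\<in>{(i, j). int i \<le> l \<and> int j \<le> m}. c i j 0 * x ^ i * y ^ j)"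
        using c[THEN fun_cong, of x, THEN fun_cong, of y, THEN fun_cong] .
    qed
    then show "f \<in> polyQ2 l m"
      unfolding polyQ2_def by (intro CollectI exI) }
qed

lemma polyQ2_iff:
  "f \<in> polyQ2 l m \<longleftrightarrow> (\<forall>y. (\<lambda>x. f x y) \<in> poly1 l) \<and> (\<forall>x. (\<lambda>y. f x y) \<in> poly1 m)"
  unfolding polyQ2_iff_Q3 polyQ3_iff by (simp add: poly1_const)

text \<open>The one-variable problem is solved for the Lagrange basis only, and the solutions are
  combined with the coefficients \<open>f i y z\<close>; these are polynomial in \<open>y\<close>
  and \<open>z\<close>, so the result keeps the degrees in these variables. \<open>R\<close> is a
  relation because the problems come as existence statements; \<open>lin\<close> expresses its
  linearity.\<close>

lemma polyQ3_lift:
  assumes f: "f \<in> polyQ3 l m n"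
    and ex: "\<And>a. a \<in> poly1 l \<Longrightarrow> \<exists>b\<in>poly1 l'. R a b"
    and lin: "\<And>I (a :: nat \<Rightarrow> real \<Rightarrow> real) b c. finite I \<Longrightarrow> (\<And>i. i \<in> I \<Longrightarrow> a i \<in> poly1 l \<and> b i \<in> poly1 l' \<and> R (a i) (b i)) \<Longrightarrow>
        R (\<lambda>x. \<Sum>i\<in>I. c i * a i x) (\<lambda>x. \<Sum>i\<in>I. c i * b i x)"
  shows "\<exists>g\<in>polyQ3 l' m n. \<forall>y z. R (\<lambda>x. f x y z) (\<lambda>x. g x y z)"
proof -
  obtain L where L: "\<forall>i. L i \<in> poly1 l" "\<forall>f\<in>poly1 l. \<forall>x. f x = (\<Sum>i\<in>{i. int i \<le> l}. f (real i) * L i x)"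
    using poly1_interpolation by metis
  obtain N where N: "\<And>i. N i \<in> poly1 l'" "\<And>i. R (L i) (N i)"
    using ex[OF L(1)[rule_format]] by metis
  define g where "g = (\<lambda>x y z. \<Sum>i\<in>{i. int i \<le> l}. f i y z * N i x)"
  have "g \<in> polyQ3 l' m n"
    unfolding g_def using N(1) f
    by (auto simp: polyQ3_iff intro!: poly1_sum poly1_cmult poly1_cmult_right)
  moreover have "R (\<lambda>x. f x y z) (\<lambda>x. g x y z)" for y z
  proof -
    have "(\<lambda>x. f x y z) = (\<lambda>x. \<Sum>i\<in>{i. int i \<le> l}. f i y z * L i x)"
      by (rule ext, rule L(2)[rule_format, of "\<lambda>x. f x y z"], rule polyQ3_sec(1)[OF f])
    then show ?thesis
      using lin[of "{i. int i \<le> l}" L N "\<lambda>i. f i y z"] L N by (simp add: g_def)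
  qed
  ultimately show ?thesis by blast
qed

lemma polyQ3_lift_z:
  assumes "f \<in> polyQ3 l m n"
    and "\<And>a. a \<in> poly1 n \<Longrightarrow> \<exists>b\<in>poly1 n'. R a b"
    and "\<And>I (a :: nat \<Rightarrow> real \<Rightarrow> real) b c. finite I \<Longrightarrow> (\<And>i. i \<in> I \<Longrightarrow> a i \<in> poly1 n \<and> b i \<in> poly1 n' \<and> R (a i) (b i)) \<Longrightarrow>
        R (\<lambda>x. \<Sum>i\<in>I. c i * a i x) (\<lambda>x. \<Sum>i\<in>I. c i * b i x)"
  shows "\<exists>g\<in>polyQ3 l m n'. \<forall>x y. R (\<lambda>z. f x y z) (\<lambda>z. g x y z)"
proof -
  have "(\<lambda>x y z. f z y x) \<in> polyQ3 n m l" using assms(1) by (simp add: polyQ3_iff)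
  note fs = this
  have "\<exists>g\<in>polyQ3 n' m l. \<forall>y z. R (\<lambda>x. f z y x) (\<lambda>x. g x y z)"
  proof (rule polyQ3_lift[where R = R, OF fs])
    show "\<exists>b\<in>poly1 n'. R a b" if "a \<in> poly1 n" for a
      using that by (rule assms(2))
    show "R (\<lambda>x. \<Sum>i\<in>I. c i * a i x) (\<lambda>x. \<Sum>i\<in>I. c i * b i x)"
      if "finite I" "\<And>i. i \<in> I \<Longrightarrow> a i \<in> poly1 n \<and> b i \<in> poly1 n' \<and> R (a i) (b i)" for I and a b :: "nat \<Rightarrow> real \<Rightarrow> real" and c
      using that by (rule assms(3))
  qed
  then obtain g where g: "g \<in> polyQ3 n' m l" "\<And>y z. R (\<lambda>x. f z y x) (\<lambda>x. g x y z)"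
    by blast
  then show ?thesis by (intro bexI[of _ "\<lambda>x y z. g z y x"]) (use g in \<open>simp_all add: polyQ3_iff\<close>)
qed

section \<open>Partial derivatives of polynomials\<close>

definition dX :: "(real \<Rightarrow> real \<Rightarrow> real \<Rightarrow> real) \<Rightarrow> real \<Rightarrow> real \<Rightarrow> real \<Rightarrow> real" where
  "dX f x y z = deriv (\<lambda>x. f x y z) x"
definition dY :: "(real \<Rightarrow> real \<Rightarrow> real \<Rightarrow> real) \<Rightarrow> real \<Rightarrow> real \<Rightarrow> real \<Rightarrow> real" where
  "dY f x y z = deriv (\<lambda>y. f x y z) y"
definition dZ :: "(real \<Rightarrow> real \<Rightarrow> real \<Rightarrow> real) \<Rightarrow> real \<Rightarrow> real \<Rightarrow> real \<Rightarrow> real" where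
  "dZ f x y z = deriv (\<lambda>z. f x y z) z"

lemma DERIV_dX: "f \<in> polyQ3 l m n \<Longrightarrow> ((\<lambda>x. f x y z) has_real_derivative dX f x y z) (at x)"
  unfolding dX_def by (rule poly1_DERIV[OF polyQ3_sec(1)])
lemma DERIV_dY: "f \<in> polyQ3 l m n \<Longrightarrow> ((\<lambda>y. f x y z) has_real_derivative dY f x y z) (at y)"
  unfolding dY_def by (rule poly1_DERIV[OF polyQ3_sec(2)])
lemma DERIV_dZ: "f \<in> polyQ3 l m n \<Longrightarrow> ((\<lambda>z. f x y z) has_real_derivative dZ f x y z) (at z)"
  unfolding dZ_def by (rule poly1_DERIV[OF polyQ3_sec(3)])

lemma dX_eqI: "((\<lambda>x. f x y z) has_real_derivative d) (at x) \<Longrightarrow> dX f x y z = d"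
  unfolding dX_def by (rule DERIV_imp_deriv)
lemma dY_eqI: "((\<lambda>y. f x y z) has_real_derivative d) (at y) \<Longrightarrow> dY f x y z = d"
  unfolding dY_def by (rule DERIV_imp_deriv)
lemma dZ_eqI: "((\<lambda>z. f x y z) has_real_derivative d) (at z) \<Longrightarrow> dZ f x y z = d"
  unfolding dZ_def by (rule DERIV_imp_deriv)

text \<open>Interpolation in \<open>x\<close> writes \<open>f\<close> as a sum of products
  \<open>f i y z * L i x\<close>. Differentiation in \<open>x\<close> touches only the second
  factor, in \<open>y\<close> or \<open>z\<close> only the first, so the mixed derivatives
  agree.\<close>

lemma dX_polyQ3:
  assumes f: "f \<in> polyQ3 l m n"
  shows "dX f \<in> polyQ3 (l - 1) m n" "dY (dX f) x y z = dX (dY f) x y z" "dZ (dX f) x y z = dX (dZ f) x y z"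
proof -
  obtain L where L: "\<And>i. L i \<in> poly1 l" "\<forall>f\<in>poly1 l. \<forall>x. f x = (\<Sum>i\<in>{i. int i \<le> l}. f (real i) * L i x)"
    using poly1_interpolation by metis
  have f_eq: "f = (\<lambda>x y z. \<Sum>i\<in>{i. int i \<le> l}. f i y z * L i x)"
    by (intro ext, rule L(2)[rule_format, of "\<lambda>x. f x y z" for y z], rule polyQ3_sec(1)[OF f])
  have dX: "dX f = (\<lambda>x y z. \<Sum>i\<in>{i. int i \<le> l}. f i y z * deriv (L i) x)"
    by (subst f_eq, intro ext dX_eqI) (intro DERIV_sum DERIV_cmult poly1_DERIV[OF L(1)])
  show "dX f \<in> polyQ3 (l - 1) m n"
    unfolding dX using f L(1) poly1_deriv
    by (auto simp: polyQ3_iff intro!: poly1_sum poly1_cmult poly1_cmult_right)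
  have Y: "dY f = (\<lambda>x y z. \<Sum>i\<in>{i. int i \<le> l}. dY f i y z * L i x)"
    by (intro ext dY_eqI, subst f_eq) (intro DERIV_sum DERIV_cmult_right DERIV_dY[OF f])
  have Z: "dZ f = (\<lambda>x y z. \<Sum>i\<in>{i. int i \<le> l}. dZ f i y z * L i x)"
    by (intro ext dZ_eqI, subst f_eq) (intro DERIV_sum DERIV_cmult_right DERIV_dZ[OF f])
  have "dY (dX f) x y z = (\<Sum>i\<in>{i. int i \<le> l}. dY f i y z * deriv (L i) x)"
    unfolding dX by (intro dY_eqI DERIV_sum DERIV_cmult_right DERIV_dY[OF f])
  also have "\<dots> = dX (dY f) x y z"
    by (subst Y, rule dX_eqI[symmetric]) (intro DERIV_sum DERIV_cmult poly1_DERIV[OF L(1)])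
  finally show "dY (dX f) x y z = dX (dY f) x y z" .
  have "dZ (dX f) x y z = (\<Sum>i\<in>{i. int i \<le> l}. dZ f i y z * deriv (L i) x)"
    unfolding dX by (intro dZ_eqI DERIV_sum DERIV_cmult_right DERIV_dZ[OF f])
  also have "\<dots> = dX (dZ f) x y z"
    by (subst Z, rule dX_eqI[symmetric]) (intro DERIV_sum DERIV_cmult poly1_DERIV[OF L(1)])
  finally show "dZ (dX f) x y z = dX (dZ f) x y z" .
qed

lemma dY_polyQ3:
  assumes f: "f \<in> polyQ3 l m n"
  shows "dY f \<in> polyQ3 l (m - 1) n" "dZ (dY f) x y z = dY (dZ f) x y z"
proof -
  have f': "(\<lambda>x y z. f y x z) \<in> polyQ3 m l n" using f by (simp add: polyQ3_iff)
  show "dY f \<in> polyQ3 l (m - 1) n" 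
    using dX_polyQ3(1)[OF f'] polyQ3_swap12[of "dY f" "m - 1" l n] by (simp add: dX_def[abs_def] dY_def[abs_def])
  show "dZ (dY f) x y z = dY (dZ f) x y z"
    using dX_polyQ3(3)[OF f', of y x z] by (simp add: dX_def[abs_def] dY_def[abs_def] dZ_def[abs_def])
qed

lemma dZ_polyQ3:
  assumes f: "f \<in> polyQ3 l m n"
  shows "dZ f \<in> polyQ3 l m (n - 1)"
proof -
  have f': "(\<lambda>x y z. f z y x) \<in> polyQ3 n m l" using f by (simp add: polyQ3_iff)
  show ?thesis
    using dX_polyQ3(1)[OF f'] polyQ3_swap13[of "dZ f" "n - 1" m l] by (simp add: dX_def[abs_def] dZ_def[abs_def])
qed

lemma polyQ3_has_derivative:
  assumes "f \<in> polyQ3 l m n"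
  shows "((\<lambda>p::real^3. f (p$1) (p$2) (p$3)) has_derivative
     (\<lambda>h. h$1 * dX f (p$1) (p$2) (p$3) + h$2 * dY f (p$1) (p$2) (p$3) + h$3 * dZ f (p$1) (p$2) (p$3))) (at p)"
proof -
  define x y z where "x = p$1" "y = p$2" "z = p$3"
  obtain c S where c: "f = (\<lambda>x y z. \<Sum>t\<in>S. c (fst t) (fst (snd t)) (snd (snd t)) * x ^ fst t * y ^ fst (snd t) * z ^ snd (snd t))"
    and S: "S = {(i, j, h). int i \<le> l \<and> int j \<le> m \<and> int h \<le> n}"
    using assms by (auto simp: polyQ3_def case_prod_unfold)
  let ?c = "\<lambda>t. c (fst t) (fst (snd t)) (snd (snd t))"
  have X: "dX f x y z = (\<Sum>t\<in>S. ?c t * (real (fst t) * x ^ (fst t - 1)) * y ^ fst (snd t) * z ^ snd (snd t))"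
    unfolding c by (rule dX_eqI) (auto intro!: DERIV_sum derivative_eq_intros)
  have Y: "dY f x y z = (\<Sum>t\<in>S. ?c t * x ^ fst t * (real (fst (snd t)) * y ^ (fst (snd t) - 1)) * z ^ snd (snd t))"
    unfolding c by (rule dY_eqI) (auto intro!: DERIV_sum derivative_eq_intros)
  have Z: "dZ f x y z = (\<Sum>t\<in>S. ?c t * x ^ fst t * y ^ fst (snd t) * (real (snd (snd t)) * z ^ (snd (snd t) - 1)))"
    unfolding c by (rule dZ_eqI) (auto intro!: DERIV_sum derivative_eq_intros)
  have "((\<lambda>p::real^3. f (p$1) (p$2) (p$3)) has_derivative (\<lambda>h. h$1 * dX f x y z + h$2 * dY f x y z + h$3 * dZ f x y z)) (at p)"
    unfolding X Y Z unfolding c x_y_z_def sum_distrib_left sum.distrib[symmetric]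
    by (intro has_derivative_sum)
       (auto intro!: derivative_eq_intros bounded_linear.has_derivative[OF bounded_linear_vec_nth] simp: algebra_simps)
  then show ?thesis by (simp add: x_y_z_def)
qed

text \<open>The growth on the infinite pyramid, in the form in which a power of
  \<open>1 - q$3\<close> compensates it on the finite one.\<close>

lemma polyQ3_bound:
  assumes "f \<in> polyQ3 l m (int n)"
  shows "\<exists>C. \<forall>x y z. 0 \<le> x \<longrightarrow> x \<le> 1 \<longrightarrow> 0 \<le> y \<longrightarrow> y \<le> 1 \<longrightarrow> 0 \<le> z \<longrightarrow> \<bar>f x y z\<bar> \<le> C * (1 + z) ^ n"
proof -
  obtain c S where c: "f = (\<lambda>x y z. \<Sum>t\<in>S. c (fst t) (fst (snd t)) (snd (snd t)) * x ^ fst t * y ^ fst (snd t) * z ^ snd (snd t))"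
    and S: "S = {(i, j, h). int i \<le> l \<and> int j \<le> m \<and> int h \<le> int n}"
    using assms by (auto simp: polyQ3_def case_prod_unfold)
  let ?c = "\<lambda>t. c (fst t) (fst (snd t)) (snd (snd t))"
  have "\<bar>f x y z\<bar> \<le> (\<Sum>t\<in>S. \<bar>?c t\<bar>) * (1 + z) ^ n" if "0 \<le> x" "x \<le> 1" "0 \<le> y" "y \<le> 1" "0 \<le> z" for x y z
    unfolding c sum_distrib_right
  proof (rule order_trans[OF sum_abs sum_mono])
    fix t assume t: "t \<in> S"
    have 1: "z ^ snd (snd t) \<le> (1 + z) ^ snd (snd t)" using that by (intro power_mono) auto
    have "(1 + z) ^ snd (snd t) \<le> (1 + z) ^ n" using that t S by (intro power_increasing) auto
    with 1 have "z ^ snd (snd t) \<le> (1 + z) ^ n" by simp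
    moreover have "x ^ fst t \<le> 1" "y ^ fst (snd t) \<le> 1" using that by (auto intro: power_le_one)
    ultimately have "x ^ fst t * y ^ fst (snd t) * z ^ snd (snd t) \<le> 1 * 1 * (1 + z) ^ n"
      using that by (intro mult_mono) auto
    then have "\<bar>?c t\<bar> * (x ^ fst t * y ^ fst (snd t) * z ^ snd (snd t)) \<le> \<bar>?c t\<bar> * (1 + z) ^ n"
      by (intro mult_left_mono) auto
    then show "\<bar>?c t * x ^ fst t * y ^ fst (snd t) * z ^ snd (snd t)\<bar> \<le> \<bar>?c t\<bar> * (1 + z) ^ n"
      using that by (simp add: abs_mult mult.assoc)
  qed
  then show ?thesis by blast
qed

lemma polyQ3_mono: "f \<in> polyQ3 l m n \<Longrightarrow> l \<le> l' \<Longrightarrow> m \<le> m' \<Longrightarrow> n \<le> n' \<Longrightarrow> f \<in> polyQ3 l' m' n'"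
  unfolding polyQ3_iff by (meson poly1_mono)

lemma polyQ3_diff: "f \<in> polyQ3 l m n \<Longrightarrow> g \<in> polyQ3 l m n \<Longrightarrow> (\<lambda>x y z. f x y z - g x y z) \<in> polyQ3 l m n"
  by (auto simp: polyQ3_iff intro!: poly1_diff)

lemma polyQ3_minus: "f \<in> polyQ3 l m n \<Longrightarrow> (\<lambda>x y z. - f x y z) \<in> polyQ3 l m n"
  by (auto simp: polyQ3_iff intro!: poly1_minus)

lemma polyQ3_cmult: "f \<in> polyQ3 l m n \<Longrightarrow> (\<lambda>x y z. c * f x y z) \<in> polyQ3 l m n"
  by (auto simp: polyQ3_iff intro!: poly1_cmult)

lemma polyQ3_mult: "f \<in> polyQ3 l m n \<Longrightarrow> g \<in> polyQ3 l' m' n' \<Longrightarrow> (\<lambda>x y z. f x y z * g x y z) \<in> polyQ3 (l + l') (m + m') (n + n')"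
  by (auto simp: polyQ3_iff intro!: poly1_mult)

lemma polyQ3_x: "a \<in> poly1 l \<Longrightarrow> (\<lambda>x y z. a x) \<in> polyQ3 l 0 0"
  and polyQ3_y: "a \<in> poly1 l \<Longrightarrow> (\<lambda>x y z. a y) \<in> polyQ3 0 l 0"
  and polyQ3_z: "a \<in> poly1 l \<Longrightarrow> (\<lambda>x y z. a z) \<in> polyQ3 0 0 l"
  by (auto simp: polyQ3_iff intro!: poly1_const)

lemma polyQ3_z1: "1 \<le> n \<Longrightarrow> (\<lambda>x y z. 1 + z) \<in> polyQ3 0 0 n"
  using polyQ3_z[OF poly1_add[OF poly1_const[of n 1] poly1_ident[of n]]] by simp

lemma polyQ3_zpow: "(\<lambda>x y z. z ^ i) \<in> polyQ3 0 0 (int i)"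
  by (rule polyQ3_z[OF poly1_power])

lemma poly1_bubble: "(\<lambda>x. x * (1 - x)) \<in> poly1 2"
  using poly1_mult[of "\<lambda>x. x" 1 "\<lambda>x. 1 - x" 1] by (simp add: poly1_ident poly1_diff poly1_const)

lemma polyQ3_neg:
  assumes "f \<in> polyQ3 l m n" "l < 0 \<or> m < 0 \<or> n < 0"
  shows "f x y z = 0"
  using assms polyQ3_sec[OF assms(1)] by (auto simp: poly1_neg fun_eq_iff)

section \<open>Dividing out boundary factors and inverting the operator in \<open>z\<close>\<close>

lemma polyQ3_div_x:
  assumes f: "f \<in> polyQ3 l m n" and 0: "\<And>y z. f a y z = 0"
  shows "\<exists>g\<in>polyQ3 (l - 1) m n. \<forall>x y z. f x y z = (x - a) * g x y z"
proof -
  \<comment> \<open>The lifted relation keeps the remainder \<open>f a\<close>, because it has to be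
    solvable for the Lagrange polynomials too, and these need not vanish at \<open>a\<close>. The
    hypothesis removes it at the end.\<close>
  have "\<exists>g\<in>polyQ3 (l - 1) m n. \<forall>y z. \<forall>x. f x y z = f a y z + (x - a) * g x y z"
  proof (rule polyQ3_lift[where R = "\<lambda>f g. \<forall>x. f x = f a + (x - a) * g x", OF f])
    fix b assume b: "b \<in> poly1 l"
    show "\<exists>g\<in>poly1 (l - 1). \<forall>x. b x = b a + (x - a) * g x"
    proof (cases "l < 0")
      case True
      then show ?thesis using b by (intro bexI[of _ "\<lambda>x. 0"]) (auto simp: poly1_neg)
    next
      case False
      then have "(\<lambda>x. b x - b a) \<in> poly1 l" using b by (intro poly1_diff poly1_const) auto
      from poly1_div_root[OF this, of a] show ?thesis by (auto simp: fun_eq_iff algebra_simps)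
    qed
  next
    fix I and b g :: "nat \<Rightarrow> real \<Rightarrow> real" and c
    assume "\<And>i. i \<in> I \<Longrightarrow> b i \<in> poly1 l \<and> g i \<in> poly1 (l - 1) \<and> (\<forall>x. b i x = b i a + (x - a) * g i x)"
    then show "\<forall>x. (\<Sum>i\<in>I. c i * b i x) = (\<Sum>i\<in>I. c i * b i a) + (x - a) * (\<Sum>i\<in>I. c i * g i x)"
      unfolding sum_distrib_left sum.distrib[symmetric]
      by (intro allI sum.cong refl) (metis distrib_left mult.left_commute)
  qed
  then show ?thesis unfolding 0 add_0 by blast
qed

lemma polyQ3_div_z:
  assumes f: "f \<in> polyQ3 l m n" and 0: "\<And>x y. f x y 0 = 0"
  shows "\<exists>g\<in>polyQ3 l m (n - 1). \<forall>x y z. f x y z = z * g x y z"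
proof -
  have "(\<lambda>x y z. f z y x) \<in> polyQ3 n m l" using f by (simp add: polyQ3_iff)
  from polyQ3_div_x[OF this, of 0] 0 obtain g where "g \<in> polyQ3 (n - 1) m l" "\<And>x y z. f x y z = z * g z y x"
    by auto
  then show ?thesis by (intro bexI[of _ "\<lambda>x y z. g z y x"]) (simp_all add: polyQ3_iff)
qed

lemma polyQ3_bubble_x:
  assumes f: "f \<in> polyQ3 l m n" and 0: "\<And>y z. f 0 y z = 0" "\<And>y z. f 1 y z = 0"
  shows "\<exists>g\<in>polyQ3 (l - 2) m n. \<forall>x y z. f x y z = x * (1 - x) * g x y z"
proof -
  obtain g where g: "g \<in> polyQ3 (l - 1) m n" "\<And>x y z. f x y z = x * g x y z"
    using polyQ3_div_x[OF f, of 0] 0 by auto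
  then have "g 1 y z = 0" for y z using 0(2)[of y z] by simp
  then obtain h where h: "h \<in> polyQ3 (l - 1 - 1) m n" "\<And>x y z. g x y z = (x - 1) * h x y z"
    using polyQ3_div_x[OF g(1), of 1] by auto
  have "l - 1 - 1 = l - 2" by simp
  then show ?thesis using polyQ3_minus[OF h(1)]
    by (intro bexI[of _ "\<lambda>x y z. - h x y z"]) (auto simp: g(2) h(2) algebra_simps)
qed

lemma polyQ3_bubble_y:
  assumes f: "f \<in> polyQ3 l m n" and 0: "\<And>x z. f x 0 z = 0" "\<And>x z. f x 1 z = 0"
  shows "\<exists>g\<in>polyQ3 l (m - 2) n. \<forall>x y z. f x y z = y * (1 - y) * g x y z"
proof -
  have "(\<lambda>x y z. f y x z) \<in> polyQ3 m l n" using f by (simp add: polyQ3_iff)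
  from polyQ3_bubble_x[OF this] 0 obtain g where "g \<in> polyQ3 (m - 2) l n" "\<And>x y z. f x y z = y * (1 - y) * g y x z"
    by auto
  then show ?thesis by (intro bexI[of _ "\<lambda>x y z. g y x z"]) (simp_all add: polyQ3_iff)
qed

lemma polyQ3_op:
  assumes f: "f \<in> polyQ3 l m n" and "real_of_int n < w"
  shows "\<exists>F\<in>polyQ3 l m n. \<forall>x y z. (1 + z) * dZ F x y z - w * F x y z = f x y z"
proof -
  have "\<exists>F\<in>polyQ3 l m n. \<forall>x y. \<forall>z. (1 + z) * deriv (\<lambda>z. F x y z) z - w * F x y z = f x y z"
  proof (rule polyQ3_lift_z[where R = "\<lambda>f F. \<forall>z. (1 + z) * deriv F z - w * F z = f z", OF f])
    show "\<exists>F\<in>poly1 n. \<forall>z. (1 + z) * deriv F z - w * F z = f z" if "f \<in> poly1 n" for f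
      by (rule poly1_op_surj[OF that assms(2)])
  next
    fix I and f F :: "nat \<Rightarrow> real \<Rightarrow> real" and c
    assume *: "\<And>i. i \<in> I \<Longrightarrow> f i \<in> poly1 n \<and> F i \<in> poly1 n \<and> (\<forall>z. (1 + z) * deriv (F i) z - w * F i z = f i z)"
    show "\<forall>z. (1 + z) * deriv (\<lambda>z. \<Sum>i\<in>I. c i * F i z) z - w * (\<Sum>i\<in>I. c i * F i z) = (\<Sum>i\<in>I. c i * f i z)"
    proof
      fix z
      have "deriv (\<lambda>z. \<Sum>i\<in>I. c i * F i z) z = (\<Sum>i\<in>I. c i * deriv (F i) z)"
        by (rule DERIV_imp_deriv, intro DERIV_sum DERIV_cmult) (use * in \<open>blast intro: poly1_DERIV\<close>)
      moreover have "(\<Sum>i\<in>I. c i * f i z) = (\<Sum>i\<in>I. c i * ((1 + z) * deriv (F i) z - w * F i z))"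
        using * by (intro sum.cong refl) auto
      ultimately show "(1 + z) * deriv (\<lambda>z. \<Sum>i\<in>I. c i * F i z) z - w * (\<Sum>i\<in>I. c i * F i z) = (\<Sum>i\<in>I. c i * f i z)"
        by (simp add: sum_distrib_left sum_subtractf[symmetric] algebra_simps)
    qed
  qed
  then show ?thesis by (simp add: dZ_def)
qed

text \<open>The equation is solved once more within degree \<open>n'\<close>, and uniqueness within
  degree \<open>n\<close> identifies the two solutions.\<close>

lemma polyQ3_op_degree:
  assumes f: "f \<in> polyQ3 l m n" and w: "real_of_int n < w" "n' \<le> n"
    and g: "(\<lambda>x y z. (1 + z) * dZ f x y z - w * f x y z) \<in> polyQ3 l m n'"
  shows "f \<in> polyQ3 l m n'"
proof -
  obtain F where F: "F \<in> polyQ3 l m n'" 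
    "\<And>x y z. (1 + z) * dZ F x y z - w * F x y z = (1 + z) * dZ f x y z - w * f x y z"
    using polyQ3_op[OF g, of w] w by force
  have "F x y z - f x y z = 0" for x y z
  proof (rule poly1_op_inj[of "\<lambda>z. F x y z - f x y z" n w])
    have "F \<in> polyQ3 l m n" using F w by (auto intro: polyQ3_mono)
    then show "(\<lambda>z. F x y z - f x y z) \<in> poly1 n" using f by (intro poly1_diff polyQ3_sec)
    have "deriv (\<lambda>z. F x y z - f x y z) z = dZ F x y z - dZ f x y z" for z
      by (intro DERIV_imp_deriv DERIV_diff DERIV_dZ[OF F(1)] DERIV_dZ[OF f])
    note d = this
    show "(1 + z) * deriv (\<lambda>z. F x y z - f x y z) z - w * (F x y z - f x y z) = 0" for z
      unfolding d using F(2)[of z x y] by (simp add: algebra_simps)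
  qed (fact w)
  then have "F = f" by (simp add: fun_eq_iff)
  with F show ?thesis by simp
qed

lemma polyQ3_antideriv_x:
  assumes f: "f \<in> polyQ3 l m n"
  shows "\<exists>H\<in>polyQ3 (l + 1) m n. \<forall>y z. H 0 y z = 0 \<and> (\<forall>x. ((\<lambda>x. H x y z) has_real_derivative f x y z) (at x))"
proof (rule polyQ3_lift[where R = "\<lambda>f H. H 0 = 0 \<and> (\<forall>x. (H has_real_derivative f x) (at x))", OF f])
  show "\<exists>b\<in>poly1 (l + 1). b 0 = 0 \<and> (\<forall>x. (b has_real_derivative a x) (at x))" if "a \<in> poly1 l" for a
    by (rule poly1_antideriv[OF that])
next
  fix I and f F :: "nat \<Rightarrow> real \<Rightarrow> real" and c
  assume *: "\<And>i. i \<in> I \<Longrightarrow> f i \<in> poly1 l \<and> F i \<in> poly1 (l + 1) \<and> F i 0 = 0 \<and> (\<forall>z. (F i has_real_derivative f i z) (at z))"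
  show "(\<Sum>i\<in>I. c i * F i 0) = 0 \<and> (\<forall>x. ((\<lambda>x. \<Sum>i\<in>I. c i * F i x) has_real_derivative (\<Sum>i\<in>I. c i * f i x)) (at x))"
    using * by (auto intro!: sum.neutral DERIV_sum DERIV_cmult)
qed

lemma polyQ3_top_z:
  assumes f: "f \<in> polyQ3 l m (int n)"
  shows "\<exists>c\<in>polyQ2 l m. \<exists>g\<in>polyQ3 l m (int n - 1). \<forall>x y z. f x y z = c x y * z ^ n + g x y z"
proof -
  \<comment> \<open>The coefficient is sought as a polynomial of degree \<open>0\<close> in
    \<open>z\<close> so that the lifting lemma provides it; \<open>b 0\<close> reads off its
    constant value.\<close>
  have "\<exists>b\<in>polyQ3 l m 0. \<forall>x y. (\<lambda>z. f x y z - b x y 0 * z ^ n) \<in> poly1 (int n - 1)"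
  proof (rule polyQ3_lift_z[where R = "\<lambda>f b. (\<lambda>z. f z - b 0 * z ^ n) \<in> poly1 (int n - 1)", OF f])
    fix a assume "a \<in> poly1 (int n)"
    from poly1_top[OF this] obtain c g where g: "g \<in> poly1 (int n - 1)" "a = (\<lambda>x. c * x ^ n + g x)" by blast
    then show "\<exists>b\<in>poly1 0. (\<lambda>z. a z - b 0 * z ^ n) \<in> poly1 (int n - 1)"
      by (intro bexI[of _ "\<lambda>x. c"] poly1_const) auto
  next
    fix I and a b :: "nat \<Rightarrow> real \<Rightarrow> real" and c
    assume *: "\<And>i. i \<in> I \<Longrightarrow> a i \<in> poly1 (int n) \<and> b i \<in> poly1 0 \<and> (\<lambda>z. a i z - b i 0 * z ^ n) \<in> poly1 (int n - 1)"
    have "(\<lambda>z. \<Sum>i\<in>I. c i * (a i z - b i 0 * z ^ n)) \<in> poly1 (int n - 1)"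
      using * by (intro poly1_sum poly1_cmult) auto
    then show "(\<lambda>z. (\<Sum>i\<in>I. c i * a i z) - (\<Sum>i\<in>I. c i * b i 0) * z ^ n) \<in> poly1 (int n - 1)"
      by (simp add: sum_distrib_left sum_distrib_right sum_subtractf algebra_simps)
  qed
  then obtain b where b: "b \<in> polyQ3 l m 0" "\<And>x y. (\<lambda>z. f x y z - b x y 0 * z ^ n) \<in> poly1 (int n - 1)"
    by blast
  have c: "(\<lambda>x y. b x y 0) \<in> polyQ2 l m"
    using b(1) by (simp add: polyQ2_iff polyQ3_iff)
  then have "(\<lambda>x y z. b x y 0) \<in> polyQ3 l m 0" by (simp add: polyQ2_iff_Q3)
  from polyQ3_diff[OF f, of "\<lambda>x y z. b x y 0 * z ^ n"] polyQ3_mult[OF this polyQ3_zpow[of n]]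
  have "(\<lambda>x y z. f x y z - b x y 0 * z ^ n) \<in> polyQ3 l m (int n)" by simp
  with b(2) have "(\<lambda>x y z. f x y z - b x y 0 * z ^ n) \<in> polyQ3 l m (int n - 1)"
    unfolding polyQ3_iff by blast
  with c show ?thesis
    by (intro bexI[of _ "\<lambda>x y. b x y 0"] bexI[of _ "\<lambda>x y z. f x y z - b x y 0 * z ^ n"]) auto
qed

lemma polyQ3_zero_box:
  assumes f: "f \<in> polyQ3 l m n" and 0: "\<And>x y z. 0 < x \<Longrightarrow> x < 1 \<Longrightarrow> 0 < y \<Longrightarrow> y < 1 \<Longrightarrow> 0 < z \<Longrightarrow> f x y z = 0"
  shows "f x y z = 0"
proof -
  have inf: "infinite {0<..<1::real}" "infinite ({0<..} :: real set)" by (auto simp: infinite_Ioi)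
  have 1: "f x y z = 0" if "0 < x" "x < 1" "0 < y" "y < 1" for x y z
    by (rule poly1_zero_infinite[OF polyQ3_sec(3)[OF f] inf(2)]) (use that 0 in auto)
  have 2: "f x y z = 0" if "0 < x" "x < 1" for x y z
    by (rule poly1_zero_infinite[OF polyQ3_sec(2)[OF f] inf(1)]) (use that 1 in auto)
  show ?thesis
    by (rule poly1_zero_infinite[OF polyQ3_sec(1)[OF f] inf(1)]) (use 2 in auto)
qed

section \<open>Numerators of the fields on the infinite pyramid\<close>

type_synonym fun3 = "real \<Rightarrow> real \<Rightarrow> real \<Rightarrow> real"

definition rat_field :: "nat \<Rightarrow> fun3 \<Rightarrow> fun3 \<Rightarrow> fun3 \<Rightarrow> real^3 \<Rightarrow> real^3" where
  "rat_field w n1 n2 n3 = (\<lambda>p. vector [n1 (p$1) (p$2) (p$3) / (1 + p$3) ^ w,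
      n2 (p$1) (p$2) (p$3) / (1 + p$3) ^ w, n3 (p$1) (p$2) (p$3) / (1 + p$3) ^ w])"

definition divergence_num :: "real \<Rightarrow> fun3 \<Rightarrow> fun3 \<Rightarrow> fun3 \<Rightarrow> fun3" where
  "divergence_num w n1 n2 n3 = (\<lambda>x y z. (1 + z) * (dX n1 x y z + dY n2 x y z + dZ n3 x y z) - w * n3 x y z)"

text \<open>The divergence of \<open>rat_field (k+2) n1 n2 n3\<close> is \<open>divergence_num (k+2) n1 n2 n3 / (1+z)^(k+3)\<close>. The correction
  terms with \<open>s\<close> and \<open>t\<close> are exactly those that keep the degree in \<open>z\<close> of this numerator below \<open>k\<close>.\<close>

definition flux_num :: "nat \<Rightarrow> fun3 \<Rightarrow> fun3 \<Rightarrow> fun3 \<Rightarrow> bool" where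
  "flux_num k n1 n2 n3 \<longleftrightarrow> n1 \<in> polyQ3 (int k) (int k - 1) (int k - 1) \<and> n2 \<in> polyQ3 (int k - 1) (int k) (int k - 1)
     \<and> n3 \<in> polyQ3 (int k - 1) (int k - 1) (int k)
     \<and> divergence_num (real k + 2) n1 n2 n3 \<in> polyQ3 (int k - 1) (int k - 1) (int k - 1)"

lemma dX_linear:
  assumes "f \<in> polyQ3 l m n" "g \<in> polyQ3 l' m' n'"
  shows "dX (\<lambda>x y z. f x y z + g x y z) = (\<lambda>x y z. dX f x y z + dX g x y z)"
    "dY (\<lambda>x y z. f x y z + g x y z) = (\<lambda>x y z. dY f x y z + dY g x y z)"
    "dZ (\<lambda>x y z. f x y z + g x y z) = (\<lambda>x y z. dZ f x y z + dZ g x y z)"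
  by (intro ext dX_eqI dY_eqI dZ_eqI DERIV_add DERIV_dX[OF assms(1)] DERIV_dX[OF assms(2)]
      DERIV_dY[OF assms(1)] DERIV_dY[OF assms(2)] DERIV_dZ[OF assms(1)] DERIV_dZ[OF assms(2)])+

lemma dX_cmult:
  assumes "f \<in> polyQ3 l m n"
  shows "dX (\<lambda>x y z. c * f x y z) = (\<lambda>x y z. c * dX f x y z)"
    "dY (\<lambda>x y z. c * f x y z) = (\<lambda>x y z. c * dY f x y z)"
    "dZ (\<lambda>x y z. c * f x y z) = (\<lambda>x y z. c * dZ f x y z)"
  by (intro ext dX_eqI dY_eqI dZ_eqI DERIV_cmult DERIV_dX[OF assms(1)] 
      DERIV_dY[OF assms(1)] DERIV_dZ[OF assms(1)])+

lemma divergence_num_add: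
  assumes "n1 \<in> polyQ3 l1 l2 l3" "n2 \<in> polyQ3 l4 l5 l6" "n3 \<in> polyQ3 l7 l8 l9"
   "m1 \<in> polyQ3 r1 r2 r3" "m2 \<in> polyQ3 r4 r5 r6" "m3 \<in> polyQ3 r7 r8 r9"
  shows "divergence_num w (\<lambda>x y z. n1 x y z + m1 x y z) (\<lambda>x y z. n2 x y z + m2 x y z) (\<lambda>x y z. n3 x y z + m3 x y z)
    = (\<lambda>x y z. divergence_num w n1 n2 n3 x y z + divergence_num w m1 m2 m3 x y z)"
  unfolding divergence_num_def dX_linear(1)[OF assms(1,4)] dX_linear(2)[OF assms(2,5)] dX_linear(3)[OF assms(3,6)]
  by (simp add: algebra_simps)

lemma divergence_num_cmult:
  assumes "n1 \<in> polyQ3 l1 l2 l3" "n2 \<in> polyQ3 l4 l5 l6" "n3 \<in> polyQ3 l7 l8 l9"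
  shows "divergence_num w (\<lambda>x y z. c * n1 x y z) (\<lambda>x y z. c * n2 x y z) (\<lambda>x y z. c * n3 x y z)
    = (\<lambda>x y z. c * divergence_num w n1 n2 n3 x y z)"
  unfolding divergence_num_def dX_cmult(1)[OF assms(1)] dX_cmult(2)[OF assms(2)] dX_cmult(3)[OF assms(3)]
  by (simp add: algebra_simps)

lemma flux_num_add:
  assumes "flux_num k n1 n2 n3" "flux_num k m1 m2 m3"
  shows "flux_num k (\<lambda>x y z. n1 x y z + m1 x y z) (\<lambda>x y z. n2 x y z + m2 x y z) (\<lambda>x y z. n3 x y z + m3 x y z)"
proof -
  have *: "n1 \<in> polyQ3 (int k) (int k - 1) (int k - 1)" "n2 \<in> polyQ3 (int k - 1) (int k) (int k - 1)" "n3 \<in> polyQ3 (int k - 1) (int k - 1) (int k)"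
    "m1 \<in> polyQ3 (int k) (int k - 1) (int k - 1)" "m2 \<in> polyQ3 (int k - 1) (int k) (int k - 1)" "m3 \<in> polyQ3 (int k - 1) (int k - 1) (int k)"
    using assms by (auto simp: flux_num_def)
  show ?thesis using assms unfolding flux_num_def divergence_num_add[OF *] by (auto intro: polyQ3_add)
qed

lemma flux_num_cmult:
  assumes "flux_num k n1 n2 n3"
  shows "flux_num k (\<lambda>x y z. c * n1 x y z) (\<lambda>x y z. c * n2 x y z) (\<lambda>x y z. c * n3 x y z)"
proof -
  have *: "n1 \<in> polyQ3 (int k) (int k - 1) (int k - 1)" "n2 \<in> polyQ3 (int k - 1) (int k) (int k - 1)" "n3 \<in> polyQ3 (int k - 1) (int k - 1) (int k)"
    using assms by (auto simp: flux_num_def)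
  show ?thesis using assms unfolding flux_num_def divergence_num_cmult[OF *] by (auto intro: polyQ3_cmult)
qed

lemma flux_num_diff:
  assumes "flux_num k n1 n2 n3" "flux_num k m1 m2 m3"
  shows "flux_num k (\<lambda>x y z. n1 x y z - m1 x y z) (\<lambda>x y z. n2 x y z - m2 x y z) (\<lambda>x y z. n3 x y z - m3 x y z)"
  using flux_num_add[OF assms(1) flux_num_cmult[OF assms(2), of "-1"]] by simp

text \<open>The part of the space without correction terms: \<open>a\<close> and \<open>b\<close>
  stop at degree \<open>k - 2\<close> in \<open>z\<close>, which leaves room for the factor
  \<open>1 + z\<close> in the divergence numerator.\<close>

lemma flux_num_base:
  assumes a: "a \<in> polyQ3 (int k) (int k - 1) (int k - 2)" and b: "b \<in> polyQ3 (int k - 1) (int k) (int k - 2)"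
    and c: "c \<in> polyQ3 (int k - 1) (int k - 1) (int k - 1)"
  shows "flux_num k a b c"
proof -
  have "(\<lambda>x y z. (1 + z) * (dX a x y z + dY b x y z)) \<in> polyQ3 (0 + (int k - 1)) (0 + (int k - 1)) (1 + (int k - 2))"
    by (intro polyQ3_mult polyQ3_z1 polyQ3_add dX_polyQ3(1)[OF a] dY_polyQ3(1)[OF b]) simp
  moreover have "(\<lambda>x y z. (1 + z) * dZ c x y z) \<in> polyQ3 (0 + (int k - 1)) (0 + (int k - 1)) (1 + (int k - 1 - 1))"
    by (intro polyQ3_mult polyQ3_z1 dZ_polyQ3[OF c]) simp
  ultimately have "(\<lambda>x y z. (1 + z) * (dX a x y z + dY b x y z) + ((1 + z) * dZ c x y z - (real k + 2) * c x y z)) \<in> polyQ3 (int k - 1) (int k - 1) (int k - 1)"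
    by (intro polyQ3_add polyQ3_diff polyQ3_cmult c) simp_all
  then have "divergence_num (real k + 2) a b c \<in> polyQ3 (int k - 1) (int k - 1) (int k - 1)"
    by (simp add: divergence_num_def algebra_simps)
  then show ?thesis using assms by (auto simp: flux_num_def intro: polyQ3_mono)
qed

text \<open>Numerator of the third component of the two correction terms taken together.\<close>

definition ext_num :: "nat \<Rightarrow> (real \<Rightarrow> real \<Rightarrow> real) \<Rightarrow> (real \<Rightarrow> real \<Rightarrow> real) \<Rightarrow> fun3" where
  "ext_num k s t = (\<lambda>x y z. z ^ (k - 1) * ((deriv (\<lambda>y. s x y) y + deriv (\<lambda>x. t x y) x) * (1 + z)))"

text \<open>The factor \<open>2\<close> in the first two components is decisive. With
  \<open>D = s_y + t_x\<close> and the common factor \<open>(1+z) D\<close> taken out, the terms in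
  \<open>z ^ (k - 1)\<close> add up to \<open>2 + 1 + (k - 1) - (k + 2) = 0\<close>, and only
  \<open>(k - 1) z ^ (k - 2)\<close> survives.\<close>

lemma flux_num_ext:
  assumes s: "s \<in> polyQ2 (int k - 1) (int k)" and t: "t \<in> polyQ2 (int k) (int k - 1)" and k: "k \<ge> 1"
  shows "flux_num k (\<lambda>x y z. z ^ (k - 1) * (2 * t x y)) (\<lambda>x y z. z ^ (k - 1) * (2 * s x y)) (ext_num k s t)"
    and "divergence_num (real k + 2) (\<lambda>x y z. z ^ (k - 1) * (2 * t x y)) (\<lambda>x y z. z ^ (k - 1) * (2 * s x y)) (ext_num k s t)
      = (\<lambda>x y z. (1 + z) * real (k - 1) * z ^ (k - 2) * (deriv (\<lambda>y. s x y) y + deriv (\<lambda>x. t x y) x))"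
proof -
  let ?s = "\<lambda>x y (z::real). s x y" and ?t = "\<lambda>x y (z::real). t x y"
  have s3: "?s \<in> polyQ3 (int k - 1) (int k) 0" and t3: "?t \<in> polyQ3 (int k) (int k - 1) 0"
    using s t by (simp_all add: polyQ2_iff_Q3)
  let ?D = "\<lambda>x y z. dY ?s x y z + dX ?t x y z"
  have D: "?D \<in> polyQ3 (int k - 1) (int k - 1) 0"
    by (intro polyQ3_add dX_polyQ3(1)[OF t3] dY_polyQ3(1)[OF s3])
  have D_eq: "?D x y z = deriv (\<lambda>y. s x y) y + deriv (\<lambda>x. t x y) x" for x y z
    by (simp add: dX_def dY_def)
  have zp: "(\<lambda>x y z. z ^ (k - 1)) \<in> polyQ3 0 0 (int k - 1)"
    using polyQ3_zpow[of "k - 1"] k by simp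
  have e: "ext_num k s t = (\<lambda>x y z. z ^ (k - 1) * (?D x y z * (1 + z)))"
    by (simp add: ext_num_def dX_def dY_def)
  have 1: "(\<lambda>x y z. z ^ (k - 1) * (2 * t x y)) \<in> polyQ3 (int k) (int k - 1) (int k - 1)"
    using polyQ3_mult[OF zp polyQ3_cmult[OF t3, of 2]] by simp
  have 2: "(\<lambda>x y z. z ^ (k - 1) * (2 * s x y)) \<in> polyQ3 (int k - 1) (int k) (int k - 1)"
    using polyQ3_mult[OF zp polyQ3_cmult[OF s3, of 2]] by simp
  have 3: "ext_num k s t \<in> polyQ3 (int k - 1) (int k - 1) (int k)"
    unfolding e using polyQ3_mult[OF zp polyQ3_mult[OF D polyQ3_z1[of 1]]] by simp
  have d1: "dX (\<lambda>x y z. z ^ (k - 1) * (2 * t x y)) x y z = z ^ (k - 1) * (2 * dX ?t x y z)" for x y z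
    by (intro dX_eqI DERIV_cmult DERIV_dX[OF t3])
  have d2: "dY (\<lambda>x y z. z ^ (k - 1) * (2 * s x y)) x y z = z ^ (k - 1) * (2 * dY ?s x y z)" for x y z
    by (intro dY_eqI DERIV_cmult DERIV_dY[OF s3])
  have d3: "dZ (ext_num k s t) x y z = (real (k - 1) * z ^ (k - 2) * (1 + z) + z ^ (k - 1)) * ?D x y z" for x y z
  proof (rule dZ_eqI)
    have "k - 1 - Suc 0 = k - 2" by simp
    then show "(ext_num k s t x y has_real_derivative (real (k - 1) * z ^ (k - 2) * (1 + z) + z ^ (k - 1)) * ?D x y z) (at z)"
      unfolding e dX_def dY_def by (auto intro!: derivative_eq_intros simp: algebra_simps)
  qed
  show dv: "divergence_num (real k + 2) (\<lambda>x y z. z ^ (k - 1) * (2 * t x y)) (\<lambda>x y z. z ^ (k - 1) * (2 * s x y)) (ext_num k s t)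
      = (\<lambda>x y z. (1 + z) * real (k - 1) * z ^ (k - 2) * (deriv (\<lambda>y. s x y) y + deriv (\<lambda>x. t x y) x))"
  proof (intro ext)
    fix x y z
    have kk: "real (k - 1) = real k - 1" using k by simp
    \<comment> \<open>For \<open>k = 1\<close> the exponent \<open>k - 2\<close> truncates to
      \<open>0\<close>; the factor \<open>real (k - 1)\<close> then annihilates both sides.\<close>
    have zz: "real (k - 1) * (z * z ^ (k - 2)) = real (k - 1) * z ^ (k - 1)"
    proof (cases "k \<ge> 2")
      case True
      then have "k - 1 = Suc (k - 2)" by simp
      then show ?thesis by simp
    next
      case False
      then have "k - 1 = 0" by simp
      then show ?thesis by simp
    qed
    have *: "(1 + z) * (Q * (2 * a) + Q * (2 * b) + (K * P * (1 + z) + Q) * (b + a)) - w * (Q * ((b + a) * (1 + z)))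
        = (1 + z) * K * P * (b + a)" if "K * (z * P) = K * Q" "w = K + 3" for K P Q a b w :: real
    proof -
      have "(1 + z) * (Q * (2 * a) + Q * (2 * b) + (K * P * (1 + z) + Q) * (b + a)) - w * (Q * ((b + a) * (1 + z)))
        - (1 + z) * K * P * (b + a) = (1 + z) * (a + b) * (K * (z * P) - K * Q)"
        by (simp add: that(2) algebra_simps)
      then show ?thesis using that(1) by simp
    qed
    have "divergence_num (real k + 2) (\<lambda>x y z. z ^ (k - 1) * (2 * t x y)) (\<lambda>x y z. z ^ (k - 1) * (2 * s x y)) (ext_num k s t) x y z
      = (1 + z) * real (k - 1) * z ^ (k - 2) * ?D x y z"
      unfolding divergence_num_def d1 d2 d3 unfolding e
      by (rule *[OF zz]) (use k in \<open>simp add: of_nat_diff\<close>)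
    then show "divergence_num (real k + 2) (\<lambda>x y z. z ^ (k - 1) * (2 * t x y)) (\<lambda>x y z. z ^ (k - 1) * (2 * s x y)) (ext_num k s t) x y z
      = (1 + z) * real (k - 1) * z ^ (k - 2) * (deriv (\<lambda>y. s x y) y + deriv (\<lambda>x. t x y) x)"
      by (simp only: D_eq)
  qed
  have "(\<lambda>x y z. (1 + z) * ((real (k - 1) * z ^ (k - 2)) * ?D x y z)) \<in> polyQ3 (0 + (0 + (int k - 1))) (0 + (0 + (int k - 1))) (1 + ((int k - 2) + 0))"
  proof (intro polyQ3_mult D polyQ3_z1)
    show "(\<lambda>x y z. real (k - 1) * z ^ (k - 2)) \<in> polyQ3 0 0 (int k - 2)"
    proof (cases "k \<ge> 2")
      case True
      then show ?thesis using polyQ3_zpow[of "k - 2"] by (intro polyQ3_cmult) simp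
    qed (simp add: polyQ3_zero)
  qed simp
  then show "flux_num k (\<lambda>x y z. z ^ (k - 1) * (2 * t x y)) (\<lambda>x y z. z ^ (k - 1) * (2 * s x y)) (ext_num k s t)"
    unfolding flux_num_def dv using 1 2 3 by (simp add: D_eq mult_ac)
qed

lemma ratQI: "g \<in> polyQ3 l m n \<Longrightarrow> (\<lambda>p. g (p$1) (p$2) (p$3) / (1 + p$3) ^ w) \<in> ratQ w l m n"
  unfolding ratQ_def by blast

text \<open>From right to left, the top coefficients in \<open>z\<close> of \<open>n1\<close> and
  \<open>n2\<close> dictate \<open>t\<close> and \<open>s\<close>. Once the corresponding correction
  terms are subtracted, the divergence bound and \<open>polyQ3_op_degree\<close> leave only degree
  \<open>k - 1\<close> in \<open>z\<close> for the third component.\<close>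

lemma U2bar_inf_iff:
  assumes k: "k \<ge> 1"
  shows "U2bar_inf k = {rat_field (k + 2) n1 n2 n3 | n1 n2 n3. flux_num k n1 n2 n3}"
proof (intro equalityI subsetI)
  fix u assume "u \<in> U2bar_inf k"
  then obtain a b c s t where a: "a \<in> polyQ3 (int k) (int k - 1) (int k - 2)" and b: "b \<in> polyQ3 (int k - 1) (int k) (int k - 2)"
    and c: "c \<in> polyQ3 (int k - 1) (int k - 1) (int k - 1)"
    and s: "s \<in> polyQ2 (int k - 1) (int k)" and t: "t \<in> polyQ2 (int k) (int k - 1)"
    and u: "u = (\<lambda>p. let x = p$1; y = p$2; z = p$3 in
              vector [a (p$1) (p$2) (p$3) / (1 + p$3) ^ (k+2), b (p$1) (p$2) (p$3) / (1 + p$3) ^ (k+2), c (p$1) (p$2) (p$3) / (1 + p$3) ^ (k+2)]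
              + (z ^ (k - 1) / (1 + z) ^ (k + 2)) *\<^sub>R
                  vector [0, 2 * s x y, deriv (\<lambda>y. s x y) y * (1 + z)]
              + (z ^ (k - 1) / (1 + z) ^ (k + 2)) *\<^sub>R
                  vector [2 * t x y, 0, deriv (\<lambda>x. t x y) x * (1 + z)])"
    unfolding U2bar_inf_def ratQ_def by auto
  have "u = rat_field (k + 2) (\<lambda>x y z. a x y z + z ^ (k - 1) * (2 * t x y)) (\<lambda>x y z. b x y z + z ^ (k - 1) * (2 * s x y)) (\<lambda>x y z. c x y z + ext_num k s t x y z)"
    unfolding u rat_field_def ext_num_def Let_def
    by (simp add: fun_eq_iff vec_eq_iff forall_3 add_divide_distrib algebra_simps)
  with flux_num_add[OF flux_num_base[OF a b c] flux_num_ext(1)[OF s t k]]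
  show "u \<in> {rat_field (k + 2) n1 n2 n3 | n1 n2 n3. flux_num k n1 n2 n3}" by blast
next
  fix u assume "u \<in> {rat_field (k + 2) n1 n2 n3 | n1 n2 n3. flux_num k n1 n2 n3}"
  then obtain n1 n2 n3 where n: "flux_num k n1 n2 n3" and u: "u = rat_field (k + 2) n1 n2 n3" by blast
  have km: "int (k - 1) = int k - 1" using k by simp
  obtain t' a where t': "t' \<in> polyQ2 (int k) (int k - 1)" and a: "a \<in> polyQ3 (int k) (int k - 1) (int k - 1 - 1)"
    and n1: "\<And>x y z. n1 x y z = t' x y * z ^ (k - 1) + a x y z"
    using polyQ3_top_z[of n1 "int k" "int k - 1" "k - 1"] n unfolding flux_num_def km by blast
  obtain s' b where s': "s' \<in> polyQ2 (int k - 1) (int k)" and b: "b \<in> polyQ3 (int k - 1) (int k) (int k - 1 - 1)"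
    and n2: "\<And>x y z. n2 x y z = s' x y * z ^ (k - 1) + b x y z"
    using polyQ3_top_z[of n2 "int k - 1" "int k" "k - 1"] n unfolding flux_num_def km by blast
  \<comment> \<open>Halved because the correction terms contain \<open>2 * s\<close> and
    \<open>2 * t\<close>.\<close>
  define s where "s = (\<lambda>x y. s' x y / 2)"
  define t where "t = (\<lambda>x y. t' x y / 2)"
  have s: "s \<in> polyQ2 (int k - 1) (int k)" and t: "t \<in> polyQ2 (int k) (int k - 1)"
    using s' t' by (auto simp: polyQ2_iff s_def t_def intro!: poly1_divide)
  define c where "c = (\<lambda>x y z. n3 x y z - ext_num k s t x y z)"
  have d: "flux_num k (\<lambda>x y z. n1 x y z - z ^ (k - 1) * (2 * t x y)) (\<lambda>x y z. n2 x y z - z ^ (k - 1) * (2 * s x y)) c"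
    unfolding c_def by (rule flux_num_diff[OF n flux_num_ext(1)[OF s t k]])
  also have "(\<lambda>x y z. n1 x y z - z ^ (k - 1) * (2 * t x y)) = a"
    by (simp add: n1 t_def fun_eq_iff)
  also have "(\<lambda>x y z. n2 x y z - z ^ (k - 1) * (2 * s x y)) = b"
    by (simp add: n2 s_def fun_eq_iff)
  finally have NUc: "flux_num k a b c" .
  have a': "a \<in> polyQ3 (int k) (int k - 1) (int k - 2)" and b': "b \<in> polyQ3 (int k - 1) (int k) (int k - 2)" using a b by simp_all
  have c': "c \<in> polyQ3 (int k - 1) (int k - 1) (int k)" using NUc by (simp add: flux_num_def)
  have c: "c \<in> polyQ3 (int k - 1) (int k - 1) (int k - 1)"
  proof (rule polyQ3_op_degree[OF c', of "real k + 2"])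
    have "divergence_num (real k + 2) a b c \<in> polyQ3 (int k - 1) (int k - 1) (int k - 1)" using NUc by (simp add: flux_num_def)
    moreover have "(\<lambda>x y z. (1 + z) * (dX a x y z + dY b x y z)) \<in> polyQ3 (0 + (int k - 1)) (0 + (int k - 1)) (1 + (int k - 2))"
      by (intro polyQ3_mult polyQ3_z1 polyQ3_add dX_polyQ3(1)[OF a'] dY_polyQ3(1)[OF b']) simp
    ultimately have "(\<lambda>x y z. divergence_num (real k + 2) a b c x y z - (1 + z) * (dX a x y z + dY b x y z)) \<in> polyQ3 (int k - 1) (int k - 1) (int k - 1)"
      by (intro polyQ3_diff) simp_all
    then show "(\<lambda>x y z. (1 + z) * dZ c x y z - (real k + 2) * c x y z) \<in> polyQ3 (int k - 1) (int k - 1) (int k - 1)"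
      by (simp add: divergence_num_def algebra_simps)
  qed auto
  have "u = (\<lambda>p. let x = p$1; y = p$2; z = p$3 in
              vector [a (p$1) (p$2) (p$3) / (1 + p$3) ^ (k+2), b (p$1) (p$2) (p$3) / (1 + p$3) ^ (k+2), c (p$1) (p$2) (p$3) / (1 + p$3) ^ (k+2)]
              + (z ^ (k - 1) / (1 + z) ^ (k + 2)) *\<^sub>R
                  vector [0, 2 * s x y, deriv (\<lambda>y. s x y) y * (1 + z)]
              + (z ^ (k - 1) / (1 + z) ^ (k + 2)) *\<^sub>R
                  vector [2 * t x y, 0, deriv (\<lambda>x. t x y) x * (1 + z)])"
  proof -
    have "2 * s x y = s' x y" "2 * t x y = t' x y" for x y by (simp_all add: s_def t_def)
    moreover have "n3 x y z = c x y z + ext_num k s t x y z" for x y z by (simp add: c_def)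
    ultimately show ?thesis
    unfolding u rat_field_def Let_def
    by (simp add: fun_eq_iff vec_eq_iff forall_3 n1 n2 add_divide_distrib ext_num_def algebra_simps)
  qed
  then show "u \<in> U2bar_inf k"
    unfolding U2bar_inf_def
    by (intro CollectI bexI[OF _ ratQI[OF a']] bexI[OF _ ratQI[OF b']] bexI[OF _ ratQI[OF c]] bexI[OF _ s] bexI[OF _ t])
qed

section \<open>Curls of the curl test fields\<close>

definition curl_num :: "nat \<Rightarrow> fun3 \<Rightarrow> fun3 \<Rightarrow> fun3 \<Rightarrow> bool" where
  "curl_num k m1 m2 m3 \<longleftrightarrow> (\<exists>q1\<in>polyQ3 (int k - 1) (int k - 2) (int k - 2). \<exists>q2\<in>polyQ3 (int k - 2) (int k - 1) (int k - 2).
     \<exists>\<rho>\<in>polyQ3 (int k - 2) (int k - 2) 0. m1 = (\<lambda>x y z. y * (1 - y) * z * q1 x y z) \<and>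
       m2 = (\<lambda>x y z. x * (1 - x) * z * q2 x y z) \<and> m3 = (\<lambda>x y z. x * (1 - x) * y * (1 - y) * \<rho> x y z))"

text \<open>Over the denominator \<open>(1+z) ^ (w+1)\<close>, the functions \<open>curl1\<close>,
  \<open>curl2\<close> and \<open>curl3\<close> are the components of the curl of
  \<open>rat_field w m1 m2 m3\<close>.\<close>

definition curl1 :: "real \<Rightarrow> fun3 \<Rightarrow> fun3 \<Rightarrow> fun3 \<Rightarrow> fun3" where
  "curl1 w m1 m2 m3 = (\<lambda>x y z. (1 + z) * dY m3 x y z - ((1 + z) * dZ m2 x y z - w * m2 x y z))"
definition curl2 :: "real \<Rightarrow> fun3 \<Rightarrow> fun3 \<Rightarrow> fun3 \<Rightarrow> fun3" where
  "curl2 w m1 m2 m3 = (\<lambda>x y z. ((1 + z) * dZ m1 x y z - w * m1 x y z) - (1 + z) * dX m3 x y z)"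
definition curl3 :: "real \<Rightarrow> fun3 \<Rightarrow> fun3 \<Rightarrow> fun3 \<Rightarrow> fun3" where
  "curl3 w m1 m2 m3 = (\<lambda>x y z. (1 + z) * (dX m2 x y z - dY m1 x y z))"

definition zero_trace :: "fun3 \<Rightarrow> fun3 \<Rightarrow> fun3 \<Rightarrow> bool" where
  "zero_trace n1 n2 n3 \<longleftrightarrow> (\<forall>y z. n1 0 y z = 0 \<and> n1 1 y z = 0) \<and> (\<forall>x z. n2 x 0 z = 0 \<and> n2 x 1 z = 0) \<and> (\<forall>x y. n3 x y 0 = 0)"

lemma U1_0curl_inf_iff: "U1_0curl_inf k = {rat_field (k + 1) m1 m2 m3 | m1 m2 m3. curl_num k m1 m2 m3}"
proof (intro equalityI subsetI)
  fix u assume "u \<in> U1_0curl_inf k"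
  then obtain q1 q2 \<rho> where q: "q1 \<in> polyQ3 (int k - 1) (int k - 2) (int k - 2)" "q2 \<in> polyQ3 (int k - 2) (int k - 1) (int k - 2)"
     "\<rho> \<in> polyQ3 (int k - 2) (int k - 2) 0"
    and u: "u = (\<lambda>p. let x = p$1; y = p$2; z = p$3 in
              vector [y * (1 - y) * z * (q1 (p$1) (p$2) (p$3) / (1 + p$3) ^ (k + 1)), 
                x * (1 - x) * z * (q2 (p$1) (p$2) (p$3) / (1 + p$3) ^ (k + 1)), x * (1 - x) * y * (1 - y) * (\<rho> (p$1) (p$2) (p$3) / (1 + p$3) ^ (k + 1))])"
    unfolding U1_0curl_inf_def ratQ_def by auto
  have "curl_num k (\<lambda>x y z. y * (1 - y) * z * q1 x y z) (\<lambda>x y z. x * (1 - x) * z * q2 x y z) (\<lambda>x y z. x * (1 - x) * y * (1 - y) * \<rho> x y z)"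
    unfolding curl_num_def using q by blast
  moreover have "u = rat_field (k + 1) (\<lambda>x y z. y * (1 - y) * z * q1 x y z) (\<lambda>x y z. x * (1 - x) * z * q2 x y z) (\<lambda>x y z. x * (1 - x) * y * (1 - y) * \<rho> x y z)"
    unfolding u rat_field_def Let_def by simp
  ultimately show "u \<in> {rat_field (k + 1) m1 m2 m3 | m1 m2 m3. curl_num k m1 m2 m3}" by blast
next
  fix u assume "u \<in> {rat_field (k + 1) m1 m2 m3 | m1 m2 m3. curl_num k m1 m2 m3}"
  then obtain q1 q2 \<rho> where q: "q1 \<in> polyQ3 (int k - 1) (int k - 2) (int k - 2)" "q2 \<in> polyQ3 (int k - 2) (int k - 1) (int k - 2)"
     "\<rho> \<in> polyQ3 (int k - 2) (int k - 2) 0"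
    and u: "u = rat_field (k + 1) (\<lambda>x y z. y * (1 - y) * z * q1 x y z) (\<lambda>x y z. x * (1 - x) * z * q2 x y z) (\<lambda>x y z. x * (1 - x) * y * (1 - y) * \<rho> x y z)"
    unfolding curl_num_def by blast
  show "u \<in> U1_0curl_inf k"
    unfolding U1_0curl_inf_def
    by (intro CollectI bexI[OF _ ratQI[OF q(1)]] bexI[OF _ ratQI[OF q(2)]] bexI[OF _ ratQI[OF q(3)]])
       (simp add: u rat_field_def Let_def)
qed

lemma curl_num_degrees:
  assumes "curl_num k m1 m2 m3"
  shows "m1 \<in> polyQ3 (int k - 1) (int k) (int k - 1)" "m2 \<in> polyQ3 (int k) (int k - 1) (int k - 1)" 
    "m3 \<in> polyQ3 (int k) (int k) 0"
proof -
  obtain q1 q2 \<rho> where q: "q1 \<in> polyQ3 (int k - 1) (int k - 2) (int k - 2)" "q2 \<in> polyQ3 (int k - 2) (int k - 1) (int k - 2)"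
     "\<rho> \<in> polyQ3 (int k - 2) (int k - 2) 0" "m1 = (\<lambda>x y z. y * (1 - y) * z * q1 x y z)" 
       "m2 = (\<lambda>x y z. x * (1 - x) * z * q2 x y z)" "m3 = (\<lambda>x y z. x * (1 - x) * y * (1 - y) * \<rho> x y z)"
    using assms unfolding curl_num_def by blast
  note z = polyQ3_z[OF poly1_ident[of 1]] and x = polyQ3_x[OF poly1_bubble] and y = polyQ3_y[OF poly1_bubble]
  show "m1 \<in> polyQ3 (int k - 1) (int k) (int k - 1)" 
    using polyQ3_mult[OF polyQ3_mult[OF y z] q(1)] by (simp add: q)
  show "m2 \<in> polyQ3 (int k) (int k - 1) (int k - 1)" 
    using polyQ3_mult[OF polyQ3_mult[OF x z] q(2)] by (simp add: q)
  show "m3 \<in> polyQ3 (int k) (int k) 0" 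
    using polyQ3_mult[OF polyQ3_mult[OF x y] q(3)] by (simp add: q mult.assoc)
qed

text \<open>Below \<open>k = 2\<close> each of the three factor spaces has a negative degree bound.
  This case is set apart wherever a factor \<open>1 + z\<close> would overrun the degree
  \<open>k - 1\<close>.\<close>

lemma curl_num_zero:
  assumes "curl_num k m1 m2 m3" "k < 2"
  shows "m1 = (\<lambda>x y z. 0)" "m2 = (\<lambda>x y z. 0)" "m3 = (\<lambda>x y z. 0)"
  using assms unfolding curl_num_def by (auto simp: fun_eq_iff polyQ3_neg)

lemma curl_num_flux_num:
  assumes C: "curl_num k m1 m2 m3"
  shows "flux_num k (curl1 (real k + 1) m1 m2 m3) (curl2 (real k + 1) m1 m2 m3) (curl3 (real k + 1) m1 m2 m3)" (is "flux_num k ?c1 ?c2 ?c3")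
    and "divergence_num (real k + 2) (curl1 (real k + 1) m1 m2 m3) (curl2 (real k + 1) m1 m2 m3) (curl3 (real k + 1) m1 m2 m3) = (\<lambda>x y z. 0)"
    and "zero_trace (curl1 (real k + 1) m1 m2 m3) (curl2 (real k + 1) m1 m2 m3) (curl3 (real k + 1) m1 m2 m3)"
proof -
  note d = curl_num_degrees[OF C]
  note dd = dX_polyQ3[OF d(1)] dX_polyQ3[OF d(2)] dX_polyQ3[OF d(3)] dY_polyQ3[OF d(1)] dY_polyQ3[OF d(2)] dY_polyQ3[OF d(3)]
    dZ_polyQ3[OF d(1)] dZ_polyQ3[OF d(2)] dZ_polyQ3[OF d(3)]
  have m3: "(\<lambda>x y z. (1 + z) * dY m3 x y z) \<in> polyQ3 (int k) (int k - 1) (int k - 1)"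
    "(\<lambda>x y z. (1 + z) * dX m3 x y z) \<in> polyQ3 (int k - 1) (int k) (int k - 1)"
  proof -
    have "(\<lambda>x y z. (1 + z) * dY m3 x y z) \<in> polyQ3 (0 + int k) (0 + (int k - 1)) (1 + 0)"
      "(\<lambda>x y z. (1 + z) * dX m3 x y z) \<in> polyQ3 (0 + (int k - 1)) (0 + int k) (1 + 0)"
      by (intro polyQ3_mult polyQ3_z1 dd; simp)+
    \<comment> \<open>Passing from degree \<open>1\<close> to degree \<open>k - 1\<close> in
      \<open>z\<close> requires \<open>k \<ge> 2\<close>; otherwise the fields are zero.\<close>
    then show "(\<lambda>x y z. (1 + z) * dY m3 x y z) \<in> polyQ3 (int k) (int k - 1) (int k - 1)"
      "(\<lambda>x y z. (1 + z) * dX m3 x y z) \<in> polyQ3 (int k - 1) (int k) (int k - 1)"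
      by (cases "k \<ge> 2"; use curl_num_zero[OF C] in \<open>force simp: dX_def dY_def polyQ3_zero intro: polyQ3_mono\<close>)+
  qed
  have "(\<lambda>x y z. (1 + z) * dZ m2 x y z) \<in> polyQ3 (0 + int k) (0 + (int k - 1)) (1 + (int k - 1 - 1))"
    by (intro polyQ3_mult polyQ3_z1 dd) simp
  then have 1: "?c1 \<in> polyQ3 (int k) (int k - 1) (int k - 1)"
    unfolding curl1_def by (intro polyQ3_diff polyQ3_cmult d m3) simp
  have "(\<lambda>x y z. (1 + z) * dZ m1 x y z) \<in> polyQ3 (0 + (int k - 1)) (0 + int k) (1 + (int k - 1 - 1))"
    by (intro polyQ3_mult polyQ3_z1 dd) simp
  then have 2: "?c2 \<in> polyQ3 (int k - 1) (int k) (int k - 1)"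
    unfolding curl2_def by (intro polyQ3_diff polyQ3_cmult d m3) simp
  have "?c3 \<in> polyQ3 (0 + (int k - 1)) (0 + (int k - 1)) (1 + (int k - 1))"
    unfolding curl3_def by (intro polyQ3_mult polyQ3_diff polyQ3_z1 dd) simp
  then have 3: "?c3 \<in> polyQ3 (int k - 1) (int k - 1) (int k)" by simp
  have X: "dX ?c1 x y z = (1 + z) * dX (dY m3) x y z - ((1 + z) * dX (dZ m2) x y z - (real k + 1) * dX m2 x y z)" for x y z
    unfolding curl1_def
    by (intro dX_eqI DERIV_diff DERIV_cmult DERIV_dX[OF dY_polyQ3(1)[OF d(3)]] DERIV_dX[OF dZ_polyQ3[OF d(2)]] DERIV_dX[OF d(2)])
  have Y: "dY ?c2 x y z = ((1 + z) * dY (dZ m1) x y z - (real k + 1) * dY m1 x y z) - (1 + z) * dY (dX m3) x y z" for x y z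
    unfolding curl2_def
    by (intro dY_eqI DERIV_diff DERIV_cmult DERIV_dY[OF dX_polyQ3(1)[OF d(3)]] DERIV_dY[OF dZ_polyQ3[OF d(1)]] DERIV_dY[OF d(1)])
  have Z: "dZ ?c3 x y z = (dX m2 x y z - dY m1 x y z) + (1 + z) * (dZ (dX m2) x y z - dZ (dY m1) x y z)" for x y z
    unfolding curl3_def
    by (rule dZ_eqI) (auto intro!: derivative_eq_intros DERIV_dZ[OF dX_polyQ3(1)[OF d(2)]] DERIV_dZ[OF dY_polyQ3(1)[OF d(1)]])
  show dv: "divergence_num (real k + 2) ?c1 ?c2 ?c3 = (\<lambda>x y z. 0)"
    unfolding divergence_num_def X Y Z unfolding curl3_def dX_polyQ3(2)[OF d(3)] dX_polyQ3(3)[OF d(2)] dY_polyQ3(2)[OF d(1)]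
    by (simp add: algebra_simps)
  show "flux_num k ?c1 ?c2 ?c3" unfolding flux_num_def dv using 1 2 3 by (simp add: polyQ3_zero)
  obtain q1 q2 \<rho> where q: "m1 = (\<lambda>x y z. y * (1 - y) * z * q1 x y z)" 
       "m2 = (\<lambda>x y z. x * (1 - x) * z * q2 x y z)" "m3 = (\<lambda>x y z. x * (1 - x) * y * (1 - y) * \<rho> x y z)"
    using C unfolding curl_num_def by blast
  show "zero_trace ?c1 ?c2 ?c3"
    unfolding zero_trace_def curl1_def curl2_def curl3_def dX_def dY_def dZ_def by (simp add: q)
qed

lemma deriv_zero_const:
  fixes f :: "real \<Rightarrow> real"
  assumes "f \<in> poly1 n" "\<And>x. deriv f x = 0" shows "f x = f y"
  by (rule DERIV_isconst_all) (use poly1_DERIV[OF assms(1)] assms(2) in simp)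

text \<open>Since \<open>m3\<close> is constant in \<open>z\<close>, it enters both equations only
  as a multiple of \<open>1 + z\<close>. The vanishing of \<open>m1\<close> and \<open>m2\<close> at
  \<open>z = 0\<close> separates their contribution from this one.\<close>

lemma curl_inj:
  assumes C: "curl_num k m1 m2 m3" and c1: "\<And>x y z. curl1 (real k + 1) m1 m2 m3 x y z = 0" 
    and c2: "\<And>x y z. curl2 (real k + 1) m1 m2 m3 x y z = 0"
  shows "m1 = (\<lambda>x y z. 0)" "m2 = (\<lambda>x y z. 0)" "m3 = (\<lambda>x y z. 0)"
proof -
  have "m1 = (\<lambda>x y z. 0) \<and> m2 = (\<lambda>x y z. 0) \<and> m3 = (\<lambda>x y z. 0)"
  proof (cases "k < 2")
    case True
    then show ?thesis using curl_num_zero[OF C] by simp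
  next
    case False
    note d = curl_num_degrees[OF C]
    obtain q1 q2 \<rho> where q: "m1 = (\<lambda>x y z. y * (1 - y) * z * q1 x y z)" 
         "m2 = (\<lambda>x y z. x * (1 - x) * z * q2 x y z)" "m3 = (\<lambda>x y z. x * (1 - x) * y * (1 - y) * \<rho> x y z)"
      using C unfolding curl_num_def by blast
    have const: "f x y z = f x y 0" if f: "f \<in> polyQ3 l m 0" for f l m x y z
      using polyQ3_sec(3)[OF f, of x y] by (auto simp: poly1_def int_le_set fun_eq_iff)
    \<comment> \<open>The operator with \<open>w = k + 1\<close> sends \<open>1 + z\<close> to
      \<open>- k (1 + z)\<close>. Hence \<open>M\<close> plus \<open>e / k\<close> times
      \<open>1 + z\<close> lies in its kernel and is zero, \<open>1 + z\<close> having admissible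
      degree as \<open>k \<ge> 2\<close>. At \<open>z = 0\<close>, where \<open>M\<close> vanishes,
      this gives \<open>e = 0\<close>.\<close>
    have key: "e = 0 \<and> M z = 0" if M: "M \<in> poly1 (int k - 1)" "M 0 = 0"
      and eq: "\<And>z. (1 + z) * deriv M z - (real k + 1) * M z = (1 + z) * e" for M e z
    proof -
      let ?N = "\<lambda>z. M z + e / real k * (1 + z)"
      have "?N z = 0" for z
      proof (rule poly1_op_inj[of ?N "int k - 1" "real k + 1"])
        show "?N \<in> poly1 (int k - 1)"
          by (intro poly1_add M poly1_cmult poly1_const poly1_ident) (use False in auto)
        have D: "deriv ?N z = deriv M z + e / real k" for z
          by (rule DERIV_imp_deriv) (use False in \<open>auto intro!: derivative_eq_intros poly1_DERIV[OF M(1)]\<close>)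
        have *: "(1 + z) * (e / real k) - (real k + 1) * (e / real k * (1 + z)) = - ((1 + z) * e)" for z
          using False by (cases "k = 0") (simp_all add: field_simps)
        show "(1 + z) * deriv ?N z - (real k + 1) * ?N z = 0" for z
        proof -
          have "(1 + z) * (deriv M z + e / real k) - (real k + 1) * (M z + e / real k * (1 + z))
            = ((1 + z) * deriv M z - (real k + 1) * M z) + ((1 + z) * (e / real k) - (real k + 1) * (e / real k * (1 + z)))"
            by (simp only: algebra_simps)
          then show ?thesis unfolding D eq * by simp
        qed
      qed simp
      note N = this
      from N[of 0] M(2) False have "e = 0" by (cases "k = 0") auto
      with N show ?thesis by simp
    qed
    have dm2: "dY m3 x y 0 = 0 \<and> m2 x y z = 0" for x y z
    proof (rule key[where M = "m2 x y"])
      show "m2 x y \<in> poly1 (int k - 1)" by (rule polyQ3_sec(3)[OF d(2)])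
      show "m2 x y 0 = 0" by (simp add: q)
      show "(1 + z) * deriv (m2 x y) z - (real k + 1) * m2 x y z = (1 + z) * dY m3 x y 0" for z
        using c1[of x y z] const[OF dY_polyQ3(1)[OF d(3)], of x y z] by (simp add: curl1_def dZ_def)
    qed
    have dm1: "dX m3 x y 0 = 0 \<and> m1 x y z = 0" for x y z
    proof (rule key[where M = "m1 x y"])
      show "m1 x y \<in> poly1 (int k - 1)" by (rule polyQ3_sec(3)[OF d(1)])
      show "m1 x y 0 = 0" by (simp add: q)
      show "(1 + z) * deriv (m1 x y) z - (real k + 1) * m1 x y z = (1 + z) * dX m3 x y 0" for z
        using c2[of x y z] const[OF dX_polyQ3(1)[OF d(3)], of x y z] by (simp add: curl2_def dZ_def)
    qed
    have "m3 x y z = 0" for x y z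
    proof -
      have "deriv (\<lambda>y. m3 x y z) y = 0" for y
        using dm2[of x y 0] const[OF dY_polyQ3(1)[OF d(3)], of x y z] by (simp add: dY_def)
      from deriv_zero_const[OF polyQ3_sec(2)[OF d(3)] this, of y 0] show ?thesis by (simp add: q)
    qed
    with dm1 dm2 show ?thesis by (simp add: fun_eq_iff)
  qed
  then show "m1 = (\<lambda>x y z. 0)" "m2 = (\<lambda>x y z. 0)" "m3 = (\<lambda>x y z. 0)" by auto
qed

section \<open>Divergences of the divergence test fields\<close>

text \<open>The potential \<open>r\<close> of the divergence test fields, as a function of its
  polynomial factor.\<close>

definition bubble_mult :: "(real \<Rightarrow> real \<Rightarrow> real) \<Rightarrow> real \<Rightarrow> real \<Rightarrow> real" where
  "bubble_mult pp x y = x * (1 - x) * y * (1 - y) * pp x y"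

definition div_num :: "nat \<Rightarrow> fun3 \<Rightarrow> fun3 \<Rightarrow> fun3 \<Rightarrow> bool" where
  "div_num k d1 d2 d3 \<longleftrightarrow> (\<exists>pp\<in>polyQ2 (int k - 2) (int k - 2). \<exists>tt\<in>poly1 (int k - 2). \<exists>ss\<in>poly1 (int k - 2).
     \<exists>chi\<in>polyQ3 (int k - 1) (int k - 1) (int k - 2).
       d1 = (\<lambda>x y z. z ^ (k - 1) * (deriv (\<lambda>y. bubble_mult pp x y) y + 2 * (x * (1 - x) * tt x))) \<and>
       d2 = (\<lambda>x y z. z ^ (k - 1) * (deriv (\<lambda>x. bubble_mult pp x y) x + 2 * (y * (1 - y) * ss y))) \<and>
       d3 = (\<lambda>x y z. z ^ (k - 1) * ((1 + z) * (deriv (\<lambda>y. deriv (\<lambda>x. bubble_mult pp x y) x) y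
               + deriv (\<lambda>y. y * (1 - y) * ss y) y + deriv (\<lambda>x. x * (1 - x) * tt x) x)) + z * chi x y z))"

lemma U2_0div_inf_iff: "U2_0div_inf k = {rat_field (k + 2) d1 d2 d3 | d1 d2 d3. div_num k d1 d2 d3}"
proof -
  have eq: "(\<lambda>p. let x = p$1; y = p$2; z = p$3;
                    r = (\<lambda>x y. x * (1 - x) * y * (1 - y) * pp x y);
                    t = (\<lambda>x. x * (1 - x) * tt x);
                    s = (\<lambda>y. y * (1 - y) * ss y);
                    r_x = (\<lambda>x y. deriv (\<lambda>x. r x y) x);
                    r_y = (\<lambda>x y. deriv (\<lambda>y. r x y) y);
                    r_xy = (\<lambda>x y. deriv (\<lambda>y. r_x x y) y)
                in
              (z ^ (k - 1) / (1 + z) ^ (k + 2)) *\<^sub>R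
                vector [r_y x y + 2 * t x, r_x x y + 2 * s y,
                        (1 + z) * (r_xy x y + deriv s y + deriv t x)]
              + vector [0, 0, z * (chi (p$1) (p$2) (p$3) / (1 + p$3) ^ (k + 2))])
     = rat_field (k + 2) (\<lambda>x y z. z ^ (k - 1) * (deriv (\<lambda>y. bubble_mult pp x y) y + 2 * (x * (1 - x) * tt x)))
        (\<lambda>x y z. z ^ (k - 1) * (deriv (\<lambda>x. bubble_mult pp x y) x + 2 * (y * (1 - y) * ss y)))
        (\<lambda>x y z. z ^ (k - 1) * ((1 + z) * (deriv (\<lambda>y. deriv (\<lambda>x. bubble_mult pp x y) x) y
               + deriv (\<lambda>y. y * (1 - y) * ss y) y + deriv (\<lambda>x. x * (1 - x) * tt x) x)) + z * chi x y z)" for pp tt ss chi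
    unfolding rat_field_def Let_def bubble_mult_def by (simp add: fun_eq_iff vec_eq_iff forall_3 add_divide_distrib)
  show ?thesis
  proof (intro equalityI subsetI)
    fix u assume "u \<in> U2_0div_inf k"
    then show "u \<in> {rat_field (k + 2) d1 d2 d3 | d1 d2 d3. div_num k d1 d2 d3}"
      unfolding U2_0div_inf_def ratQ_def
    proof (elim CollectE bexE, goal_cases)
      case (1 pp tt ss chi3 g)
      show ?case unfolding 1(4) 1(6) eq div_num_def using 1 by blast
    qed
  next
    fix u assume "u \<in> {rat_field (k + 2) d1 d2 d3 | d1 d2 d3. div_num k d1 d2 d3}"
    then show "u \<in> U2_0div_inf k"
      unfolding div_num_def
    proof (elim CollectE bexE conjE exE, goal_cases)
      case (1 d1 d2 d3 pp tt ss chi)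
      show ?case unfolding 1(1) 1(6,7,8) eq[symmetric] U2_0div_inf_def
        by (intro CollectI bexI[OF _ 1(2)] bexI[OF _ 1(3)] bexI[OF _ 1(4)] bexI[OF _ ratQI[OF 1(5)]] refl)
    qed
  qed
qed

lemma bubble_mult_Q3:
  assumes "pp \<in> polyQ2 (int k - 2) (int k - 2)"
  shows "(\<lambda>x y z. bubble_mult pp x y) \<in> polyQ3 (int k) (int k) 0"
  using polyQ3_mult[OF polyQ3_mult[OF polyQ3_x[OF poly1_bubble] polyQ3_y[OF poly1_bubble]], 
      of "\<lambda>x y z. pp x y" "int k - 2" "int k - 2" 0] assms
  by (simp add: polyQ2_iff_Q3 bubble_mult_def mult.assoc)

lemma poly1_bubble_mult: "s \<in> poly1 (int k - 2) \<Longrightarrow> (\<lambda>x. x * (1 - x) * s x) \<in> poly1 (int k)"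
  using poly1_mult[OF poly1_bubble, of s "int k - 2"] by simp

text \<open>Half of each first derivative of the bubble \<open>r\<close> goes into \<open>s\<close>
  and into \<open>t\<close>. A divergence test field thus becomes a correction pair
  \<open>s\<close>, \<open>t\<close> plus \<open>z * chi\<close> in the third component, and the two
  halves of \<open>r_xy\<close> add up in \<open>s_y + t_x\<close>. The idle \<open>+ 0\<close>
  gives the fields the shape of the addition rules for numerators.\<close>

lemma div_num_cases:
  assumes k: "k \<ge> 1" and D: "div_num k d1 d2 d3"
  obtains pp tt ss chi s t where
    "pp \<in> polyQ2 (int k - 2) (int k - 2)" "tt \<in> poly1 (int k - 2)" "ss \<in> poly1 (int k - 2)"
    "chi \<in> polyQ3 (int k - 1) (int k - 1) (int k - 2)"
    "s \<in> polyQ2 (int k - 1) (int k)" "t \<in> polyQ2 (int k) (int k - 1)"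
    "\<And>x y. 2 * t x y = deriv (\<lambda>y. bubble_mult pp x y) y + 2 * (x * (1 - x) * tt x)"
    "\<And>x y. 2 * s x y = deriv (\<lambda>x. bubble_mult pp x y) x + 2 * (y * (1 - y) * ss y)"
    "\<And>x y. deriv (\<lambda>y. s x y) y + deriv (\<lambda>x. t x y) x = deriv (\<lambda>y. deriv (\<lambda>x. bubble_mult pp x y) x) y
               + deriv (\<lambda>y. y * (1 - y) * ss y) y + deriv (\<lambda>x. x * (1 - x) * tt x) x"
    "d1 = (\<lambda>x y z. z ^ (k - 1) * (2 * t x y) + 0)" "d2 = (\<lambda>x y z. z ^ (k - 1) * (2 * s x y) + 0)"
    "d3 = (\<lambda>x y z. ext_num k s t x y z + z * chi x y z)"
    "\<And>x y. deriv (\<lambda>y. deriv (\<lambda>x. bubble_mult pp x y) x) y = deriv (\<lambda>x. deriv (\<lambda>y. bubble_mult pp x y) y) x"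
proof -
  from D obtain pp tt ss chi where pp: "pp \<in> polyQ2 (int k - 2) (int k - 2)" and tt: "tt \<in> poly1 (int k - 2)" 
    and ss: "ss \<in> poly1 (int k - 2)" and chi: "chi \<in> polyQ3 (int k - 1) (int k - 1) (int k - 2)"
    and d: "d1 = (\<lambda>x y z. z ^ (k - 1) * (deriv (\<lambda>y. bubble_mult pp x y) y + 2 * (x * (1 - x) * tt x)))"
       "d2 = (\<lambda>x y z. z ^ (k - 1) * (deriv (\<lambda>x. bubble_mult pp x y) x + 2 * (y * (1 - y) * ss y)))"
       "d3 = (\<lambda>x y z. z ^ (k - 1) * ((1 + z) * (deriv (\<lambda>y. deriv (\<lambda>x. bubble_mult pp x y) x) y
               + deriv (\<lambda>y. y * (1 - y) * ss y) y + deriv (\<lambda>x. x * (1 - x) * tt x) x)) + z * chi x y z)"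
    unfolding div_num_def by blast
  let ?R = "\<lambda>x y (z::real). bubble_mult pp x y"
  note R = bubble_mult_Q3[OF pp]
  define s where "s = (\<lambda>x y. y * (1 - y) * ss y + dX ?R x y 0 / 2)"
  define t where "t = (\<lambda>x y. x * (1 - x) * tt x + dY ?R x y 0 / 2)"
  have s: "s \<in> polyQ2 (int k - 1) (int k)"
    unfolding polyQ2_iff s_def using k
    by (auto intro!: poly1_add poly1_const poly1_bubble_mult[OF ss] poly1_divide polyQ3_sec[OF dX_polyQ3(1)[OF R]])
  have t: "t \<in> polyQ2 (int k) (int k - 1)"
    unfolding polyQ2_iff t_def using k
    by (auto intro!: poly1_add poly1_const poly1_bubble_mult[OF tt] poly1_divide polyQ3_sec[OF dY_polyQ3(1)[OF R]])
  have eq: "2 * t x y = deriv (\<lambda>y. bubble_mult pp x y) y + 2 * (x * (1 - x) * tt x)"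
    "2 * s x y = deriv (\<lambda>x. bubble_mult pp x y) x + 2 * (y * (1 - y) * ss y)" for x y
    by (simp_all add: s_def t_def dX_def dY_def)
  have mixed: "deriv (\<lambda>y. deriv (\<lambda>x. bubble_mult pp x y) x) y = deriv (\<lambda>x. deriv (\<lambda>y. bubble_mult pp x y) y) x" for x y
    using dX_polyQ3(2)[OF R, of x y 0] by (simp add: dX_def[abs_def] dY_def[abs_def])
  have ds: "deriv (\<lambda>y. s x y) y = deriv (\<lambda>y. y * (1 - y) * ss y) y + dY (dX ?R) x y 0 / 2" for x y
    unfolding s_def
    by (intro DERIV_imp_deriv DERIV_add poly1_DERIV[OF poly1_bubble_mult[OF ss]] DERIV_cdivide DERIV_dY[OF dX_polyQ3(1)[OF R]])
  have dt: "deriv (\<lambda>x. t x y) x = deriv (\<lambda>x. x * (1 - x) * tt x) x + dX (dY ?R) x y 0 / 2" for x y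
    unfolding t_def
    by (intro DERIV_imp_deriv DERIV_add poly1_DERIV[OF poly1_bubble_mult[OF tt]] DERIV_cdivide DERIV_dX[OF dY_polyQ3(1)[OF R]])
  have "dY (dX ?R) x y 0 = deriv (\<lambda>y. deriv (\<lambda>x. bubble_mult pp x y) x) y" for x y
    by (simp add: dX_def[abs_def] dY_def[abs_def])
  with ds dt have dst: "deriv (\<lambda>y. s x y) y + deriv (\<lambda>x. t x y) x = deriv (\<lambda>y. deriv (\<lambda>x. bubble_mult pp x y) x) y
               + deriv (\<lambda>y. y * (1 - y) * ss y) y + deriv (\<lambda>x. x * (1 - x) * tt x) x" for x y
    using dX_polyQ3(2)[OF R, of x y 0] by simp
  show thesis
    by (rule that[OF pp tt ss chi s t eq dst _ _ _ mixed]) (simp_all add: d eq ext_num_def dst mult_ac)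
qed

lemma polyQ3_zmult: "chi \<in> polyQ3 l m (n - 1) \<Longrightarrow> (\<lambda>x y z. z * chi x y z) \<in> polyQ3 l m n"
  using polyQ3_mult[OF polyQ3_z[OF poly1_ident[of 1]], of chi l m "n - 1"] by simp

lemma div_num_flux_num:
  assumes k: "k \<ge> 1" and D: "div_num k d1 d2 d3"
  shows "flux_num k d1 d2 d3" "zero_trace d1 d2 d3"
proof -
  obtain pp tt ss chi s t where pp: "pp \<in> polyQ2 (int k - 2) (int k - 2)" 
    and tt: "tt \<in> poly1 (int k - 2)" and ss: "ss \<in> poly1 (int k - 2)" 
    and chi: "chi \<in> polyQ3 (int k - 1) (int k - 1) (int k - 2)" 
    and s: "s \<in> polyQ2 (int k - 1) (int k)" and t: "t \<in> polyQ2 (int k) (int k - 1)" 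
    and t2: "\<And>x y. 2 * t x y = deriv (\<lambda>y. bubble_mult pp x y) y + 2 * (x * (1 - x) * tt x)"
    and s2: "\<And>x y. 2 * s x y = deriv (\<lambda>x. bubble_mult pp x y) x + 2 * (y * (1 - y) * ss y)"
    and dst: "\<And>x y. deriv (\<lambda>y. s x y) y + deriv (\<lambda>x. t x y) x = deriv (\<lambda>y. deriv (\<lambda>x. bubble_mult pp x y) x) y
               + deriv (\<lambda>y. y * (1 - y) * ss y) y + deriv (\<lambda>x. x * (1 - x) * tt x) x"
    and d: "d1 = (\<lambda>x y z. z ^ (k - 1) * (2 * t x y) + 0)" "d2 = (\<lambda>x y z. z ^ (k - 1) * (2 * s x y) + 0)"
    "d3 = (\<lambda>x y z. ext_num k s t x y z + z * chi x y z)"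
    by (rule div_num_cases[OF k D]) (rule that; assumption)
  have chi': "(\<lambda>x y z. z * chi x y z) \<in> polyQ3 (int k - 1) (int k - 1) (int k - 1)"
    using chi by (intro polyQ3_zmult) simp
  show "flux_num k d1 d2 d3" unfolding d
    by (rule flux_num_add[OF flux_num_ext(1)[OF s t k] flux_num_base[OF polyQ3_zero polyQ3_zero chi']])
  \<comment> \<open>The factor \<open>z ^ (k - 1)\<close> vanishes at \<open>0\<close> only for
    \<open>k \<ge> 2\<close>; for \<open>k = 1\<close> the data themselves are zero.\<close>
  have "d3 x y 0 = 0" for x y
  proof (cases "k < 2")
    case True
    then have "bubble_mult pp x y = 0" "tt x = 0" "ss y = 0" for x y
      using pp tt ss by (auto simp: bubble_mult_def poly1_neg polyQ2_iff fun_eq_iff)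
    then show ?thesis by (simp add: d ext_num_def dst)
  qed (simp add: d ext_num_def)
  then show "zero_trace d1 d2 d3"
    unfolding zero_trace_def by (simp add: d t2 s2 bubble_mult_def)
qed

text \<open>In the variable \<open>z\<close>, the equation forces \<open>DD = 0\<close> and
  \<open>z * chi = 0\<close> separately. In the plane, \<open>DD = 0\<close> reads
  \<open>r_xy + s' + t' = 0\<close>; integrated over the unit interval in \<open>y\<close> or in
  \<open>x\<close> it kills \<open>t'\<close> or \<open>s'\<close>, because the derivatives of the
  bubble \<open>r\<close> vanish at the ends. Then \<open>r_xy = 0\<close>, and the boundary values
  give \<open>r = 0\<close>.\<close>

lemma div_inj:
  assumes k: "k \<ge> 1" and D: "div_num k d1 d2 d3" and 0: "\<And>x y z. divergence_num (real k + 2) d1 d2 d3 x y z = 0"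
  shows "d1 = (\<lambda>x y z. 0)" "d2 = (\<lambda>x y z. 0)" "d3 = (\<lambda>x y z. 0)"
proof -
  obtain pp tt ss chi s t where pp: "pp \<in> polyQ2 (int k - 2) (int k - 2)" 
    and tt: "tt \<in> poly1 (int k - 2)" and ss: "ss \<in> poly1 (int k - 2)" 
    and chi: "chi \<in> polyQ3 (int k - 1) (int k - 1) (int k - 2)" 
    and s: "s \<in> polyQ2 (int k - 1) (int k)" and t: "t \<in> polyQ2 (int k) (int k - 1)" 
    and t2: "\<And>x y. 2 * t x y = deriv (\<lambda>y. bubble_mult pp x y) y + 2 * (x * (1 - x) * tt x)"
    and s2: "\<And>x y. 2 * s x y = deriv (\<lambda>x. bubble_mult pp x y) x + 2 * (y * (1 - y) * ss y)"
    and dst: "\<And>x y. deriv (\<lambda>y. s x y) y + deriv (\<lambda>x. t x y) x = deriv (\<lambda>y. deriv (\<lambda>x. bubble_mult pp x y) x) y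
               + deriv (\<lambda>y. y * (1 - y) * ss y) y + deriv (\<lambda>x. x * (1 - x) * tt x) x"
    and d: "d1 = (\<lambda>x y z. z ^ (k - 1) * (2 * t x y) + 0)" "d2 = (\<lambda>x y z. z ^ (k - 1) * (2 * s x y) + 0)"
    "d3 = (\<lambda>x y z. ext_num k s t x y z + z * chi x y z)"
    and mixed: "\<And>x y. deriv (\<lambda>y. deriv (\<lambda>x. bubble_mult pp x y) x) y = deriv (\<lambda>x. deriv (\<lambda>y. bubble_mult pp x y) y) x"
    by (rule div_num_cases[OF k D]) (rule that; assumption)
  define DD where "DD x y = deriv (\<lambda>y. s x y) y + deriv (\<lambda>x. t x y) x" for x y
  let ?H = "\<lambda>x y z. z * chi x y z"
  have H: "?H \<in> polyQ3 (int k - 1) (int k - 1) (int k - 1)"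
    using chi by (intro polyQ3_zmult) simp
  have dv: "(1 + z) * real (k - 1) * z ^ (k - 2) * DD x y + ((1 + z) * dZ ?H x y z - (real k + 2) * ?H x y z) = 0" for x y z
  proof -
    have n: "flux_num k (\<lambda>x y z. z ^ (k - 1) * (2 * t x y)) (\<lambda>x y z. z ^ (k - 1) * (2 * s x y)) (ext_num k s t)"
      by (rule flux_num_ext(1)[OF s t k])
    have "divergence_num (real k + 2) d1 d2 d3 = (\<lambda>x y z. (1 + z) * real (k - 1) * z ^ (k - 2) * DD x y + divergence_num (real k + 2) (\<lambda>x y z. 0) (\<lambda>x y z. 0) ?H x y z)"
      unfolding d 
      by (subst divergence_num_add[OF _ _ _ polyQ3_zero polyQ3_zero H]) (use n flux_num_ext(2)[OF s t k] in \<open>auto simp: flux_num_def DD_def\<close>)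
    moreover have "dX (\<lambda>x y z. 0) x y z = 0" "dY (\<lambda>x y z. 0) x y z = 0" for x y z
      by (auto simp: dX_def dY_def)
    ultimately show ?thesis using 0[of x y z] by (simp add: divergence_num_def)
  qed
  have main: "DD x y = 0 \<and> ?H x y z = 0" for x y z
  proof (cases "k < 2")
    case True
    then have "bubble_mult pp x y = 0" "tt x = 0" "ss y = 0" for x y
      using pp tt ss by (auto simp: bubble_mult_def poly1_neg polyQ2_iff fun_eq_iff)
    then have "DD x y = 0" unfolding DD_def dst by simp
    moreover have "chi x y z = 0" using True by (intro polyQ3_neg[OF chi]) auto
    ultimately show ?thesis by simp
  next
    case False
    \<comment> \<open>Adding \<open>DD z ^ (k - 1)\<close> to \<open>z chi\<close> absorbs the term
      with \<open>z ^ (k - 2)\<close>: the operator with \<open>w = k + 2\<close> now gives just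
      \<open>- (k + 2) DD z ^ (k - 1)\<close>, the situation of
      \<open>poly1_op_power\<close>.\<close>
    let ?F = "\<lambda>z. ?H x y z + DD x y * z ^ (k - 1)"
    have km: "int (k - 1) = int k - 1" using k by simp
    have pow: "((\<lambda>z. z ^ (k - 1)) has_real_derivative real (k - 1) * z ^ (k - 2)) (at z)" for z :: real
      using DERIV_pow[of "k - 1" z] by (simp add: numeral_2_eq_2)
    have F: "?F \<in> poly1 (int (k - 1))"
      unfolding km using polyQ3_sec(3)[OF H] poly1_power[of "k - 1"] km by (intro poly1_add poly1_cmult) auto
    have F0: "?F 0 = 0" using False by auto
    have dF: "deriv ?F z = dZ ?H x y z + DD x y * (real (k - 1) * z ^ (k - 2))" for z
      by (intro DERIV_imp_deriv DERIV_add DERIV_cmult DERIV_dZ[OF H] pow)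
    have "(1 + z) * deriv ?F z - (real k + 2) * ?F z = - ((real k + 2) * DD x y) * z ^ (k - 1)" for z
      unfolding dF using dv[of z x y] by (simp add: algebra_simps)
    from poly1_op_power[OF F F0 this] have *: "?F z = 0" "(real k + 2) * DD x y = 0" by auto
    then have "DD x y = 0" by (simp add: add_nonneg_eq_0_iff)
    with * show ?thesis by simp
  qed
  let ?R = "\<lambda>x y (z::real). bubble_mult pp x y"
  note R = bubble_mult_Q3[OF pp]
  have ss0: "y * (1 - y) * ss y = 0" and tt0: "x * (1 - x) * tt x = 0" for x y
  proof -
    have "(\<lambda>x. x * (1 - x) * tt x) x = (\<lambda>x. x * (1 - x) * tt x) 0" for x
    proof (rule deriv_zero_const[OF poly1_bubble_mult[OF tt]])
      fix x
      \<comment> \<open>A primitive of \<open>DD x y\<close> in \<open>y\<close>. Its first two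
        summands vanish at both ends, so equal end values mean that the derivative in the last
        summand is zero.\<close>
      let ?W = "\<lambda>y. dX ?R x y 0 + y * (1 - y) * ss y + y * deriv (\<lambda>x. x * (1 - x) * tt x) x"
      have "(?W has_real_derivative 0) (at y)" for y
      proof -
        have "(?W has_real_derivative (dY (dX ?R) x y 0 + deriv (\<lambda>y. y * (1 - y) * ss y) y + deriv (\<lambda>x. x * (1 - x) * tt x) x)) (at y)"
          using DERIV_add[OF DERIV_add[OF DERIV_dY[OF dX_polyQ3(1)[OF R], of x 0 y] poly1_DERIV[OF poly1_bubble_mult[OF ss], of y]]
            DERIV_cmult_right[OF DERIV_ident, where c = "deriv (\<lambda>x. x * (1 - x) * tt x) x"]] by simp
        moreover have "dY (dX ?R) x y 0 + deriv (\<lambda>y. y * (1 - y) * ss y) y + deriv (\<lambda>x. x * (1 - x) * tt x) x = DD x y"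
          unfolding DD_def dst by (simp add: dX_def[abs_def] dY_def[abs_def])
        ultimately show ?thesis using main by simp
      qed
      then have "?W 1 = ?W 0" by (intro DERIV_isconst_all) auto
      moreover have "dX ?R x 0 0 = 0" "dX ?R x 1 0 = 0" by (simp_all add: dX_def bubble_mult_def)
      ultimately show "deriv (\<lambda>x. x * (1 - x) * tt x) x = 0" by simp
    qed
    then show "x * (1 - x) * tt x = 0" by simp
    have "(\<lambda>x. x * (1 - x) * ss x) x = (\<lambda>x. x * (1 - x) * ss x) 0" for x
    proof (rule deriv_zero_const[OF poly1_bubble_mult[OF ss]])
      fix y
      let ?W = "\<lambda>x. dY ?R x y 0 + x * (1 - x) * tt x + x * deriv (\<lambda>x. x * (1 - x) * ss x) y"
      have "(?W has_real_derivative 0) (at x)" for x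
      proof -
        have "(?W has_real_derivative (dX (dY ?R) x y 0 + deriv (\<lambda>y. y * (1 - y) * tt y) x + deriv (\<lambda>x. x * (1 - x) * ss x) y)) (at x)"
          using DERIV_add[OF DERIV_add[OF DERIV_dX[OF dY_polyQ3(1)[OF R], of y 0 x] poly1_DERIV[OF poly1_bubble_mult[OF tt], of x]]
            DERIV_cmult_right[OF DERIV_ident, where c = "deriv (\<lambda>x. x * (1 - x) * ss x) y"]] by simp
        moreover have "dX (dY ?R) x y 0 + deriv (\<lambda>y. y * (1 - y) * tt y) x + deriv (\<lambda>x. x * (1 - x) * ss x) y = DD x y"
          unfolding DD_def dst mixed by (simp add: dX_def[abs_def] dY_def[abs_def])
        ultimately show ?thesis using main by simp
      qed
      then have "?W 1 = ?W 0" by (intro DERIV_isconst_all) auto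
      moreover have "dY ?R 0 y 0 = 0" "dY ?R 1 y 0 = 0" by (simp_all add: dY_def bubble_mult_def)
      ultimately show "deriv (\<lambda>x. x * (1 - x) * ss x) y = 0" by simp
    qed
    then show "y * (1 - y) * ss y = 0" by simp
  qed
  have rx: "dX ?R x y 0 = 0" for x y
  proof -
    have "deriv (\<lambda>y. dX ?R x y 0) y = 0" for y
    proof -
      have "deriv (\<lambda>y. dX ?R x y 0) y = DD x y"
        unfolding DD_def dst ss0 tt0 by (simp add: dX_def)
      then show ?thesis using main by simp
    qed
    from deriv_zero_const[OF polyQ3_sec(2)[OF dX_polyQ3(1)[OF R]] this, of y 0]
    show ?thesis by (simp add: dX_def bubble_mult_def)
  qed
  have r: "bubble_mult pp x y = 0" for x y
  proof -
    have "deriv (\<lambda>x. ?R x y 0) x = 0" for x using rx[of x y] by (simp add: dX_def)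
    from deriv_zero_const[OF polyQ3_sec(1)[OF R] this, of x 0] show ?thesis by (simp add: bubble_mult_def)
  qed
  have "DD x y = 0" for x y using main by simp
  then have "ext_num k s t x y z = 0" for x y z
    unfolding ext_num_def DD_def by simp
  moreover have "t x y = 0" "s x y = 0" for x y
    using t2[of x y] s2[of x y] ss0 tt0 r by simp_all
  ultimately show "d1 = (\<lambda>x y z. 0)" "d2 = (\<lambda>x y z. 0)" "d3 = (\<lambda>x y z. 0)"
    using main unfolding d by (simp_all add: fun_eq_iff)
qed

section \<open>Splitting fields with vanishing normal traces\<close>

text \<open>\<open>H\<close> is built as the primitive of \<open>A\<close> vanishing at
  \<open>0\<close>, so \<open>H 1\<close> is the mean over the unit interval, and \<open>H\<close>
  minus \<open>x\<close> times the mean vanishes at both ends and has a bubble factor. The mean is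
  returned as a value of \<open>H\<close>, which keeps its degrees in the other variables at
  hand.\<close>

lemma mean_bubble_x:
  assumes A: "A \<in> polyQ3 l m n" and l: "l \<ge> 0 \<or> l = -1"
  shows "\<exists>P\<in>polyQ3 (l - 1) m n. \<exists>H\<in>polyQ3 (l + 1) m n. \<forall>y z. \<forall>x. 
    ((\<lambda>x. x * (1 - x) * P x y z) has_real_derivative A x y z - H 1 y z) (at x)"
proof -
  obtain H where H: "H \<in> polyQ3 (l + 1) m n" "\<And>y z. H 0 y z = 0" 
    "\<And>x y z. ((\<lambda>x. H x y z) has_real_derivative A x y z) (at x)"
    using polyQ3_antideriv_x[OF A] by blast
  let ?G = "\<lambda>x y z. H x y z - x * H 1 y z"
  \<comment> \<open>For \<open>l = -1\<close> the factor \<open>x\<close> exceeds the degree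
    \<open>l + 1\<close>, but then \<open>A\<close> and with it \<open>H\<close> vanish.\<close>
  have G: "?G \<in> polyQ3 (l + 1) m n"
  proof (cases "l = -1")
    case True
    then have "A x y z = 0" for x y z using polyQ3_neg[OF A] by simp
    then have "((\<lambda>x. H x y z) has_real_derivative 0) (at x)" for x y z using H(3) by metis
    then have "H x y z = H 0 y z" for x y z by (intro DERIV_isconst_all[of "\<lambda>x. H x y z"]) simp
    then show ?thesis using H(2) by (simp add: polyQ3_zero)
  next
    case False
    have "(\<lambda>x. x) \<in> poly1 (l + 1)" using False l by (intro poly1_ident) auto
    then show ?thesis
      using polyQ3_sec[OF H(1)] unfolding polyQ3_iff
      by (auto intro!: poly1_diff poly1_cmult poly1_cmult_right)
  qed
  have "l + 1 - 2 = l - 1" by simp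
  with polyQ3_bubble_x[OF G] H(2) obtain P where P: "P \<in> polyQ3 (l - 1) m n" "\<And>x y z. H x y z - x * H 1 y z = x * (1 - x) * P x y z"
    by auto
  have "((\<lambda>x. x * (1 - x) * P x y z) has_real_derivative A x y z - H 1 y z) (at x)" for x y z
    unfolding P(2)[symmetric] using H(3)[of y z x] by (auto intro!: derivative_eq_intros)
  with P(1) H(1) show ?thesis by blast
qed

lemma mean_bubble_y:
  assumes A: "A \<in> polyQ3 l m n" and m: "m \<ge> 0 \<or> m = -1"
  shows "\<exists>P\<in>polyQ3 l (m - 1) n. \<exists>H\<in>polyQ3 l (m + 1) n. \<forall>x z. \<forall>y. 
    ((\<lambda>y. y * (1 - y) * P x y z) has_real_derivative A x y z - H x 1 z) (at y)"
proof -
  have "(\<lambda>x y z. A y x z) \<in> polyQ3 m l n" using A by (simp add: polyQ3_iff)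
  from mean_bubble_x[OF this m] obtain P H where PH: "P \<in> polyQ3 (m - 1) l n" "H \<in> polyQ3 (m + 1) l n"
    "\<And>y z x. ((\<lambda>x. x * (1 - x) * P x y z) has_real_derivative A y x z - H 1 y z) (at x)"
    by blast
  show ?thesis
    by (intro bexI[of _ "\<lambda>x y z. P y x z"] bexI[of _ "\<lambda>x y z. H y x z"] allI PH(3))
       (use PH(1,2) in \<open>simp_all add: polyQ3_iff\<close>)
qed

text \<open>The data \<open>e\<close> and \<open>g\<close> do not depend on \<open>z\<close>; they make the primitive vanish at \<open>z = 0\<close>, as the
  factor \<open>z\<close> in \<open>U1_0curl\<close> demands.\<close>

lemma op_solution:
  assumes k: "k \<ge> 1" and F: "F \<in> polyQ3 l m (int k - 1)" 
    and e: "\<And>x y z. e x y z = e x y 0" "e \<in> polyQ3 l m 0" 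
    and g: "g \<in> polyQ3 l m 0" "\<And>x y z. g x y z = g x y 0"
    and G: "G \<in> poly1 (int k - 1)" "\<And>z. (1 + z) * deriv G z - (real k + 1) * G z = z ^ (k - 1)"
    and Fa: "\<And>x y z. (1 + z) * dZ F x y z - (real k + 1) * F x y z = a x y z"
    and F0: "\<And>x y. F x y 0 = G 0 * g x y 0 + e x y 0 / real k"
    and neg: "k = 1 \<Longrightarrow> l < 0 \<or> m < 0"
  shows "\<exists>M\<in>polyQ3 l m (int k - 2). \<forall>x y z. 
    (1 + z) * dZ (\<lambda>x y z. z * M x y z) x y z - (real k + 1) * (z * M x y z) = a x y z + (1 + z) * e x y z - z ^ (k - 1) * g x y z"
proof -
  \<comment> \<open>The operator maps \<open>1 + z\<close> to \<open>- k (1 + z)\<close> and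
    \<open>G\<close> to \<open>z ^ (k - 1)\<close>, so these subtractions produce the wanted
    right-hand side; \<open>F0\<close> says precisely that the result vanishes at
    \<open>z = 0\<close>.\<close>
  let ?M = "\<lambda>x y z. F x y z - (1 + z) * (e x y z / real k) - G z * g x y z"
  \<comment> \<open>Only for \<open>k = 1\<close> is the degree of \<open>1 + z\<close> too large;
    there \<open>neg\<close> makes all data zero.\<close>
  have M: "?M \<in> polyQ3 l m (int k - 1)"
  proof (cases "k = 1")
    case True
    then have "F x y z = 0" "e x y z = 0" "g x y z = 0" for x y z 
      using neg polyQ3_neg[OF F] polyQ3_neg[OF e(2)] polyQ3_neg[OF g(1)] by blast+
    then show ?thesis by (simp add: polyQ3_zero)
  next
    case False
    have "(\<lambda>x y z. (1 / real k) * ((1 + z) * e x y z)) \<in> polyQ3 (0 + l) (0 + m) (1 + 0)"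
      by (intro polyQ3_cmult polyQ3_mult e polyQ3_z1) simp
    moreover have "(\<lambda>x y z. G z * g x y z) \<in> polyQ3 (0 + l) (0 + m) ((int k - 1) + 0)"
      by (intro polyQ3_mult g polyQ3_z G)
    ultimately show ?thesis using False k by (intro polyQ3_diff F) (auto intro: polyQ3_mono)
  qed
  have km: "int k - 1 - 1 = int k - 2" by simp
  have "?M x y 0 = 0" for x y using F0[of x y] by (simp add: algebra_simps)
  with polyQ3_div_z[OF M] obtain N where N: "N \<in> polyQ3 l m (int k - 2)" "\<And>x y z. ?M x y z = z * N x y z"
    unfolding km by blast
  have "(1 + z) * dZ (\<lambda>x y z. z * N x y z) x y z - (real k + 1) * (z * N x y z) = a x y z + (1 + z) * e x y z - z ^ (k - 1) * g x y z" for x y z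
  proof -
    have M': "?M = (\<lambda>x y z. F x y z - (1 + z) * (e x y 0 / real k) - G z * g x y 0)"
      by (intro ext) (metis e(1) g(2))
    have "dZ (\<lambda>x y z. z * N x y z) x y z = dZ F x y z - e x y 0 / real k - deriv G z * g x y 0"
      unfolding N(2)[symmetric] unfolding M'
      using k by (intro dZ_eqI) (auto intro!: derivative_eq_intros DERIV_dZ[OF F] poly1_DERIV[OF G(1)])
    moreover have "z * N x y z = F x y z - (1 + z) * (e x y 0 / real k) - G z * g x y 0"
      unfolding N(2)[symmetric] using e(1)[of x y z] g(2)[of x y z] by simp
    ultimately have "(1 + z) * dZ (\<lambda>x y z. z * N x y z) x y z - (real k + 1) * (z * N x y z) =
      (1 + z) * (dZ F x y z - e x y 0 / real k - deriv G z * g x y 0) - (real k + 1) * (F x y z - (1 + z) * (e x y 0 / real k) - G z * g x y 0)"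
      by simp
    also have "\<dots> = ((1 + z) * dZ F x y z - (real k + 1) * F x y z) - (1 + z) * (e x y 0 / real k) + (real k + 1) * (1 + z) * (e x y 0 / real k)
        - ((1 + z) * deriv G z - (real k + 1) * G z) * g x y 0"
      by (simp only: algebra_simps)
    also have "\<dots> = a x y z + (1 + z) * (real k * (e x y 0 / real k)) - z ^ (k - 1) * g x y 0"
      unfolding Fa G(2) by (simp only: algebra_simps)
    also have "real k * (e x y 0 / real k) = e x y z" using k e(1)[of x y z] by simp
    finally show ?thesis using g(2)[of x y z] by simp
  qed
  with N(1) show ?thesis by blast
qed

lemma const_in_z:
  assumes "f \<in> polyQ3 l m 0" shows "f x y z = f x y 0"
  using polyQ3_sec(3)[OF assms, of x y] by (auto simp: poly1_def int_le_set fun_eq_iff)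

lemma at_z0: "f \<in> polyQ3 l m n \<Longrightarrow> (\<lambda>x y z. f x y 0) \<in> polyQ3 l m 0"
  by (simp add: polyQ3_iff poly1_const)

text \<open>Write \<open>L F = (1+z) F_z - (k+1) F\<close>. After division by the bubbles
  \<open>x(1-x)\<close> and \<open>y(1-y)\<close>, the first two equations read \<open>\<alpha> =
  L(z q2) + (1+z) (y(1-y) \<rho>)_y + z^(k-1) ((y(1-y) p)_y + 2 tt)\<close> and \<open>\<beta> = L(z
  q1) - (1+z) (x(1-x) \<rho>)_x + z^(k-1) ((x(1-x) p)_x + 2 ss)\<close>. Inverting \<open>L\<close>
  and setting \<open>z = 0\<close> removes \<open>q1\<close> and \<open>q2\<close> and leaves
  equations for \<open>p\<close>, \<open>\<rho>\<close>, \<open>tt\<close> and \<open>ss\<close>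
  alone.\<close>

lemma decomposition:
  assumes k: "k \<ge> 1" and N: "flux_num k n1 n2 n3" and Z: "zero_trace n1 n2 n3"
  obtains m1 m2 m3 d1 d2 d3 where "curl_num k m1 m2 m3" "div_num k d1 d2 d3"
    "n1 = (\<lambda>x y z. curl1 (real k + 1) m1 m2 m3 x y z + d1 x y z)"
    "n2 = (\<lambda>x y z. curl2 (real k + 1) m1 m2 m3 x y z + d2 x y z)"
    "n3 = (\<lambda>x y z. curl3 (real k + 1) m1 m2 m3 x y z + d3 x y z)"
proof -
  obtain \<alpha> where \<alpha>: "\<alpha> \<in> polyQ3 (int k - 2) (int k - 1) (int k - 1)" "\<And>x y z. n1 x y z = x * (1 - x) * \<alpha> x y z"
    using polyQ3_bubble_x[of n1 "int k" "int k - 1" "int k - 1"] N Z unfolding flux_num_def zero_trace_def by blast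
  obtain \<beta> where \<beta>: "\<beta> \<in> polyQ3 (int k - 1) (int k - 2) (int k - 1)" "\<And>x y z. n2 x y z = y * (1 - y) * \<beta> x y z"
    using polyQ3_bubble_y[of n2 "int k - 1" "int k" "int k - 1"] N Z unfolding flux_num_def zero_trace_def by blast
  obtain F where F: "F \<in> polyQ3 (int k - 2) (int k - 1) (int k - 1)" "\<And>x y z. (1 + z) * dZ F x y z - (real k + 1) * F x y z = \<alpha> x y z"
    using polyQ3_op[OF \<alpha>(1), of "real k + 1"] by auto
  obtain F' where F': "F' \<in> polyQ3 (int k - 1) (int k - 2) (int k - 1)" "\<And>x y z. (1 + z) * dZ F' x y z - (real k + 1) * F' x y z = \<beta> x y z"
    using polyQ3_op[OF \<beta>(1), of "real k + 1"] by auto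
  have km: "int (k - 1) = int k - 1" using k by simp
  have zk: "(\<lambda>z. z ^ (k - 1)) \<in> poly1 (int k - 1)" using poly1_power[of "k - 1"] by (simp only: km)
  obtain G where G: "G \<in> poly1 (int k - 1)" "\<And>z. (1 + z) * deriv G z - (real k + 1) * G z = z ^ (k - 1)"
    using poly1_op_surj[OF zk, of "real k + 1"] by auto
  \<comment> \<open>Otherwise \<open>poly1_op_power\<close> would force the coefficient
    \<open>1\<close> of \<open>z ^ (k - 1)\<close> to be zero. The data \<open>p\<close>,
    \<open>tt\<close> and \<open>ss\<close> are obtained by dividing by \<open>G 0\<close>.\<close>
  have G0: "G 0 \<noteq> 0"
  proof
    assume "G 0 = 0"
    then have "(1::real) = 0" using poly1_op_power(2)[of G "k - 1" "real k + 1" 1] G by (simp only: km mult_1)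
    then show False by simp
  qed
  obtain PA HA where PA: "PA \<in> polyQ3 (int k - 2) (int k - 1 - 1) 0" "HA \<in> polyQ3 (int k - 2) (int k - 1 + 1) 0"
    "\<And>x z y. ((\<lambda>y. y * (1 - y) * PA x y z) has_real_derivative F x y 0 - HA x 1 z) (at y)"
    using mean_bubble_y[OF at_z0[OF F(1)]] k by fastforce
  obtain PB HB where PB: "PB \<in> polyQ3 (int k - 1 - 1) (int k - 2) 0" "HB \<in> polyQ3 (int k - 1 + 1) (int k - 2) 0"
    "\<And>y z x. ((\<lambda>x. x * (1 - x) * PB x y z) has_real_derivative F' x y 0 - HB 1 y z) (at x)"
    using mean_bubble_x[OF at_z0[OF F'(1)]] k by fastforce
  have k2: "int k - 1 - 1 = int k - 2" by simp
  note PA1 = PA(1)[unfolded k2] and PB1 = PB(1)[unfolded k2]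
  \<comment> \<open>Solution of \<open>G 0 * p - \<rho> / k = PA\<close> and
    \<open>G 0 * p + \<rho> / k = PB\<close>, the bubble parts of the two equations at
    \<open>z = 0\<close>. The means are taken up by \<open>tt\<close> and \<open>ss\<close>.\<close>
  define \<rho> where "\<rho> = (\<lambda>x y z. real k / 2 * (PB x y z - PA x y z))"
  define p where "p = (\<lambda>x y z. (1 / (2 * G 0)) * (PA x y z + PB x y z))"
  define tt where "tt = (\<lambda>x. HA x 1 0 / (2 * G 0))"
  define ss where "ss = (\<lambda>y. HB 1 y 0 / (2 * G 0))"
  have \<rho>: "\<rho> \<in> polyQ3 (int k - 2) (int k - 2) 0" unfolding \<rho>_def by (intro polyQ3_cmult polyQ3_diff PA1 PB1)
  have p: "p \<in> polyQ3 (int k - 2) (int k - 2) 0" unfolding p_def by (intro polyQ3_cmult polyQ3_add PA1 PB1)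
  have tt: "tt \<in> poly1 (int k - 2)" unfolding tt_def by (intro poly1_divide polyQ3_sec[OF PA(2)])
  have ss: "ss \<in> poly1 (int k - 2)" unfolding ss_def by (intro poly1_divide polyQ3_sec[OF PB(2)])
  let ?Yp = "\<lambda>x y z. y * (1 - y) * p x y z" and ?Xp = "\<lambda>x y z. x * (1 - x) * p x y z"
  let ?Yr = "\<lambda>x y z. y * (1 - y) * \<rho> x y z" and ?Xr = "\<lambda>x y z. x * (1 - x) * \<rho> x y z"
  have Yp: "?Yp \<in> polyQ3 (int k - 2) (int k) 0" using polyQ3_mult[OF polyQ3_y[OF poly1_bubble] p] by simp
  have Yr: "?Yr \<in> polyQ3 (int k - 2) (int k) 0" using polyQ3_mult[OF polyQ3_y[OF poly1_bubble] \<rho>] by simp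
  have Xp: "?Xp \<in> polyQ3 (int k) (int k - 2) 0" using polyQ3_mult[OF polyQ3_x[OF poly1_bubble] p] by simp
  have Xr: "?Xr \<in> polyQ3 (int k) (int k - 2) 0" using polyQ3_mult[OF polyQ3_x[OF poly1_bubble] \<rho>] by simp
  have A: "F x y 0 = G 0 * (dY ?Yp x y 0 + 2 * tt x) + - dY ?Yr x y 0 / real k" for x y
  proof -
    have "((\<lambda>y. G 0 * ?Yp x y 0 - ?Yr x y 0 / real k) has_real_derivative (G 0 * dY ?Yp x y 0 - dY ?Yr x y 0 / real k)) (at y)"
      by (intro DERIV_diff DERIV_cmult DERIV_cdivide DERIV_dY[OF Yp] DERIV_dY[OF Yr])
    moreover have "G 0 * ?Yp x y 0 - ?Yr x y 0 / real k = y * (1 - y) * PA x y 0" for y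
      unfolding p_def \<rho>_def using G0 k by (simp add: field_simps)
    ultimately have "G 0 * dY ?Yp x y 0 - dY ?Yr x y 0 / real k = F x y 0 - HA x 1 0"
      using PA(3)[of x 0 y] DERIV_unique by simp
    then show ?thesis using G0 by (simp add: tt_def algebra_simps)
  qed
  have B: "F' x y 0 = G 0 * (dX ?Xp x y 0 + 2 * ss y) + dX ?Xr x y 0 / real k" for x y
  proof -
    have "((\<lambda>x. G 0 * ?Xp x y 0 + ?Xr x y 0 / real k) has_real_derivative (G 0 * dX ?Xp x y 0 + dX ?Xr x y 0 / real k)) (at x)"
      by (intro DERIV_add DERIV_cmult DERIV_cdivide DERIV_dX[OF Xp] DERIV_dX[OF Xr])
    moreover have "G 0 * ?Xp x y 0 + ?Xr x y 0 / real k = x * (1 - x) * PB x y 0" for x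
      unfolding p_def \<rho>_def using G0 k by (simp add: field_simps)
    ultimately have "G 0 * dX ?Xp x y 0 + dX ?Xr x y 0 / real k = F' x y 0 - HB 1 y 0"
      using PB(3)[of y 0 x] DERIV_unique by simp
    then show ?thesis using G0 by (simp add: ss_def algebra_simps)
  qed
  have 1: "(\<lambda>x y z. - dY ?Yr x y z) \<in> polyQ3 (int k - 2) (int k - 1) 0" "(\<lambda>x y z. dY ?Yp x y z + 2 * tt x) \<in> polyQ3 (int k - 2) (int k - 1) 0"
    using dY_polyQ3(1)[OF Yr] dY_polyQ3(1)[OF Yp] polyQ3_mono[OF polyQ3_x[OF tt], of "int k - 2" "int k - 1" 0] k
    by (auto intro!: polyQ3_minus polyQ3_add polyQ3_cmult)
  have 2: "dX ?Xr \<in> polyQ3 (int k - 1) (int k - 2) 0" "(\<lambda>x y z. dX ?Xp x y z + 2 * ss y) \<in> polyQ3 (int k - 1) (int k - 2) 0"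
    using dX_polyQ3(1)[OF Xr] dX_polyQ3(1)[OF Xp] polyQ3_mono[OF polyQ3_y[OF ss], of "int k - 1" "int k - 2" 0] k
    by (auto intro!: polyQ3_add polyQ3_cmult)
  obtain q2 where q2: "q2 \<in> polyQ3 (int k - 2) (int k - 1) (int k - 2)"
    "\<And>x y z. (1 + z) * dZ (\<lambda>x y z. z * q2 x y z) x y z - (real k + 1) * (z * q2 x y z) = \<alpha> x y z + (1 + z) * (- dY ?Yr x y z) - z ^ (k - 1) * (dY ?Yp x y z + 2 * tt x)"
    using op_solution[OF k F(1) const_in_z[OF 1(1)] 1 const_in_z[OF 1(2)] G F(2) A] by auto
  obtain q1 where q1: "q1 \<in> polyQ3 (int k - 1) (int k - 2) (int k - 2)"
    "\<And>x y z. (1 + z) * dZ (\<lambda>x y z. z * q1 x y z) x y z - (real k + 1) * (z * q1 x y z) = \<beta> x y z + (1 + z) * dX ?Xr x y z - z ^ (k - 1) * (dX ?Xp x y z + 2 * ss y)"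
    using op_solution[OF k F'(1) const_in_z[OF 2(1)] 2 const_in_z[OF 2(2)] G F'(2) B] by auto
  have zq1: "(\<lambda>x y z. z * q1 x y z) \<in> polyQ3 (int k - 1) (int k - 2) (int k - 1)"
    by (rule polyQ3_zmult) (use q1(1) in simp)
  have zq2: "(\<lambda>x y z. - (z * q2 x y z)) \<in> polyQ3 (int k - 2) (int k - 1) (int k - 1)"
    by (intro polyQ3_minus polyQ3_zmult) (use q2(1) in simp)
  define m1 where "m1 = (\<lambda>x y z. y * (1 - y) * z * q1 x y z)"
  define m2 where "m2 = (\<lambda>x y z. x * (1 - x) * z * (- q2 x y z))"
  define m3 where "m3 = (\<lambda>x y z. x * (1 - x) * y * (1 - y) * \<rho> x y z)"
  have C: "curl_num k m1 m2 m3"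
    unfolding curl_num_def m1_def m2_def m3_def 
    by (rule bexI[OF _ q1(1)], rule bexI[OF _ polyQ3_minus[OF q2(1)]], rule bexI[OF _ \<rho>]) simp
  define pp where "pp = (\<lambda>x y. p x y 0)"
  have pp: "pp \<in> polyQ2 (int k - 2) (int k - 2)"
    unfolding pp_def polyQ2_iff using polyQ3_sec[OF p] by blast
  define d1 where "d1 = (\<lambda>x y z::real. z ^ (k - 1) * (deriv (\<lambda>y. bubble_mult pp x y) y + 2 * (x * (1 - x) * tt x)))"
  define d2 where "d2 = (\<lambda>x y z::real. z ^ (k - 1) * (deriv (\<lambda>x. bubble_mult pp x y) x + 2 * (y * (1 - y) * ss y)))"
  define d3 where "d3 = (\<lambda>x y z::real. z ^ (k - 1) * ((1 + z) * (deriv (\<lambda>y. deriv (\<lambda>x. bubble_mult pp x y) x) y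
               + deriv (\<lambda>y. y * (1 - y) * ss y) y + deriv (\<lambda>x. x * (1 - x) * tt x) x)))"
  have D: "div_num k d1 d2 (\<lambda>x y z. d3 x y z + z * chi x y z)" 
    if "chi \<in> polyQ3 (int k - 1) (int k - 1) (int k - 2)" for chi
    unfolding div_num_def d1_def d2_def d3_def
    by (rule bexI[OF _ pp], rule bexI[OF _ tt], rule bexI[OF _ ss], rule bexI[OF _ that]) simp
  have D0: "div_num k d1 d2 d3" using D[OF polyQ3_zero] by simp
  have rr1: "deriv (\<lambda>y. bubble_mult pp x y) y = x * (1 - x) * dY ?Yp x y 0" for x y
  proof (rule DERIV_imp_deriv)
    show "((\<lambda>y. bubble_mult pp x y) has_real_derivative x * (1 - x) * dY ?Yp x y 0) (at y)"
      using DERIV_cmult[OF DERIV_dY[OF Yp, of x 0 y], of "x * (1 - x)"] by (simp add: bubble_mult_def pp_def mult.assoc)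
  qed
  have rr2: "deriv (\<lambda>x. bubble_mult pp x y) x = y * (1 - y) * dX ?Xp x y 0" for x y
  proof (rule DERIV_imp_deriv)
    show "((\<lambda>x. bubble_mult pp x y) has_real_derivative y * (1 - y) * dX ?Xp x y 0) (at x)"
      using DERIV_cmult[OF DERIV_dX[OF Xp, of y 0 x], of "y * (1 - y)"] by (simp add: bubble_mult_def pp_def mult_ac)
  qed
  have m3y: "dY m3 x y z = x * (1 - x) * dY ?Yr x y z" for x y z
  proof (rule dY_eqI)
    show "((\<lambda>y. m3 x y z) has_real_derivative x * (1 - x) * dY ?Yr x y z) (at y)"
      using DERIV_cmult[OF DERIV_dY[OF Yr, of x z y], of "x * (1 - x)"] by (simp add: m3_def mult.assoc)
  qed
  have m3x: "dX m3 x y z = y * (1 - y) * dX ?Xr x y z" for x y z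
  proof (rule dX_eqI)
    show "((\<lambda>x. m3 x y z) has_real_derivative y * (1 - y) * dX ?Xr x y z) (at x)"
      using DERIV_cmult[OF DERIV_dX[OF Xr, of y z x], of "y * (1 - y)"] by (simp add: m3_def mult_ac)
  qed
  have zq2': "(\<lambda>x y z. z * q2 x y z) \<in> polyQ3 (int k - 2) (int k - 1) (int k - 1)"
    using polyQ3_minus[OF zq2] by simp
  have m2z: "dZ m2 x y z = - (x * (1 - x)) * dZ (\<lambda>x y z. z * q2 x y z) x y z" for x y z
  proof (rule dZ_eqI)
    show "((\<lambda>z. m2 x y z) has_real_derivative - (x * (1 - x)) * dZ (\<lambda>x y z. z * q2 x y z) x y z) (at z)"
      using DERIV_cmult[OF DERIV_dZ[OF zq2', of x y z], of "- (x * (1 - x))"] by (simp add: m2_def mult.assoc)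
  qed
  have m1z: "dZ m1 x y z = y * (1 - y) * dZ (\<lambda>x y z. z * q1 x y z) x y z" for x y z
  proof (rule dZ_eqI)
    show "((\<lambda>z. m1 x y z) has_real_derivative y * (1 - y) * dZ (\<lambda>x y z. z * q1 x y z) x y z) (at z)"
      using DERIV_cmult[OF DERIV_dZ[OF zq1, of x y z], of "y * (1 - y)"] by (simp add: m1_def mult.assoc)
  qed
  have n1: "n1 x y z = curl1 (real k + 1) m1 m2 m3 x y z + d1 x y z" for x y z
  proof -
    have c: "dY ?Yp x y 0 = dY ?Yp x y z" using const_in_z[OF dY_polyQ3(1)[OF Yp], of x y z] by simp
    have "curl1 (real k + 1) m1 m2 m3 x y z + d1 x y z = x * (1 - x) * ((1 + z) * dY ?Yr x y z
       + ((1 + z) * dZ (\<lambda>x y z. z * q2 x y z) x y z - (real k + 1) * (z * q2 x y z)) + z ^ (k - 1) * (dY ?Yp x y z + 2 * tt x))"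
      unfolding curl1_def d1_def m3y m2z rr1 c unfolding m2_def by (simp add: algebra_simps)
    also have "\<dots> = n1 x y z" unfolding q2(2) \<alpha>(2) by (simp add: algebra_simps)
    finally show ?thesis by simp
  qed
  have n2: "n2 x y z = curl2 (real k + 1) m1 m2 m3 x y z + d2 x y z" for x y z
  proof -
    have c: "dX ?Xp x y 0 = dX ?Xp x y z" using const_in_z[OF dX_polyQ3(1)[OF Xp], of x y z] by simp
    have "curl2 (real k + 1) m1 m2 m3 x y z + d2 x y z = y * (1 - y) * (
       ((1 + z) * dZ (\<lambda>x y z. z * q1 x y z) x y z - (real k + 1) * (z * q1 x y z)) - (1 + z) * dX ?Xr x y z + z ^ (k - 1) * (dX ?Xp x y z + 2 * ss y))"
      unfolding curl2_def d2_def m3x m1z rr2 c unfolding m1_def by (simp add: algebra_simps)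
    also have "\<dots> = n2 x y z" unfolding q1(2) \<beta>(2) by (simp add: algebra_simps)
    finally show ?thesis by simp
  qed
  \<comment> \<open>All that is left sits in the third component. Its divergence numerator has
    degree at most \<open>k - 1\<close> in \<open>z\<close>, hence so has \<open>e3\<close> itself,
    and its zero trace on the base supplies the factor \<open>z\<close> in front of
    \<open>chi\<close>.\<close>
  define e3 where "e3 = (\<lambda>x y z. n3 x y z - (curl3 (real k + 1) m1 m2 m3 x y z + d3 x y z))"
  have "flux_num k (\<lambda>x y z. n1 x y z - (curl1 (real k + 1) m1 m2 m3 x y z + d1 x y z))
    (\<lambda>x y z. n2 x y z - (curl2 (real k + 1) m1 m2 m3 x y z + d2 x y z)) e3"
    unfolding e3_def by (rule flux_num_diff[OF N flux_num_add[OF curl_num_flux_num(1)[OF C] div_num_flux_num(1)[OF k D0]]])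
  then have e: "flux_num k (\<lambda>x y z. 0) (\<lambda>x y z. 0) e3" by (simp add: n1 n2)
  have e3: "e3 \<in> polyQ3 (int k - 1) (int k - 1) (int k - 1)"
  proof (rule polyQ3_op_degree)
    show "e3 \<in> polyQ3 (int k - 1) (int k - 1) (int k)" using e by (simp add: flux_num_def)
    have "dX (\<lambda>x y z. 0) x y z = 0" "dY (\<lambda>x y z. 0) x y z = 0" for x y z
      by (auto simp: dX_def dY_def)
    then show "(\<lambda>x y z. (1 + z) * dZ e3 x y z - (real k + 2) * e3 x y z) \<in> polyQ3 (int k - 1) (int k - 1) (int k - 1)" 
      using e by (simp add: flux_num_def divergence_num_def)
  qed auto
  have "e3 x y 0 = 0" for x y
    using Z curl_num_flux_num(3)[OF C] div_num_flux_num(2)[OF k D0] unfolding zero_trace_def e3_def by simp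
  with polyQ3_div_z[OF e3] obtain chi where chi: "chi \<in> polyQ3 (int k - 1) (int k - 1) (int k - 2)" "\<And>x y z. e3 x y z = z * chi x y z"
    unfolding k2 by blast
  have "n3 x y z = curl3 (real k + 1) m1 m2 m3 x y z + (d3 x y z + z * chi x y z)" for x y z
    unfolding chi(2)[symmetric] e3_def by simp
  then show thesis
    by (intro that[OF C D[OF chi(1)]] ext n1 n2)
qed

section \<open>The Jacobian of \<open>phi\<close> and the inverse pullbacks\<close>

lemma has_derivative_vector3:
  fixes f1 :: "'a::real_normed_vector \<Rightarrow> real"
  assumes "(f1 has_derivative g1) F" "(f2 has_derivative g2) F" "(f3 has_derivative g3) F"
  shows "((\<lambda>x. vector [f1 x, f2 x, f3 x] :: real^3) has_derivative (\<lambda>h. vector [g1 h, g2 h, g3 h])) F"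
proof -
  have v: "vector [a, b, c] = a *\<^sub>R axis 1 1 + b *\<^sub>R axis 2 1 + c *\<^sub>R (axis 3 1 :: real^3)" for a b c
    by (simp add: vec_eq_iff forall_3 axis_def)
  show ?thesis unfolding v by (intro has_derivative_add has_derivative_scaleR_left assms)
qed

lemma has_derivative_nth: "(f has_derivative f') F \<Longrightarrow> ((\<lambda>x. f x $ i) has_derivative (\<lambda>h. f' h $ i)) F"
  by (rule bounded_linear.has_derivative[OF bounded_linear_vec_nth])

lemma jacobian_entry:
  "(f has_derivative f') (at p) \<Longrightarrow> jacobian f (at p) $ i $ j = f' (axis j 1) $ i"
  by (simp add: jacobian_def matrix_def frechet_derivative_at[symmetric])

definition phi_inv :: "real^3 \<Rightarrow> real^3" where
  "phi_inv q = vector [q$1 / (1 - q$3), q$2 / (1 - q$3), q$3 / (1 - q$3)]"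

lemma Omega_less1: "q \<in> Omega - {apex} \<Longrightarrow> q$3 < 1"
proof (rule ccontr)
  assume q: "q \<in> Omega - {apex}" "\<not> q$3 < 1"
  then have "q$3 = 1" "q$1 = 0" "q$2 = 0" by (auto simp: Omega_def)
  with q show False by (auto simp: apex_def vec_eq_iff forall_3)
qed

lemma Omega_inf_z: "p \<in> Omega_inf \<Longrightarrow> 1 + p$3 > 0"
  by (simp add: Omega_inf_def)

lemma phi_inv_Omega_inf: "q \<in> Omega - {apex} \<Longrightarrow> phi_inv q \<in> Omega_inf"
  using Omega_less1[of q] by (auto simp: Omega_inf_def phi_inv_def Omega_def divide_simps)

lemma phi_phi_inv: "q \<in> Omega - {apex} \<Longrightarrow> phi (phi_inv q) = q"
  using Omega_less1[of q] by (simp add: vec_eq_iff forall_3 phi_def phi_inv_def divide_simps)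

lemma phi_inv_phi: "p \<in> Omega_inf \<Longrightarrow> phi_inv (phi p) = p"
  using Omega_inf_z[of p] by (simp add: vec_eq_iff forall_3 phi_def phi_inv_def divide_simps)

lemma phi_Omega: "p \<in> Omega_inf \<Longrightarrow> phi p \<in> Omega - {apex}"
  using phi_bij_betw by (auto simp: bij_betw_def)

text \<open>A pullback is invertible at each point, with inverse \<open>L\<close>, and values off
  \<open>Omega - {apex}\<close> are fixed to zero; so each field of \<open>W\<close> comes from
  exactly one field on the finite pyramid.\<close>

lemma push_space_eq:
  assumes "\<And>v p w. p \<in> Omega_inf \<Longrightarrow> pb v p = w \<longleftrightarrow> v (phi p) = L (phi p) w"
  shows "push_space pb W = {(\<lambda>q. if q \<in> Omega - {apex} then L q (w (phi_inv q)) else 0) | w. w \<in> W}"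
proof (intro equalityI subsetI)
  fix v assume "v \<in> push_space pb W"
  then obtain w where w: "w \<in> W" "\<And>p. p \<in> Omega_inf \<Longrightarrow> pb v p = w p" and 0: "\<And>q. q \<notin> Omega - {apex} \<Longrightarrow> v q = 0"
    unfolding push_space_def by blast
  have "v q = L q (w (phi_inv q))" if q: "q \<in> Omega - {apex}" for q
    using assms[OF phi_inv_Omega_inf[OF q], of v "w (phi_inv q)"] w(2)[OF phi_inv_Omega_inf[OF q]] phi_phi_inv[OF q] by simp
  with 0 have "v = (\<lambda>q. if q \<in> Omega - {apex} then L q (w (phi_inv q)) else 0)" by auto
  with w(1) show "v \<in> {(\<lambda>q. if q \<in> Omega - {apex} then L q (w (phi_inv q)) else 0) | w. w \<in> W}" by blast
next
  fix v assume "v \<in> {(\<lambda>q. if q \<in> Omega - {apex} then L q (w (phi_inv q)) else 0) | w. w \<in> W}"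
  then obtain w where w: "w \<in> W" and v: "v = (\<lambda>q. if q \<in> Omega - {apex} then L q (w (phi_inv q)) else 0)" by blast
  have "pb v p = w p" if p: "p \<in> Omega_inf" for p
    using assms[OF p, of v "w p"] phi_Omega[OF p] phi_inv_phi[OF p] by (simp add: v)
  with w show "v \<in> push_space pb W" unfolding push_space_def v by auto
qed

text \<open>The Piola transform, the Jacobian applied to \<open>w\<close> and divided by its
  determinant, simplified with \<open>1 + p$3 = 1 / (1 - q$3)\<close> for
  \<open>q = phi p\<close>.\<close>

definition push2_at :: "(real^3 \<Rightarrow> real^3) \<Rightarrow> real^3 \<Rightarrow> real^3" where
  "push2_at w q = vector [(w (phi_inv q) $ 1 - q$1 * w (phi_inv q) $ 3) / (1 - q$3) ^ 3,
     (w (phi_inv q) $ 2 - q$2 * w (phi_inv q) $ 3) / (1 - q$3) ^ 3, w (phi_inv q) $ 3 / (1 - q$3) ^ 2]"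

text \<open>The covariant transform, the inverse transpose of the Jacobian applied to
  \<open>w\<close>, in the same variables.\<close>

definition push1_at :: "(real^3 \<Rightarrow> real^3) \<Rightarrow> real^3 \<Rightarrow> real^3" where
  "push1_at w q = vector [w (phi_inv q) $ 1 / (1 - q$3), w (phi_inv q) $ 2 / (1 - q$3),
     (w (phi_inv q) $ 3 + q$1 * w (phi_inv q) $ 1 + q$2 * w (phi_inv q) $ 2) / (1 - q$3) ^ 2]"

lemma has_derivative_phi:
  assumes "1 + p$3 \<noteq> 0"
  shows "(phi has_derivative (\<lambda>h. vector [h$1 / (1 + p$3) - h$3 * p$1 / (1 + p$3)^2,
     h$2 / (1 + p$3) - h$3 * p$2 / (1 + p$3)^2, h$3 / (1 + p$3)^2])) (at p)"
proof -
  define a where "a = 1 + p$3"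
  have a: "a \<noteq> 0" and a3: "p$3 = a - 1" using assms by (simp_all add: a_def)
  have *: "((\<lambda>p. p$i / (1 + p$3)) has_derivative (\<lambda>h. h$i / (1 + p$3) - h$3 * p$i / (1 + p$3)^2)) (at p)" for i
    by (rule derivative_eq_intros has_derivative_nth refl assms | simp)+
       (use a in \<open>simp add: a_def[symmetric] fun_eq_iff field_simps power2_eq_square\<close>)
  have "h$3 / (1 + p$3) - h$3 * p$3 / (1 + p$3)^2 = h$3 / (1 + p$3)^2" for h :: "real^3"
    using a unfolding a3 by (simp add: field_simps power2_eq_square)
  with *[of 3] have 3: "((\<lambda>p. p$3 / (1 + p$3)) has_derivative (\<lambda>h. h$3 / (1 + p$3)^2)) (at p)" by simp
  show ?thesis
    unfolding phi_def[abs_def] by (rule has_derivative_vector3[OF * * 3])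
qed

lemma jacobian_phi:
  assumes "1 + p$3 \<noteq> 0"
  shows "jacobian phi (at p) = vector [vector [1 / (1 + p$3), 0, - p$1 / (1 + p$3)^2],
     vector [0, 1 / (1 + p$3), - p$2 / (1 + p$3)^2], vector [0, 0, 1 / (1 + p$3)^2]]"
  by (simp add: vec_eq_iff forall_3 jacobian_entry[OF has_derivative_phi[OF assms]] axis_def)

lemma det_jacobian_phi:
  assumes "1 + p$3 \<noteq> 0"
  shows "det (jacobian phi (at p)) = 1 / (1 + p$3) ^ 4"
  by (simp add: jacobian_phi[OF assms] det_3 power4_eq_xxxx power2_eq_square)

lemma pullback2_iff:
  assumes p: "p \<in> Omega_inf"
  shows "pullback2 v p = w \<longleftrightarrow> v (phi p) = vector [(w$1 - phi p$1 * w$3) / (1 - phi p$3)^3, 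
    (w$2 - phi p$2 * w$3) / (1 - phi p$3)^3, w$3 / (1 - phi p$3)^2]" (is "_ \<longleftrightarrow> _ = ?L")
proof -
  define a where "a = 1 + p$3"
  have a: "a > 0" using Omega_inf_z[OF p] by (simp add: a_def)
  have a0: "1 + p$3 \<noteq> 0" using a by (simp add: a_def)
  let ?J = "jacobian phi (at p)"
  have d: "det ?J = 1 / a ^ 4" using det_jacobian_phi[of p] a by (simp add: a_def)
  then have "invertible ?J" using a by (simp add: invertible_det_nz)
  then have "?J ** matrix_inv ?J = mat 1 \<and> matrix_inv ?J ** ?J = mat 1"
    unfolding invertible_def matrix_inv_def by (rule someI_ex)
  then have J: "?J *v (matrix_inv ?J *v x) = x" "matrix_inv ?J *v (?J *v x) = x" for x
    by (simp_all add: matrix_vector_mul_assoc)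
  have "phi p $ 3 = 1 - 1 / a" using a by (simp add: phi_def a_def field_simps)
  then have D: "1 - phi p $ 3 = 1 / a" by simp
  have L: "?L = a ^ 4 *\<^sub>R (?J *v w)"
    unfolding D jacobian_phi[OF a0] using a
    by (simp add: vec_eq_iff forall_3 matrix_vector_mult_def sum_3 phi_def a_def[symmetric] field_simps power2_eq_square power3_eq_cube power4_eq_xxxx)
  show ?thesis
  proof
    assume "pullback2 v p = w"
    then have "?J *v w = (1 / a ^ 4) *\<^sub>R v (phi p)"
      unfolding pullback2_def d by (auto simp: J matrix_vector_mult_scaleR)
    then show "v (phi p) = ?L" using a unfolding L by simp
  next
    assume "v (phi p) = ?L"
    then show "pullback2 v p = w"
      unfolding pullback2_def d L using a by (simp add: J matrix_vector_mult_scaleR)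
  qed
qed

lemma pullback1_iff:
  assumes p: "p \<in> Omega_inf"
  shows "pullback1 v p = w \<longleftrightarrow> v (phi p) = vector [w$1 / (1 - phi p$3), w$2 / (1 - phi p$3), 
    (w$3 + phi p$1 * w$1 + phi p$2 * w$2) / (1 - phi p$3)^2]" (is "_ \<longleftrightarrow> _ = ?L")
proof -
  define a where "a = 1 + p$3"
  have a: "a > 0" using Omega_inf_z[OF p] by (simp add: a_def)
  have a0: "1 + p$3 \<noteq> 0" using a by (simp add: a_def)
  have "phi p $ 3 = 1 - 1 / a" using a by (simp add: phi_def a_def field_simps)
  then have D: "1 - phi p $ 3 = 1 / a" by simp
  have ph: "phi p $ 1 = p$1 / a" "phi p $ 2 = p$2 / a" by (simp_all add: phi_def a_def)
  have e: "pullback1 v p = vector [v (phi p) $ 1 / a, v (phi p) $ 2 / a, (v (phi p) $ 3 - p$1 * v (phi p) $ 1 - p$2 * v (phi p) $ 2) / a^2]"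
    unfolding pullback1_def jacobian_phi[OF a0] using a
    by (simp add: vec_eq_iff forall_3 matrix_vector_mult_def transpose_def sum_3 a_def[symmetric] field_simps)
  have L3: "(w$3 + p$1 / a * w$1 + p$2 / a * w$2) / (1 / a)^2 = a^2 * w$3 + a * p$1 * w$1 + a * p$2 * w$2"
    using a by (simp add: field_simps power2_eq_square)
  have R3: "(v3 - p$1 * (a * w$1) - p$2 * (a * w$2)) / a^2 = w$3 \<longleftrightarrow> v3 = a^2 * w$3 + a * p$1 * w$1 + a * p$2 * w$2" for v3
    using a by (auto simp: field_simps)
  have "pullback1 v p = w \<longleftrightarrow> v (phi p) $ 1 = a * w$1 \<and> v (phi p) $ 2 = a * w$2 \<and> 
      (v (phi p) $ 3 - p$1 * v (phi p) $ 1 - p$2 * v (phi p) $ 2) / a^2 = w$3"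
    unfolding e using a by (auto simp add: vec_eq_iff forall_3 field_simps)
  also have "\<dots> \<longleftrightarrow> v (phi p) $ 1 = a * w$1 \<and> v (phi p) $ 2 = a * w$2 \<and> 
      v (phi p) $ 3 = a^2 * w$3 + a * p$1 * w$1 + a * p$2 * w$2"
    using R3 by metis
  also have "\<dots> \<longleftrightarrow> v (phi p) = ?L"
    unfolding D ph L3 using a by (simp add: vec_eq_iff forall_3 mult.commute)
  finally show ?thesis .
qed

definition push2 :: "(real^3 \<Rightarrow> real^3) \<Rightarrow> real^3 \<Rightarrow> real^3" where
  "push2 w q = (if q \<in> Omega - {apex} then push2_at w q else 0)"
definition push1 :: "(real^3 \<Rightarrow> real^3) \<Rightarrow> real^3 \<Rightarrow> real^3" where
  "push1 w q = (if q \<in> Omega - {apex} then push1_at w q else 0)"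

lemma push_space2: "push_space pullback2 W = push2 ` W"
  by (subst push_space_eq[where L = "\<lambda>q w. vector [(w$1 - q$1 * w$3) / (1 - q$3)^3, 
    (w$2 - q$2 * w$3) / (1 - q$3)^3, w$3 / (1 - q$3)^2]"], erule pullback2_iff)
    (unfold Setcompr_eq_image push2_def[abs_def] push2_at_def, rule refl)

lemma push_space1: "push_space pullback1 W = push1 ` W"
  by (subst push_space_eq[where L = "\<lambda>q w. vector [w$1 / (1 - q$3), w$2 / (1 - q$3), 
    (w$3 + q$1 * w$1 + q$2 * w$2) / (1 - q$3)^2]"], erule pullback1_iff)
    (unfold Setcompr_eq_image push1_def[abs_def] push1_at_def, rule refl)

section \<open>Derivatives on the finite pyramid\<close>

lemma has_derivative_phi_inv:
  assumes "q$3 \<noteq> 1"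
  shows "(phi_inv has_derivative (\<lambda>h. vector [h$1 / (1 - q$3) + h$3 * q$1 / (1 - q$3)^2,
     h$2 / (1 - q$3) + h$3 * q$2 / (1 - q$3)^2, h$3 / (1 - q$3)^2])) (at q)"
proof -
  define a where "a = 1 - q$3"
  have a: "a \<noteq> 0" and a3: "q$3 = 1 - a" using assms by (simp_all add: a_def)
  have D: "1 - q$3 \<noteq> 0" using assms by simp
  have *: "((\<lambda>q. q$i / (1 - q$3)) has_derivative (\<lambda>h. h$i / (1 - q$3) + h$3 * q$i / (1 - q$3)^2)) (at q)" for i
    by (rule derivative_eq_intros has_derivative_nth refl D | simp)+
       (use a in \<open>simp add: a_def[symmetric] fun_eq_iff field_simps power2_eq_square\<close>)
  have "h$3 / (1 - q$3) + h$3 * q$3 / (1 - q$3)^2 = h$3 / (1 - q$3)^2" for h :: "real^3"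
    using a unfolding a3 by (simp add: field_simps power2_eq_square)
  with *[of 3] have 3: "((\<lambda>q. q$3 / (1 - q$3)) has_derivative (\<lambda>h. h$3 / (1 - q$3)^2)) (at q)" by simp
  show ?thesis
    unfolding phi_inv_def[abs_def] by (rule has_derivative_vector3[OF * * 3])
qed

definition lin3 :: "real \<Rightarrow> real \<Rightarrow> real \<Rightarrow> real^3 \<Rightarrow> real" where
  "lin3 a b c h = h$1 * a + h$2 * b + h$3 * c"

lemma axis3_nth [simp]: "axis 1 (1::real) $ (1::3) = 1" "axis 1 (1::real) $ (2::3) = 0" "axis 1 (1::real) $ (3::3) = 0"
  "axis 2 (1::real) $ (1::3) = 0" "axis 2 (1::real) $ (2::3) = 1" "axis 2 (1::real) $ (3::3) = 0"
  "axis 3 (1::real) $ (1::3) = 0" "axis 3 (1::real) $ (2::3) = 0" "axis 3 (1::real) $ (3::3) = 1"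
  by (simp_all add: axis_def)

lemma lin3_axis [simp]: "lin3 a b c (axis 1 1) = a" "lin3 a b c (axis 2 1) = b" "lin3 a b c (axis 3 1) = c"
  by (simp_all add: lin3_def)

lemma has_derivative_comp_phi_inv:
  assumes q: "q$3 \<noteq> 1" and W: "(W has_derivative lin3 a b c) (at (phi_inv q))"
  shows "((\<lambda>q. W (phi_inv q)) has_derivative lin3 (a / (1 - q$3)) (b / (1 - q$3)) 
     ((q$1 * a + q$2 * b + c) / (1 - q$3)^2)) (at q)"
proof -
  have eq: "lin3 (a / (1 - q$3)) (b / (1 - q$3)) ((q$1 * a + q$2 * b + c) / (1 - q$3)^2) = 
      (\<lambda>h. lin3 a b c (vector [h$1 / (1 - q$3) + h$3 * q$1 / (1 - q$3)^2,
     h$2 / (1 - q$3) + h$3 * q$2 / (1 - q$3)^2, h$3 / (1 - q$3)^2]))"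
    by (rule ext) (simp add: lin3_def add_divide_distrib algebra_simps)
  show ?thesis unfolding eq by (rule has_derivative_compose[OF has_derivative_phi_inv[OF q] W])
qed

text \<open>Of the derivative matrix only the diagonal is recorded, as the divergence consists of
  it.\<close>

lemma push2_at_has_derivative:
  assumes q: "q$3 \<noteq> 1"
    and W: "((\<lambda>p. w p $ 1) has_derivative lin3 a11 a12 a13) (at (phi_inv q))"
      "((\<lambda>p. w p $ 2) has_derivative lin3 a21 a22 a23) (at (phi_inv q))"
      "((\<lambda>p. w p $ 3) has_derivative lin3 a31 a32 a33) (at (phi_inv q))"
  shows "\<exists>f'. (push2_at w has_derivative f') (at q) \<and> 
    f' (axis 1 1) $ 1 = (a11 / (1 - q$3) - (q$1 * a31 / (1 - q$3) + w (phi_inv q) $ 3)) / (1 - q$3) ^ 3 \<and>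
    f' (axis 2 1) $ 2 = (a22 / (1 - q$3) - (q$2 * a32 / (1 - q$3) + w (phi_inv q) $ 3)) / (1 - q$3) ^ 3 \<and>
    f' (axis 3 1) $ 3 = (q$1 * a31 + q$2 * a32 + a33) / (1 - q$3) ^ 4 + 2 * w (phi_inv q) $ 3 / (1 - q$3) ^ 3"
proof -
  have D: "1 - q$3 \<noteq> 0" using q by simp
  note c = has_derivative_comp_phi_inv[OF q W(1)] has_derivative_comp_phi_inv[OF q W(2)] has_derivative_comp_phi_inv[OF q W(3)]
  define b where "b = 1 - q$3"
  have b: "b \<noteq> 0" using D by (simp add: b_def)
  let ?w = "w (phi_inv q)"
  let ?e = "\<lambda>f i j. (lin3 (f 1) (f 2) (f 3)) :: real^3 \<Rightarrow> real"
  have 1: "((\<lambda>q. (w (phi_inv q) $ 1 - q$1 * w (phi_inv q) $ 3) / (1 - q$3) ^ 3) has_derivative 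
    (\<lambda>h. (lin3 (a11 / b) (a12 / b) ((q$1 * a11 + q$2 * a12 + a13) / b^2) h - 
       (q$1 * lin3 (a31 / b) (a32 / b) ((q$1 * a31 + q$2 * a32 + a33) / b^2) h + h$1 * ?w$3)) / b^3
       + 3 * h$3 * (?w$1 - q$1 * ?w$3) / b^4)) (at q)"
    by (rule derivative_eq_intros c has_derivative_nth refl D power_not_zero | simp)+ 
       (use b in \<open>simp add: b_def[symmetric] fun_eq_iff field_simps eval_nat_numeral\<close>)
  have 2: "((\<lambda>q. (w (phi_inv q) $ 2 - q$2 * w (phi_inv q) $ 3) / (1 - q$3) ^ 3) has_derivative 
    (\<lambda>h. (lin3 (a21 / b) (a22 / b) ((q$1 * a21 + q$2 * a22 + a23) / b^2) h - 
       (q$2 * lin3 (a31 / b) (a32 / b) ((q$1 * a31 + q$2 * a32 + a33) / b^2) h + h$2 * ?w$3)) / b^3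
       + 3 * h$3 * (?w$2 - q$2 * ?w$3) / b^4)) (at q)"
    by (rule derivative_eq_intros c has_derivative_nth refl D power_not_zero | simp)+ 
       (use b in \<open>simp add: b_def[symmetric] fun_eq_iff field_simps eval_nat_numeral\<close>)
  have 3: "((\<lambda>q. w (phi_inv q) $ 3 / (1 - q$3) ^ 2) has_derivative 
    (\<lambda>h. lin3 (a31 / b) (a32 / b) ((q$1 * a31 + q$2 * a32 + a33) / b^2) h / b^2 + 2 * h$3 * ?w$3 / b^3)) (at q)"
    by (rule derivative_eq_intros c has_derivative_nth refl D power_not_zero | simp)+ 
       (use b in \<open>simp add: b_def[symmetric] fun_eq_iff field_simps eval_nat_numeral\<close>)
  show ?thesis
    unfolding push2_at_def[abs_def]
    by (intro exI conjI, rule has_derivative_vector3[OF 1 2 3])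
       (use b in \<open>simp_all add: b_def[symmetric] field_simps eval_nat_numeral\<close>)
qed

text \<open>Only the antisymmetric part is recorded. In it the undifferentiated values of
  \<open>w\<close> cancel, which is why the curl of a covariant transform is a Piola
  transform.\<close>

lemma push1_at_has_derivative:
  assumes q: "q$3 \<noteq> 1"
    and W: "((\<lambda>p. w p $ 1) has_derivative lin3 a11 a12 a13) (at (phi_inv q))"
      "((\<lambda>p. w p $ 2) has_derivative lin3 a21 a22 a23) (at (phi_inv q))"
      "((\<lambda>p. w p $ 3) has_derivative lin3 a31 a32 a33) (at (phi_inv q))"
  shows "\<exists>f'. (push1_at w has_derivative f') (at q) \<and> 
    f' (axis 2 1) $ 3 - f' (axis 3 1) $ 2 = ((a32 - a23) - q$1 * (a21 - a12)) / (1 - q$3) ^ 3 \<and>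
    f' (axis 3 1) $ 1 - f' (axis 1 1) $ 3 = ((a13 - a31) - q$2 * (a21 - a12)) / (1 - q$3) ^ 3 \<and>
    f' (axis 1 1) $ 2 - f' (axis 2 1) $ 1 = (a21 - a12) / (1 - q$3) ^ 2"
proof -
  have D: "1 - q$3 \<noteq> 0" using q by simp
  note c = has_derivative_comp_phi_inv[OF q W(1)] has_derivative_comp_phi_inv[OF q W(2)] has_derivative_comp_phi_inv[OF q W(3)]
  define b where "b = 1 - q$3"
  have b: "b \<noteq> 0" using D by (simp add: b_def)
  let ?w = "w (phi_inv q)"
  let ?d1 = "lin3 (a11 / b) (a12 / b) ((q$1 * a11 + q$2 * a12 + a13) / b^2)"
  let ?d2 = "lin3 (a21 / b) (a22 / b) ((q$1 * a21 + q$2 * a22 + a23) / b^2)"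
  let ?d3 = "lin3 (a31 / b) (a32 / b) ((q$1 * a31 + q$2 * a32 + a33) / b^2)"
  have 1: "((\<lambda>q. w (phi_inv q) $ 1 / (1 - q$3)) has_derivative (\<lambda>h. ?d1 h / b + h$3 * ?w$1 / b^2)) (at q)"
    by (rule derivative_eq_intros c has_derivative_nth refl D power_not_zero | simp)+ 
       (use b in \<open>simp add: b_def[symmetric] fun_eq_iff field_simps eval_nat_numeral\<close>)
  have 2: "((\<lambda>q. w (phi_inv q) $ 2 / (1 - q$3)) has_derivative (\<lambda>h. ?d2 h / b + h$3 * ?w$2 / b^2)) (at q)"
    by (rule derivative_eq_intros c has_derivative_nth refl D power_not_zero | simp)+ 
       (use b in \<open>simp add: b_def[symmetric] fun_eq_iff field_simps eval_nat_numeral\<close>)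
  have 3: "((\<lambda>q. (w (phi_inv q) $ 3 + q$1 * w (phi_inv q) $ 1 + q$2 * w (phi_inv q) $ 2) / (1 - q$3) ^ 2) has_derivative 
    (\<lambda>h. (?d3 h + (q$1 * ?d1 h + h$1 * ?w$1) + (q$2 * ?d2 h + h$2 * ?w$2)) / b^2 + 
       2 * h$3 * (?w$3 + q$1 * ?w$1 + q$2 * ?w$2) / b^3)) (at q)"
    by (rule derivative_eq_intros c has_derivative_nth refl D power_not_zero | simp)+ 
       (use b in \<open>simp add: b_def[symmetric] fun_eq_iff field_simps eval_nat_numeral\<close>)
  show ?thesis
    unfolding push1_at_def[abs_def]
    by (intro exI conjI, rule has_derivative_vector3[OF 1 2 3])
       (use b in \<open>simp_all add: b_def[symmetric] field_simps eval_nat_numeral\<close>)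
qed

text \<open>The last entry is the origin of the operator \<open>(1+z) F' - w F\<close> on
  numerators.\<close>

lemma rat_field_has_derivative:
  assumes n: "n \<in> polyQ3 l m r" and z: "1 + p$3 \<noteq> 0"
  shows "((\<lambda>p. n (p$1) (p$2) (p$3) / (1 + p$3) ^ w) has_derivative 
    lin3 (dX n (p$1) (p$2) (p$3) / (1 + p$3) ^ w) (dY n (p$1) (p$2) (p$3) / (1 + p$3) ^ w) 
     (((1 + p$3) * dZ n (p$1) (p$2) (p$3) - real w * n (p$1) (p$2) (p$3)) / (1 + p$3) ^ (w + 1))) (at p)"
proof -
  define a where "a = 1 + p$3"
  have a: "a \<noteq> 0" using z by (simp add: a_def)
  have pw: "((\<lambda>p::real^3. (1 + p$3) ^ w) has_derivative (\<lambda>h. real w * h$3 * a ^ w / a)) (at p)"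
    by (rule derivative_eq_intros has_derivative_nth refl | simp)+
       (use a in \<open>cases w, simp_all add: a_def[symmetric] fun_eq_iff\<close>)
  have "((\<lambda>p. n (p$1) (p$2) (p$3) / (1 + p$3) ^ w) has_derivative 
    (\<lambda>h. - n (p$1) (p$2) (p$3) * (inverse (a ^ w) * (real w * h$3 * a ^ w / a) * inverse (a ^ w)) +
      (h$1 * dX n (p$1) (p$2) (p$3) + h$2 * dY n (p$1) (p$2) (p$3) + h$3 * dZ n (p$1) (p$2) (p$3)) / a ^ w)) (at p)"
    using has_derivative_divide[OF polyQ3_has_derivative[OF n] pw] a by (simp add: a_def)
  also have "(\<lambda>h::real^3. - n (p$1) (p$2) (p$3) * (inverse (a ^ w) * (real w * h$3 * a ^ w / a) * inverse (a ^ w)) +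
      (h$1 * dX n (p$1) (p$2) (p$3) + h$2 * dY n (p$1) (p$2) (p$3) + h$3 * dZ n (p$1) (p$2) (p$3)) / a ^ w)
    = lin3 (dX n (p$1) (p$2) (p$3) / a ^ w) (dY n (p$1) (p$2) (p$3) / a ^ w) 
     ((a * dZ n (p$1) (p$2) (p$3) - real w * n (p$1) (p$2) (p$3)) / a ^ (w + 1))"
    using a by (simp add: fun_eq_iff lin3_def field_simps)
  finally show ?thesis by (simp add: a_def)
qed

section \<open>Integrals of bounded functions that are continuous in the interior\<close>

text \<open>Only the interior is controlled: the fields are cut off to zero off
  \<open>Omega - {apex}\<close>, their derivatives are not examined on the boundary, and the
  boundary of a convex set is negligible.\<close>

definition nice :: "'a::euclidean_space set \<Rightarrow> ('a \<Rightarrow> real) \<Rightarrow> bool" where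
  "nice S f \<longleftrightarrow> continuous_on (interior S) f \<and> bounded (f ` interior S)"

lemma niceI: "continuous_on (interior S) f \<Longrightarrow> (\<And>x. x \<in> interior S \<Longrightarrow> \<bar>f x\<bar> \<le> C) \<Longrightarrow> nice S f"
  unfolding nice_def bounded_iff by auto

lemma niceE:
  assumes "nice S f"
  obtains C where "\<And>x. x \<in> interior S \<Longrightarrow> \<bar>f x\<bar> \<le> C" "continuous_on (interior S) f"
  using assms unfolding nice_def bounded_iff by auto

lemma nice_cong: "(\<And>x. x \<in> interior S \<Longrightarrow> f x = g x) \<Longrightarrow> nice S f \<longleftrightarrow> nice S g"
  unfolding nice_def by (metis continuous_on_cong image_cong)

lemma nice_add:
  assumes "nice S f" "nice S g" shows "nice S (\<lambda>x. f x + g x)"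
proof -
  obtain C D where "\<And>x. x \<in> interior S \<Longrightarrow> \<bar>f x\<bar> \<le> C" "continuous_on (interior S) f"
   "\<And>x. x \<in> interior S \<Longrightarrow> \<bar>g x\<bar> \<le> D" "continuous_on (interior S) g"
    using assms by (metis niceE)
  then show ?thesis by (intro niceI[where C = "C + D"] continuous_on_add) (auto intro: order_trans[OF abs_triangle_ineq] add_mono)
qed

lemma nice_mult:
  assumes "nice S f" "nice S g" shows "nice S (\<lambda>x. f x * g x)"
proof -
  obtain C D where C: "\<And>x. x \<in> interior S \<Longrightarrow> \<bar>f x\<bar> \<le> C" "continuous_on (interior S) f"
   "\<And>x. x \<in> interior S \<Longrightarrow> \<bar>g x\<bar> \<le> D" "continuous_on (interior S) g"
    using assms by (metis niceE)
  have "\<bar>f x * g x\<bar> \<le> C * D" if "x \<in> interior S" for x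
    unfolding abs_mult using C(1)[OF that] C(3)[OF that] by (intro mult_mono) auto
  with C show ?thesis by (intro niceI[where C = "C * D"] continuous_on_mult)
qed

lemma nice_const: "nice S (\<lambda>x. c)"
  by (rule niceI[where C = "\<bar>c\<bar>"]) auto

lemma nice_sum: "(\<And>i. i \<in> I \<Longrightarrow> nice S (f i)) \<Longrightarrow> nice S (\<lambda>x. \<Sum>i\<in>I. f i x)"
  by (induction I rule: infinite_finite_induct) (auto intro: nice_add nice_const)

context
  fixes S :: "'a::euclidean_space set"
  assumes S: "convex S" "bounded S"
begin

lemma S_measurable: "S \<in> lmeasurable" "S \<in> sets lebesgue" "interior S \<in> sets lebesgue" "interior S \<in> lmeasurable"
  using measurable_convex[OF S] measurable_convex[of "interior S"] S bounded_subset[OF S(2) interior_subset]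
  by (auto simp: convex_interior fmeasurableD)

lemma nice_integrable:
  assumes "nice S f"
  shows "integrable (lebesgue_on S) f" "f absolutely_integrable_on S" "f integrable_on S" 
    "(LINT x|lebesgue_on S. f x) = integral S f"
proof -
  obtain C where C: "\<And>x. x \<in> interior S \<Longrightarrow> \<bar>f x\<bar> \<le> C" "continuous_on (interior S) f"
    using niceE[OF assms] by metis
  have "f absolutely_integrable_on interior S"
  proof (rule measurable_bounded_by_integrable_imp_absolutely_integrable)
    show "f \<in> borel_measurable (lebesgue_on (interior S))"
      by (rule continuous_imp_measurable_on_sets_lebesgue[OF C(2) S_measurable(3)])
    show "(\<lambda>x. C) integrable_on interior S" by (rule integrable_on_const[OF S_measurable(4)])
  qed (use C S_measurable in auto)
  moreover have "f absolutely_integrable_on interior S \<longleftrightarrow> f absolutely_integrable_on S"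
  proof (rule absolutely_integrable_spike_set_eq)
    have "negligible (frontier S)" by (rule negligible_convex_frontier[OF S(1)])
    then show "negligible {x \<in> S - interior S. f x \<noteq> 0}"
      by (rule negligible_subset) (use closure_subset in \<open>auto simp: frontier_def\<close>)
    have "{x \<in> interior S - S. f x \<noteq> 0} = {}" using interior_subset[of S] by blast
    then show "negligible {x \<in> interior S - S. f x \<noteq> 0}" by (simp only: negligible_empty)
  qed
  ultimately show a: "f absolutely_integrable_on S" by simp
  then show i: "integrable (lebesgue_on S) f"
    by (rule absolutely_integrable_imp_integrable[OF _ S_measurable(2)])
  show "f integrable_on S" using a by (simp add: absolutely_integrable_on_def)
  show "(LINT x|lebesgue_on S. f x) = integral S f"
    by (rule lebesgue_integral_eq_integral[OF i S_measurable(2)])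
qed

lemma nice_integral_cong:
  assumes "nice S f" "\<And>x. x \<in> interior S \<Longrightarrow> f x = g x"
  shows "(LINT x|lebesgue_on S. f x) = (LINT x|lebesgue_on S. g x)"
proof -
  have g: "nice S g" using assms nice_cong by blast
  have "integral S g = integral S f"
  proof (rule integral_spike)
    show "negligible (frontier S)" by (rule negligible_convex_frontier[OF S(1)])
    show "f x = g x" if "x \<in> S - frontier S" for x
      using that closure_subset assms(2)[of x] by (auto simp: frontier_def)
  qed
  then show ?thesis using nice_integrable(4)[OF g] nice_integrable(4)[OF assms(1)] by simp
qed

lemma nice_integral_add:
  "nice S f \<Longrightarrow> nice S g \<Longrightarrow> (LINT x|lebesgue_on S. f x + g x) = (LINT x|lebesgue_on S. f x) + (LINT x|lebesgue_on S. g x)"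
  by (intro Bochner_Integration.integral_add nice_integrable)

text \<open>Continuity is available on a closed box around \<open>x\<close> inside the interior, and
  the integral over this box is squeezed between zero and the full integral. This is the source of
  definiteness for all three kinds of degrees of freedom.\<close>

lemma nice_integral_zero:
  assumes f: "nice S f" "\<And>x. x \<in> interior S \<Longrightarrow> 0 \<le> f x" and 0: "(LINT x|lebesgue_on S. f x) = 0" and x: "x \<in> interior S"
  shows "f x = 0"
proof -
  have "integral S f = 0" using nice_integrable(4)[OF f(1)] 0 by simp
  then have "(f has_integral 0) S" using nice_integrable(3)[OF f(1)] by (metis integrable_integral)
  then have I: "(f has_integral 0) (interior S)"
    using has_integral_interior[OF negligible_convex_frontier[OF S(1)]] by blast
  obtain a b where ab: "x \<in> box a b" "cbox a b \<subseteq> interior S"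
    using x open_interior by (metis open_contains_cbox)
  have cont: "continuous_on (cbox a b) f" using f(1) ab(2) unfolding nice_def by (blast intro: continuous_on_subset)
  then have i: "f integrable_on cbox a b" by (rule integrable_continuous)
  have "integral (cbox a b) f \<le> integral (interior S) f"
    using I f(2) i by (intro integral_subset_le ab(2)) (auto simp: has_integral_integrable_integral)
  moreover have "integral (interior S) f = 0" using I by (rule integral_unique)
  moreover have "0 \<le> integral (cbox a b) f" using i ab(2) f(2) by (intro integral_nonneg) auto
  ultimately have "(f has_integral 0) (cbox a b)" using i by (metis antisym integrable_integral)
  then show ?thesis
    by (rule has_integral_0_cbox_imp_0[OF cont, rotated]) (use ab f(2) box_subset_cbox[of a b] in auto)
qed

end

section \<open>Finite bases and Gram systems\<close>

lemma fscale_apply: "fscale c f x = c *\<^sub>R f x"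
  by (simp add: fscale_def)

text \<open>A prescribed basis comes without a finiteness assumption; independence inside a finitely
  generated space provides it.\<close>

lemma basis_finite:
  assumes "is_basis B V" "finite T" "V \<subseteq> fun_vs.span T"
  shows "finite B"
proof -
  have "B \<subseteq> fun_vs.span T" using assms fun_vs.span_superset unfolding is_basis_def by blast
  then show ?thesis
    using fun_vs.independent_span_bound[OF assms(2)] assms(1) unfolding is_basis_def by blast
qed

text \<open>Gram-Schmidt in disguise: from a new \<open>b\<close> subtract the element
  \<open>v\<close> of the span of \<open>B\<close> with the same products against \<open>B\<close>.
  The difference \<open>w\<close> is orthogonal to that span and nonzero by independence, so adding
  a multiple of \<open>w\<close> adjusts the value at \<open>b\<close> and no other.\<close>

lemma gram_solve:
  fixes g :: "('a \<Rightarrow> 'b::real_vector) \<Rightarrow> ('a \<Rightarrow> 'b) \<Rightarrow> real"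
  assumes V: "fun_vs.subspace V"
    and add: "\<And>x y z. x \<in> V \<Longrightarrow> y \<in> V \<Longrightarrow> z \<in> V \<Longrightarrow> g (x + y) z = g x z + g y z"
    and scale: "\<And>c x z. x \<in> V \<Longrightarrow> z \<in> V \<Longrightarrow> g (fscale c x) z = c * g x z"
    and sym: "\<And>x y. x \<in> V \<Longrightarrow> y \<in> V \<Longrightarrow> g x y = g y x"
    and def: "\<And>x. x \<in> V \<Longrightarrow> g x x = 0 \<Longrightarrow> x = 0"
    and B: "finite B" "fun_vs.independent B" "B \<subseteq> V"
  shows "\<exists>v\<in>fun_vs.span B. \<forall>b\<in>B. g v b = c b"
  using B
proof (induction B arbitrary: c rule: finite_induct)
  case empty
  then show ?case using fun_vs.span_zero by blast
next
  case (insert b B)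
  then have ind: "fun_vs.independent B" and bV: "b \<in> V" and BV: "B \<subseteq> V" and nb: "b \<notin> fun_vs.span B"
    using fun_vs.independent_insert[of b B] by auto
  have sp: "fun_vs.span B \<subseteq> V" using fun_vs.span_minimal[OF BV V] .
  obtain v where v: "v \<in> fun_vs.span B" "\<forall>b'\<in>B. g v b' = g b b'" using insert.IH[OF ind BV, of "g b"] by blast
  obtain u where u: "u \<in> fun_vs.span B" "\<forall>b'\<in>B. g u b' = c b'" using insert.IH[OF ind BV, of c] by blast
  have vV: "v \<in> V" and uV: "u \<in> V" using u v sp by auto
  define w where "w = b + fscale (-1) v"
  have wV: "w \<in> V" unfolding w_def using V vV bV by (intro fun_vs.subspace_add fun_vs.subspace_scale)
  have gw: "g w z = g b z - g v z" if "z \<in> V" for z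
    unfolding w_def using add[OF bV _ that, of "fscale (-1) v"] scale[OF vV that, of "-1"] fun_vs.subspace_scale[OF V vV, of "-1"] by simp
  have w0: "g w b' = 0" if "b' \<in> B" for b' using gw[of b'] that BV v(2) by auto
  have "w \<noteq> 0"
  proof
    assume "w = 0"
    then have "b = v" unfolding w_def by (auto simp: fun_eq_iff plus_fun_def zero_fun_def fscale_apply)
    with v(1) nb show False by simp
  qed
  then have ww: "g w w \<noteq> 0" using def wV by blast
  have orth: "g w z = 0 \<and> z \<in> V" if "z \<in> fun_vs.span B" for z
    using that
  proof (induction rule: fun_vs.span_induct_alt)
    case base
    have 0: "0 \<in> V" by (rule fun_vs.subspace_0[OF V])
    have "g 0 w = 0" using add[OF 0 0 wV] by simp
    then show ?case using 0 sym[OF wV 0] unfolding zero_fun_def by simp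
  next
    case (step a x y)
    then have x: "x \<in> V" "fscale a x \<in> V" "y \<in> V" "fscale a x + y \<in> V"
      using BV fun_vs.subspace_scale[OF V] fun_vs.subspace_add[OF V] by auto
    have "g w (fscale a x + y) = a * g x w + g y w"
      using sym[OF wV x(4)] add[OF x(2,3) wV] scale[OF x(1) wV] by simp
    also have "\<dots> = 0" using sym[OF wV x(1)] sym[OF wV x(3)] w0 step by simp
    finally show ?case using x(4) by blast
  qed
  have wb: "g w b = g w w"
  proof -
    have "b = w + v" unfolding w_def by (auto simp: fun_eq_iff plus_fun_def fscale_apply)
    then have "g w b = g w w + g w v" using add[OF wV vV wV] sym[OF wV, of "w + v"] sym[OF wV vV] fun_vs.subspace_add[OF V wV vV] by simp
    then show ?thesis using orth[OF v(1)] by simp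
  qed
  define t where "t = (c b - g u b) / g w w"
  have tw: "fscale t w \<in> V" by (rule fun_vs.subspace_scale[OF V wV])
  have val: "g (u + fscale t w) z = g u z + t * g w z" if "z \<in> V" for z
    using add[OF uV tw that] scale[OF wV that] by simp
  have "\<forall>b'\<in>insert b B. g (u + fscale t w) b' = c b'"
  proof
    fix b' assume b': "b' \<in> insert b B"
    then have "b' \<in> V" using bV BV by auto
    note val[OF this]
    moreover have "b' = b \<or> b' \<in> B" using b' by auto
    ultimately show "g (u + fscale t w) b' = c b'"
      using w0 u(2) ww by (auto simp: wb t_def)
  qed
  moreover have "u + fscale t w \<in> fun_vs.span (insert b B)"
  proof -
    have "B \<subseteq> insert b B" by auto
    then have "fun_vs.span B \<subseteq> fun_vs.span (insert b B)" by (rule fun_vs.span_mono)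
    then have "u \<in> fun_vs.span (insert b B)" "v \<in> fun_vs.span (insert b B)" using u v by auto
    then show ?thesis unfolding w_def
      by (intro fun_vs.span_add fun_vs.span_scale) (auto intro: fun_vs.span_base)
  qed
  ultimately show ?case by blast
qed

section \<open>The finite pyramid and the behaviour at its apex\<close>

lemma convex_Omega: "convex Omega"
proof -
  have "Omega = {p. inner (axis 1 (-1)) p \<le> 0} \<inter> {p. inner (axis 2 (-1)) p \<le> 0} \<inter> {p. inner (axis 3 (-1)) p \<le> 0}
    \<inter> {p. inner (vector [1, 0, 1]) p \<le> 1} \<inter> {p. inner (vector [0, 1, 1]) p \<le> 1}"
    by (auto simp: Omega_def inner_vec_def sum_3 axis_def)
  also have "convex \<dots>" by (intro convex_Int convex_halfspace_le)
  finally show ?thesis .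
qed

lemma bounded_Omega: "bounded Omega"
proof (rule boundedI)
  fix p assume "p \<in> Omega"
  then have "\<bar>p$i\<bar> \<le> 1" for i using exhaust_3[of i] by (auto simp: Omega_def)
  then have "(\<Sum>i\<in>UNIV. \<bar>p$i\<bar>) \<le> (\<Sum>i\<in>(UNIV::3 set). 1)" by (intro sum_mono)
  then show "norm p \<le> 3" using norm_le_l1_cart[of p] by simp
qed

lemmas Omega_S = convex_Omega bounded_Omega

lemma interior_Omega: 
  assumes "q \<in> interior Omega" shows "q \<in> Omega - {apex}" "q$3 < 1"
proof -
  obtain e where e: "e > 0" "ball q e \<subseteq> Omega" using assms by (auto simp: mem_interior)
  have "q + (e/2) *\<^sub>R axis 3 1 \<in> ball q e" using e by (simp add: dist_norm)
  then have "q + (e/2) *\<^sub>R axis 3 1 \<in> Omega" using e by auto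
  then have "q$3 + e/2 \<le> 1" by (auto simp: Omega_def)
  then show "q$3 < 1" using e by simp
  moreover have "q \<in> Omega" using assms interior_subset by auto
  ultimately show "q \<in> Omega - {apex}" by (auto simp: apex_def)
qed

text \<open>Supplies enough interior points for the identity principle: a numerator that vanishes at
  all of them is the zero polynomial.\<close>

lemma phi_interior:
  assumes "0 < x" "x < 1" "0 < y" "y < 1" "0 < z"
  shows "phi (vector [x, y, z]) \<in> interior Omega" "phi_inv (phi (vector [x, y, z])) = vector [x, y, z]"
proof -
  let ?U = "{p::real^3. 0 < p$1} \<inter> {p. 0 < p$2} \<inter> {p. 0 < p$3} \<inter> {p. p$1 + p$3 < 1} \<inter> {p. p$2 + p$3 < 1}"
  have "open ?U" by (intro open_Int open_Collect_less continuous_intros)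
  moreover have "?U \<subseteq> Omega" by (auto simp: Omega_def)
  ultimately have U: "?U \<subseteq> interior Omega" by (rule interior_maximal[rotated])
  have "x / (1 + z) + z / (1 + z) < 1" "y / (1 + z) + z / (1 + z) < 1"
    using assms by (simp_all add: add_divide_distrib[symmetric])
  then have "phi (vector [x, y, z]) \<in> ?U" using assms by (simp add: phi_def)
  with U show "phi (vector [x, y, z]) \<in> interior Omega" by blast
  show "phi_inv (phi (vector [x, y, z])) = vector [x, y, z]"
    using assms by (intro phi_inv_phi) (simp add: Omega_inf_def)
qed

lemma phi_inv_simps:
  assumes "q$3 < 1"
  shows "1 + phi_inv q $ 3 = 1 / (1 - q$3)"
  using assms by (simp add: phi_inv_def field_simps)

definition at_inv :: "fun3 \<Rightarrow> real^3 \<Rightarrow> real" where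
  "at_inv n q = n (phi_inv q $ 1) (phi_inv q $ 2) (phi_inv q $ 3)"

text \<open>Of the \<open>k + 2\<close> powers of \<open>1 - q$3\<close> coming from the
  denominator, the Piola transform removes three in the first two components and two in the
  third.\<close>

lemma push2_at_rat_field:
  assumes q: "q$3 < 1" and k: "k \<ge> 1"
  shows "push2_at (rat_field (k + 2) n1 n2 n3) q = vector [(at_inv n1 q - q$1 * at_inv n3 q) * (1 - q$3) ^ (k - 1), 
    (at_inv n2 q - q$2 * at_inv n3 q) * (1 - q$3) ^ (k - 1), at_inv n3 q * (1 - q$3) ^ k]"
proof -
  define D where "D = 1 - q$3"
  have D: "D > 0" using q by (simp add: D_def)
  have k2: "k + 2 = (k - 1) + 3" using k by simp
  have "D ^ (k + 2) / D ^ 3 = D ^ (k - 1)" unfolding k2 using D by (simp only: power_add) simp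
  moreover have "D ^ (k + 2) / D ^ 2 = D ^ k" using D by (simp only: power_add) simp
  moreover have "rat_field (k + 2) n1 n2 n3 (phi_inv q) = vector [at_inv n1 q * D ^ (k + 2), at_inv n2 q * D ^ (k + 2), at_inv n3 q * D ^ (k + 2)]"
    unfolding rat_field_def at_inv_def phi_inv_simps[OF q] D_def by (simp add: power_one_over divide_simps)
  ultimately have e: "rat_field (k + 2) n1 n2 n3 (phi_inv q) = vector [at_inv n1 q * D ^ (k + 2), at_inv n2 q * D ^ (k + 2), at_inv n3 q * D ^ (k + 2)]"
    and d: "(a * D ^ (k + 2) - b * (c * D ^ (k + 2))) / D ^ 3 = (a - b * c) * D ^ (k - 1)" "a * D ^ (k + 2) / D ^ 2 = a * D ^ k" for a b c
    by (metis mult.assoc left_diff_distrib times_divide_eq_right)+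
  show ?thesis unfolding push2_at_def e D_def[symmetric] vector_3 d ..
qed

text \<open>Since \<open>1 + z\<close> is \<open>1 / (1 - q$3)\<close>, a numerator of degree
  \<open>r\<close> in \<open>z\<close> is tamed by the power \<open>r\<close> of
  \<open>1 - q$3\<close>, and by any higher one.\<close>

lemma at_inv_bound:
  assumes "n \<in> polyQ3 l m (int r)"
  shows "\<exists>C\<ge>0. \<forall>q\<in>Omega - {apex}. \<forall>j\<ge>r. \<bar>at_inv n q * (1 - q$3) ^ j\<bar> \<le> C"
proof -
  obtain C where C: "\<And>x y z. 0 \<le> x \<Longrightarrow> x \<le> 1 \<Longrightarrow> 0 \<le> y \<Longrightarrow> y \<le> 1 \<Longrightarrow> 0 \<le> z \<Longrightarrow> \<bar>n x y z\<bar> \<le> C * (1 + z) ^ r"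
    using polyQ3_bound[OF assms] by blast
  have "\<bar>n 0 0 0\<bar> \<le> C" using C[of 0 0 0] by simp
  then have C0: "0 \<le> C" using abs_ge_zero[of "n 0 0 0"] by linarith
  have "\<bar>at_inv n q * (1 - q$3) ^ j\<bar> \<le> C" if q: "q \<in> Omega - {apex}" and j: "j \<ge> r" for q j
  proof -
    have q3: "q$3 < 1" "0 \<le> q$3" using Omega_less1[OF q] q by (auto simp: Omega_def)
    have "\<bar>at_inv n q\<bar> \<le> C * (1 / (1 - q$3)) ^ r"
      using C[of "phi_inv q $ 1" "phi_inv q $ 2" "phi_inv q $ 3"] phi_inv_Omega_inf[OF q]
      unfolding phi_inv_simps[OF q3(1)] at_inv_def by (auto simp: Omega_inf_def)
    then have "\<bar>at_inv n q * (1 - q$3) ^ j\<bar> \<le> C * (1 / (1 - q$3)) ^ r * (1 - q$3) ^ j"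
      unfolding abs_mult using q3 by (intro mult_mono) auto
    also have "(1 / (1 - q$3)) ^ r * (1 - q$3) ^ j = (1 - q$3) ^ (j - r)"
      using q3 j by (simp add: power_one_over power_diff)
    then have "C * (1 / (1 - q$3)) ^ r * (1 - q$3) ^ j = C * (1 - q$3) ^ (j - r)" by (simp only: mult.assoc)
    also have "\<dots> \<le> C * 1" using q3 C0 by (intro mult_left_mono power_le_one) auto
    finally show ?thesis by simp
  qed
  with C0 show ?thesis by blast
qed

lemma at_inv_continuous:
  assumes "n \<in> polyQ3 l m r" and q: "q$3 < 1"
  shows "isCont (at_inv n) q"
proof -
  have "(phi_inv has_derivative (\<lambda>h. vector [h$1 / (1 - q$3) + h$3 * q$1 / (1 - q$3)^2,
     h$2 / (1 - q$3) + h$3 * q$2 / (1 - q$3)^2, h$3 / (1 - q$3)^2])) (at q)"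
    using q by (intro has_derivative_phi_inv) simp
  then have "isCont phi_inv q" by (rule has_derivative_continuous)
  then have "isCont (\<lambda>q. (\<lambda>p. n (p$1) (p$2) (p$3)) (phi_inv q)) q"
    by (rule isCont_o2) (rule has_derivative_continuous[OF polyQ3_has_derivative[OF assms(1)]])
  then show ?thesis by (simp add: at_inv_def[abs_def])
qed

lemma nice_at_inv:
  assumes "n \<in> polyQ3 l m (int r)" "j \<ge> r"
  shows "nice Omega (\<lambda>q. at_inv n q * (1 - q$3) ^ j)"
proof -
  obtain C where C: "\<And>q. q \<in> Omega - {apex} \<Longrightarrow> \<bar>at_inv n q * (1 - q$3) ^ j\<bar> \<le> C"
    using at_inv_bound[OF assms(1)] assms(2) by blast
  show ?thesis
  proof (rule niceI)
    show "continuous_on (interior Omega) (\<lambda>q. at_inv n q * (1 - q$3) ^ j)"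
      using interior_Omega(2) by (intro continuous_at_imp_continuous_on ballI continuous_intros at_inv_continuous[OF assms(1)]) auto
    show "\<bar>at_inv n q * (1 - q$3) ^ j\<bar> \<le> C" if "q \<in> interior Omega" for q
      using C interior_Omega(1)[OF that] by blast
  qed
qed

lemma nice_diff: "nice S f \<Longrightarrow> nice S g \<Longrightarrow> nice S (\<lambda>x. f x - g x)"
  using nice_add[of S f "\<lambda>x. (-1) * g x"] nice_mult[OF nice_const[of S "-1"], of g] by simp

lemma nice_push2:
  assumes N: "flux_num k n1 n2 n3" and k: "k \<ge> 1"
  shows "nice Omega (\<lambda>q. push2 (rat_field (k + 2) n1 n2 n3) q $ i)"
proof -
  have km: "int k - 1 = int (k - 1)" using k by simp
  have n: "n1 \<in> polyQ3 (int k) (int (k - 1)) (int (k - 1))" "n2 \<in> polyQ3 (int (k - 1)) (int k) (int (k - 1))" 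
    "n3 \<in> polyQ3 (int (k - 1)) (int (k - 1)) (int k)"
    using N unfolding flux_num_def km by auto
  \<comment> \<open>The third numerator has degree \<open>k\<close> but meets only
    \<open>k - 1\<close> powers here. The missing one comes from
    \<open>\<bar>q$i\<bar> \<le> 1 - q$3\<close>: the pyramid narrows to its apex.\<close>
  have n3: "nice Omega (\<lambda>q. q$i * at_inv n3 q * (1 - q$3) ^ (k - 1))" if "i = 1 \<or> i = 2" for i
  proof -
    obtain C where C: "C \<ge> 0" "\<And>q. q \<in> Omega - {apex} \<Longrightarrow> \<bar>at_inv n3 q * (1 - q$3) ^ k\<bar> \<le> C"
      using at_inv_bound[OF n(3)] by blast
    show ?thesis
    proof (rule niceI)
      show "continuous_on (interior Omega) (\<lambda>q. q$i * at_inv n3 q * (1 - q$3) ^ (k - 1))"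
        using interior_Omega(2) by (intro continuous_at_imp_continuous_on ballI continuous_intros at_inv_continuous[OF n(3)]) auto
      show "\<bar>q$i * at_inv n3 q * (1 - q$3) ^ (k - 1)\<bar> \<le> C" if q: "q \<in> interior Omega" for q
      proof -
        have q3: "q$3 < 1" "q \<in> Omega" using interior_Omega[OF q] by auto
        then have "\<bar>q$i\<bar> \<le> 1 - q$3" using \<open>i = 1 \<or> i = 2\<close> by (auto simp: Omega_def)
        then have "\<bar>q$i\<bar> * \<bar>at_inv n3 q * (1 - q$3) ^ (k - 1)\<bar> \<le> (1 - q$3) * \<bar>at_inv n3 q * (1 - q$3) ^ (k - 1)\<bar>"
          by (intro mult_right_mono) auto
        also have "\<dots> = \<bar>at_inv n3 q * (1 - q$3) ^ k\<bar>"
          using q3 k by (cases k) (auto simp: abs_mult)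
        also have "\<dots> \<le> C" using C interior_Omega(1)[OF q] by blast
        finally show ?thesis by (simp add: abs_mult mult_ac)
      qed
    qed
  qed
  have "nice Omega (\<lambda>q. (vector [(at_inv n1 q - q$1 * at_inv n3 q) * (1 - q$3) ^ (k - 1), 
    (at_inv n2 q - q$2 * at_inv n3 q) * (1 - q$3) ^ (k - 1), at_inv n3 q * (1 - q$3) ^ k] :: real^3) $ i)"
  proof -
    have "nice Omega (\<lambda>q. at_inv n1 q * (1 - q$3) ^ (k - 1) - q$1 * at_inv n3 q * (1 - q$3) ^ (k - 1))"
      "nice Omega (\<lambda>q. at_inv n2 q * (1 - q$3) ^ (k - 1) - q$2 * at_inv n3 q * (1 - q$3) ^ (k - 1))"
      by (intro nice_diff n3 nice_at_inv[OF n(1)] nice_at_inv[OF n(2)]; simp)+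
    moreover have "nice Omega (\<lambda>q. at_inv n3 q * (1 - q$3) ^ k)" by (intro nice_at_inv[OF n(3)]) simp
    ultimately show ?thesis using exhaust_3[of i] by (auto simp: left_diff_distrib)
  qed
  then show ?thesis
    by (rule iffD1[OF nice_cong, rotated]) (use interior_Omega push2_at_rat_field[OF _ k] in \<open>auto simp: push2_def\<close>)
qed

text \<open>Membership in \<open>Hdiv\<close> is proved by integrating the three partial derivatives separately, so they are
  recorded individually.\<close>

definition pd1 :: "nat \<Rightarrow> fun3 \<Rightarrow> fun3 \<Rightarrow> fun3 \<Rightarrow> real^3 \<Rightarrow> real" where
  "pd1 k n1 n2 n3 q = (at_inv (dX n1) q * (1 - q$3) ^ (k + 2) / (1 - q$3) - (q$1 * (at_inv (dX n3) q * (1 - q$3) ^ (k + 2)) / (1 - q$3)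
     + at_inv n3 q * (1 - q$3) ^ (k + 2))) / (1 - q$3) ^ 3"
definition pd2 :: "nat \<Rightarrow> fun3 \<Rightarrow> fun3 \<Rightarrow> fun3 \<Rightarrow> real^3 \<Rightarrow> real" where
  "pd2 k n1 n2 n3 q = (at_inv (dY n2) q * (1 - q$3) ^ (k + 2) / (1 - q$3) - (q$2 * (at_inv (dY n3) q * (1 - q$3) ^ (k + 2)) / (1 - q$3)
     + at_inv n3 q * (1 - q$3) ^ (k + 2))) / (1 - q$3) ^ 3"
definition pd3 :: "nat \<Rightarrow> fun3 \<Rightarrow> fun3 \<Rightarrow> fun3 \<Rightarrow> real^3 \<Rightarrow> real" where
  "pd3 k n1 n2 n3 q = (q$1 * (at_inv (dX n3) q * (1 - q$3) ^ (k + 2)) + q$2 * (at_inv (dY n3) q * (1 - q$3) ^ (k + 2)) 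
     + (at_inv (dZ n3) q - (real k + 2) * at_inv n3 q * (1 - q$3)) * (1 - q$3) ^ (k + 2)) / (1 - q$3) ^ 4 
     + 2 * (at_inv n3 q * (1 - q$3) ^ (k + 2)) / (1 - q$3) ^ 3"

lemma push2_partials:
  assumes n: "n1 \<in> polyQ3 a1 a2 a3" "n2 \<in> polyQ3 b1 b2 b3" "n3 \<in> polyQ3 c1 c2 c3" and q: "q \<in> interior Omega"
  shows "\<exists>f'. (push2 (rat_field (k + 2) n1 n2 n3) has_derivative f') (at q) \<and> f' (axis 1 1) $ 1 = pd1 k n1 n2 n3 q
     \<and> f' (axis 2 1) $ 2 = pd2 k n1 n2 n3 q \<and> f' (axis 3 1) $ 3 = pd3 k n1 n2 n3 q"
proof -
  note q3 = interior_Omega[OF q]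
  define D where "D = 1 - q$3"
  have D: "D > 0" using q3 by (simp add: D_def)
  have z1: "1 + phi_inv q $ 3 = 1 / D" using phi_inv_simps[OF q3(2)] by (simp add: D_def)
  then have z: "1 + phi_inv q $ 3 \<noteq> 0" using D by simp
  have f: "((\<lambda>p. rat_field (k + 2) n1 n2 n3 p $ 1) = (\<lambda>p. n1 (p$1) (p$2) (p$3) / (1 + p$3) ^ (k + 2)))"
    "((\<lambda>p. rat_field (k + 2) n1 n2 n3 p $ 2) = (\<lambda>p. n2 (p$1) (p$2) (p$3) / (1 + p$3) ^ (k + 2)))"
    "((\<lambda>p. rat_field (k + 2) n1 n2 n3 p $ 3) = (\<lambda>p. n3 (p$1) (p$2) (p$3) / (1 + p$3) ^ (k + 2)))"
    by (simp_all add: rat_field_def)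
  have w3: "rat_field (k + 2) n1 n2 n3 p $ 3 = n3 (p$1) (p$2) (p$3) / (1 + p$3) ^ (k + 2)" for p
    by (simp add: rat_field_def)
  have e: "a / (1 / D) ^ (k + 2) = a * D ^ (k + 2)" 
    "((1 / D) * b - real (k + 2) * c) / (1 / D) ^ (k + 2 + 1) = (b - (real k + 2) * c * D) * D ^ (k + 2)" for a b c
    using D by (simp_all add: power_one_over field_simps)
  have "q$3 \<noteq> 1" using q3 by simp
  from push2_at_has_derivative[OF this, of "rat_field (k + 2) n1 n2 n3", unfolded f, OF rat_field_has_derivative[OF n(1) z] rat_field_has_derivative[OF n(2) z] rat_field_has_derivative[OF n(3) z]]
  obtain f' where f': "(push2_at (rat_field (k + 2) n1 n2 n3) has_derivative f') (at q)"
    and pd: "f' (axis 1 1) $ 1 = pd1 k n1 n2 n3 q" "f' (axis 2 1) $ 2 = pd2 k n1 n2 n3 q" "f' (axis 3 1) $ 3 = pd3 k n1 n2 n3 q"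
    unfolding w3 z1 e at_inv_def[symmetric] D_def[symmetric] pd1_def pd2_def pd3_def by blast
  have "(push2 (rat_field (k + 2) n1 n2 n3) has_derivative f') (at q)"
    by (rule has_derivative_transform_within_open[OF f' open_interior q]) 
       (use interior_Omega in \<open>auto simp: push2_def\<close>)
  with pd show ?thesis by blast
qed

text \<open>The divergence of a Piola transform is the old divergence over the Jacobian determinant:
  of the \<open>k + 3\<close> powers in the denominator four are cancelled, which leaves
  \<open>(1 - q$3) ^ (k - 1)\<close>.\<close>

lemma push2_has_derivative:
  assumes n: "n1 \<in> polyQ3 a1 a2 a3" "n2 \<in> polyQ3 b1 b2 b3" "n3 \<in> polyQ3 c1 c2 c3" and q: "q \<in> interior Omega" and k: "k \<ge> 1"
  shows "\<exists>f'. (push2 (rat_field (k + 2) n1 n2 n3) has_derivative f') (at q) \<and> 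
    f' (axis 1 1) $ 1 + f' (axis 2 1) $ 2 + f' (axis 3 1) $ 3 = at_inv (divergence_num (real k + 2) n1 n2 n3) q * (1 - q$3) ^ (k - 1)"
proof -
  note q3 = interior_Omega[OF q]
  define D where "D = 1 - q$3"
  have D: "D > 0" using q3 by (simp add: D_def)
  have z1: "1 + phi_inv q $ 3 = 1 / D" using phi_inv_simps[OF q3(2)] by (simp add: D_def)
  have "k + 3 = k - 1 + 4" using k by simp
  then have Dk: "D ^ (k + 3) = D ^ (k - 1) * D ^ 4" by (simp only: power_add)
  \<comment> \<open>\<open>P\<close> stands for \<open>D ^ (k + 3)\<close> and
    \<open>P / D ^ 1\<close> for \<open>D ^ (k + 2)\<close>; with the variable exponent hidden, this
    is an identity of rational functions.\<close>
  have eq: "(A * (P / D ^ 1) / D - (q1 * (X * (P / D ^ 1)) / D + N * (P / D ^ 1))) / D ^ 3 + (B * (P / D ^ 1) / D - (q2 * (Y * (P / D ^ 1)) / D + N * (P / D ^ 1))) / D ^ 3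
     + ((q1 * (X * (P / D ^ 1)) + q2 * (Y * (P / D ^ 1)) + (Z - w * N * D) * (P / D ^ 1)) / D ^ 4 + 2 * (N * (P / D ^ 1)) / D ^ 3)
     = (1 / D * (A + B + Z) - w * N) * (P / D ^ 4)" for A B X Y Z N w q1 q2 P
    using D by (simp add: field_simps eval_nat_numeral)
  have D2: "D ^ (k + 2) = D ^ (k + 3) / D ^ 1" using D by (simp add: eval_nat_numeral)
  have "pd1 k n1 n2 n3 q + pd2 k n1 n2 n3 q + pd3 k n1 n2 n3 q = at_inv (divergence_num (real k + 2) n1 n2 n3) q * (D ^ (k + 3) / D ^ 4)"
    unfolding pd1_def pd2_def pd3_def D_def[symmetric] D2 eq divergence_num_def at_inv_def z1 ..
  also have "D ^ (k + 3) / D ^ 4 = D ^ (k - 1)" unfolding Dk using D by simp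
  finally have "pd1 k n1 n2 n3 q + pd2 k n1 n2 n3 q + pd3 k n1 n2 n3 q = at_inv (divergence_num (real k + 2) n1 n2 n3) q * (1 - q$3) ^ (k - 1)"
    by (simp add: D_def)
  then show ?thesis using push2_partials[OF n q, of k] by metis
qed

lemma pd_continuous:
  assumes n: "n1 \<in> polyQ3 a1 a2 a3" "n2 \<in> polyQ3 b1 b2 b3" "n3 \<in> polyQ3 c1 c2 c3"
  shows "continuous_on (interior Omega) (pd1 k n1 n2 n3)" "continuous_on (interior Omega) (pd2 k n1 n2 n3)" 
    "continuous_on (interior Omega) (pd3 k n1 n2 n3)"
proof -
  have ne: "\<forall>q\<in>interior Omega. q$3 \<noteq> 1" using interior_Omega(2) by force
  have c: "continuous_on (interior Omega) (at_inv n)" if "n \<in> polyQ3 l m r" for n l m r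
    by (intro continuous_at_imp_continuous_on ballI at_inv_continuous[OF that] interior_Omega(2))
  note cc = c[OF n(3)] c[OF dX_polyQ3(1)[OF n(1)]] c[OF dX_polyQ3(1)[OF n(3)]] c[OF dY_polyQ3(1)[OF n(2)]] c[OF dY_polyQ3(1)[OF n(3)]] c[OF dZ_polyQ3[OF n(3)]]
  show "continuous_on (interior Omega) (pd1 k n1 n2 n3)"
    unfolding pd1_def[abs_def] by (intro continuous_intros cc) (use ne in auto)
  show "continuous_on (interior Omega) (pd2 k n1 n2 n3)" 
    unfolding pd2_def[abs_def] by (intro continuous_intros cc) (use ne in auto)
  show "continuous_on (interior Omega) (pd3 k n1 n2 n3)"
    unfolding pd3_def[abs_def] by (intro continuous_intros cc) (use ne in auto)
qed

lemma divergence_push2: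
  assumes N: "flux_num k n1 n2 n3" and q: "q \<in> interior Omega" and k: "k \<ge> 1"
  shows "divergence (push2 (rat_field (k + 2) n1 n2 n3)) q = at_inv (divergence_num (real k + 2) n1 n2 n3) q * (1 - q$3) ^ (k - 1)"
proof -
  have n: "n1 \<in> polyQ3 (int k) (int k - 1) (int k - 1)" "n2 \<in> polyQ3 (int k - 1) (int k) (int k - 1)" "n3 \<in> polyQ3 (int k - 1) (int k - 1) (int k)"
    using N by (auto simp: flux_num_def)
  obtain f' where f': "(push2 (rat_field (k + 2) n1 n2 n3) has_derivative f') (at q)"
    "f' (axis 1 1) $ 1 + f' (axis 2 1) $ 2 + f' (axis 3 1) $ 3 = at_inv (divergence_num (real k + 2) n1 n2 n3) q * (1 - q$3) ^ (k - 1)"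
    using push2_has_derivative[OF n q k] by blast
  show ?thesis
    unfolding divergence_def at_within_interior[OF q] trace_def sum_3 jacobian_entry[OF f'(1)] by (rule f'(2))
qed

text \<open>Here the bound on the divergence numerator pays off: its degree and the weight are both
  \<open>k - 1\<close>, so the divergence stays bounded up to the apex.\<close>

lemma nice_divergence:
  assumes N: "flux_num k n1 n2 n3" and k: "k \<ge> 1"
  shows "nice Omega (divergence (push2 (rat_field (k + 2) n1 n2 n3)))"
proof -
  have "divergence_num (real k + 2) n1 n2 n3 \<in> polyQ3 (int k - 1) (int k - 1) (int (k - 1))"
    using N k by (simp add: flux_num_def)
  from nice_at_inv[OF this order_refl] show ?thesis
    by (rule iffD1[OF nice_cong, rotated]) (rule divergence_push2[OF N _ k, symmetric])
qed

text \<open>Exterior differentiation commutes with pullbacks, here from 1-forms to 2-forms.\<close>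

lemma curl_push1:
  assumes C: "curl_num k m1 m2 m3" and q: "q \<in> interior Omega"
  shows "curl (push1 (rat_field (k + 1) m1 m2 m3)) q = 
    push2 (rat_field (k + 2) (curl1 (real k + 1) m1 m2 m3) (curl2 (real k + 1) m1 m2 m3) (curl3 (real k + 1) m1 m2 m3)) q"
proof -
  note m = curl_num_degrees[OF C]
  note q3 = interior_Omega[OF q]
  have z: "1 + phi_inv q $ 3 \<noteq> 0" using phi_inv_simps[OF q3(2)] q3(2) by simp
  have f: "((\<lambda>p. rat_field (k + 1) m1 m2 m3 p $ 1) = (\<lambda>p. m1 (p$1) (p$2) (p$3) / (1 + p$3) ^ (k + 1)))"
    "((\<lambda>p. rat_field (k + 1) m1 m2 m3 p $ 2) = (\<lambda>p. m2 (p$1) (p$2) (p$3) / (1 + p$3) ^ (k + 1)))"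
    "((\<lambda>p. rat_field (k + 1) m1 m2 m3 p $ 3) = (\<lambda>p. m3 (p$1) (p$2) (p$3) / (1 + p$3) ^ (k + 1)))"
    by (simp_all add: rat_field_def)
  have "q$3 \<noteq> 1" using q3 by simp
  from push1_at_has_derivative[OF this, of "rat_field (k + 1) m1 m2 m3", unfolded f, OF rat_field_has_derivative[OF m(1) z] rat_field_has_derivative[OF m(2) z] rat_field_has_derivative[OF m(3) z]]
  obtain f' where f': "(push1_at (rat_field (k + 1) m1 m2 m3) has_derivative f') (at q)"
    and c: "f' (axis 2 1) $ 3 - f' (axis 3 1) $ 2 = 
       ((at_inv (dY m3) q / (1 + phi_inv q $ 3) ^ (k + 1) - ((1 + phi_inv q $ 3) * at_inv (dZ m2) q - real (k + 1) * at_inv m2 q) / (1 + phi_inv q $ 3) ^ (k + 1 + 1))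
         - q$1 * (at_inv (dX m2) q / (1 + phi_inv q $ 3) ^ (k + 1) - at_inv (dY m1) q / (1 + phi_inv q $ 3) ^ (k + 1))) / (1 - q$3) ^ 3"
    "f' (axis 3 1) $ 1 - f' (axis 1 1) $ 3 = 
       ((((1 + phi_inv q $ 3) * at_inv (dZ m1) q - real (k + 1) * at_inv m1 q) / (1 + phi_inv q $ 3) ^ (k + 1 + 1) - at_inv (dX m3) q / (1 + phi_inv q $ 3) ^ (k + 1))
         - q$2 * (at_inv (dX m2) q / (1 + phi_inv q $ 3) ^ (k + 1) - at_inv (dY m1) q / (1 + phi_inv q $ 3) ^ (k + 1))) / (1 - q$3) ^ 3"
    "f' (axis 1 1) $ 2 - f' (axis 2 1) $ 1 = (at_inv (dX m2) q / (1 + phi_inv q $ 3) ^ (k + 1) - at_inv (dY m1) q / (1 + phi_inv q $ 3) ^ (k + 1)) / (1 - q$3) ^ 2"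
    unfolding at_inv_def by blast
  have "(push1 (rat_field (k + 1) m1 m2 m3) has_derivative f') (at q)"
    by (rule has_derivative_transform_within_open[OF f' open_interior q]) 
       (use interior_Omega in \<open>auto simp: push1_def\<close>)
  then have "curl (push1 (rat_field (k + 1) m1 m2 m3)) q = vector [f' (axis 2 1) $ 3 - f' (axis 3 1) $ 2,
     f' (axis 3 1) $ 1 - f' (axis 1 1) $ 3, f' (axis 1 1) $ 2 - f' (axis 2 1) $ 1]"
    by (simp add: curl_def Let_def at_within_interior[OF q] jacobian_entry)
  also have "\<dots> = push2_at (rat_field (k + 2) (curl1 (real k + 1) m1 m2 m3) (curl2 (real k + 1) m1 m2 m3) (curl3 (real k + 1) m1 m2 m3)) q"
  proof -
    have e1: "a / b ^ (k + 1) - (b * c - real (k + 1) * d) / b ^ (k + 1 + 1) = (b * a - (b * c - (real k + 1) * d)) / b ^ (k + 2)"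
      "(b * c - real (k + 1) * d) / b ^ (k + 1 + 1) - a / b ^ (k + 1) = ((b * c - (real k + 1) * d) - b * a) / b ^ (k + 2)"
      "a / b ^ (k + 1) - c / b ^ (k + 1) = (b * (a - c)) / b ^ (k + 2)" if "b \<noteq> 0" for a b c d :: real
      using that by (simp_all add: field_simps)
    show ?thesis
      unfolding c e1[OF z] push2_at_def rat_field_def curl1_def curl2_def curl3_def at_inv_def by simp
  qed
  finally show ?thesis using q3 by (simp add: push2_def)
qed

section \<open>Linearity and finite dimension\<close>

lemma rat_field_add: "rat_field w (\<lambda>x y z. n1 x y z + m1 x y z) (\<lambda>x y z. n2 x y z + m2 x y z) (\<lambda>x y z. n3 x y z + m3 x y z)
    = rat_field w n1 n2 n3 + rat_field w m1 m2 m3"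
  by (simp add: rat_field_def fun_eq_iff plus_fun_def vec_eq_iff forall_3 add_divide_distrib)

lemma rat_field_cmult: "rat_field w (\<lambda>x y z. c * n1 x y z) (\<lambda>x y z. c * n2 x y z) (\<lambda>x y z. c * n3 x y z) = fscale c (rat_field w n1 n2 n3)"
  by (simp add: rat_field_def fun_eq_iff fscale_def vec_eq_iff forall_3)

lemma push2_at_linear: "push2_at (v + w) q = push2_at v q + push2_at w q" "push2_at (fscale c w) q = c *\<^sub>R push2_at w q"
  by (simp_all add: push2_at_def vec_eq_iff forall_3 fscale_apply add_divide_distrib[symmetric] algebra_simps)

lemma push2_add: "push2 (v + w) = push2 v + push2 w"
  unfolding push2_def push2_at_linear by (rule ext) simp

lemma push2_scale: "push2 (fscale c w) = fscale c (push2 w)"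
  unfolding push2_def push2_at_linear by (rule ext) (simp add: fscale_apply)

lemma push1_at_linear: "push1_at (v + w) q = push1_at v q + push1_at w q" "push1_at (fscale c w) q = c *\<^sub>R push1_at w q"
  by (simp_all add: push1_at_def vec_eq_iff forall_3 fscale_apply add_divide_distrib[symmetric] algebra_simps)

lemma push1_add: "push1 (v + w) = push1 v + push1 w"
  unfolding push1_def push1_at_linear by (rule ext) simp

lemma push1_scale: "push1 (fscale c w) = fscale c (push1 w)"
  unfolding push1_def push1_at_linear by (rule ext) (simp add: fscale_apply)

lemma finite_dim_polyQ3:
  fixes T :: "fun3 \<Rightarrow> 'a \<Rightarrow> 'b::real_vector"
  assumes add: "\<And>f g. T (\<lambda>x y z. f x y z + g x y z) = T f + T g" and scale: "\<And>c f. T (\<lambda>x y z. c * f x y z) = fscale c (T f)"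
  shows "\<exists>S. finite S \<and> T ` polyQ3 l m n \<subseteq> fun_vs.span S"
proof -
  let ?I = "{(i, j, h). int i \<le> l \<and> int j \<le> m \<and> int h \<le> n}"
  let ?m = "\<lambda>(i, j, h). T (\<lambda>x y z. x ^ i * y ^ j * z ^ h)"
  have fin: "finite ?I" unfolding polyQ3_index by (intro finite_cartesian_product finite_int_le)
  have zero: "T (\<lambda>x y z. 0) = 0"
    using scale[of 0 "\<lambda>x y z. 0"] by (simp add: fun_eq_iff fscale_def)
  have sum: "T (\<lambda>x y z. \<Sum>t\<in>J. f t x y z) = (\<Sum>t\<in>J. T (f t))" if "finite J" for J and f :: "nat \<times> nat \<times> nat \<Rightarrow> fun3"
    using that
  proof (induction J rule: finite_induct)
    case empty
    then show ?case using zero by simp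
  next
    case (insert t J)
    then show ?case using add[of "f t" "\<lambda>x y z. \<Sum>t\<in>J. f t x y z"] by simp
  qed
  have "T f \<in> fun_vs.span (?m ` ?I)" if f: "f \<in> polyQ3 l m n" for f
  proof -
    obtain c where c: "f = (\<lambda>x y z. \<Sum>(i, j, h)\<in>?I. c i j h * x ^ i * y ^ j * z ^ h)"
      using f unfolding polyQ3_def by blast
    then have "f = (\<lambda>x y z. \<Sum>t\<in>?I. (\<lambda>x y z. c (fst t) (fst (snd t)) (snd (snd t)) * (x ^ fst t * y ^ fst (snd t) * z ^ snd (snd t))) x y z)"
      by (simp add: case_prod_unfold mult.assoc)
    then have "T f = (\<Sum>t\<in>?I. T (\<lambda>x y z. c (fst t) (fst (snd t)) (snd (snd t)) * (x ^ fst t * y ^ fst (snd t) * z ^ snd (snd t))))"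
      using sum[OF fin] by simp
    also have "\<dots> = (\<Sum>t\<in>?I. fscale (c (fst t) (fst (snd t)) (snd (snd t))) (?m t))"
      unfolding scale by (simp add: case_prod_unfold)
    also have "\<dots> \<in> fun_vs.span (?m ` ?I)"
      by (intro fun_vs.span_sum fun_vs.span_scale fun_vs.span_base) auto
    finally show ?thesis .
  qed
  then show ?thesis using fin by (intro exI[of _ "?m ` ?I"]) auto
qed

lemma finite_dim_push:
  fixes P :: "(real^3 \<Rightarrow> real^3) \<Rightarrow> real^3 \<Rightarrow> real^3"
  assumes add: "\<And>v w. P (v + w) = P v + P w" and scale: "\<And>c w. P (fscale c w) = fscale c (P w)"
  shows "\<exists>S. finite S \<and> {P (rat_field w n1 n2 n3) | n1 n2 n3. n1 \<in> polyQ3 l m n \<and> n2 \<in> polyQ3 l m n \<and> n3 \<in> polyQ3 l m n} \<subseteq> fun_vs.span S"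
proof -
  let ?z = "(\<lambda>x y z. 0) :: fun3"
  let ?T1 = "\<lambda>f. P (rat_field w f ?z ?z)" and ?T2 = "\<lambda>f. P (rat_field w ?z f ?z)" and ?T3 = "\<lambda>f. P (rat_field w ?z ?z f)"
  obtain S1 where S1: "finite S1" "?T1 ` polyQ3 l m n \<subseteq> fun_vs.span S1"
    using finite_dim_polyQ3[of ?T1 l m n] rat_field_add[of w _ _ ?z ?z ?z ?z] rat_field_cmult[of w _ _ ?z ?z] add scale by auto
  obtain S2 where S2: "finite S2" "?T2 ` polyQ3 l m n \<subseteq> fun_vs.span S2"
    using finite_dim_polyQ3[of ?T2 l m n] rat_field_add[of w ?z ?z _ _ ?z ?z] rat_field_cmult[of w _ ?z _ ?z] add scale by auto
  obtain S3 where S3: "finite S3" "?T3 ` polyQ3 l m n \<subseteq> fun_vs.span S3"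
    using finite_dim_polyQ3[of ?T3 l m n] rat_field_add[of w ?z ?z ?z ?z] rat_field_cmult[of w _ ?z ?z] add scale by auto
  have "P (rat_field w n1 n2 n3) \<in> fun_vs.span (S1 \<union> S2 \<union> S3)" 
    if "n1 \<in> polyQ3 l m n" "n2 \<in> polyQ3 l m n" "n3 \<in> polyQ3 l m n" for n1 n2 n3
  proof -
    have "rat_field w n1 n2 n3 = rat_field w n1 ?z ?z + rat_field w ?z n2 ?z + rat_field w ?z ?z n3"
      unfolding rat_field_add[symmetric] by simp
    then have "P (rat_field w n1 n2 n3) = ?T1 n1 + ?T2 n2 + ?T3 n3" by (simp add: add)
    moreover have "fun_vs.span S1 \<subseteq> fun_vs.span (S1 \<union> S2 \<union> S3)" "fun_vs.span S2 \<subseteq> fun_vs.span (S1 \<union> S2 \<union> S3)" 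
      "fun_vs.span S3 \<subseteq> fun_vs.span (S1 \<union> S2 \<union> S3)" by (rule fun_vs.span_mono; blast)+
    ultimately show ?thesis using S1(2) S2(2) S3(2) that by (auto intro!: fun_vs.span_add)
  qed
  then show ?thesis using S1 S2 S3 by (intro exI[of _ "S1 \<union> S2 \<union> S3"]) auto
qed

section \<open>Faces\<close>

lemma finite_P2_index [simp]: "finite {(i, j). int (i + j) \<le> n}"
  by (rule finite_subset[of _ "{..nat n} \<times> {..nat n}"]) auto

lemma finite_P3_index [simp]: "finite {(i, j, h). int (i + j + h) \<le> n}"
  by (rule finite_subset[of _ "{..nat n} \<times> {..nat n} \<times> {..nat n}"]) auto

lemma polyP2_add: "f \<in> polyP2 n \<Longrightarrow> g \<in> polyP2 n \<Longrightarrow> (\<lambda>x y. f x y + g x y) \<in> polyP2 n"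
proof -
  assume "f \<in> polyP2 n" "g \<in> polyP2 n"
  then obtain c d where "f = (\<lambda>x y. \<Sum>(i, j)\<in>{(i, j). int (i + j) \<le> n}. c i j * x ^ i * y ^ j)"
    "g = (\<lambda>x y. \<Sum>(i, j)\<in>{(i, j). int (i + j) \<le> n}. d i j * x ^ i * y ^ j)"
    unfolding polyP2_def by blast
  then show ?thesis unfolding polyP2_def
    by (intro CollectI exI[of _ "\<lambda>i j. c i j + d i j"]) (simp add: sum.distrib[symmetric] case_prod_unfold algebra_simps)
qed

lemma polyP2_cmult: "f \<in> polyP2 n \<Longrightarrow> (\<lambda>x y. a * f x y) \<in> polyP2 n"
proof -
  assume "f \<in> polyP2 n"
  then obtain c where "f = (\<lambda>x y. \<Sum>(i, j)\<in>{(i, j). int (i + j) \<le> n}. c i j * x ^ i * y ^ j)"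
    unfolding polyP2_def by blast
  then show ?thesis unfolding polyP2_def
    by (intro CollectI exI[of _ "\<lambda>i j. a * c i j"]) (simp add: sum_distrib_left case_prod_unfold mult.assoc)
qed

lemma polyP2_zero: "(\<lambda>x y. 0) \<in> polyP2 n"
  unfolding polyP2_def by (intro CollectI exI[of _ "\<lambda>i j. 0"]) simp

lemma polyP2_sum: "(\<And>i. i \<in> I \<Longrightarrow> f i \<in> polyP2 n) \<Longrightarrow> (\<lambda>x y. \<Sum>i\<in>I. f i x y) \<in> polyP2 n"
  by (induction I rule: infinite_finite_induct) (auto intro: polyP2_add polyP2_zero)

lemma polyP2_monom:
  assumes "int (i + j) \<le> n" shows "(\<lambda>x y. x ^ i * y ^ j) \<in> polyP2 n"
proof -
  have "(\<Sum>(i', j')\<in>{(i, j). int (i + j) \<le> n}. (if i' = i \<and> j' = j then 1 else 0) * x ^ i' * y ^ j') = x ^ i * y ^ j" for x y :: real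
  proof -
    have "(\<Sum>(i', j')\<in>{(i, j). int (i + j) \<le> n}. (if i' = i \<and> j' = j then 1 else 0) * x ^ i' * y ^ j') = 
      (\<Sum>t\<in>{(i, j). int (i + j) \<le> n}. if t = (i, j) then x ^ i * y ^ j else 0)"
      by (intro sum.cong) (auto split: if_splits)
    also have "\<dots> = x ^ i * y ^ j" by (subst sum.delta[OF finite_P2_index]) (use assms in auto)
    finally show ?thesis .
  qed
  then show ?thesis unfolding polyP2_def
    by (intro CollectI exI[of _ "\<lambda>i' j'. if i' = i \<and> j' = j then 1 else 0"]) (simp add: fun_eq_iff)
qed

lemma polyP2_mono: "f \<in> polyP2 m \<Longrightarrow> m \<le> n \<Longrightarrow> f \<in> polyP2 n"
proof -
  assume "f \<in> polyP2 m" "m \<le> n"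
  then obtain c where c: "f = (\<lambda>x y. \<Sum>t\<in>{(i, j). int (i + j) \<le> m}. c (fst t) (snd t) * (x ^ fst t * y ^ snd t))"
    by (auto simp: polyP2_def case_prod_unfold mult.assoc)
  show "f \<in> polyP2 n" unfolding c using \<open>m \<le> n\<close> by (intro polyP2_sum polyP2_cmult polyP2_monom) auto
qed

lemma polyP2_mult:
  assumes "f \<in> polyP2 m" "g \<in> polyP2 n" shows "(\<lambda>x y. f x y * g x y) \<in> polyP2 (m + n)"
proof -
  obtain c where c: "f = (\<lambda>x y. \<Sum>t\<in>{(i, j). int (i + j) \<le> m}. c (fst t) (snd t) * (x ^ fst t * y ^ snd t))"
    using assms(1) by (auto simp: polyP2_def case_prod_unfold mult.assoc)
  obtain d where d: "g = (\<lambda>x y. \<Sum>t\<in>{(i, j). int (i + j) \<le> n}. d (fst t) (snd t) * (x ^ fst t * y ^ snd t))"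
    using assms(2) by (auto simp: polyP2_def case_prod_unfold mult.assoc)
  have *: "(\<lambda>x y. c i j * (x ^ i * y ^ j) * (d i' j' * (x ^ i' * y ^ j'))) = (\<lambda>x y. (c i j * d i' j') * (x ^ (i + i') * y ^ (j + j')))" for i j i' j'
    by (simp add: fun_eq_iff power_add mult_ac)
  show ?thesis unfolding c d sum_product
    by (intro polyP2_sum, unfold *) (intro polyP2_cmult polyP2_monom, auto)
qed

lemma polyP2_power: "f \<in> polyP2 1 \<Longrightarrow> (\<lambda>x y. f x y ^ i) \<in> polyP2 (int i)"
proof (induction i)
  case 0
  then show ?case using polyP2_monom[of 0 0 0] by simp
next
  case (Suc i)
  then show ?case using polyP2_mult[OF Suc.prems Suc.IH[OF Suc.prems]] by (simp add: add.commute)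
qed

text \<open>An affine substitution preserves total degree, which therefore passes from the ambient
  coordinates to the parameters of a face.\<close>

lemma polyP3_subst:
  assumes f: "f \<in> polyP3 n" and abc: "a \<in> polyP2 1" "b \<in> polyP2 1" "c \<in> polyP2 1"
  shows "(\<lambda>s t. f (a s t) (b s t) (c s t)) \<in> polyP2 n"
proof -
  obtain d where d: "f = (\<lambda>x y z. \<Sum>t\<in>{(i, j, h). int (i + j + h) \<le> n}. d (fst t) (fst (snd t)) (snd (snd t)) * (x ^ fst t * y ^ fst (snd t) * z ^ snd (snd t)))"
    using f by (auto simp: polyP3_def case_prod_unfold mult.assoc)
  show ?thesis unfolding d
  proof (intro polyP2_sum polyP2_cmult)
    fix t assume "t \<in> {(i, j, h). int (i + j + h) \<le> n}"
    then have "int (fst t) + int (fst (snd t)) + int (snd (snd t)) \<le> n" by auto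
    then show "(\<lambda>s u. a s u ^ fst t * b s u ^ fst (snd t) * c s u ^ snd (snd t)) \<in> polyP2 n"
      by (intro polyP2_mono[OF polyP2_mult[OF polyP2_mult[OF polyP2_power[OF abc(1)] polyP2_power[OF abc(2)]] polyP2_power[OF abc(3)]]])
  qed
qed

lemma polyP3_embed:
  assumes "g \<in> polyP2 n"
  shows "(\<lambda>x y z. g y z) \<in> polyP3 n" "(\<lambda>x y z. g x z) \<in> polyP3 n"
proof -
  obtain c where c: "g = (\<lambda>x y. \<Sum>(i, j)\<in>{(i, j). int (i + j) \<le> n}. c i j * x ^ i * y ^ j)"
    using assms unfolding polyP2_def by blast
  let ?I = "{(i, j, h). int (i + j + h) \<le> n}"
  have 1: "(\<Sum>(i, j, h)\<in>?I. (if i = 0 then c j h else 0) * x ^ i * y ^ j * z ^ h) = g y z" for x y z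
  proof -
    have "(\<Sum>(i, j, h)\<in>?I. (if i = 0 then c j h else 0) * x ^ i * y ^ j * z ^ h) = (\<Sum>(i, j, h)\<in>(\<lambda>(j, h). (0, j, h)) ` {(i, j). int (i + j) \<le> n}. (if i = 0 then c j h else 0) * x ^ i * y ^ j * z ^ h)"
      by (rule sum.mono_neutral_right[OF finite_P3_index]) (auto simp: image_iff split: if_splits)
    also have "\<dots> = g y z" unfolding c by (subst sum.reindex) (auto simp: inj_on_def intro!: sum.cong)
    finally show ?thesis .
  qed
  have 2: "(\<Sum>(i, j, h)\<in>?I. (if j = 0 then c i h else 0) * x ^ i * y ^ j * z ^ h) = g x z" for x y z
  proof -
    have "(\<Sum>(i, j, h)\<in>?I. (if j = 0 then c i h else 0) * x ^ i * y ^ j * z ^ h) = (\<Sum>(i, j, h)\<in>(\<lambda>(j, h). (j, 0, h)) ` {(i, j). int (i + j) \<le> n}. (if j = 0 then c i h else 0) * x ^ i * y ^ j * z ^ h)"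
      by (rule sum.mono_neutral_right[OF finite_P3_index]) (auto simp: image_iff split: if_splits)
    also have "\<dots> = g x z" unfolding c by (subst sum.reindex) (auto simp: inj_on_def intro!: sum.cong)
    finally show ?thesis .
  qed
  show "(\<lambda>x y z. g y z) \<in> polyP3 n"
    unfolding polyP3_def by (intro CollectI exI[of _ "\<lambda>i j h. if i = 0 then c j h else 0"] ext 1[symmetric])
  show "(\<lambda>x y z. g x z) \<in> polyP3 n"
    unfolding polyP3_def by (intro CollectI exI[of _ "\<lambda>i j h. if j = 0 then c i h else 0"] ext 2[symmetric])
qed

lemma polyP2_sub_Q2: "f \<in> polyP2 n \<Longrightarrow> f \<in> polyQ2 n n"
proof -
  assume "f \<in> polyP2 n"
  then obtain c where c: "f = (\<lambda>x y. \<Sum>t\<in>{(i, j). int (i + j) \<le> n}. c (fst t) (snd t) * (x ^ fst t * y ^ snd t))"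
    by (auto simp: polyP2_def case_prod_unfold mult.assoc)
  show "f \<in> polyQ2 n n" unfolding c polyQ2_iff
    by (intro conjI allI poly1_sum poly1_cmult poly1_cmult_right poly1_mono[OF poly1_power]) auto
qed

text \<open>Scaling a polynomial of total degree at most \<open>n\<close> back and forth between a face of the
  finite and a face of the infinite pyramid (\<open>e\<close> is \<open>-1\<close> or \<open>1\<close>).\<close>

lemma polyP2_homogenise:
  assumes "f \<in> polyP2 (int n)"
  shows "\<exists>g\<in>polyP2 (int n). \<forall>s t. 1 + e * t \<noteq> 0 \<longrightarrow> g s t = f (s / (1 + e * t)) (t / (1 + e * t)) * (1 + e * t) ^ n"
proof -
  obtain c where c: "f = (\<lambda>x y. \<Sum>p\<in>{(i, j). int (i + j) \<le> int n}. c (fst p) (snd p) * (x ^ fst p * y ^ snd p))"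
    using assms by (auto simp: polyP2_def case_prod_unfold mult.assoc)
  let ?g = "\<lambda>s t. \<Sum>p\<in>{(i, j). int (i + j) \<le> int n}. c (fst p) (snd p) * (s ^ fst p * t ^ snd p * (1 + e * t) ^ (n - fst p - snd p))"
  have e: "(\<lambda>s t. 1 + e * t) \<in> polyP2 1"
    using polyP2_add[OF polyP2_monom[of 0 0 1] polyP2_cmult[OF polyP2_monom[of 0 1 1], of e]] by simp
  have "?g \<in> polyP2 (int n)"
  proof (intro polyP2_sum polyP2_cmult)
    fix p assume p: "p \<in> {(i, j). int (i + j) \<le> int n}"
    show "(\<lambda>s t. s ^ fst p * t ^ snd p * (1 + e * t) ^ (n - fst p - snd p)) \<in> polyP2 (int n)"
      by (rule polyP2_mono[OF polyP2_mult[OF polyP2_monom[OF order_refl] polyP2_power[OF e]]]) (use p in auto)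
  qed
  moreover have "?g s t = f (s / (1 + e * t)) (t / (1 + e * t)) * (1 + e * t) ^ n" if "1 + e * t \<noteq> 0" for s t
    unfolding c sum_distrib_right
  proof (rule sum.cong)
    fix p assume "p \<in> {(i, j). int (i + j) \<le> int n}"
    then have "n = fst p + snd p + (n - fst p - snd p)" by auto
    then have "(1 + e * t) ^ n = (1 + e * t) ^ fst p * (1 + e * t) ^ snd p * (1 + e * t) ^ (n - fst p - snd p)"
      by (metis power_add)
    then show "c (fst p) (snd p) * (s ^ fst p * t ^ snd p * (1 + e * t) ^ (n - fst p - snd p)) = 
      c (fst p) (snd p) * ((s / (1 + e * t)) ^ fst p * (t / (1 + e * t)) ^ snd p) * (1 + e * t) ^ n"
      using that by (simp add: power_divide)
  qed simp
  ultimately show ?thesis by (intro bexI[of _ ?g] allI impI)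
qed

text \<open>The side \<open>1/2\<close> makes the box fit into the triangle
  \<open>s + t \<le> 1\<close> as well as into the square.\<close>

lemma polyQ2_zero_box:
  assumes f: "f \<in> polyQ2 l m" and 0: "\<And>x y. 0 < x \<Longrightarrow> x < 1/2 \<Longrightarrow> 0 < y \<Longrightarrow> y < 1/2 \<Longrightarrow> f x y = 0"
  shows "f x y = 0"
proof -
  have inf: "infinite {0<..<1/2::real}" by auto
  have 1: "f x y = 0" if "0 < x" "x < 1/2" for x y
    by (rule poly1_zero_infinite[OF _ inf, of "\<lambda>y. f x y" m]) (use f that 0 in \<open>auto simp: polyQ2_iff\<close>)
  show ?thesis
    by (rule poly1_zero_infinite[OF _ inf, of "\<lambda>x. f x y" l]) (use f 1 in \<open>auto simp: polyQ2_iff\<close>)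
qed

section \<open>Face polynomials in face parameters\<close>

text \<open>One space for two purposes: polynomials in the parameters of a face of the finite
  pyramid, and traces of numerators on the corresponding face of the infinite one.\<close>

definition ref_poly :: "nat \<Rightarrow> pyramid_face \<Rightarrow> (real \<Rightarrow> real \<Rightarrow> real) set" where
  "ref_poly k F = (if F = Base then polyQ2 (int k - 1) (int k - 1) else polyP2 (int k - 1))"

lemma ref_poly_Q2: "g \<in> ref_poly k F \<Longrightarrow> g \<in> polyQ2 (int k - 1) (int k - 1)"
  unfolding ref_poly_def using polyP2_sub_Q2 by (auto split: if_splits)

lemma ref_poly_add: "f \<in> ref_poly k F \<Longrightarrow> g \<in> ref_poly k F \<Longrightarrow> (\<lambda>x y. f x y + g x y) \<in> ref_poly k F"
  and ref_poly_cmult: "f \<in> ref_poly k F \<Longrightarrow> (\<lambda>x y. a * f x y) \<in> ref_poly k F"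
  unfolding ref_poly_def by (auto simp: polyQ2_iff intro!: polyP2_add polyP2_cmult poly1_add poly1_cmult split: if_splits)

text \<open>Every parametrisation of a face is inverted by reading off two coordinates.\<close>

lemma face_param_inv:
  assumes "p = face_param F (s, t)"
  shows "s = (if F = Xi0 \<or> F = Xi1 then p$2 else p$1)" "t = (if F = Base then p$2 else p$3)"
  using assms by (cases F; simp add: face_param_def)+

text \<open>Ambient polynomials restrict by affine substitution. Conversely, a polynomial in the
  parameters extends to the ambient space because the parameters are coordinates.\<close>

lemma face_polys_iff:
  "q \<in> face_polys k F \<longleftrightarrow> (\<forall>p. p \<notin> face F \<longrightarrow> q p = 0) \<and> 
     (\<exists>g\<in>ref_poly k F. \<forall>s t. (s, t) \<in> face_domain F \<longrightarrow> q (face_param F (s, t)) = g s t)"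
proof -
  have inF: "face_param F (s, t) \<in> face F" if "(s, t) \<in> face_domain F" for s t
    using face_param_image[of F] that by blast
  have x: "(\<lambda>s t. s) \<in> polyP2 1" "(\<lambda>s t. t) \<in> polyP2 1" "(\<lambda>s t. 0) \<in> polyP2 1" "(\<lambda>s t. 1 - t) \<in> polyP2 1"
    using polyP2_monom[of 1 0 1] polyP2_monom[of 0 1 1] polyP2_zero[of 1] 
      polyP2_add[OF polyP2_monom[of 0 0 1] polyP2_cmult[OF polyP2_monom[of 0 1 1], of "-1"]] by simp_all
  show ?thesis
  proof
    assume q: "q \<in> face_polys k F"
    show "(\<forall>p. p \<notin> face F \<longrightarrow> q p = 0) \<and> (\<exists>g\<in>ref_poly k F. \<forall>s t. (s, t) \<in> face_domain F \<longrightarrow> q (face_param F (s, t)) = g s t)"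
    proof (cases "F = Base")
      case True
      with q obtain g where g: "g \<in> polyQ2 (int k - 1) (int k - 1)" "q = (\<lambda>p. if p \<in> face F then g (p$1) (p$2) else 0)"
        by (auto simp: face_polys_def)
      then show ?thesis using True inF
        by (intro conjI bexI[of _ g]) (auto simp: ref_poly_def face_param_def)
    next
      case False
      with q obtain g where g: "g \<in> polyP3 (int k - 1)" "q = (\<lambda>p. if p \<in> face F then g (p$1) (p$2) (p$3) else 0)"
        by (auto simp: face_polys_def)
      let ?g = "\<lambda>s t. g (face_param F (s, t) $ 1) (face_param F (s, t) $ 2) (face_param F (s, t) $ 3)"
      have "?g \<in> polyP2 (int k - 1)"
        using False by (cases F; simp add: face_param_def; intro polyP3_subst[OF g(1)] x)
      then show ?thesis using False g inF
        by (intro conjI bexI[of _ ?g]) (auto simp: ref_poly_def)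
    qed
  next
    assume "(\<forall>p. p \<notin> face F \<longrightarrow> q p = 0) \<and> (\<exists>g\<in>ref_poly k F. \<forall>s t. (s, t) \<in> face_domain F \<longrightarrow> q (face_param F (s, t)) = g s t)"
    then obtain g where q0: "\<And>p. p \<notin> face F \<Longrightarrow> q p = 0" and g: "g \<in> ref_poly k F" 
      and qg: "\<And>s t. (s, t) \<in> face_domain F \<Longrightarrow> q (face_param F (s, t)) = g s t" by blast
    have qp: "q = (\<lambda>p. if p \<in> face F then g (if F = Xi0 \<or> F = Xi1 then p$2 else p$1) (if F = Base then p$2 else p$3) else 0)"
    proof (rule ext)
      fix p
      show "q p = (if p \<in> face F then g (if F = Xi0 \<or> F = Xi1 then p$2 else p$1) (if F = Base then p$2 else p$3) else 0)"
      proof (cases "p \<in> face F")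
        case True
        then obtain s t where st: "(s, t) \<in> face_domain F" "p = face_param F (s, t)"
          using face_param_image[of F] by (metis image_iff surj_pair)
        then show ?thesis using True qg[OF st(1)] face_param_inv[OF st(2)] by simp
      qed (simp add: q0)
    qed
    show "q \<in> face_polys k F"
    proof (cases "F = Base")
      case True
      have "q = (\<lambda>p. if p \<in> face F then g (p$1) (p$2) else 0)" by (subst qp, rule ext) (use True in auto)
      then show ?thesis using g True unfolding face_polys_def ref_poly_def by (simp only: simp_thms if_True) blast
    next
      case False
      then have P: "(\<lambda>x y z. g y z) \<in> polyP3 (int k - 1)" "(\<lambda>x y z. g x z) \<in> polyP3 (int k - 1)"
        using g polyP3_embed by (auto simp: ref_poly_def)
      show ?thesis
      proof (cases "F = Xi0 \<or> F = Xi1")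
        case True
        then have e: "q = (\<lambda>p. if p \<in> face F then (\<lambda>x y z. g y z) (p$1) (p$2) (p$3) else 0)" by (subst qp, intro ext) (use False in auto)
        show ?thesis unfolding face_polys_def if_not_P[OF False] by (intro CollectI bexI[OF _ P(1)] e)
      next
        case n: False
        then have e: "q = (\<lambda>p. if p \<in> face F then (\<lambda>x y z. g x z) (p$1) (p$2) (p$3) else 0)" by (subst qp, intro ext) (use False in auto)
        show ?thesis unfolding face_polys_def if_not_P[OF False] by (intro CollectI bexI[OF _ P(2)] e)
      qed
    qed
  qed
qed

lemma face_domain_convex: "convex (face_domain F)"
proof -
  have "convex {(s, t). 0 \<le> s \<and> s \<le> (1::real) \<and> 0 \<le> t \<and> t \<le> (1::real)}" 
  proof -
    have "{(s, t). 0 \<le> s \<and> s \<le> (1::real) \<and> 0 \<le> t \<and> t \<le> (1::real)} = {0..1} \<times> {0..1}" by auto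
    then show ?thesis by (simp add: convex_Times)
  qed
  moreover have "convex {(s, t). 0 \<le> s \<and> 0 \<le> t \<and> s + t \<le> (1::real)}"
  proof -
    have "{(s, t). 0 \<le> s \<and> 0 \<le> t \<and> s + t \<le> (1::real)} = {p. inner (-1, 0) p \<le> 0} \<inter> {p. inner (0, -1) p \<le> 0} \<inter> {p. inner (1, 1) p \<le> 1}"
      by auto
    also have "convex \<dots>" by (intro convex_Int convex_halfspace_le)
    finally show ?thesis .
  qed
  ultimately show ?thesis by (simp add: face_domain_def)
qed

lemma face_domain_sub: "face_domain F \<subseteq> cbox (0, 0) (1, 1)"
  by (auto simp: face_domain_def cbox_Pair_eq split: if_splits)

lemma face_domain_bounded: "bounded (face_domain F)"
  using face_domain_sub bounded_cbox bounded_subset by blast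

lemmas face_S = face_domain_convex face_domain_bounded

lemma face_domain_interior:
  assumes "0 < s" "s < 1/2" "0 < t" "t < 1/2" shows "(s, t) \<in> interior (face_domain F)"
proof -
  have "open ({0<..<1/2::real} \<times> {0<..<1/2::real})" by (intro open_Times) auto
  moreover have "{0<..<1/2::real} \<times> {0<..<1/2::real} \<subseteq> face_domain F" by (auto simp: face_domain_def)
  ultimately have "{0<..<1/2::real} \<times> {0<..<1/2::real} \<subseteq> interior (face_domain F)" by (rule interior_maximal[rotated])
  then show ?thesis using assms by auto
qed

lemma polyQ2_nice:
  assumes "f \<in> polyQ2 l m" shows "nice (face_domain F) (\<lambda>st. f (fst st) (snd st))"
proof -
  obtain c where "f = (\<lambda>x y. \<Sum>(i, j)\<in>{(i, j). int i \<le> l \<and> int j \<le> m}. c i j * x ^ i * y ^ j)"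
    using assms by (auto simp: polyQ2_def)
  then have c: "continuous_on S (\<lambda>st. f (fst st) (snd st))" for S :: "(real \<times> real) set"
    by (auto simp: case_prod_unfold intro!: continuous_intros)
  have "compact ((\<lambda>st. f (fst st) (snd st)) ` cbox (0, 0) (1, 1))"
    by (intro compact_continuous_image c compact_cbox)
  then have "bounded ((\<lambda>st. f (fst st) (snd st)) ` interior (face_domain F))"
    by (rule bounded_subset[OF compact_imp_bounded]) (use interior_subset face_domain_sub in blast)
  with c show ?thesis by (simp add: nice_def)
qed

section \<open>Normals and normal traces\<close>

definition face_const :: "pyramid_face \<Rightarrow> real" where
  "face_const F = norm (cross3 (face_edge1 F) (face_edge2 F))"

lemma face_const_pos: "face_const F > 0"
proof -
  have "cross3 (face_edge1 F) (face_edge2 F) \<noteq> 0"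
    by (cases F) (simp_all add: cross3_def vec_eq_iff forall_3)
  then show ?thesis by (simp add: face_const_def)
qed

text \<open>Neither normalised nor consistently oriented: a unit normal is a nonzero multiple of it,
  and that multiple affects neither vanishing nor solvability.\<close>

definition face_normal :: "pyramid_face \<Rightarrow> real^3" where
  "face_normal F = (case F of Xi0 \<Rightarrow> vector [1, 0, 0] | Eta0 \<Rightarrow> vector [0, 1, 0] | Xi1 \<Rightarrow> vector [1, 0, 1]
     | Eta1 \<Rightarrow> vector [0, 1, 1] | Base \<Rightarrow> vector [0, 0, 1])"

lemma inner3: "inner (a::real^3) b = a$1 * b$1 + a$2 * b$2 + a$3 * b$3"
  by (simp add: inner_vec_def sum_3)

lemma unit_normal_eq:
  assumes "unit_normal F n"
  shows "\<exists>c. c \<noteq> 0 \<and> n = c *\<^sub>R face_normal F"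
proof -
  have n: "n \<noteq> 0" and o: "\<And>p q. p \<in> face F \<Longrightarrow> q \<in> face F \<Longrightarrow> inner (p - q) n = 0"
    using assms by (auto simp: unit_normal_def)
  have "\<exists>c. n = c *\<^sub>R face_normal F"
  proof (cases F)
    case Xi0
    then show ?thesis using o[of "vector [0, 1, 0]" 0] o[of "vector [0, 0, 1]" 0]
      by (intro exI[of _ "n$1"]) (simp add: Omega_def face_normal_def vec_eq_iff forall_3 inner3)
  next
    case Eta0
    then show ?thesis using o[of "vector [1, 0, 0]" 0] o[of "vector [0, 0, 1]" 0]
      by (intro exI[of _ "n$2"]) (simp add: Omega_def face_normal_def vec_eq_iff forall_3 inner3)
  next
    case Xi1
    then show ?thesis using o[of "vector [1, 1, 0]" "vector [1, 0, 0]"] o[of "vector [0, 0, 1]" "vector [1, 0, 0]"]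
      by (intro exI[of _ "n$1"]) (simp add: Omega_def face_normal_def vec_eq_iff forall_3 inner3)
  next
    case Eta1
    then show ?thesis using o[of "vector [1, 1, 0]" "vector [0, 1, 0]"] o[of "vector [0, 0, 1]" "vector [0, 1, 0]"]
      by (intro exI[of _ "n$2"]) (simp add: Omega_def face_normal_def vec_eq_iff forall_3 inner3)
  next
    case Base
    then show ?thesis using o[of "vector [0, 1, 0]" 0] o[of "vector [1, 0, 0]" 0]
      by (intro exI[of _ "n$3"]) (simp add: Omega_def face_normal_def vec_eq_iff forall_3 inner3)
  qed
  with n show ?thesis by force
qed

definition face_trace :: "pyramid_face \<Rightarrow> fun3 \<Rightarrow> fun3 \<Rightarrow> fun3 \<Rightarrow> real \<Rightarrow> real \<Rightarrow> real" where
  "face_trace F n1 n2 n3 = (case F of Xi0 \<Rightarrow> n1 0 | Eta0 \<Rightarrow> (\<lambda>x z. n2 x 0 z) | Xi1 \<Rightarrow> n1 1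
     | Eta1 \<Rightarrow> (\<lambda>x z. n2 x 1 z) | Base \<Rightarrow> (\<lambda>x y. n3 x y 0))"

definition U2_num :: "nat \<Rightarrow> fun3 \<Rightarrow> fun3 \<Rightarrow> fun3 \<Rightarrow> bool" where
  "U2_num k n1 n2 n3 \<longleftrightarrow> flux_num k n1 n2 n3 \<and> (\<forall>F. face_trace F n1 n2 n3 \<in> ref_poly k F)"

text \<open>On the slanted faces \<open>q$1\<close> or \<open>q$2\<close> equals
  \<open>1 - q$3\<close>, so the two contributions of the third numerator cancel; on the vertical
  ones that coordinate is zero. Each normal component thus depends on a single numerator.\<close>

lemma normal_trace:
  assumes k: "k \<ge> 1" and st: "(s, t) \<in> face_domain F" and ap: "face_param F (s, t) \<noteq> apex"
  shows "inner (push2 (rat_field (k + 2) n1 n2 n3) (face_param F (s, t))) (face_normal F) = 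
    (if F = Base then face_trace F n1 n2 n3 s t else face_trace F n1 n2 n3 (s / (1 - t)) (t / (1 - t)) * (1 - t) ^ (k - 1))"
proof -
  let ?p = "face_param F (s, t)"
  have p: "?p \<in> Omega - {apex}"
  proof -
    have "?p \<in> face F" using face_param_image[of F] st by blast
    then show ?thesis using ap by (cases F) auto
  qed
  note p3 = Omega_less1[OF p]
  have kk: "(1 - t) ^ k = (1 - t) * (1 - t) ^ (k - 1)" using k by (cases k) auto
  have e: "push2 (rat_field (k + 2) n1 n2 n3) ?p = push2_at (rat_field (k + 2) n1 n2 n3) ?p"
    using p by (simp add: push2_def)
  show ?thesis
  proof (cases F)
    case Xi0
    then show ?thesis unfolding e push2_at_rat_field[OF p3 k] using p3
      by (simp add: inner3 face_normal_def face_trace_def at_inv_def phi_inv_def face_param_def)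
  next
    case Eta0
    then show ?thesis unfolding e push2_at_rat_field[OF p3 k] using p3
      by (simp add: inner3 face_normal_def face_trace_def at_inv_def phi_inv_def face_param_def)
  next
    case Xi1
    then have t: "t < 1" using p3 by (simp add: face_param_def)
    show ?thesis unfolding e push2_at_rat_field[OF p3 k] using Xi1 t
      by (simp add: inner3 face_normal_def face_trace_def at_inv_def phi_inv_def face_param_def kk algebra_simps)
  next
    case Eta1
    then have t: "t < 1" using p3 by (simp add: face_param_def)
    show ?thesis unfolding e push2_at_rat_field[OF p3 k] using Eta1 t
      by (simp add: inner3 face_normal_def face_trace_def at_inv_def phi_inv_def face_param_def kk algebra_simps)
  next
    case Base
    then show ?thesis unfolding e push2_at_rat_field[OF p3 k] using p3
      by (simp add: inner3 face_normal_def face_trace_def at_inv_def phi_inv_def face_param_def)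
  qed
qed

lemma face_param_apex:
  assumes "(s, t) \<in> face_domain F" shows "face_param F (s, t) = apex \<longleftrightarrow> F \<noteq> Base \<and> t = 1"
  using assms by (cases F) (auto simp: face_param_def face_domain_def apex_def vec_eq_iff forall_3)

text \<open>The weight \<open>(1 - t) ^ (k - 1)\<close> clears the quotients exactly when the trace
  of the numerator has total degree at most \<open>k - 1\<close>, and the total degree is kept. This
  is the purpose of the restriction on normal components in \<open>U2_inf\<close>.\<close>

lemma normal_trace_poly:
  assumes k: "k \<ge> 1" and g: "face_trace F n1 n2 n3 \<in> ref_poly k F"
  shows "\<exists>g\<in>ref_poly k F. \<forall>s t. (s, t) \<in> face_domain F \<longrightarrow> face_param F (s, t) \<noteq> apex \<longrightarrow>
    inner (push2 (rat_field (k + 2) n1 n2 n3) (face_param F (s, t))) (face_normal F) = g s t"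
proof (cases "F = Base")
  case True
  then show ?thesis using normal_trace[OF k] g by (intro bexI[of _ "face_trace F n1 n2 n3"]) auto
next
  case False
  have km: "int k - 1 = int (k - 1)" using k by simp
  have "face_trace F n1 n2 n3 \<in> polyP2 (int (k - 1))" using g False by (simp add: ref_poly_def km)
  from polyP2_homogenise[OF this, of "-1"] obtain h where h: "h \<in> polyP2 (int (k - 1))"
    "\<And>s t. 1 - t \<noteq> 0 \<Longrightarrow> h s t = face_trace F n1 n2 n3 (s / (1 - t)) (t / (1 - t)) * (1 - t) ^ (k - 1)" by auto
  show ?thesis
  proof (intro bexI[of _ h] allI impI)
    show "h \<in> ref_poly k F" using h(1) False by (simp add: ref_poly_def km)
    fix s t assume st: "(s, t) \<in> face_domain F" "face_param F (s, t) \<noteq> apex"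
    then have "1 - t \<noteq> 0" using face_param_apex[OF st(1)] False by auto
    then show "inner (push2 (rat_field (k + 2) n1 n2 n3) (face_param F (s, t))) (face_normal F) = h s t"
      using normal_trace[OF k st] False h(2) by simp
  qed
qed

lemma normal_trace_zero:
  assumes k: "k \<ge> 1" and g: "face_trace F n1 n2 n3 \<in> ref_poly k F"
    and 0: "\<And>p. p \<in> face F - {apex} \<Longrightarrow> inner (push2 (rat_field (k + 2) n1 n2 n3) p) (face_normal F) = 0"
  shows "face_trace F n1 n2 n3 x y = 0"
proof (rule polyQ2_zero_box[OF ref_poly_Q2[OF g]])
  have z: "inner (push2 (rat_field (k + 2) n1 n2 n3) (face_param F (s, t))) (face_normal F) = 0" 
    if "(s, t) \<in> face_domain F" "face_param F (s, t) \<noteq> apex" for s t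
    using 0 that face_param_image[of F] by blast
  fix x y :: real assume xy: "0 < x" "x < 1/2" "0 < y" "y < 1/2"
  show "face_trace F n1 n2 n3 x y = 0"
  proof (cases "F = Base")
    case True
    then have st: "(x, y) \<in> face_domain F" using xy by (simp add: face_domain_def)
    then have "face_param F (x, y) \<noteq> apex" using face_param_apex[OF st] True by simp
    then show ?thesis using z[OF st] normal_trace[OF k st] True by simp
  next
    case False
    \<comment> \<open>The image of \<open>(x, y)\<close> under \<open>phi\<close>, restricted to the
      face and read in face parameters.\<close>
    define s t where "s = x / (1 + y)" and "t = y / (1 + y)"
    have D: "1 - t = 1 / (1 + y)" using xy by (simp add: t_def field_simps)
    then have e: "s / (1 - t) = x" "t / (1 - t) = y" "1 - t \<noteq> 0" "t \<noteq> 1" using xy by (simp_all add: s_def t_def)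
    have "s + t = (x + y) / (1 + y)" by (simp add: s_def t_def add_divide_distrib)
    also have "\<dots> \<le> 1" using xy by (simp add: divide_simps)
    finally have st: "(s, t) \<in> face_domain F" using xy False by (simp add: face_domain_def s_def t_def)
    then have "face_param F (s, t) \<noteq> apex" using face_param_apex[OF st] e by simp
    then show ?thesis using z[OF st] normal_trace[OF k st] False e by simp
  qed
qed

section \<open>Conformity\<close>

lemma directional_DERIV:
  assumes "(f has_derivative f') (at p)"
  shows "((\<lambda>t. f (p + t *\<^sub>R e)) has_real_derivative f' e) (at 0)"
proof -
  have "((\<lambda>t. p + t *\<^sub>R e) has_derivative (\<lambda>t. t *\<^sub>R e)) (at 0)"
    by (auto intro!: derivative_eq_intros)
  from has_derivative_compose[OF this, of f f'] assms
  have "((\<lambda>t. f (p + t *\<^sub>R e)) has_derivative (\<lambda>t. f' (t *\<^sub>R e))) (at 0)" by simp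
  moreover have "f' (t *\<^sub>R e) = f' e * t" for t
    using linear_scale[OF has_derivative_linear[OF assms], of t e] by simp
  ultimately show ?thesis by (simp add: has_field_derivative_def)
qed

text \<open>Translation invariance makes the difference quotients integrate to zero.\<close>

lemma integral_directional_derivative_zero:
  fixes f g :: "'a::euclidean_space \<Rightarrow> real"
  assumes K: "bounded K" and fK: "\<And>p. p \<notin> K \<Longrightarrow> f p = 0" 
    and d: "\<And>p. ((\<lambda>t. f (p + t *\<^sub>R e)) has_real_derivative g p) (at 0)"
    and cont: "continuous_on UNIV f" and C: "\<And>p. \<bar>g p\<bar> \<le> C"
  shows "g \<in> borel_measurable borel" "integrable lborel g" "(LINT p|lborel. g p) = 0"
proof -
  define h where "h n = inverse (real (Suc n))" for n
  have h: "0 < h n" "h n \<le> 1" for n by (auto simp: h_def field_simps)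
  define s where "s n p = (f (h n *\<^sub>R e + p) - f p) / h n" for n p
  have fm[measurable]: "f \<in> borel_measurable borel" by (rule borel_measurable_continuous_onI[OF cont])
  have sm[measurable]: "s n \<in> borel_measurable borel" for n unfolding s_def[abs_def] by measurable
  have C0: "0 \<le> C" using C[of 0] abs_ge_zero[of "g 0"] by linarith
  obtain R where R: "\<And>p. p \<in> K \<Longrightarrow> norm p \<le> R" using K by (auto simp: bounded_iff)
  have d': "((\<lambda>t. f (p + t *\<^sub>R e)) has_real_derivative g (p + r *\<^sub>R e)) (at r)" for p r
    using d[of "p + r *\<^sub>R e"] DERIV_shift[of "\<lambda>t. f (p + t *\<^sub>R e)" "g (p + r *\<^sub>R e)" 0 r]
    by (simp add: algebra_simps)
  \<comment> \<open>By the mean value theorem the bound on the derivative holds for all difference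
    quotients, as dominated convergence demands.\<close>
  have sC: "\<bar>s n p\<bar> \<le> C" for n p
  proof -
    obtain r where "f (p + h n *\<^sub>R e) - f (p + 0 *\<^sub>R e) = (h n - 0) * g (p + r *\<^sub>R e)"
      using MVT2[of 0 "h n" "\<lambda>t. f (p + t *\<^sub>R e)" "\<lambda>r. g (p + r *\<^sub>R e)"] d' h(1)[of n] by blast
    then have "s n p = g (p + r *\<^sub>R e)" using h(1)[of n] by (simp add: s_def add.commute)
    then show ?thesis using C by simp
  qed
  \<comment> \<open>Since \<open>h n \<le> 1\<close>, all quotients vanish outside one ball; with
    the bound \<open>C\<close> this gives the majorant \<open>?w\<close>.\<close>
  have s0: "s n p = 0" if "p \<notin> cball 0 (R + norm e)" for n p
  proof -
    have p: "norm p > R + norm e" using that by simp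
    have "norm (h n *\<^sub>R e) \<le> norm e" using h[of n] by (simp add: mult_left_le_one_le)
    then have "norm (h n *\<^sub>R e + p) > R" using p norm_diff_ineq[of p "h n *\<^sub>R e"] by (simp add: add.commute)
    then have "f (h n *\<^sub>R e + p) = 0" using fK R by (meson not_le)
    moreover have "norm p > R" using p norm_ge_zero[of e] by linarith
    then have "f p = 0" using fK R by (meson not_le)
    ultimately show ?thesis by (simp add: s_def)
  qed
  have lim: "(\<lambda>n. s n p) \<longlonglongrightarrow> g p" for p
  proof -
    have "((\<lambda>t. (f (p + t *\<^sub>R e) - f (p + 0 *\<^sub>R e)) / (t - 0)) \<longlongrightarrow> g p) (at 0)"
      using d[of p] by (simp add: has_field_derivative_iff)
    moreover have "filterlim h (at 0) sequentially"
      unfolding filterlim_at using h(1) LIMSEQ_inverse_real_of_nat by (auto simp: h_def[abs_def] less_imp_neq[symmetric] intro!: always_eventually)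
    ultimately have "((\<lambda>n. (f (p + h n *\<^sub>R e) - f (p + 0 *\<^sub>R e)) / (h n - 0)) \<longlongrightarrow> g p) sequentially"
      by (rule filterlim_compose)
    then show ?thesis by (simp add: s_def add.commute)
  qed
  show gm[measurable]: "g \<in> borel_measurable borel"
    by (rule borel_measurable_LIMSEQ_real[where u = s]) (use lim sm in auto)
  let ?w = "\<lambda>p::'a. C * indicator (cball 0 (R + norm e)) p"
  have w: "integrable lborel ?w"
    by (intro integrable_mult_right integrable_real_indicator) (use emeasure_bounded_finite[OF bounded_cball] in auto)
  have "\<bar>s n p\<bar> \<le> ?w p" for n p using sC[of n p] s0[of p n] by (cases "p \<in> cball 0 (R + norm e)") auto
  then have bd: "AE p in lborel. norm (s n p) \<le> ?w p" for n by simp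
  have f_int: "integrable lborel f"
  proof -
    have "bounded (f ` cball 0 R)"
      by (intro compact_imp_bounded compact_continuous_image continuous_on_subset[OF cont]) auto
    then obtain B where B: "\<And>p. p \<in> cball 0 R \<Longrightarrow> \<bar>f p\<bar> \<le> B" 
      unfolding bounded_iff by (metis image_eqI real_norm_def)
    have "integrable lborel (\<lambda>p::'a. B * indicator (cball 0 R) p)"
      by (intro integrable_mult_right integrable_real_indicator) (use emeasure_bounded_finite[OF bounded_cball] in auto)
    then show ?thesis
    proof (rule Bochner_Integration.integrable_bound)
      have "\<bar>f p\<bar> \<le> norm (B * indicator (cball 0 R) p)" for p
      proof (cases "p \<in> cball 0 R")
        case True
        then show ?thesis using B[OF True] by auto
      next
        case False
        then have "f p = 0" using fK R by auto
        then show ?thesis by simp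
      qed
      then show "AE p in lborel. norm (f p) \<le> norm (B * indicator (cball 0 R) p)" by simp
    qed simp
  qed
  have shift: "integrable lborel (\<lambda>p. f (c + p))" "(LINT p|lborel. f (c + p)) = (LINT p|lborel. f p)" for c
  proof -
    have "integrable (distr lborel borel ((+) c)) f" using f_int by (simp add: lborel_distr_plus)
    then show "integrable lborel (\<lambda>p. f (c + p))" by (subst (asm) integrable_distr_eq) auto
    have "(LINT p|distr lborel borel ((+) c). f p) = (LINT p|lborel. f (c + p))" by (rule integral_distr) auto
    then show "(LINT p|lborel. f (c + p)) = (LINT p|lborel. f p)" by (simp add: lborel_distr_plus)
  qed
  have s_int: "(LINT p|lborel. s n p) = 0" for n
    unfolding s_def using shift[of "h n *\<^sub>R e"] f_int by simp
  show "integrable lborel g"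
    by (rule integrable_dominated_convergence[where s = s and w = ?w]) (use lim w bd in auto)
  have "(\<lambda>n. LINT p|lborel. s n p) \<longlonglongrightarrow> (LINT p|lborel. g p)"
    by (rule integral_dominated_convergence[where s = s and w = ?w]) (use lim w bd in auto)
  then show "(LINT p|lborel. g p) = 0" by (simp add: s_int LIMSEQ_const_iff)
qed

text \<open>The product \<open>u_i \<psi>\<close>, extended by zero, is differentiable everywhere
  because \<open>\<psi>\<close> vanishes near the boundary, and its derivative in direction
  \<open>i\<close> integrates to zero. A single \<open>d i\<close> may be unbounded on
  \<open>S\<close>; it is bounded on the compact support of \<open>\<psi>\<close>, and only the sum
  has to be nice.\<close>

lemma Hdiv_I:
  fixes u :: "real^3 \<Rightarrow> real^3" and d :: "3 \<Rightarrow> real^3 \<Rightarrow> real"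
  assumes S: "open S" "convex S" "bounded S"
    and u: "\<And>i. nice S (\<lambda>p. u p $ i)"
    and du: "\<And>p. p \<in> S \<Longrightarrow> \<exists>f'. (u has_derivative f') (at p) \<and> (\<forall>i. f' (axis i 1) $ i = d i p)"
    and d: "\<And>i. continuous_on S (d i)" and D: "nice S (\<lambda>p. \<Sum>i\<in>UNIV. d i p)"
  shows "u \<in> Hdiv S"
proof -
  note S' = S(2,3)
  have int: "interior S = S" using S(1) by (simp add: interior_open)
  have Sm: "S \<in> sets lebesgue" by (rule S_measurable(2)[OF S'])
  have L2: "L2_on S f" if "\<And>p. p \<in> S \<Longrightarrow> isCont f p" "nice S (\<lambda>p. (norm (f p))\<^sup>2)" for f :: "real^3 \<Rightarrow> 'b::euclidean_space"
    unfolding L2_on_def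
  proof
    show "f \<in> borel_measurable (lebesgue_on S)"
      by (rule continuous_imp_measurable_on_sets_lebesgue[OF continuous_at_imp_continuous_on Sm]) (use that in blast)
    show "integrable (lebesgue_on S) (\<lambda>p. (norm (f p))\<^sup>2)" by (rule nice_integrable(1)[OF S' that(2)])
  qed
  have "L2_on S u"
  proof (rule L2)
    show "isCont u p" if "p \<in> S" for p using du[OF that] has_derivative_continuous by blast
    have "nice S (\<lambda>p. \<Sum>i\<in>UNIV. u p $ i * u p $ i)" by (intro nice_sum nice_mult u)
    then show "nice S (\<lambda>p. (norm (u p))\<^sup>2)" by (simp add: power2_norm_eq_inner inner_vec_def)
  qed
  moreover have "L2_on S (\<lambda>p. \<Sum>i\<in>UNIV. d i p)"
  proof (rule L2)
    show "isCont (\<lambda>p. \<Sum>i\<in>UNIV. d i p) p" if "p \<in> S" for p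
      using d that S(1) by (intro continuous_intros) (auto simp: continuous_on_eq_continuous_at)
    show "nice S (\<lambda>p. (norm (\<Sum>i\<in>UNIV. d i p))\<^sup>2)" using nice_mult[OF D D] by (simp add: power2_eq_square)
  qed
  moreover have "(LINT p|lebesgue_on S. u p \<bullet> gradient \<psi> p) = - (LINT p|lebesgue_on S. (\<Sum>i\<in>UNIV. d i p) * \<psi> p)"
    if \<psi>: "\<psi> \<in> test_functions S" for \<psi>
  proof -
    define K where "K = closure {p. \<psi> p \<noteq> 0}"
    have K: "compact K" "K \<subseteq> S" and Cd: "\<And>n. C_diff n \<psi>" using \<psi> by (auto simp: test_functions_def K_def)
    have \<psi>K: "\<psi> p = 0" if "p \<notin> K" for p using that closure_subset[of "{p. \<psi> p \<noteq> 0}"] by (auto simp: K_def)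
    have \<psi>d: "(\<psi> has_derivative frechet_derivative \<psi> (at p)) (at p)" for p
      using Cd[of 1] frechet_derivative_works by auto
    define G where "G i p = frechet_derivative \<psi> (at p) (axis i 1)" for i p
    have Gg: "gradient \<psi> p $ i = G i p" for i p by (simp add: gradient_def G_def)
    have Gc: "continuous_on UNIV (G i)" for i using Cd[of 1] by (simp add: Gg)
    have \<psi>c: "continuous_on UNIV \<psi>" using Cd[of 0] by simp
    have GK: "G i p = 0" if "p \<notin> K" for p i
    proof -
      have "((\<lambda>p. 0) has_derivative frechet_derivative \<psi> (at p)) (at p)"
        by (rule has_derivative_transform_within_open[OF \<psi>d, of "- K"]) (use K that \<psi>K in \<open>auto simp: compact_imp_closed open_Compl\<close>)
      then have "frechet_derivative \<psi> (at p) = (\<lambda>h. 0)" using has_derivative_unique[OF _ has_derivative_const] by blast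
      then show ?thesis by (simp add: G_def)
    qed
    have niceU: "nice S f" if "continuous_on UNIV f" for f :: "real^3 \<Rightarrow> real"
    proof -
      have "bounded (f ` closure S)" 
        by (intro compact_imp_bounded compact_continuous_image continuous_on_subset[OF that]) (use S(3) in auto)
      then have "bounded (f ` S)" by (rule bounded_subset) (use closure_subset in auto)
      then show ?thesis using continuous_on_subset[OF that subset_UNIV] by (simp add: nice_def int)
    qed
    \<comment> \<open>The product rule for \<open>u_i \<psi>\<close> in direction \<open>i\<close>,
      extended by zero; summed over \<open>i\<close> it is the integrand of the claim.\<close>
    define g where "g i p = (if p \<in> S then d i p * \<psi> p + u p $ i * G i p else 0)" for i p
    have main: "integrable lborel (g i) \<and> g i \<in> borel_measurable borel \<and> (LINT p|lborel. g i p) = 0" for i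
    proof -
      let ?f = "\<lambda>p. if p \<in> S then u p $ i * \<psi> p else 0"
      have der: "\<exists>f'. (?f has_derivative f') (at p) \<and> f' (axis i 1) = g i p" for p
      proof (cases "p \<in> S")
        case True
        then obtain u' where u': "(u has_derivative u') (at p)" "u' (axis i 1) $ i = d i p" using du by blast
        have "((\<lambda>p. u p $ i * \<psi> p) has_derivative (\<lambda>h. u p $ i * frechet_derivative \<psi> (at p) h + u' h $ i * \<psi> p)) (at p)"
          by (intro has_derivative_mult has_derivative_nth u' \<psi>d)
        then have hd: "(?f has_derivative (\<lambda>h. u p $ i * frechet_derivative \<psi> (at p) h + u' h $ i * \<psi> p)) (at p)"
          by (rule has_derivative_transform_within_open[OF _ S(1) True]) auto
        show ?thesis by (rule exI, rule conjI, rule hd) (use True u'(2) in \<open>simp add: g_def G_def\<close>)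
      next
        case False
        have "(?f has_derivative (\<lambda>h. 0)) (at p)"
          by (rule has_derivative_transform_within_open[OF has_derivative_const[of 0], of "- K"]) (use False K \<psi>K in \<open>auto simp: compact_imp_closed open_Compl\<close>)
        then show ?thesis using False by (intro exI conjI) (auto simp: g_def)
      qed
      have g0: "g i p = 0" if "p \<notin> K" for p using that \<psi>K GK by (simp add: g_def)
      have "continuous_on K (\<lambda>p. d i p * \<psi> p + u p $ i * G i p)"
      proof (intro continuous_on_add continuous_on_mult)
        show "continuous_on K (d i)" by (rule continuous_on_subset[OF d K(2)])
        show "continuous_on K \<psi>" "continuous_on K (G i)" using Gc \<psi>c continuous_on_subset by blast+
        have "continuous_on S (\<lambda>p. u p $ i)" using u[of i] by (simp add: nice_def int)
        then show "continuous_on K (\<lambda>p. u p $ i)" by (rule continuous_on_subset[OF _ K(2)])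
      qed
      then have "bounded ((\<lambda>p. d i p * \<psi> p + u p $ i * G i p) ` K)"
        by (intro compact_imp_bounded compact_continuous_image K)
      then obtain C where C: "\<And>p. p \<in> K \<Longrightarrow> \<bar>d i p * \<psi> p + u p $ i * G i p\<bar> \<le> C" by (auto simp: bounded_iff)
      have gC: "\<bar>g i p\<bar> \<le> max C 0" for p
        using C[of p] g0[of p] K(2) by (cases "p \<in> K") (auto simp: g_def)
      have fc: "continuous_on UNIV ?f"
        using der has_derivative_continuous by (intro continuous_at_imp_continuous_on) blast
      have dd: "((\<lambda>t. ?f (p + t *\<^sub>R axis i 1)) has_real_derivative g i p) (at 0)" for p
      proof -
        obtain f' where "(?f has_derivative f') (at p)" "f' (axis i 1) = g i p" using der by blast
        then show ?thesis using directional_DERIV[of ?f f' p "axis i 1"] by simp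
      qed
      have f0: "?f p = 0" if "p \<notin> K" for p using \<psi>K[OF that] by simp
      show ?thesis
        using integral_directional_derivative_zero[OF compact_imp_bounded[OF K(1)] f0 dd fc gC] by blast
    qed
    have n1: "nice S (\<lambda>p. u p \<bullet> gradient \<psi> p)"
      unfolding inner_vec_def Gg inner_real_def by (intro nice_sum nice_mult u niceU Gc)
    have n2: "nice S (\<lambda>p. (\<Sum>i\<in>UNIV. d i p) * \<psi> p)" by (intro nice_mult D niceU \<psi>c)
    have "(LINT p|lebesgue_on S. u p \<bullet> gradient \<psi> p) + (LINT p|lebesgue_on S. (\<Sum>i\<in>UNIV. d i p) * \<psi> p)
      = (LINT p|lebesgue_on S. u p \<bullet> gradient \<psi> p + (\<Sum>i\<in>UNIV. d i p) * \<psi> p)"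
      by (rule nice_integral_add[OF S' n1 n2, symmetric])
    also have "\<dots> = (LINT p|lebesgue. indicator S p *\<^sub>R (u p \<bullet> gradient \<psi> p + (\<Sum>i\<in>UNIV. d i p) * \<psi> p))"
      by (rule integral_restrict_space) (use Sm in simp)
    also have "\<dots> = (LINT p|lebesgue. (\<Sum>i\<in>UNIV. g i p))"
      by (rule Bochner_Integration.integral_cong)
         (auto simp: g_def inner_vec_def Gg indicator_def sum.distrib sum_distrib_right)
    also have "\<dots> = (LINT p|lborel. (\<Sum>i\<in>UNIV. g i p))"
      by (rule integral_completion) (use main in \<open>auto intro!: borel_measurable_sum\<close>)
    also have "\<dots> = 0" using main by (subst Bochner_Integration.integral_sum) auto
    finally show ?thesis by simp
  qed
  ultimately show ?thesis unfolding Hdiv_def by blast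
qed

lemma push2_Hdiv:
  assumes N: "flux_num k n1 n2 n3" and k: "k \<ge> 1"
  shows "push2 (rat_field (k + 2) n1 n2 n3) \<in> Hdiv (interior Omega)"
proof -
  have n: "n1 \<in> polyQ3 (int k) (int k - 1) (int k - 1)" "n2 \<in> polyQ3 (int k - 1) (int k) (int k - 1)" "n3 \<in> polyQ3 (int k - 1) (int k - 1) (int k)"
    using N by (auto simp: flux_num_def)
  define d where "d i = (if i = (1::3) then pd1 k n1 n2 n3 else if i = 2 then pd2 k n1 n2 n3 else pd3 k n1 n2 n3)" for i
  have nI: "nice (interior Omega) f \<longleftrightarrow> nice Omega f" for f by (simp add: nice_def)
  have part: "\<exists>f'. (push2 (rat_field (k + 2) n1 n2 n3) has_derivative f') (at p) \<and> (\<forall>i. f' (axis i 1) $ i = d i p)" if p: "p \<in> interior Omega" for p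
    using push2_partials[OF n p, of k] by (auto simp: forall_3 d_def)
  show ?thesis
  proof (rule Hdiv_I[where d = d])
    show "open (interior Omega)" "convex (interior Omega)" "bounded (interior Omega)"
      using convex_Omega bounded_Omega by (auto simp: convex_interior intro: bounded_subset[OF _ interior_subset])
    show "nice (interior Omega) (\<lambda>p. push2 (rat_field (k + 2) n1 n2 n3) p $ i)" for i
      unfolding nI by (rule nice_push2[OF N k])
    show "continuous_on (interior Omega) (d i)" for i
      using pd_continuous[OF n, of k] by (simp add: d_def)
    have "(\<Sum>i\<in>UNIV. d i p) = divergence (push2 (rat_field (k + 2) n1 n2 n3)) p" if p: "p \<in> interior Omega" for p
    proof -
      obtain f' where f': "(push2 (rat_field (k + 2) n1 n2 n3) has_derivative f') (at p)" "\<forall>i. f' (axis i 1) $ i = d i p" using part[OF p] by blast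
      show ?thesis using f'(2) 
        unfolding divergence_def at_within_interior[OF p] trace_def jacobian_entry[OF f'(1)] by simp
    qed
    then show "nice (interior Omega) (\<lambda>p. \<Sum>i\<in>UNIV. d i p)"
      unfolding nI by (intro iffD2[OF nice_cong nice_divergence[OF N k]])
  qed (rule part)
qed

section \<open>The space of approximation and its traces\<close>

text \<open>Under a bound on the total degree, the power \<open>z ^ (k - 1)\<close> can only have a
  constant coefficient.\<close>

lemma polyP2_top:
  assumes f: "f \<in> polyP2 (int k - 1)" and k: "k \<ge> 1"
  shows "\<exists>c. \<exists>f'\<in>polyQ2 (int k - 1) (int k - 2). \<forall>v z. f v z = c * z ^ (k - 1) + f' v z"
proof -
  let ?I = "{(i, j). int (i + j) \<le> int k - 1}"
  obtain c where c: "f = (\<lambda>x y. \<Sum>t\<in>?I. c (fst t) (snd t) * (x ^ fst t * y ^ snd t))"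
    using f by (auto simp: polyP2_def case_prod_unfold mult.assoc)
  let ?f = "\<lambda>x y. \<Sum>t\<in>?I - {(0, k - 1)}. c (fst t) (snd t) * (x ^ fst t * y ^ snd t)"
  have "f v z = c 0 (k - 1) * z ^ (k - 1) + ?f v z" for v z
    unfolding c by (subst sum.remove[of _ "(0, k - 1)"]) (use finite_P2_index[of "int k - 1"] k in \<open>auto simp del: zle_diff1_eq\<close>)
  moreover have "?f \<in> polyQ2 (int k - 1) (int k - 2)"
    unfolding polyQ2_iff by (intro conjI allI poly1_sum poly1_cmult poly1_cmult_right poly1_mono[OF poly1_power]) auto
  ultimately show ?thesis by (intro exI[of _ "c 0 (k - 1)"] bexI[of _ ?f] allI)
qed

text \<open>The linear factor carries the face polynomial to one of two opposite faces;
  \<open>1 - x\<close> and \<open>x\<close> are the intended choices. The top coefficient in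
  \<open>z\<close> goes into a correction term, the rest into the uncorrected part of the
  space.\<close>

lemma trace_lift_x:
  assumes f: "f \<in> polyP2 (int k - 1)" and k: "k \<ge> 1"
  shows "\<exists>n3. flux_num k (\<lambda>x y z. (p + q * x) * f y z) (\<lambda>x y z. 0) n3 \<and> (\<forall>x y. n3 x y 0 = 0)"
proof -
  obtain c f' where f': "f' \<in> polyQ2 (int k - 1) (int k - 2)" "\<And>v z. f v z = c * z ^ (k - 1) + f' v z"
    using polyP2_top[OF f k] by blast
  let ?t = "\<lambda>x y::real. (p + q * x) * c / 2"
  have l: "(\<lambda>x. p + q * x) \<in> poly1 1" by (intro poly1_add poly1_const poly1_cmult poly1_ident) auto
  then have l': "(\<lambda>x. p + q * x) \<in> poly1 (int k)" by (rule poly1_mono) (use k in simp)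
  have a: "(\<lambda>x y z. (p + q * x) * f' y z) \<in> polyQ3 (int k) (int k - 1) (int k - 2)"
    unfolding polyQ3_iff using f'(1) l' by (auto simp: polyQ2_iff intro!: poly1_cmult poly1_cmult_right)
  have t: "?t \<in> polyQ2 (int k) (int k - 1)" unfolding polyQ2_iff using l' k
    by (auto intro!: poly1_divide poly1_cmult_right poly1_const)
  have s: "(\<lambda>x y. 0) \<in> polyQ2 (int k - 1) (int k)" by (simp add: polyQ2_iff)
  have dt: "deriv (\<lambda>x. (p + q * x) * c / 2) x = q * c / 2" for x
    by (rule DERIV_imp_deriv) (auto intro!: derivative_eq_intros)
  \<comment> \<open>For \<open>k = 1\<close> the correction term has the trace
    \<open>q * c / 2\<close> on the base, as \<open>0 ^ 0 = 1\<close>, and \<open>?e\<close> cancels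
    it; for \<open>k \<ge> 2\<close> the power is zero and so is \<open>?e\<close>.\<close>
  let ?e = "\<lambda>x y z::real. - (0 ^ (k - 1) * (q * c / 2))"
  have e: "?e \<in> polyQ3 (int k - 1) (int k - 1) (int k - 1)" unfolding polyQ3_iff using k by (auto intro!: poly1_const)
  have "flux_num k (\<lambda>x y z. (p + q * x) * f' y z + z ^ (k - 1) * (2 * ?t x y)) (\<lambda>x y z. 0 + z ^ (k - 1) * (2 * 0)) 
     (\<lambda>x y z. ?e x y z + ext_num k (\<lambda>x y. 0) ?t x y z)"
    by (rule flux_num_add[OF flux_num_base[OF a polyQ3_zero e] flux_num_ext(1)[OF s t k]])
  moreover have "(\<lambda>x y z. (p + q * x) * f' y z + z ^ (k - 1) * (2 * ?t x y)) = (\<lambda>x y z. (p + q * x) * f y z)"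
    by (simp add: f'(2) fun_eq_iff algebra_simps)
  moreover have "?e x y 0 + ext_num k (\<lambda>x y. 0) ?t x y 0 = 0" for x y
    by (simp add: ext_num_def dt)
  ultimately show ?thesis by (intro exI[of _ "\<lambda>x y z. ?e x y z + ext_num k (\<lambda>x y. 0) ?t x y z"]) simp
qed

lemma trace_lift_y:
  assumes f: "f \<in> polyP2 (int k - 1)" and k: "k \<ge> 1"
  shows "\<exists>n3. flux_num k (\<lambda>x y z. 0) (\<lambda>x y z. (p + q * y) * f x z) n3 \<and> (\<forall>x y. n3 x y 0 = 0)"
proof -
  obtain c f' where f': "f' \<in> polyQ2 (int k - 1) (int k - 2)" "\<And>v z. f v z = c * z ^ (k - 1) + f' v z"
    using polyP2_top[OF f k] by blast
  let ?t = "\<lambda>x y::real. (p + q * y) * c / 2"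
  have l: "(\<lambda>x. p + q * x) \<in> poly1 1" by (intro poly1_add poly1_const poly1_cmult poly1_ident) auto
  then have l': "(\<lambda>x. p + q * x) \<in> poly1 (int k)" by (rule poly1_mono) (use k in simp)
  have a: "(\<lambda>x y z. (p + q * y) * f' x z) \<in> polyQ3 (int k - 1) (int k) (int k - 2)"
    unfolding polyQ3_iff using f'(1) l' by (auto simp: polyQ2_iff intro!: poly1_cmult poly1_cmult_right)
  have t: "?t \<in> polyQ2 (int k - 1) (int k)" unfolding polyQ2_iff using l' k
    by (auto intro!: poly1_divide poly1_cmult_right poly1_const)
  have s: "(\<lambda>x y. 0) \<in> polyQ2 (int k) (int k - 1)" by (simp add: polyQ2_iff)
  have dt: "deriv (\<lambda>x. (p + q * x) * c / 2) x = q * c / 2" for x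
    by (rule DERIV_imp_deriv) (auto intro!: derivative_eq_intros)
  let ?e = "\<lambda>x y z::real. - (0 ^ (k - 1) * (q * c / 2))"
  have e: "?e \<in> polyQ3 (int k - 1) (int k - 1) (int k - 1)" unfolding polyQ3_iff using k by (auto intro!: poly1_const)
  have "flux_num k (\<lambda>x y z. 0 + z ^ (k - 1) * (2 * 0)) (\<lambda>x y z. (p + q * y) * f' x z + z ^ (k - 1) * (2 * ?t x y)) 
     (\<lambda>x y z. ?e x y z + ext_num k ?t (\<lambda>x y. 0) x y z)"
    by (rule flux_num_add[OF flux_num_base[OF polyQ3_zero a e] flux_num_ext(1)[OF t s k]])
  moreover have "(\<lambda>x y z. (p + q * y) * f' x z + z ^ (k - 1) * (2 * ?t x y)) = (\<lambda>x y z. (p + q * y) * f x z)"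
    by (simp add: f'(2) fun_eq_iff algebra_simps)
  moreover have "?e x y 0 + ext_num k ?t (\<lambda>x y. 0) x y 0 = 0" for x y
    by (simp add: ext_num_def dt)
  ultimately show ?thesis by (intro exI[of _ "\<lambda>x y z. ?e x y z + ext_num k ?t (\<lambda>x y. 0) x y z"]) simp
qed

lemma face_trace_add: "face_trace F (\<lambda>x y z. n1 x y z + m1 x y z) (\<lambda>x y z. n2 x y z + m2 x y z) (\<lambda>x y z. n3 x y z + m3 x y z)
    = (\<lambda>x y. face_trace F n1 n2 n3 x y + face_trace F m1 m2 m3 x y)"
  by (cases F) (simp_all add: face_trace_def)

lemma face_trace_cmult: "face_trace F (\<lambda>x y z. c * n1 x y z) (\<lambda>x y z. c * n2 x y z) (\<lambda>x y z. c * n3 x y z) = (\<lambda>x y. c * face_trace F n1 n2 n3 x y)"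
  by (cases F) (simp_all add: face_trace_def)

lemma ref_poly_zero: "(\<lambda>x y. 0) \<in> ref_poly k F"
  by (simp add: ref_poly_def polyP2_zero polyQ2_iff)

lemma face_trace_surj_single:
  assumes k: "k \<ge> 1" and g: "g \<in> ref_poly k F"
  shows "\<exists>n1 n2 n3. flux_num k n1 n2 n3 \<and> (\<forall>F'. face_trace F' n1 n2 n3 = (if F' = F then g else (\<lambda>x y. 0)))"
proof (cases F)
  case Xi0
  then have "g \<in> polyP2 (int k - 1)" using g by (simp add: ref_poly_def)
  from trace_lift_x[OF this k, of 1 "-1"] obtain n3 where "flux_num k (\<lambda>x y z. (1 + -1 * x) * g y z) (\<lambda>x y z. 0) n3" "\<And>x y. n3 x y 0 = 0" by blast
  moreover from this(2) have "face_trace F' (\<lambda>x y z. (1 + -1 * x) * g y z) (\<lambda>x y z. 0) n3 = (if F' = F then g else (\<lambda>x y. 0))" for F'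
    unfolding Xi0 by (cases F') (simp_all add: face_trace_def fun_eq_iff)
  ultimately show ?thesis by blast
next
  case Xi1
  then have "g \<in> polyP2 (int k - 1)" using g by (simp add: ref_poly_def)
  from trace_lift_x[OF this k, of 0 1] obtain n3 where "flux_num k (\<lambda>x y z. (0 + 1 * x) * g y z) (\<lambda>x y z. 0) n3" "\<And>x y. n3 x y 0 = 0" by blast
  moreover from this(2) have "face_trace F' (\<lambda>x y z. (0 + 1 * x) * g y z) (\<lambda>x y z. 0) n3 = (if F' = F then g else (\<lambda>x y. 0))" for F'
    unfolding Xi1 by (cases F') (simp_all add: face_trace_def fun_eq_iff)
  ultimately show ?thesis by blast
next
  case Eta0
  then have "g \<in> polyP2 (int k - 1)" using g by (simp add: ref_poly_def)
  from trace_lift_y[OF this k, of 1 "-1"] obtain n3 where "flux_num k (\<lambda>x y z. 0) (\<lambda>x y z. (1 + -1 * y) * g x z) n3" "\<And>x y. n3 x y 0 = 0" by blast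
  moreover from this(2) have "face_trace F' (\<lambda>x y z. 0) (\<lambda>x y z. (1 + -1 * y) * g x z) n3 = (if F' = F then g else (\<lambda>x y. 0))" for F'
    unfolding Eta0 by (cases F') (simp_all add: face_trace_def fun_eq_iff)
  ultimately show ?thesis by blast
next
  case Eta1
  then have "g \<in> polyP2 (int k - 1)" using g by (simp add: ref_poly_def)
  from trace_lift_y[OF this k, of 0 1] obtain n3 where "flux_num k (\<lambda>x y z. 0) (\<lambda>x y z. (0 + 1 * y) * g x z) n3" "\<And>x y. n3 x y 0 = 0" by blast
  moreover from this(2) have "face_trace F' (\<lambda>x y z. 0) (\<lambda>x y z. (0 + 1 * y) * g x z) n3 = (if F' = F then g else (\<lambda>x y. 0))" for F'
    unfolding Eta1 by (cases F') (simp_all add: face_trace_def fun_eq_iff)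
  ultimately show ?thesis by blast
next
  case Base
  then have "(\<lambda>x y z. g x y) \<in> polyQ3 (int k - 1) (int k - 1) 0" using g by (simp add: ref_poly_def polyQ2_iff_Q3)
  then have "(\<lambda>x y z. g x y) \<in> polyQ3 (int k - 1) (int k - 1) (int k - 1)" by (rule polyQ3_mono) (use k in auto)
  then have "flux_num k (\<lambda>x y z. 0) (\<lambda>x y z. 0) (\<lambda>x y z. g x y)" by (rule flux_num_base[OF polyQ3_zero polyQ3_zero])
  moreover have "face_trace F' (\<lambda>x y z. 0) (\<lambda>x y z. 0) (\<lambda>x y z. g x y) = (if F' = F then g else (\<lambda>x y. 0))" for F'
    unfolding Base by (cases F') (simp_all add: face_trace_def fun_eq_iff)
  ultimately show ?thesis by blast
qed

lemma UNIV_face: "UNIV = {Xi0, Eta0, Xi1, Eta1, Base}"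
  using pyramid_face.exhaust by blast

text \<open>Each single lifting has zero trace on the other four faces, so the liftings can be added
  up.\<close>

lemma face_trace_surj:
  assumes k: "k \<ge> 1" and g: "\<And>F. g F \<in> ref_poly k F"
  shows "\<exists>n1 n2 n3. flux_num k n1 n2 n3 \<and> (\<forall>F. face_trace F n1 n2 n3 = g F)"
proof -
  have "\<exists>n1 n2 n3. flux_num k n1 n2 n3 \<and> (\<forall>F. face_trace F n1 n2 n3 = (if F \<in> A then g F else (\<lambda>x y. 0)))" if "finite A" for A
    using that
  proof (induction A rule: finite_induct)
    case empty
    have "face_trace F (\<lambda>x y z. 0) (\<lambda>x y z. 0) (\<lambda>x y z. 0) = (\<lambda>x y. 0)" for F by (cases F) (simp_all add: face_trace_def)
    then show ?case using flux_num_base[OF polyQ3_zero polyQ3_zero polyQ3_zero, of k]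
      by (intro exI[of _ "\<lambda>x y z. 0"]) simp
  next
    case (insert F A)
    then obtain n1 n2 n3 where n: "flux_num k n1 n2 n3" "\<And>F. face_trace F n1 n2 n3 = (if F \<in> A then g F else (\<lambda>x y. 0))" by blast
    obtain m1 m2 m3 where m: "flux_num k m1 m2 m3" "\<And>F'. face_trace F' m1 m2 m3 = (if F' = F then g F else (\<lambda>x y. 0))"
      using face_trace_surj_single[OF k g[of F]] by blast
    have "face_trace F' (\<lambda>x y z. n1 x y z + m1 x y z) (\<lambda>x y z. n2 x y z + m2 x y z) (\<lambda>x y z. n3 x y z + m3 x y z) = 
      (if F' \<in> insert F A then g F' else (\<lambda>x y. 0))" for F'
      unfolding face_trace_add n(2) m(2) using insert.hyps by auto
    with flux_num_add[OF n(1) m(1)] show ?case by blast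
  qed
  moreover have "finite (UNIV :: pyramid_face set)" unfolding UNIV_face by simp
  ultimately show ?thesis by force
qed

text \<open>The face conditions concern quotients on the face only. By the identity principle they
  become conditions on the numerators; the entry for \<open>Base\<close> in \<open>U2_num\<close>
  comes from the degrees of \<open>n3\<close>.\<close>

lemma U2_eq:
  assumes k: "k \<ge> 1"
  shows "U2 k = {push2 (rat_field (k + 2) n1 n2 n3) | n1 n2 n3. U2_num k n1 n2 n3}"
proof -
  have key: "(\<exists>f\<in>ratP (k+2) (int k - 1). \<forall>x\<in>{0..1}. \<forall>z\<ge>0. n x z / (1 + z) ^ (k + 2) = f x z) \<longleftrightarrow> n \<in> polyP2 (int k - 1)"
    if n: "n \<in> polyQ2 (int k - 1) (int k - 1)" for n :: "real \<Rightarrow> real \<Rightarrow> real"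
  proof
    assume "\<exists>f\<in>ratP (k+2) (int k - 1). \<forall>x\<in>{0..1}. \<forall>z\<ge>0. n x z / (1 + z) ^ (k + 2) = f x z"
    then obtain g where g: "g \<in> polyP2 (int k - 1)" "\<And>x z. 0 \<le> x \<Longrightarrow> x \<le> 1 \<Longrightarrow> 0 \<le> z \<Longrightarrow> n x z / (1 + z) ^ (k + 2) = g x z / (1 + z) ^ (k + 2)"
      by (auto simp: ratP_def)
    have "n x z - g x z = 0" for x z
    proof (rule polyQ2_zero_box[of "\<lambda>x z. n x z - g x z"])
      show "(\<lambda>x z. n x z - g x z) \<in> polyQ2 (int k - 1) (int k - 1)"
        using n polyP2_sub_Q2[OF g(1)] by (simp add: polyQ2_iff poly1_diff)
      show "n x z - g x z = 0" if "0 < x" "x < 1/2" "0 < z" "z < 1/2" for x z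
        using g(2)[of x z] that by simp
    qed
    then have "n = g" by (simp add: fun_eq_iff)
    then show "n \<in> polyP2 (int k - 1)" using g(1) by simp
  next
    assume n: "n \<in> polyP2 (int k - 1)"
    then have "(\<lambda>x z. n x z / (1 + z) ^ (k + 2)) \<in> ratP (k+2) (int k - 1)" unfolding ratP_def by blast
    then show "\<exists>f\<in>ratP (k+2) (int k - 1). \<forall>x\<in>{0..1}. \<forall>z\<ge>0. n x z / (1 + z) ^ (k + 2) = f x z" by (rule bexI[rotated]) simp
  qed
  have iff: "((\<forall>y\<in>{0, 1}. \<exists>f\<in>ratP (k+2) (int k - 1). \<forall>x\<in>{0..1}. \<forall>z\<ge>0. rat_field (k + 2) n1 n2 n3 (vector [x, y, z]) $ 2 = f x z) \<and>
     (\<forall>x\<in>{0, 1}. \<exists>f\<in>ratP (k+2) (int k - 1). \<forall>y\<in>{0..1}. \<forall>z\<ge>0. rat_field (k + 2) n1 n2 n3 (vector [x, y, z]) $ 1 = f y z))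
     \<longleftrightarrow> (\<forall>F. face_trace F n1 n2 n3 \<in> ref_poly k F)" if N: "flux_num k n1 n2 n3" for n1 n2 n3
  proof -
    have Q: "(\<lambda>x z. n2 x y z) \<in> polyQ2 (int k - 1) (int k - 1)" "(\<lambda>y z. n1 x y z) \<in> polyQ2 (int k - 1) (int k - 1)" for x y
      using N by (simp_all add: flux_num_def polyQ2_iff polyQ3_iff)
    have B: "(\<lambda>x y. n3 x y 0) \<in> polyQ2 (int k - 1) (int k - 1)"
      using N by (simp add: flux_num_def polyQ2_iff polyQ3_iff)
    have "(\<forall>F. face_trace F n1 n2 n3 \<in> ref_poly k F) \<longleftrightarrow> (\<forall>y\<in>{0, 1}. (\<lambda>x z. n2 x y z) \<in> polyP2 (int k - 1)) \<and> (\<forall>x\<in>{0, 1}. (\<lambda>y z. n1 x y z) \<in> polyP2 (int k - 1))"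
    proof -
      have "(\<forall>F. face_trace F n1 n2 n3 \<in> ref_poly k F) \<longleftrightarrow> (\<forall>F\<in>{Xi0, Eta0, Xi1, Eta1, Base}. face_trace F n1 n2 n3 \<in> ref_poly k F)"
        unfolding UNIV_face[symmetric] by simp
      also have "\<dots> \<longleftrightarrow> (\<forall>y\<in>{0, 1}. (\<lambda>x z. n2 x y z) \<in> polyP2 (int k - 1)) \<and> (\<forall>x\<in>{0, 1}. (\<lambda>y z. n1 x y z) \<in> polyP2 (int k - 1))"
        using B by (auto simp: face_trace_def ref_poly_def)
      finally show ?thesis .
    qed
    then show ?thesis unfolding key[OF Q(1), symmetric] key[OF Q(2), symmetric] by (simp add: rat_field_def)
  qed
  have "U2_inf k = {rat_field (k + 2) n1 n2 n3 | n1 n2 n3. U2_num k n1 n2 n3}"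
  proof -
    define Q where "Q u \<longleftrightarrow> (\<forall>y\<in>{0, 1}. \<exists>f\<in>ratP (k+2) (int k - 1). \<forall>x\<in>{0..1}. \<forall>z\<ge>0. u (vector [x, y, z]) $ 2 = f x z) \<and>
     (\<forall>x\<in>{0, 1}. \<exists>f\<in>ratP (k+2) (int k - 1). \<forall>y\<in>{0..1}. \<forall>z\<ge>0. u (vector [x, y, z]) $ 1 = f y z)" for u :: "real^3 \<Rightarrow> real^3"
    have Q: "Q (rat_field (k + 2) n1 n2 n3) \<longleftrightarrow> (\<forall>F. face_trace F n1 n2 n3 \<in> ref_poly k F)" if "flux_num k n1 n2 n3" for n1 n2 n3
      unfolding Q_def by (rule iff[OF that])
    have "U2_inf k = {u \<in> U2bar_inf k. Q u}" unfolding U2_inf_def Q_def ..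
    moreover have "{u \<in> U2bar_inf k. Q u} = {rat_field (k + 2) n1 n2 n3 | n1 n2 n3. U2_num k n1 n2 n3}"
    proof (intro equalityI subsetI)
      fix u assume "u \<in> {u \<in> U2bar_inf k. Q u}"
      then obtain n1 n2 n3 where n: "u = rat_field (k + 2) n1 n2 n3" "flux_num k n1 n2 n3" "Q u" unfolding U2bar_inf_iff[OF k] by blast
      then have "U2_num k n1 n2 n3" unfolding U2_num_def using Q[OF n(2)] by simp
      with n(1) show "u \<in> {rat_field (k + 2) n1 n2 n3 | n1 n2 n3. U2_num k n1 n2 n3}" by blast
    next
      fix u assume "u \<in> {rat_field (k + 2) n1 n2 n3 | n1 n2 n3. U2_num k n1 n2 n3}"
      then obtain n1 n2 n3 where n: "u = rat_field (k + 2) n1 n2 n3" "U2_num k n1 n2 n3" by blast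
      then have N: "flux_num k n1 n2 n3" "Q u" unfolding n(1) using Q by (auto simp: U2_num_def)
      with n(1) show "u \<in> {u \<in> U2bar_inf k. Q u}" unfolding U2bar_inf_iff[OF k] by blast
    qed
    ultimately show ?thesis by simp
  qed
  then show ?thesis unfolding U2_def push_space2 by auto
qed

lemma U2_add:
  assumes k: "k \<ge> 1" and u: "u \<in> U2 k" "v \<in> U2 k" shows "u + v \<in> U2 k"
proof -
  from u obtain n1 n2 n3 m1 m2 m3 where n: "U2_num k n1 n2 n3" "u = push2 (rat_field (k + 2) n1 n2 n3)"
    and m: "U2_num k m1 m2 m3" "v = push2 (rat_field (k + 2) m1 m2 m3)" unfolding U2_eq[OF k] by blast
  have "U2_num k (\<lambda>x y z. n1 x y z + m1 x y z) (\<lambda>x y z. n2 x y z + m2 x y z) (\<lambda>x y z. n3 x y z + m3 x y z)"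
    using n(1) m(1) unfolding U2_num_def face_trace_add by (intro conjI allI flux_num_add ref_poly_add) auto
  moreover have "u + v = push2 (rat_field (k + 2) (\<lambda>x y z. n1 x y z + m1 x y z) (\<lambda>x y z. n2 x y z + m2 x y z) (\<lambda>x y z. n3 x y z + m3 x y z))"
    unfolding n(2) m(2) rat_field_add push2_add ..
  ultimately show ?thesis unfolding U2_eq[OF k] by blast
qed

lemma U2_scale:
  assumes k: "k \<ge> 1" and u: "u \<in> U2 k" shows "fscale c u \<in> U2 k"
proof -
  from u obtain n1 n2 n3 where n: "U2_num k n1 n2 n3" "u = push2 (rat_field (k + 2) n1 n2 n3)" unfolding U2_eq[OF k] by blast
  have "U2_num k (\<lambda>x y z. c * n1 x y z) (\<lambda>x y z. c * n2 x y z) (\<lambda>x y z. c * n3 x y z)"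
    using n(1) unfolding U2_num_def face_trace_cmult by (intro conjI allI flux_num_cmult ref_poly_cmult) auto
  moreover have "fscale c u = push2 (rat_field (k + 2) (\<lambda>x y z. c * n1 x y z) (\<lambda>x y z. c * n2 x y z) (\<lambda>x y z. c * n3 x y z))"
    unfolding n(2) rat_field_cmult push2_scale ..
  ultimately show ?thesis unfolding U2_eq[OF k] by blast
qed

section \<open>Linearity of the degrees of freedom\<close>

lemma face_domain_interior_apex:
  assumes "st \<in> interior (face_domain F)" shows "st \<in> face_domain F" "face_param F st \<noteq> apex"
proof -
  show st: "st \<in> face_domain F" using assms interior_subset by blast
  obtain s t where [simp]: "st = (s, t)" by (cases st)
  show "face_param F st \<noteq> apex"
  proof
    assume "face_param F st = apex"
    then have F: "F \<noteq> Base" "t = 1" using face_param_apex[of s t F] st by auto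
    obtain e where e: "e > 0" "ball st e \<subseteq> face_domain F" using assms by (auto simp: mem_interior)
    have "(s, t + e / 2) \<in> ball st e" using e by (simp add: dist_Pair_Pair dist_real_def)
    then have "(s, t + e / 2) \<in> face_domain F" using e by blast
    then show False using F e by (simp add: face_domain_def)
  qed
qed

lemma face_polys_nice:
  assumes "q \<in> face_polys k F" shows "nice (face_domain F) (\<lambda>st. q (face_param F st))"
proof -
  obtain g where g: "g \<in> ref_poly k F" "\<And>s t. (s, t) \<in> face_domain F \<Longrightarrow> q (face_param F (s, t)) = g s t"
    using assms unfolding face_polys_iff by blast
  have "q (face_param F st) = g (fst st) (snd st)" if "st \<in> interior (face_domain F)" for st
    using g(2)[of "fst st" "snd st"] face_domain_interior_apex(1)[OF that] by simp
  from iffD2[OF nice_cong[OF this] polyQ2_nice[OF ref_poly_Q2[OF g(1)]]] show ?thesis by simp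
qed

text \<open>Unlike the field, which is set to zero at the apex, the polynomial \<open>v\<close>
  continues the normal component to the whole face. Face integrals thereby become integrals of
  polynomials.\<close>

lemma normal_trace_face_poly:
  assumes k: "k \<ge> 1" and u: "u \<in> U2 k"
  shows "\<exists>v\<in>face_polys k F. \<forall>p\<in>face F - {apex}. inner (u p) (face_normal F) = v p"
proof -
  obtain n1 n2 n3 where n: "U2_num k n1 n2 n3" "u = push2 (rat_field (k + 2) n1 n2 n3)" using u unfolding U2_eq[OF k] by blast
  then obtain g where g: "g \<in> ref_poly k F" "\<And>s t. (s, t) \<in> face_domain F \<Longrightarrow> face_param F (s, t) \<noteq> apex \<Longrightarrow> inner (u (face_param F (s, t))) (face_normal F) = g s t"
    using normal_trace_poly[OF k, of F n1 n2 n3] unfolding U2_num_def by blast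
  define v where "v p = (if p \<in> face F then g (if F = Xi0 \<or> F = Xi1 then p$2 else p$1) (if F = Base then p$2 else p$3) else 0)" for p
  have vg: "v (face_param F (s, t)) = g s t" if "(s, t) \<in> face_domain F" for s t
  proof -
    have "face_param F (s, t) \<in> face F" using face_param_image[of F] that by blast
    then show ?thesis unfolding v_def using face_param_inv[of "face_param F (s, t)" F s t, OF refl] by simp
  qed
  have "v \<in> face_polys k F" unfolding face_polys_iff by (intro conjI allI impI bexI[OF _ g(1)] vg) (simp_all add: v_def)
  moreover have "inner (u p) (face_normal F) = v p" if p: "p \<in> face F - {apex}" for p
  proof -
    have "p \<in> face_param F ` face_domain F" using p unfolding face_param_image by blast
    then obtain s t where st: "(s, t) \<in> face_domain F" "p = face_param F (s, t)" by auto
    then have "face_param F (s, t) \<noteq> apex" using p by auto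
    then show ?thesis unfolding st(2) vg[OF st(1)] by (rule g(2)[OF st(1)])
  qed
  ultimately show ?thesis by blast
qed

lemma normal_nice:
  assumes k: "k \<ge> 1" and u: "u \<in> U2 k" and \<nu>: "unit_normal F n" and q: "q \<in> face_polys k F"
  shows "nice (face_domain F) (\<lambda>st. inner (u (face_param F st)) n * q (face_param F st))"
proof -
  obtain c where c: "n = c *\<^sub>R face_normal F" using unit_normal_eq[OF \<nu>] by blast
  obtain v where v: "v \<in> face_polys k F" "\<And>p. p \<in> face F - {apex} \<Longrightarrow> inner (u p) (face_normal F) = v p"
    using normal_trace_face_poly[OF k u] by blast
  have N: "nice (face_domain F) (\<lambda>st. c * v (face_param F st) * q (face_param F st))"
    by (intro nice_mult nice_const face_polys_nice[OF v(1)] face_polys_nice[OF q])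
  have "inner (u (face_param F st)) n * q (face_param F st) = c * v (face_param F st) * q (face_param F st)"
    if "st \<in> interior (face_domain F)" for st
    using face_domain_interior_apex[OF that] v(2)[of "face_param F st"] face_param_image[of F] c by auto
  from iffD2[OF nice_cong[OF this] N] show ?thesis by simp
qed

lemma face_integral_eq: "face_integral F f = face_const F * (LINT st|lebesgue_on (face_domain F). f (face_param F st))"
  by (simp add: face_integral_def face_const_def)

definition field_regular :: "(real^3 \<Rightarrow> real^3) \<Rightarrow> bool" where
  "field_regular u \<longleftrightarrow> (\<forall>q\<in>interior Omega. u differentiable (at q)) \<and> (\<forall>i. nice Omega (\<lambda>q. u q $ i)) \<and> nice Omega (divergence u)"

lemma push2_regular:
  assumes N: "flux_num k n1 n2 n3" and k: "k \<ge> 1"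
  shows "field_regular (push2 (rat_field (k + 2) n1 n2 n3))"
proof -
  have n: "n1 \<in> polyQ3 (int k) (int k - 1) (int k - 1)" "n2 \<in> polyQ3 (int k - 1) (int k) (int k - 1)" "n3 \<in> polyQ3 (int k - 1) (int k - 1) (int k)"
    using N by (auto simp: flux_num_def)
  have "push2 (rat_field (k + 2) n1 n2 n3) differentiable (at q)" if "q \<in> interior Omega" for q
    using push2_partials[OF n that, of k] unfolding differentiable_def by blast
  then show ?thesis unfolding field_regular_def using nice_push2[OF N k] nice_divergence[OF N k] by blast
qed

lemma U2_regular: "k \<ge> 1 \<Longrightarrow> u \<in> U2 k \<Longrightarrow> field_regular u"
  using push2_regular unfolding U2_eq U2_num_def by auto

lemma divergence_add:
  assumes "field_regular u" "field_regular v" "q \<in> interior Omega"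
  shows "divergence (u + v) q = divergence u q + divergence v q"
proof -
  obtain u' v' where d: "(u has_derivative u') (at q)" "(v has_derivative v') (at q)"
    using assms unfolding field_regular_def differentiable_def by blast
  have "(u + v has_derivative (\<lambda>h. u' h + v' h)) (at q)"
    using has_derivative_add[OF d] by (simp add: plus_fun_def)
  from jacobian_entry[OF this] jacobian_entry[OF d(1)] jacobian_entry[OF d(2)] show ?thesis
    unfolding divergence_def at_within_interior[OF assms(3)] trace_def by (simp add: sum.distrib)
qed

lemma divergence_scale:
  assumes "field_regular u" "q \<in> interior Omega"
  shows "divergence (fscale c u) q = c * divergence u q"
proof -
  obtain u' where d: "(u has_derivative u') (at q)"
    using assms unfolding field_regular_def differentiable_def by blast
  have "(fscale c u has_derivative (\<lambda>h. c *\<^sub>R u' h)) (at q)"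
    using has_derivative_scaleR_right[OF d, of c] by (simp add: fscale_def)
  from jacobian_entry[OF this] jacobian_entry[OF d] show ?thesis
    unfolding divergence_def at_within_interior[OF assms(2)] trace_def by (simp add: sum_distrib_left)
qed

lemma nice_inner:
  "(\<And>i. nice Omega (\<lambda>q. u q $ i)) \<Longrightarrow> (\<And>i. nice Omega (\<lambda>q. v q $ i)) \<Longrightarrow> nice Omega (\<lambda>q. inner (u q) (v q :: real^3))"
  unfolding inner_vec_def inner_real_def by (intro nice_sum nice_mult)

lemma at_inv_zero:
  assumes n: "n \<in> polyQ3 l m r" and 0: "\<And>q. q \<in> interior Omega \<Longrightarrow> at_inv n q = 0"
  shows "n = (\<lambda>x y z. 0)"
proof (intro ext)
  fix x y z show "n x y z = 0"
  proof (rule polyQ3_zero_box[OF n])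
    fix x y z :: real assume a: "0 < x" "x < 1" "0 < y" "y < 1" "0 < z"
    show "n x y z = 0" using 0[OF phi_interior(1)[OF a]] by (simp add: at_inv_def phi_interior(2)[OF a])
  qed
qed

lemma push2_zero:
  assumes N: "flux_num k n1 n2 n3" and k: "k \<ge> 1" and 0: "\<And>q. q \<in> interior Omega \<Longrightarrow> push2 (rat_field (k + 2) n1 n2 n3) q = 0"
  shows "n1 = (\<lambda>x y z. 0)" "n2 = (\<lambda>x y z. 0)" "n3 = (\<lambda>x y z. 0)"
proof -
  have n: "n1 \<in> polyQ3 (int k) (int k - 1) (int k - 1)" "n2 \<in> polyQ3 (int k - 1) (int k) (int k - 1)" "n3 \<in> polyQ3 (int k - 1) (int k - 1) (int k)"
    using N by (auto simp: flux_num_def)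
  have *: "at_inv n1 q = 0 \<and> at_inv n2 q = 0 \<and> at_inv n3 q = 0" if q: "q \<in> interior Omega" for q
  proof -
    have q3: "q$3 < 1" and qO: "q \<in> Omega - {apex}" using interior_Omega[OF q] by auto
    have "push2_at (rat_field (k + 2) n1 n2 n3) q = 0" using 0[OF q] qO by (simp add: push2_def)
    then have "\<forall>i. push2_at (rat_field (k + 2) n1 n2 n3) q $ i = 0" by simp
    then show ?thesis unfolding push2_at_rat_field[OF q3 k] using q3 by (simp add: forall_3)
  qed
  show "n1 = (\<lambda>x y z. 0)" "n2 = (\<lambda>x y z. 0)" "n3 = (\<lambda>x y z. 0)"
    using at_inv_zero[OF n(1)] at_inv_zero[OF n(2)] at_inv_zero[OF n(3)] * by blast+
qed

lemma rat_field_zero: "rat_field w (\<lambda>x y z. 0) (\<lambda>x y z. 0) (\<lambda>x y z. 0) = 0"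
  by (simp add: rat_field_def fun_eq_iff vec_eq_iff forall_3)

lemma push_zero: "push1 0 = 0" "push2 0 = 0"
proof -
  have "fscale 0 w = 0" for w :: "real^3 \<Rightarrow> real^3" by (simp add: fun_eq_iff fscale_def)
  then show "push1 0 = 0" "push2 0 = 0" using push1_scale[of 0 0] push2_scale[of 0 0] by metis+
qed

section \<open>Volume test fields and the approximation space\<close>

lemma zero_trace_normal:
  assumes k: "k \<ge> 1" and N: "flux_num k n1 n2 n3" and Z: "zero_trace n1 n2 n3"
  shows "push2 (rat_field (k + 2) n1 n2 n3) \<in> U2 k" 
    "p \<in> face F - {apex} \<Longrightarrow> inner (push2 (rat_field (k + 2) n1 n2 n3) p) (face_normal F) = 0"
proof -
  have t: "face_trace F n1 n2 n3 = (\<lambda>x y. 0)" for F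
    using Z by (cases F) (simp_all add: face_trace_def zero_trace_def fun_eq_iff)
  then have "U2_num k n1 n2 n3" unfolding U2_num_def using N ref_poly_zero by simp
  then show "push2 (rat_field (k + 2) n1 n2 n3) \<in> U2 k" unfolding U2_eq[OF k] by blast
  assume p: "p \<in> face F - {apex}"
  then have "p \<in> face_param F ` face_domain F" unfolding face_param_image by blast
  then obtain s u where su: "(s, u) \<in> face_domain F" "p = face_param F (s, u)" by auto
  then show "inner (push2 (rat_field (k + 2) n1 n2 n3) p) (face_normal F) = 0"
    using normal_trace[OF k su(1)] p by (simp add: t)
qed

lemma U1_0curl_eq: "U1_0curl k = {push1 (rat_field (k + 1) m1 m2 m3) | m1 m2 m3. curl_num k m1 m2 m3}"
  unfolding U1_0curl_def U1_0curl_inf_iff push_space1 by auto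

lemma U2_0div_eq: "U2_0div k = {push2 (rat_field (k + 2) d1 d2 d3) | d1 d2 d3. div_num k d1 d2 d3}"
  unfolding U2_0div_def U2_0div_inf_iff push_space2 by auto

text \<open>The identity with \<open>curl a\<close> is claimed in the interior only, since
  derivatives at the boundary are not examined. Hence the curl is represented by a member
  \<open>r\<close> of the space; the last clause encodes that \<open>a\<close> is determined by its
  curl.\<close>

definition curl_field :: "nat \<Rightarrow> (real^3 \<Rightarrow> real^3) \<Rightarrow> (real^3 \<Rightarrow> real^3) \<Rightarrow> bool" where
  "curl_field k a r \<longleftrightarrow> r \<in> U2 k \<and> (\<forall>q\<in>interior Omega. curl a q = r q) \<and> (\<forall>q\<in>interior Omega. divergence r q = 0)
     \<and> (\<forall>F. \<forall>p\<in>face F - {apex}. inner (r p) (face_normal F) = 0) \<and> ((\<forall>q\<in>interior Omega. r q = 0) \<longrightarrow> a = 0 \<and> r = 0)"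

lemma curl_field_curl_num:
  assumes k: "k \<ge> 1" and C: "curl_num k m1 m2 m3"
  shows "curl_field k (push1 (rat_field (k + 1) m1 m2 m3)) 
    (push2 (rat_field (k + 2) (curl1 (real k + 1) m1 m2 m3) (curl2 (real k + 1) m1 m2 m3) (curl3 (real k + 1) m1 m2 m3)))"
proof -
  let ?r = "push2 (rat_field (k + 2) (curl1 (real k + 1) m1 m2 m3) (curl2 (real k + 1) m1 m2 m3) (curl3 (real k + 1) m1 m2 m3))"
  note N = curl_num_flux_num[OF C]
  have "push1 (rat_field (k + 1) m1 m2 m3) = 0 \<and> ?r = 0" if "\<forall>q\<in>interior Omega. ?r q = 0"
  proof -
    have z: "curl1 (real k + 1) m1 m2 m3 = (\<lambda>x y z. 0)" "curl2 (real k + 1) m1 m2 m3 = (\<lambda>x y z. 0)" "curl3 (real k + 1) m1 m2 m3 = (\<lambda>x y z. 0)"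
      by (rule push2_zero[OF N(1) k], rule bspec[OF that], assumption)+
    have "m1 = (\<lambda>x y z. 0)" "m2 = (\<lambda>x y z. 0)" "m3 = (\<lambda>x y z. 0)"
      by (rule curl_inj[OF C]; simp add: z)+
    then have "push1 (rat_field (k + 1) m1 m2 m3) = 0" by (simp only: rat_field_zero push_zero)
    moreover have "?r = 0" unfolding z by (simp only: rat_field_zero push_zero)
    ultimately show ?thesis ..
  qed
  moreover have "divergence ?r q = 0" if "q \<in> interior Omega" for q
    unfolding divergence_push2[OF N(1) that k] N(2) by (simp add: at_inv_def)
  ultimately show ?thesis
    unfolding curl_field_def using zero_trace_normal[OF k N(1,3)] curl_push1[OF C] by blast
qed

lemma U1_0curl_field:
  assumes "k \<ge> 1" "a \<in> U1_0curl k" shows "\<exists>r. curl_field k a r"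
  using assms(2) curl_field_curl_num[OF assms(1)] unfolding U1_0curl_eq by blast

lemma U2_0div_props:
  assumes k: "k \<ge> 1" and b: "b \<in> U2_0div k"
  shows "b \<in> U2 k" "p \<in> face F - {apex} \<Longrightarrow> inner (b p) (face_normal F) = 0"
    "(\<And>q. q \<in> interior Omega \<Longrightarrow> divergence b q = 0) \<Longrightarrow> b = 0"
proof -
  obtain d1 d2 d3 where D: "div_num k d1 d2 d3" and bd: "b = push2 (rat_field (k + 2) d1 d2 d3)" using b unfolding U2_0div_eq by blast
  note N = div_num_flux_num[OF k D]
  show "b \<in> U2 k" "p \<in> face F - {apex} \<Longrightarrow> inner (b p) (face_normal F) = 0"
    using zero_trace_normal[OF k N] unfolding bd by blast+
  assume 0: "\<And>q. q \<in> interior Omega \<Longrightarrow> divergence b q = 0"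
  have "divergence_num (real k + 2) d1 d2 d3 \<in> polyQ3 (int k - 1) (int k - 1) (int k - 1)" using N(1) by (simp add: flux_num_def)
  then have "divergence_num (real k + 2) d1 d2 d3 = (\<lambda>x y z. 0)"
  proof (rule at_inv_zero)
    fix q assume q: "q \<in> interior Omega"
    then show "at_inv (divergence_num (real k + 2) d1 d2 d3) q = 0"
      using 0[OF q] interior_Omega(2)[OF q] unfolding bd divergence_push2[OF N(1) q k] by simp
  qed
  note dv = this
  have "d1 = (\<lambda>x y z. 0)" "d2 = (\<lambda>x y z. 0)" "d3 = (\<lambda>x y z. 0)" by (rule div_inj[OF k D]; simp add: dv)+
  then show "b = 0" unfolding bd by (simp only: rat_field_zero push_zero)
qed

lemma U2_decomposition:
  assumes k: "k \<ge> 1" and u: "u \<in> U2 k" and 0: "\<And>F p. p \<in> face F - {apex} \<Longrightarrow> inner (u p) (face_normal F) = 0"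
  shows "\<exists>a\<in>U1_0curl k. \<exists>b\<in>U2_0div k. \<exists>r. curl_field k a r \<and> u = r + b"
proof -
  obtain n1 n2 n3 where n: "U2_num k n1 n2 n3" "u = push2 (rat_field (k + 2) n1 n2 n3)" using u unfolding U2_eq[OF k] by blast
  then have N: "flux_num k n1 n2 n3" and t: "face_trace F n1 n2 n3 \<in> ref_poly k F" for F by (auto simp: U2_num_def)
  have t0: "face_trace F n1 n2 n3 x y = 0" for F x y
    by (rule normal_trace_zero[OF k t]) (use 0 n(2) in blast)
  have Z: "zero_trace n1 n2 n3"
    unfolding zero_trace_def using t0[of Xi0] t0[of Xi1] t0[of Eta0] t0[of Eta1] t0[of Base] by (simp add: face_trace_def)
  obtain m1 m2 m3 d1 d2 d3 where C: "curl_num k m1 m2 m3" and D: "div_num k d1 d2 d3"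
    and e: "n1 = (\<lambda>x y z. curl1 (real k + 1) m1 m2 m3 x y z + d1 x y z)"
    "n2 = (\<lambda>x y z. curl2 (real k + 1) m1 m2 m3 x y z + d2 x y z)"
    "n3 = (\<lambda>x y z. curl3 (real k + 1) m1 m2 m3 x y z + d3 x y z)"
    by (rule decomposition[OF k N Z])
  have "u = push2 (rat_field (k + 2) (curl1 (real k + 1) m1 m2 m3) (curl2 (real k + 1) m1 m2 m3) (curl3 (real k + 1) m1 m2 m3)) + push2 (rat_field (k + 2) d1 d2 d3)"
    unfolding n(2) e rat_field_add push2_add ..
  moreover have "push2 (rat_field (k + 2) d1 d2 d3) \<in> U2_0div k" unfolding U2_0div_eq using D by blast
  moreover have "push1 (rat_field (k + 1) m1 m2 m3) \<in> U1_0curl k" unfolding U1_0curl_eq using C by blast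
  ultimately show ?thesis using curl_field_curl_num[OF k C] by blast
qed

lemma U1_differentiable:
  assumes "a \<in> U1_0curl k" "q \<in> interior Omega"
  shows "a differentiable (at q)"
proof -
  obtain m1 m2 m3 where C: "curl_num k m1 m2 m3" and a: "a = push1 (rat_field (k + 1) m1 m2 m3)" using assms(1) unfolding U1_0curl_eq by blast
  note m = curl_num_degrees[OF C]
  note q3 = interior_Omega[OF assms(2)]
  have z: "1 + phi_inv q $ 3 \<noteq> 0" using phi_inv_simps[OF q3(2)] q3(2) by simp
  have f: "((\<lambda>p. rat_field (k + 1) m1 m2 m3 p $ 1) = (\<lambda>p. m1 (p$1) (p$2) (p$3) / (1 + p$3) ^ (k + 1)))"
    "((\<lambda>p. rat_field (k + 1) m1 m2 m3 p $ 2) = (\<lambda>p. m2 (p$1) (p$2) (p$3) / (1 + p$3) ^ (k + 1)))"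
    "((\<lambda>p. rat_field (k + 1) m1 m2 m3 p $ 3) = (\<lambda>p. m3 (p$1) (p$2) (p$3) / (1 + p$3) ^ (k + 1)))"
    by (simp_all add: rat_field_def)
  have "q$3 \<noteq> 1" using q3 by simp
  from push1_at_has_derivative[OF this, of "rat_field (k + 1) m1 m2 m3", unfolded f, OF rat_field_has_derivative[OF m(1) z] rat_field_has_derivative[OF m(2) z] rat_field_has_derivative[OF m(3) z]]
  obtain f' where f': "(push1_at (rat_field (k + 1) m1 m2 m3) has_derivative f') (at q)" by blast
  have "(a has_derivative f') (at q)" unfolding a
    by (rule has_derivative_transform_within_open[OF f' open_interior assms(2)]) 
       (use interior_Omega in \<open>auto simp: push1_def\<close>)
  then show ?thesis unfolding differentiable_def by blast
qed

lemma curl_linear: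
  assumes "a differentiable (at q)" "b differentiable (at q)" "q \<in> interior Omega"
  shows "curl (a + b) q = curl a q + curl b q" "curl (fscale c a) q = c *\<^sub>R curl a q"
proof -
  obtain a' b' where d: "(a has_derivative a') (at q)" "(b has_derivative b') (at q)"
    using assms unfolding differentiable_def by blast
  have 1: "(a + b has_derivative (\<lambda>h. a' h + b' h)) (at q)"
    using has_derivative_add[OF d] by (simp add: plus_fun_def)
  have 2: "(fscale c a has_derivative (\<lambda>h. c *\<^sub>R a' h)) (at q)"
    using has_derivative_scaleR_right[OF d(1), of c] by (simp add: fscale_def)
  show "curl (a + b) q = curl a q + curl b q" "curl (fscale c a) q = c *\<^sub>R curl a q"
    unfolding curl_def Let_def at_within_interior[OF assms(3)] jacobian_entry[OF 1] jacobian_entry[OF 2] jacobian_entry[OF d(1)] jacobian_entry[OF d(2)]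
    by (simp_all add: vec_eq_iff forall_3 algebra_simps)
qed

section \<open>Finiteness of the bases\<close>

lemma polyP3_sub_Q3: "f \<in> polyP3 n \<Longrightarrow> f \<in> polyQ3 n n n"
proof -
  assume "f \<in> polyP3 n"
  then obtain d where d: "f = (\<lambda>x y z. \<Sum>t\<in>{(i, j, h). int (i + j + h) \<le> n}. d (fst t) (fst (snd t)) (snd (snd t)) * (x ^ fst t * y ^ fst (snd t) * z ^ snd (snd t)))"
    by (auto simp: polyP3_def case_prod_unfold mult.assoc)
  show ?thesis unfolding d polyQ3_iff
    by (intro conjI allI poly1_sum poly1_cmult poly1_cmult_right poly1_mono[OF poly1_power]) auto
qed

lemma face_polys_finite:
  assumes "is_basis B (face_polys k F)" shows "finite B"
proof -
  let ?T = "\<lambda>g :: fun3. \<lambda>p. if p \<in> face F then g (p$1) (p$2) (p$3) else 0"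
  \<comment> \<open>Base polynomials are constant in the third variable; the maximum with
    \<open>0\<close> admits them even if \<open>k = 0\<close>.\<close>
  have "\<exists>S. finite S \<and> ?T ` polyQ3 (int k - 1) (int k - 1) (max 0 (int k - 1)) \<subseteq> fun_vs.span S"
    by (rule finite_dim_polyQ3) (auto simp: fun_eq_iff fscale_def)
  then obtain S where S: "finite S" "?T ` polyQ3 (int k - 1) (int k - 1) (max 0 (int k - 1)) \<subseteq> fun_vs.span S" by blast
  have "face_polys k F \<subseteq> ?T ` polyQ3 (int k - 1) (int k - 1) (max 0 (int k - 1))"
  proof
    fix f assume f: "f \<in> face_polys k F"
    show "f \<in> ?T ` polyQ3 (int k - 1) (int k - 1) (max 0 (int k - 1))"
    proof (cases "F = Base")
      case True
      with f obtain g where g: "g \<in> polyQ2 (int k - 1) (int k - 1)" "f = (\<lambda>p. if p \<in> face F then g (p$1) (p$2) else 0)"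
        unfolding face_polys_def by auto
      have "(\<lambda>x y z. g x y) \<in> polyQ3 (int k - 1) (int k - 1) (max 0 (int k - 1))"
        using g(1) unfolding polyQ2_iff_Q3 by (rule polyQ3_mono) auto
      then show ?thesis using g(2) by (intro image_eqI[of _ _ "\<lambda>x y z. g x y"])
    next
      case False
      with f obtain g where g: "g \<in> polyP3 (int k - 1)" "f = (\<lambda>p. if p \<in> face F then g (p$1) (p$2) (p$3) else 0)"
        unfolding face_polys_def by auto
      have "g \<in> polyQ3 (int k - 1) (int k - 1) (max 0 (int k - 1))"
        by (rule polyQ3_mono[OF polyP3_sub_Q3[OF g(1)]]) auto
      then show ?thesis using g(2) by (intro image_eqI[of _ _ g])
    qed
  qed
  with S show ?thesis by (intro basis_finite[OF assms S(1)]) blast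
qed

lemma U1_0curl_finite:
  assumes "is_basis B (U1_0curl k)" shows "finite B"
proof -
  let ?W = "{push1 (rat_field (k + 1) n1 n2 n3) | n1 n2 n3. n1 \<in> polyQ3 (int k) (int k) (int k) \<and> n2 \<in> polyQ3 (int k) (int k) (int k) \<and> n3 \<in> polyQ3 (int k) (int k) (int k)}"
  obtain S where S: "finite S" "?W \<subseteq> fun_vs.span S"
    using finite_dim_push[where P = push1 and w = "k + 1" and l = "int k" and m = "int k" and n = "int k", OF push1_add push1_scale]
    by (elim exE conjE) (rule that)
  have "U1_0curl k \<subseteq> ?W"
  proof
    fix a assume "a \<in> U1_0curl k"
    then obtain m1 m2 m3 where C: "curl_num k m1 m2 m3" and a: "a = push1 (rat_field (k + 1) m1 m2 m3)" unfolding U1_0curl_eq by blast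
    have "m1 \<in> polyQ3 (int k) (int k) (int k)" "m2 \<in> polyQ3 (int k) (int k) (int k)" "m3 \<in> polyQ3 (int k) (int k) (int k)"
      by (rule polyQ3_mono[OF curl_num_degrees(1)[OF C]] polyQ3_mono[OF curl_num_degrees(2)[OF C]] polyQ3_mono[OF curl_num_degrees(3)[OF C]]; simp)+
    then show "a \<in> ?W" unfolding a by (intro CollectI exI[of _ m1] exI[of _ m2] exI[of _ m3] conjI refl)
  qed
  with S show ?thesis by (intro basis_finite[OF assms S(1)]) blast
qed

lemma U2_0div_finite:
  assumes "is_basis B (U2_0div k)" and k: "k \<ge> 1" shows "finite B"
proof -
  let ?W = "{push2 (rat_field (k + 2) n1 n2 n3) | n1 n2 n3. n1 \<in> polyQ3 (int k) (int k) (int k) \<and> n2 \<in> polyQ3 (int k) (int k) (int k) \<and> n3 \<in> polyQ3 (int k) (int k) (int k)}"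
  obtain S where S: "finite S" "?W \<subseteq> fun_vs.span S"
    using finite_dim_push[where P = push2 and w = "k + 2" and l = "int k" and m = "int k" and n = "int k", OF push2_add push2_scale]
    by (elim exE conjE) (rule that)
  have "U2_0div k \<subseteq> ?W"
  proof
    fix a assume "a \<in> U2_0div k"
    then obtain m1 m2 m3 where D: "div_num k m1 m2 m3" and a: "a = push2 (rat_field (k + 2) m1 m2 m3)" unfolding U2_0div_eq by blast
    have N: "m1 \<in> polyQ3 (int k) (int k - 1) (int k - 1)" "m2 \<in> polyQ3 (int k - 1) (int k) (int k - 1)" "m3 \<in> polyQ3 (int k - 1) (int k - 1) (int k)"
      using div_num_flux_num(1)[OF k D] by (auto simp: flux_num_def)
    have "m1 \<in> polyQ3 (int k) (int k) (int k)" "m2 \<in> polyQ3 (int k) (int k) (int k)" "m3 \<in> polyQ3 (int k) (int k) (int k)"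
      by (rule polyQ3_mono[OF N(1)] polyQ3_mono[OF N(2)] polyQ3_mono[OF N(3)]; simp)+
    then show "a \<in> ?W" unfolding a by (intro CollectI exI[of _ m1] exI[of _ m2] exI[of _ m3] conjI refl)
  qed
  with S show ?thesis by (intro basis_finite[OF assms(1) S(1)]) blast
qed

section \<open>Definite forms behind the degrees of freedom\<close>

lemma is_basis_sub: "is_basis B V \<Longrightarrow> b \<in> B \<Longrightarrow> b \<in> V"
  unfolding is_basis_def using fun_vs.span_superset by blast

text \<open>Unisolvence for one block. Existence is the Gram system; for uniqueness, the vanishing
  on the basis extends to its span, where \<open>v\<close> itself can be inserted.\<close>

lemma basis_solve:
  fixes g :: "('a \<Rightarrow> 'b::real_vector) \<Rightarrow> ('a \<Rightarrow> 'b) \<Rightarrow> real"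
  assumes B: "is_basis B V" "finite B"
    and add: "\<And>x y z. x \<in> V \<Longrightarrow> y \<in> V \<Longrightarrow> z \<in> V \<Longrightarrow> g (x + y) z = g x z + g y z"
    and scale: "\<And>c x z. x \<in> V \<Longrightarrow> z \<in> V \<Longrightarrow> g (fscale c x) z = c * g x z"
    and sym: "\<And>x y. x \<in> V \<Longrightarrow> y \<in> V \<Longrightarrow> g x y = g y x"
    and def: "\<And>x. x \<in> V \<Longrightarrow> g x x = 0 \<Longrightarrow> x = 0"
  shows "\<exists>v\<in>V. \<forall>b\<in>B. g v b = c b" and "v \<in> V \<Longrightarrow> (\<And>b. b \<in> B \<Longrightarrow> g v b = 0) \<Longrightarrow> v = 0"
proof -
  have V: "fun_vs.subspace V" and VB: "fun_vs.span B = V" and ind: "fun_vs.independent B"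
    using B(1) fun_vs.subspace_span unfolding is_basis_def by auto
  have BV: "B \<subseteq> V" using VB fun_vs.span_superset by blast
  from gram_solve[where g = g, OF V add scale sym def B(2) ind BV, of c]
  show "\<exists>v\<in>V. \<forall>b\<in>B. g v b = c b" unfolding VB by blast
  assume v: "v \<in> V" and 0: "\<And>b. b \<in> B \<Longrightarrow> g v b = 0"
  have "x \<in> V \<and> g v x = 0" if "x \<in> fun_vs.span B" for x
    using that
  proof (induction rule: fun_vs.span_induct_alt)
    case base
    have z: "0 \<in> V" by (rule fun_vs.subspace_0[OF V])
    have "g 0 v = 0" using add[OF z z v] by simp
    then show ?case using z sym[OF v z] unfolding zero_fun_def by simp
  next
    case (step a x y)
    then have x: "x \<in> V" "fscale a x \<in> V" "y \<in> V" "fscale a x + y \<in> V"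
      using BV fun_vs.subspace_scale[OF V] fun_vs.subspace_add[OF V] by auto
    have "g v (fscale a x + y) = a * g x v + g y v"
      using sym[OF v x(4)] add[OF x(2,3) v] scale[OF x(1) v] by simp
    also have "\<dots> = 0" using sym[OF v x(1)] sym[OF v x(3)] 0 step by simp
    finally show ?case using x(4) by blast
  qed
  then show "v = 0" using def v VB by blast
qed

text \<open>The face integral stripped of the surface factor and of the normal, which enter only as
  constants.\<close>

definition face_form :: "pyramid_face \<Rightarrow> (real^3 \<Rightarrow> real) \<Rightarrow> (real^3 \<Rightarrow> real) \<Rightarrow> real" where
  "face_form F f g = (LINT st|lebesgue_on (face_domain F). f (face_param F st) * g (face_param F st))"

lemma face_form_props:
  shows "x \<in> face_polys k F \<Longrightarrow> y \<in> face_polys k F \<Longrightarrow> z \<in> face_polys k F \<Longrightarrow> face_form F (x + y) z = face_form F x z + face_form F y z"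
    and "x \<in> face_polys k F \<Longrightarrow> z \<in> face_polys k F \<Longrightarrow> face_form F (fscale c x) z = c * face_form F x z"
    and "face_form F x y = face_form F y x"
    and "x \<in> face_polys k F \<Longrightarrow> face_form F x x = 0 \<Longrightarrow> x = 0"
proof -
  show "face_form F (x + y) z = face_form F x z + face_form F y z" if "x \<in> face_polys k F" "y \<in> face_polys k F" "z \<in> face_polys k F"
    unfolding face_form_def plus_fun_apply distrib_right
    by (intro nice_integral_add face_S nice_mult face_polys_nice[OF that(1)] face_polys_nice[OF that(2)] face_polys_nice[OF that(3)])
  show "face_form F (fscale c x) z = c * face_form F x z"
    unfolding face_form_def fscale_def by (simp add: mult.assoc)
  show "face_form F x y = face_form F y x" unfolding face_form_def by (simp add: mult.commute)
  show "x = 0" if x: "x \<in> face_polys k F" and 0: "face_form F x x = 0"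
  proof -
    obtain g where g: "g \<in> ref_poly k F" "\<And>s t. (s, t) \<in> face_domain F \<Longrightarrow> x (face_param F (s, t)) = g s t" 
      and off: "\<And>p. p \<notin> face F \<Longrightarrow> x p = 0"
      using x unfolding face_polys_iff by blast
    have z: "x (face_param F st) * x (face_param F st) = 0" if "st \<in> interior (face_domain F)" for st
      by (rule nice_integral_zero[OF face_S nice_mult[OF face_polys_nice[OF x] face_polys_nice[OF x]] _ _ that])
         (use 0 in \<open>auto simp: face_form_def\<close>)
    have "g s t = 0" for s t
    proof (rule polyQ2_zero_box[OF ref_poly_Q2[OF g(1)]])
      fix s t :: real assume "0 < s" "s < 1/2" "0 < t" "t < 1/2"
      then have st: "(s, t) \<in> interior (face_domain F)" by (rule face_domain_interior)
      show "g s t = 0" using z[OF st] g(2)[OF face_domain_interior_apex(1)[OF st]] by simp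
    qed
    note g0 = this
    have "x p = 0" for p
    proof (cases "p \<in> face F")
      case True
      then have "p \<in> face_param F ` face_domain F" unfolding face_param_image .
      then obtain s t where "(s, t) \<in> face_domain F" "p = face_param F (s, t)" by auto
      then show ?thesis using g(2) g0 by simp
    qed (rule off)
    then show "x = 0" by (simp add: fun_eq_iff)
  qed
qed

lemma dof_face_eq:
  assumes v: "v \<in> face_polys k F" and q: "q \<in> face_polys k F" and c: "\<nu> F = c *\<^sub>R face_normal F"
    and uv: "\<And>p. p \<in> face F - {apex} \<Longrightarrow> inner (u p) (face_normal F) = v p"
  shows "dof_value \<nu> (Face_dof F q) u = face_const F * c * face_form F v q"
proof -
  have "(LINT st|lebesgue_on (face_domain F). c * (v (face_param F st) * q (face_param F st))) = 
    (LINT st|lebesgue_on (face_domain F). inner (u (face_param F st)) (\<nu> F) * q (face_param F st))"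
  proof (rule nice_integral_cong[OF face_S])
    show "nice (face_domain F) (\<lambda>st. c * (v (face_param F st) * q (face_param F st)))"
      by (intro nice_mult nice_const face_polys_nice[OF v] face_polys_nice[OF q])
    fix st assume st: "st \<in> interior (face_domain F)"
    have "face_param F st \<in> face F - {apex}" 
      using face_domain_interior_apex[OF st] face_param_image[of F] by blast
    from uv[OF this] show "c * (v (face_param F st) * q (face_param F st)) = inner (u (face_param F st)) (\<nu> F) * q (face_param F st)"
      by (simp add: c)
  qed
  then show ?thesis by (simp add: face_integral_eq face_form_def mult.assoc)
qed

definition curl_form :: "(real^3 \<Rightarrow> real^3) \<Rightarrow> (real^3 \<Rightarrow> real^3) \<Rightarrow> real" where
  "curl_form a b = (LINT p|lebesgue_on Omega. inner (curl a p) (curl b p))"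

definition div_form :: "(real^3 \<Rightarrow> real^3) \<Rightarrow> (real^3 \<Rightarrow> real^3) \<Rightarrow> real" where
  "div_form a b = (LINT p|lebesgue_on Omega. divergence a p * divergence b p)"

lemma nice_curl:
  assumes k: "k \<ge> 1" and a: "a \<in> U1_0curl k" shows "nice Omega (\<lambda>q. curl a q $ i)"
proof -
  obtain r where r: "curl_field k a r" using U1_0curl_field[OF k a] by blast
  then have n: "nice Omega (\<lambda>q. r q $ i)" using U2_regular[OF k] unfolding curl_field_def field_regular_def by blast
  have "curl a q $ i = r q $ i" if "q \<in> interior Omega" for q using r that unfolding curl_field_def by simp
  from iffD2[OF nice_cong[OF this] n] show ?thesis by simp
qed

lemma curl_form_props:
  assumes k: "k \<ge> 1"
  shows "x \<in> U1_0curl k \<Longrightarrow> y \<in> U1_0curl k \<Longrightarrow> z \<in> U1_0curl k \<Longrightarrow> curl_form (x + y) z = curl_form x z + curl_form y z"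
    and "x \<in> U1_0curl k \<Longrightarrow> z \<in> U1_0curl k \<Longrightarrow> curl_form (fscale c x) z = c * curl_form x z"
    and "curl_form x y = curl_form y x"
    and "x \<in> U1_0curl k \<Longrightarrow> curl_form x x = 0 \<Longrightarrow> x = 0"
proof -
  show "curl_form (x + y) z = curl_form x z + curl_form y z" if xyz: "x \<in> U1_0curl k" "y \<in> U1_0curl k" "z \<in> U1_0curl k"
  proof -
    have n: "nice Omega (\<lambda>p. inner (curl x p) (curl z p))" "nice Omega (\<lambda>p. inner (curl y p) (curl z p))"
      by (intro nice_inner nice_curl[OF k] xyz)+
    have "(LINT p|lebesgue_on Omega. inner (curl x p) (curl z p) + inner (curl y p) (curl z p)) = curl_form (x + y) z"
      unfolding curl_form_def
    proof (rule nice_integral_cong[OF Omega_S nice_add[OF n]])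
      fix p assume p: "p \<in> interior Omega"
      show "inner (curl x p) (curl z p) + inner (curl y p) (curl z p) = inner (curl (x + y) p) (curl z p)"
        unfolding curl_linear(1)[OF U1_differentiable[OF xyz(1) p] U1_differentiable[OF xyz(2) p] p] by (simp add: inner_add_left)
    qed
    then show ?thesis using nice_integral_add[OF Omega_S n] by (simp add: curl_form_def)
  qed
  show "curl_form (fscale c x) z = c * curl_form x z" if xz: "x \<in> U1_0curl k" "z \<in> U1_0curl k"
  proof -
    have n: "nice Omega (\<lambda>p. inner (curl x p) (curl z p))"
      by (intro nice_inner nice_curl[OF k] xz)
    have "(LINT p|lebesgue_on Omega. c * inner (curl x p) (curl z p)) = curl_form (fscale c x) z"
      unfolding curl_form_def
    proof (rule nice_integral_cong[OF Omega_S nice_mult[OF nice_const n]])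
      fix p assume p: "p \<in> interior Omega"
      show "c * inner (curl x p) (curl z p) = inner (curl (fscale c x) p) (curl z p)"
        unfolding curl_linear(2)[OF U1_differentiable[OF xz(1) p] U1_differentiable[OF xz(1) p] p] by simp
    qed
    then show ?thesis by (simp add: curl_form_def)
  qed
  show "curl_form x y = curl_form y x" unfolding curl_form_def by (simp add: inner_commute)
  show "x = 0" if x: "x \<in> U1_0curl k" "curl_form x x = 0"
  proof -
    have n: "nice Omega (\<lambda>p. inner (curl x p) (curl x p))"
      by (intro nice_inner nice_curl[OF k] x)
    have "inner (curl x p) (curl x p) = 0" if "p \<in> interior Omega" for p
      by (rule nice_integral_zero[OF Omega_S n _ _ that]) (use x(2) in \<open>auto simp: curl_form_def\<close>)
    then have "curl x p = 0" if "p \<in> interior Omega" for p using that by simp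
    moreover obtain r where "curl_field k x r" using U1_0curl_field[OF k x(1)] by blast
    ultimately show ?thesis unfolding curl_field_def by simp
  qed
qed

text \<open>On regular fields the form is only semidefinite, with the divergence-free fields as its
  kernel. It becomes definite on \<open>U2_0div\<close>, where the divergence is injective.\<close>

lemma div_form_props:
  shows "field_regular x \<Longrightarrow> field_regular y \<Longrightarrow> field_regular z \<Longrightarrow> div_form (x + y) z = div_form x z + div_form y z"
    and "field_regular x \<Longrightarrow> field_regular z \<Longrightarrow> div_form (fscale c x) z = c * div_form x z"
    and "div_form x y = div_form y x"
    and "field_regular x \<Longrightarrow> div_form x x = 0 \<Longrightarrow> p \<in> interior Omega \<Longrightarrow> divergence x p = 0"
proof -
  show "div_form (x + y) z = div_form x z + div_form y z" if xyz: "field_regular x" "field_regular y" "field_regular z"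
  proof -
    have n: "nice Omega (\<lambda>p. divergence x p * divergence z p)" "nice Omega (\<lambda>p. divergence y p * divergence z p)"
      using xyz by (auto simp: field_regular_def intro: nice_mult)
    have "(LINT p|lebesgue_on Omega. divergence x p * divergence z p + divergence y p * divergence z p) = div_form (x + y) z"
      unfolding div_form_def
      by (rule nice_integral_cong[OF Omega_S nice_add[OF n]]) (simp add: divergence_add[OF xyz(1,2)] distrib_right)
    then show ?thesis using nice_integral_add[OF Omega_S n] by (simp add: div_form_def)
  qed
  show "div_form (fscale c x) z = c * div_form x z" if xz: "field_regular x" "field_regular z"
  proof -
    have n: "nice Omega (\<lambda>p. divergence x p * divergence z p)"
      using xz by (auto simp: field_regular_def intro: nice_mult)
    have "(LINT p|lebesgue_on Omega. c * (divergence x p * divergence z p)) = div_form (fscale c x) z"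
      unfolding div_form_def
      by (rule nice_integral_cong[OF Omega_S nice_mult[OF nice_const n]]) (simp add: divergence_scale[OF xz(1)])
    then show ?thesis by (simp add: div_form_def)
  qed
  show "div_form x y = div_form y x" unfolding div_form_def by (simp add: mult.commute)
  show "divergence x p = 0" if x: "field_regular x" "div_form x x = 0" "p \<in> interior Omega"
  proof -
    have n: "nice Omega (\<lambda>p. divergence x p * divergence x p)"
      using x by (auto simp: field_regular_def intro: nice_mult)
    have "divergence x p * divergence x p = 0"
      by (rule nice_integral_zero[OF Omega_S n _ _ x(3)]) (use x(2) in \<open>auto simp: div_form_def\<close>)
    then show ?thesis by simp
  qed
qed

text \<open>Connects a functional on \<open>U2\<close> with the form on \<open>U1_0curl\<close>;
  only the values of \<open>u\<close> in the interior enter.\<close>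

lemma dof_curl_eq:
  assumes "\<And>p. p \<in> interior Omega \<Longrightarrow> curl a p = u p" and k: "k \<ge> 1" and a: "a \<in> U1_0curl k" and v: "v \<in> U1_0curl k"
  shows "dof_value \<nu> (Curl_dof v) u = curl_form a v"
proof -
  have "nice Omega (\<lambda>p. inner (curl a p) (curl v p))" by (intro nice_inner nice_curl[OF k] a v)
  from nice_integral_cong[OF Omega_S this, of "\<lambda>p. inner (u p) (curl v p)"] assms(1)
  show ?thesis by (simp add: curl_form_def)
qed

lemma dof_add:
  assumes k: "k \<ge> 1" and \<nu>: "\<And>F. unit_normal F (\<nu> F)" and BF: "\<And>F. is_basis (BF F) (face_polys k F)"
    and BC: "is_basis BC (U1_0curl k)" and BD: "is_basis BD (U2_0div k)"
    and m: "m \<in> Sigma2 BF BC BD" and u: "u \<in> U2 k" and v: "v \<in> U2 k"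
  shows "dof_value \<nu> m (u + v) = dof_value \<nu> m u + dof_value \<nu> m v"
proof -
  note ru = U2_regular[OF k u] and rv = U2_regular[OF k v]
  from m consider F q where "m = Face_dof F q" "q \<in> BF F" | w where "m = Curl_dof w" "w \<in> BC" | w where "m = Div_dof w" "w \<in> BD"
    by (auto simp: Sigma2_def face_dofs_def)
  then show ?thesis
  proof cases
    case 1
    note n = normal_nice[OF k u \<nu> is_basis_sub[OF BF 1(2)]] normal_nice[OF k v \<nu> is_basis_sub[OF BF 1(2)]]
    show ?thesis using nice_integral_add[OF face_S n] unfolding 1
      by (simp add: face_integral_eq inner_add_left distrib_right distrib_left)
  next
    case 2
    have n: "nice Omega (\<lambda>p. inner (u p) (curl w p))" "nice Omega (\<lambda>p. inner (v p) (curl w p))"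
      using ru rv unfolding field_regular_def by (auto intro!: nice_inner nice_curl[OF k is_basis_sub[OF BC 2(2)]])
    show ?thesis using nice_integral_add[OF Omega_S n] unfolding 2 by (simp add: inner_add_left)
  next
    case 3
    have w: "field_regular w" using U2_regular[OF k] U2_0div_props(1)[OF k] is_basis_sub[OF BD 3(2)] by blast
    show ?thesis using div_form_props(1)[OF ru rv w] unfolding 3 by (simp add: div_form_def)
  qed
qed

lemma dof_scale:
  assumes k: "k \<ge> 1" and BD: "is_basis BD (U2_0div k)" and m: "m \<in> Sigma2 BF BC BD" and u: "u \<in> U2 k"
  shows "dof_value \<nu> m (fscale c u) = c * dof_value \<nu> m u"
proof -
  from m consider F q where "m = Face_dof F q" "q \<in> BF F" | w where "m = Curl_dof w" "w \<in> BC" | w where "m = Div_dof w" "w \<in> BD"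
    by (auto simp: Sigma2_def face_dofs_def)
  then show ?thesis
  proof cases
    case 1
    then show ?thesis by (simp add: face_integral_eq fscale_def mult.assoc)
  next
    case 2
    then show ?thesis by (simp add: fscale_def)
  next
    case 3
    have w: "field_regular w" using U2_regular[OF k] U2_0div_props(1)[OF k] is_basis_sub[OF BD 3(2)] by blast
    show ?thesis using div_form_props(2)[OF U2_regular[OF k u] w] unfolding 3 by (simp add: div_form_def)
  qed
qed

text \<open>Away from the apex the normal component is a nonzero multiple of a face polynomial
  \<open>v\<close>, so the vanishing of the degrees of freedom is a matter of definiteness of the
  face form at \<open>v\<close>.\<close>

lemma face_dofs_zero_iff:
  assumes k: "k \<ge> 1" and \<nu>: "unit_normal F (\<nu> F)" and BF: "is_basis (BF F) (face_polys k F)" and u: "u \<in> U2 k"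
  shows "(\<forall>m\<in>face_dofs BF F. dof_value \<nu> m u = 0) \<longleftrightarrow> (\<forall>p\<in>face F - {apex}. u p \<bullet> \<nu> F = 0)"
proof -
  obtain c where c: "c \<noteq> 0" "\<nu> F = c *\<^sub>R face_normal F" using unit_normal_eq[OF \<nu>] by blast
  obtain v where v: "v \<in> face_polys k F" "\<And>p. p \<in> face F - {apex} \<Longrightarrow> inner (u p) (face_normal F) = v p"
    using normal_trace_face_poly[OF k u] by blast
  have dof: "dof_value \<nu> (Face_dof F q) u = face_const F * c * face_form F v q" if "q \<in> BF F" for q
    by (rule dof_face_eq[where \<nu> = \<nu> and F = F, OF v(1) is_basis_sub[OF BF that] c(2)]) (rule v(2))
  show ?thesis
  proof
    assume "\<forall>m\<in>face_dofs BF F. dof_value \<nu> m u = 0"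
    then have 0: "face_form F v q = 0" if "q \<in> BF F" for q
      using dof[OF that] c(1) face_const_pos[of F] that by (auto simp: face_dofs_def)
    have "v = 0"
      by (rule basis_solve(2)[where g = "face_form F", OF BF face_polys_finite[OF BF] face_form_props v(1) 0])
    then show "\<forall>p\<in>face F - {apex}. u p \<bullet> \<nu> F = 0" using v(2) by (simp add: c(2))
  next
    assume 0: "\<forall>p\<in>face F - {apex}. u p \<bullet> \<nu> F = 0"
    have "v (face_param F st) = 0" if "st \<in> interior (face_domain F)" for st
    proof -
      have "face_param F st \<in> face F - {apex}" 
        using face_domain_interior_apex[OF that] face_param_image[of F] by blast
      then show ?thesis using v(2) 0 c by auto
    qed
    then have "face_form F v q = 0" if "q \<in> BF F" for q
      unfolding face_form_def using nice_integral_cong[OF face_S nice_mult[OF face_polys_nice[OF v(1)] face_polys_nice[OF is_basis_sub[OF BF that]]], of "\<lambda>_. 0"]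
      by simp
    then show "\<forall>m\<in>face_dofs BF F. dof_value \<nu> m u = 0" using dof by (auto simp: face_dofs_def)
  qed
qed

section \<open>Solving for prescribed degrees of freedom\<close>

lemma normal_trace_solve:
  assumes k: "k \<ge> 1" and v: "\<And>F. v F \<in> face_polys k F"
  shows "\<exists>u\<in>U2 k. \<forall>F. \<forall>p\<in>face F - {apex}. inner (u p) (face_normal F) = v F p"
proof -
  have km: "int k - 1 = int (k - 1)" using k by simp
  have "\<exists>f\<in>ref_poly k F. \<forall>s t. (s, t) \<in> face_domain F \<longrightarrow> face_param F (s, t) \<noteq> apex \<longrightarrow> v F (face_param F (s, t)) = 
    (if F = Base then f s t else f (s / (1 - t)) (t / (1 - t)) * (1 - t) ^ (k - 1))" for F
  proof -
    obtain g where g: "g \<in> ref_poly k F" "\<And>s t. (s, t) \<in> face_domain F \<Longrightarrow> v F (face_param F (s, t)) = g s t"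
      using v[of F] unfolding face_polys_iff by blast
    show ?thesis
    proof (cases "F = Base")
      case True
      then show ?thesis using g by (intro bexI[of _ g]) auto
    next
      case False
      then have "g \<in> polyP2 (int (k - 1))" using g(1) by (simp add: ref_poly_def km)
      from polyP2_homogenise[OF this, of 1] obtain f where f: "f \<in> polyP2 (int (k - 1))"
        "\<And>s t. 1 + t \<noteq> 0 \<Longrightarrow> f s t = g (s / (1 + t)) (t / (1 + t)) * (1 + t) ^ (k - 1)" by auto
      \<comment> \<open>Homogenising with \<open>1 + t\<close> undoes the weight, because
        \<open>1 + t / (1 - t) = 1 / (1 - t)\<close>.\<close>
      have "f (s / (1 - t)) (t / (1 - t)) * (1 - t) ^ (k - 1) = g s t" if "1 - t \<noteq> 0" for s t
      proof -
        have e: "1 + t / (1 - t) = 1 / (1 - t)" using that by (simp add: field_simps)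
        show ?thesis using f(2)[of "t / (1 - t)" "s / (1 - t)"] that unfolding e by (simp add: power_one_over)
      qed
      then show ?thesis using False f(1) g(2) face_param_apex[of _ _ F]
        by (intro bexI[of _ f]) (auto simp: ref_poly_def km)
    qed
  qed
  then obtain f where f: "\<And>F. f F \<in> ref_poly k F" "\<And>F s t. (s, t) \<in> face_domain F \<Longrightarrow> face_param F (s, t) \<noteq> apex \<Longrightarrow> v F (face_param F (s, t)) = 
    (if F = Base then f F s t else f F (s / (1 - t)) (t / (1 - t)) * (1 - t) ^ (k - 1))" by metis
  obtain n1 n2 n3 where n: "flux_num k n1 n2 n3" "\<And>F. face_trace F n1 n2 n3 = f F" using face_trace_surj[OF k f(1)] by blast
  have "U2_num k n1 n2 n3" using n f(1) by (simp add: U2_num_def)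
  then have "push2 (rat_field (k + 2) n1 n2 n3) \<in> U2 k" unfolding U2_eq[OF k] by blast
  moreover have "inner (push2 (rat_field (k + 2) n1 n2 n3) p) (face_normal F) = v F p" if p: "p \<in> face F - {apex}" for F p
  proof -
    have "p \<in> face_param F ` face_domain F" using p unfolding face_param_image by blast
    then obtain s t where st: "(s, t) \<in> face_domain F" "p = face_param F (s, t)" by auto
    then have ap: "face_param F (s, t) \<noteq> apex" using p by auto
    show ?thesis unfolding st(2) normal_trace[OF k st(1) ap] n(2) f(2)[OF st(1) ap] ..
  qed
  ultimately show ?thesis by blast
qed

theorem theorem6p3:
  fixes k :: nat
    and \<nu> :: "pyramid_face \<Rightarrow> real^3"
    and BF :: "pyramid_face \<Rightarrow> (real^3 \<Rightarrow> real) set"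
    and BC BD :: "(real^3 \<Rightarrow> real^3) set"
  assumes "k \<ge> 1"
    and "\<And>F. unit_normal F (\<nu> F)"
    and "\<And>F. is_basis (BF F) (face_polys k F)"
    and "is_basis BC (U1_0curl k)"
    and "is_basis BD (U2_0div k)"
  shows "(U2 k \<subseteq> Hdiv (interior Omega) \<and>
          (\<forall>F. \<forall>u\<in>U2 k. (\<forall>m\<in>face_dofs BF F. dof_value \<nu> m u = 0) \<longleftrightarrow>
                          (\<forall>p\<in>face F - {apex}. u p \<bullet> \<nu> F = 0)))
       \<and> (\<forall>c :: dof \<Rightarrow> real. \<exists>!u. u \<in> U2 k \<and> (\<forall>m\<in>Sigma2 BF BC BD. dof_value \<nu> m u = c m))"
proof (intro conjI allI)
  note k = assms(1) and \<nu> = assms(2) and BF = assms(3) and BC = assms(4) and BD = assms(5)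
  show "U2 k \<subseteq> Hdiv (interior Omega)"
    using push2_Hdiv[OF _ k] unfolding U2_eq[OF k] U2_num_def by blast
  show "\<forall>u\<in>U2 k. (\<forall>m\<in>face_dofs BF F. dof_value \<nu> m u = 0) \<longleftrightarrow> (\<forall>p\<in>face F - {apex}. u p \<bullet> \<nu> F = 0)" for F
    using face_dofs_zero_iff[where \<nu> = \<nu> and BF = BF and F = F, OF k \<nu> BF] by blast
  note add = dof_add[where \<nu> = \<nu> and BF = BF, OF k \<nu> BF BC BD]
  note scale = dof_scale[where \<nu> = \<nu> and BF = BF and BC = BC, OF k BD]
  note divU2 = U2_0div_props(1)[OF k]
  have reg: "field_regular x" if "x \<in> U2_0div k" for x using U2_regular[OF k divU2[OF that]] .
  have solveC: "\<exists>a\<in>U1_0curl k. \<forall>w\<in>BC. curl_form a w = d w" and zeroC: "a \<in> U1_0curl k \<Longrightarrow> (\<And>w. w \<in> BC \<Longrightarrow> curl_form a w = 0) \<Longrightarrow> a = 0" for d a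
    by (rule basis_solve[where g = curl_form, OF BC U1_0curl_finite[OF BC] curl_form_props[OF k]]; assumption)+
  have defD: "b = 0" if "b \<in> U2_0div k" "div_form b b = 0" for b
    using U2_0div_props(3)[OF k that(1)] div_form_props(4)[OF reg[OF that(1)] that(2)] by blast
  have solveD: "\<exists>b\<in>U2_0div k. \<forall>w\<in>BD. div_form b w = d w" and zeroD: "b \<in> U2_0div k \<Longrightarrow> (\<And>w. w \<in> BD \<Longrightarrow> div_form b w = 0) \<Longrightarrow> b = 0" for d b
    by (rule basis_solve[where g = div_form, OF BD U2_0div_finite[OF BD k] div_form_props(1)[OF reg reg reg] div_form_props(2)[OF reg reg] div_form_props(3) defD]; assumption)+
  have inD: "w \<in> U2_0div k" if "w \<in> BD" for w using is_basis_sub[OF BD that] .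
  have inC: "w \<in> U1_0curl k" if "w \<in> BC" for w using is_basis_sub[OF BC that] .
  have divdof: "dof_value \<nu> (Div_dof w) u = div_form u w" for u w by (simp add: div_form_def)
  \<comment> \<open>Curls are invisible to the divergence degrees of freedom, so adding one later
    does not spoil them.\<close>
  have r_div: "div_form r w = 0" if "curl_field k a r" "w \<in> U2_0div k" for a r w
  proof -
    have "nice Omega (\<lambda>p. divergence r p * divergence w p)"
      using that U2_regular[OF k] reg[OF that(2)] unfolding curl_field_def field_regular_def by (blast intro: nice_mult)
    from nice_integral_cong[OF Omega_S this, of "\<lambda>_. 0"] that(1)
    show ?thesis unfolding div_form_def curl_field_def by simp
  qed
  have faceF: "dof_value \<nu> m u = 0" if "u \<in> U2 k" "\<And>p. p \<in> face F - {apex} \<Longrightarrow> inner (u p) (face_normal F) = 0" "m \<in> face_dofs BF F" for u F m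
  proof -
    obtain c where "\<nu> F = c *\<^sub>R face_normal F" using unit_normal_eq[OF \<nu>] by blast
    then have "\<forall>p\<in>face F - {apex}. u p \<bullet> \<nu> F = 0" using that(2) by simp
    then show ?thesis using face_dofs_zero_iff[where \<nu> = \<nu> and BF = BF and F = F, OF k \<nu> BF that(1)] that(3) by blast
  qed
  have unique: "u = 0" if u: "u \<in> U2 k" and 0: "\<And>m. m \<in> Sigma2 BF BC BD \<Longrightarrow> dof_value \<nu> m u = 0" for u
  proof -
    have "inner (u p) (face_normal F) = 0" if p: "p \<in> face F - {apex}" for F p
    proof -
      obtain c where c: "c \<noteq> 0" "\<nu> F = c *\<^sub>R face_normal F" using unit_normal_eq[OF \<nu>] by blast
      have "\<forall>m\<in>face_dofs BF F. dof_value \<nu> m u = 0" using 0 by (auto simp: Sigma2_def)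
      then have "u p \<bullet> \<nu> F = 0" using face_dofs_zero_iff[where \<nu> = \<nu> and BF = BF and F = F, OF k \<nu> BF u] p by blast
      then show ?thesis using c by simp
    qed
    from U2_decomposition[OF k u this] obtain a b r where a: "a \<in> U1_0curl k" and b: "b \<in> U2_0div k" and r: "curl_field k a r" and e: "u = r + b"
      by blast
    have rU: "r \<in> U2 k" using r by (simp add: curl_field_def)
    have "div_form b w = 0" if w: "w \<in> BD" for w
    proof -
      have "div_form u w = 0" using 0[of "Div_dof w"] w divdof by (simp add: Sigma2_def)
      moreover have "div_form u w = div_form r w + div_form b w" unfolding e
        by (rule div_form_props(1)[OF U2_regular[OF k rU] reg[OF b] reg[OF inD[OF w]]])
      ultimately show ?thesis using r_div[OF r inD[OF w]] by simp
    qed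
    then have "b = 0" by (rule zeroD[OF b])
    then have ur: "u = r" using e by simp
    have "curl_form a w = 0" if w: "w \<in> BC" for w
    proof -
      have "dof_value \<nu> (Curl_dof w) u = 0" by (rule 0) (use w in \<open>simp add: Sigma2_def\<close>)
      moreover have "dof_value \<nu> (Curl_dof w) u = curl_form a w"
        by (rule dof_curl_eq[OF _ k a inC[OF w]]) (use r ur in \<open>simp add: curl_field_def\<close>)
      ultimately show ?thesis by simp
    qed
    then have "a = 0" by (rule zeroC[OF a])
    have "r q = 0" if q: "q \<in> interior Omega" for q
    proof -
      \<comment> \<open>The curl of the zero field, from homogeneity with factor
        \<open>0\<close>.\<close>
      have "curl (fscale 0 a) q = 0 *\<^sub>R curl a q"
        by (rule curl_linear(2)[OF U1_differentiable[OF a q] U1_differentiable[OF a q] q])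
      moreover have "fscale 0 a = a" using \<open>a = 0\<close> by (simp add: fun_eq_iff fscale_def)
      ultimately show ?thesis using r q by (simp add: curl_field_def)
    qed
    then show ?thesis using r ur by (simp add: curl_field_def)
  qed
  fix c :: "dof \<Rightarrow> real"
  show "\<exists>!u. u \<in> U2 k \<and> (\<forall>m\<in>Sigma2 BF BC BD. dof_value \<nu> m u = c m)"
  proof (rule ex_ex1I)
    have "\<exists>\<kappa>. \<kappa> \<noteq> 0 \<and> \<nu> F = \<kappa> *\<^sub>R face_normal F" for F using unit_normal_eq[OF \<nu>] by blast
    then obtain \<kappa> where \<kappa>: "\<And>F. \<kappa> F \<noteq> 0" "\<And>F. \<nu> F = \<kappa> F *\<^sub>R face_normal F" by metis
    \<comment> \<open>The right-hand side compensates the surface factor and the multiple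
      \<open>\<kappa> F\<close> of the normal that \<open>dof_face_eq\<close> splits off.\<close>
    have "\<exists>v\<in>face_polys k F. \<forall>q\<in>BF F. face_form F v q = c (Face_dof F q) / (face_const F * \<kappa> F)" for F
      by (rule basis_solve(1)[where g = "face_form F", OF BF face_polys_finite[OF BF] face_form_props])
    then obtain v where v: "\<And>F. v F \<in> face_polys k F" "\<And>F q. q \<in> BF F \<Longrightarrow> face_form F (v F) q = c (Face_dof F q) / (face_const F * \<kappa> F)" by metis
    obtain u0 where u0: "u0 \<in> U2 k" "\<And>F p. p \<in> face F - {apex} \<Longrightarrow> inner (u0 p) (face_normal F) = v F p"
      using normal_trace_solve[OF k v(1)] by blast
    \<comment> \<open>The data for \<open>b\<close> are corrected by the contribution of
      \<open>u0\<close>, those for \<open>a\<close> by the contribution of \<open>u0 + b\<close>,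
      since nothing makes the curl degrees of freedom of \<open>b\<close> vanish.\<close>
    obtain b where b: "b \<in> U2_0div k" "\<And>w. w \<in> BD \<Longrightarrow> div_form b w = c (Div_dof w) - div_form u0 w"
      using solveD[of "\<lambda>w. c (Div_dof w) - div_form u0 w"] by blast
    obtain a where a: "a \<in> U1_0curl k" "\<And>w. w \<in> BC \<Longrightarrow> curl_form a w = c (Curl_dof w) - dof_value \<nu> (Curl_dof w) (u0 + b)"
      using solveC[of "\<lambda>w. c (Curl_dof w) - dof_value \<nu> (Curl_dof w) (u0 + b)"] by blast
    obtain r where r: "curl_field k a r" using U1_0curl_field[OF k a(1)] by blast
    have rU: "r \<in> U2 k" using r by (simp add: curl_field_def)
    have ub: "u0 + b \<in> U2 k" by (rule U2_add[OF k u0(1) divU2[OF b(1)]])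
    have sum: "dof_value \<nu> m (u0 + b + r) = dof_value \<nu> m u0 + dof_value \<nu> m b + dof_value \<nu> m r" if "m \<in> Sigma2 BF BC BD" for m
      unfolding add[OF that ub rU] add[OF that u0(1) divU2[OF b(1)]] ..
    have "dof_value \<nu> m (u0 + b + r) = c m" if m: "m \<in> Sigma2 BF BC BD" for m
    proof -
      from m consider F q where "m = Face_dof F q" "q \<in> BF F" | w where "m = Curl_dof w" "w \<in> BC" | w where "m = Div_dof w" "w \<in> BD"
        by (auto simp: Sigma2_def face_dofs_def)
      then show ?thesis
      proof cases
        case 1
        then have mF: "m \<in> face_dofs BF F" by (simp add: face_dofs_def)
        have "dof_value \<nu> m b = 0" by (rule faceF[OF divU2[OF b(1)] U2_0div_props(2)[OF k b(1)] mF])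
        moreover have "dof_value \<nu> m r = 0" by (rule faceF[OF rU _ mF]) (use r in \<open>simp add: curl_field_def\<close>)
        moreover have "dof_value \<nu> m u0 = face_const F * \<kappa> F * face_form F (v F) q"
          unfolding 1(1) by (rule dof_face_eq[where \<nu> = \<nu> and F = F, OF v(1) is_basis_sub[OF BF 1(2)] \<kappa>(2)]) (rule u0(2))
        ultimately show ?thesis unfolding sum[OF m] using v(2)[OF 1(2)] \<kappa>(1)[of F] face_const_pos[of F] 1(1) by simp
      next
        case 2
        have "dof_value \<nu> m r = curl_form a w" unfolding 2(1)
          by (rule dof_curl_eq[OF _ k a(1) inC[OF 2(2)]]) (use r in \<open>simp add: curl_field_def\<close>)
        then show ?thesis unfolding add[OF m ub rU] using a(2)[OF 2(2)] 2(1) by simp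
      next
        case 3
        then show ?thesis unfolding sum[OF m] unfolding 3(1) divdof using b(2)[OF 3(2)] r_div[OF r inD[OF 3(2)]] by simp
      qed
    qed
    then show "\<exists>u. u \<in> U2 k \<and> (\<forall>m\<in>Sigma2 BF BC BD. dof_value \<nu> m u = c m)"
      using U2_add[OF k ub rU] by blast
  next
    fix u u' assume u: "u \<in> U2 k \<and> (\<forall>m\<in>Sigma2 BF BC BD. dof_value \<nu> m u = c m)" 
      and u': "u' \<in> U2 k \<and> (\<forall>m\<in>Sigma2 BF BC BD. dof_value \<nu> m u' = c m)"
    let ?d = "u + fscale (-1) u'"
    have s: "fscale (-1) u' \<in> U2 k" using U2_scale[OF k] u' by blast
    have "?d = 0"
    proof (rule unique)
      show "?d \<in> U2 k" using U2_add[OF k _ s] u by blast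
      fix m assume m: "m \<in> Sigma2 BF BC BD"
      have "dof_value \<nu> m ?d = dof_value \<nu> m u + (-1) * dof_value \<nu> m u'"
        using add[OF m _ s, of u] scale[OF m, of u' "-1"] u u' by simp
      then show "dof_value \<nu> m ?d = 0" using u u' m by simp
    qed
    show "u = u'"
    proof
      fix x
      have "?d x = 0" using \<open>?d = 0\<close> by (simp add: fun_eq_iff)
      then show "u x = u' x" by (simp add: fscale_def)
    qed
  qed
qed

end
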